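(* The number of connected components of the space of hyperelliptic Riemann surfaces $M$ of genus $g$ with a primitive $n$-torsion pair of points conjugated by the hyperelliptic involution is equal to $a(g,n)$, the number of connected components of $\mathscr{A}_g^n$. Moreover, if $M$ is written as the compactification of $\{(x,w)\in\mathbb{C}^2:w^2=D(x)=\prod_{e\in\mathsf{E}}(x-e)\}$ with the torsion pair being the two points at infinity $\infty_\pm$, and $f$ is a meromorphic function on $M$ whose divisor is $n(p-Jp)$ with $\{p,Jp\}=\{\infty_+,\infty_-\}$, then for a suitable normalization of $f$ by a multiplicative constant one has $f(e,0)\in\{1,-1\}$ for all $e\in\mathsf{E}$, and the degree partition $(|\mathsf{E}^-|,|\mathsf{E}^+|)$ of $D$ is given by the numbers of $e\in\mathsf{E}$ with $f(e,0)=-1$ and $f(e,0)=+1$, respectively (as an unordered pair).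
   Context: A hyperelliptic Riemann surface of genus $g$ is a compact surface $M$ with an involution $J$ such that $M/J$ is the Riemann sphere. A pair of points $p,Jp$ conjugated by $J$, with $p$ not a fixed point of $J$ (non-Weierstrass), is a primitive $n$-torsion pair if the class of the divisor $p-Jp$ in the Jacobian has order exactly $n$, i.e. $n\ge 1$ is minimal such that there is a meromorphic function on $M$ with divisor $n(p-Jp)$. The space considered is the moduli space of such $M$ together with the pair. For a monic square-free $D\in\mathbb{C}[x]$ of degree $2g+2$ with root set $\mathsf{E}$, the Pell-Abel equation is $P^2-DQ^2=1$ with unknown $P,Q\in\mathbb{C}[x]$; if it has a solution with $\deg P>0$, the solution with minimal $\deg P=n>0$ (with $P$ unique up to sign) is called primitive. $\tilde{\mathscr{A}}_g^n$ is the set of such $D$ (topologized by coefficients) whose equation has a primitive solution of degree $n$, and $\mathscr{A}_g^n$ is its quotient by the affine group acting by $D(x)\mapsto a^{-\deg D}D(ax+b)$, $a\in\mathbb{C}^*$, $b\in\mathbb{C}$. The degree partition of $D$ is the unordered pair $(|\mathsf{E}^-|,|\mathsf{E}^+|)$ where $\mathsf{E}^\pm=\{e\in\mathsf{E}:P(e)=\pm1\}$ for a primitive solution $P$. The points $\infty_\pm$ are the two points added to compactify $\{w^2=D(x)\}$, with $w^{-1}x^{g+1}\to\pm1$ at $\infty_\pm$, and $J(x,w)=(x,-w)$. *)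

theory Defs
  imports
    "HOL-Complex_Analysis.Complex_Analysis"
    "HOL-Computational_Algebra.Squarefree"
    "HOL-Library.Multiset"
    "HOL-Library.Equipollence"
begin

section \<open>Riemann surfaces\<close>

type_synonym 'a chart = "'a set \<times> ('a \<Rightarrow> complex)"

record 'a surface =
  top_space :: "'a topology"
  atlas :: "'a chart set"

abbreviation points :: "'a surface \<Rightarrow> 'a set" where
  "points M \<equiv> topspace (top_space M)"

text \<open>A second countability axiom is redundant, since the space is compact.\<close>

definition compact_riemann_surface :: "'a surface \<Rightarrow> bool" where
  "compact_riemann_surface M \<longleftrightarrow>
     points M \<noteq> {} \<and> connected_space (top_space M) \<and>
     compact_space (top_space M) \<and> Hausdorff_space (top_space M) \<and>
     (\<Union>(U, \<phi>)\<in>atlas M. U) = points M \<and>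
     (\<forall>(U, \<phi>)\<in>atlas M. openin (top_space M) U \<and> open (\<phi> ` U) \<and>
        homeomorphic_map (subtopology (top_space M) U) (top_of_set (\<phi> ` U)) \<phi>) \<and>
     (\<forall>(U, \<phi>)\<in>atlas M. \<forall>(V, \<psi>)\<in>atlas M.
        (\<psi> \<circ> inv_into U \<phi>) holomorphic_on \<phi> ` (U \<inter> V))"

definition holomorphic_map :: "'a surface \<Rightarrow> 'b surface \<Rightarrow> ('a \<Rightarrow> 'b) \<Rightarrow> bool" where
  "holomorphic_map M N h \<longleftrightarrow>
     continuous_map (top_space M) (top_space N) h \<and>
     (\<forall>(U, \<phi>)\<in>atlas M. \<forall>(V, \<psi>)\<in>atlas N.
        (\<psi> \<circ> h \<circ> inv_into U \<phi>) holomorphic_on \<phi> ` (U \<inter> h -` V))"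

definition biholomorphic_map :: "'a surface \<Rightarrow> 'b surface \<Rightarrow> ('a \<Rightarrow> 'b) \<Rightarrow> bool" where
  "biholomorphic_map M N h \<longleftrightarrow>
     bij_betw h (points M) (points N) \<and> holomorphic_map M N h \<and>
     holomorphic_map N M (inv_into (points M) h)"

definition holomorphic_fun :: "'a surface \<Rightarrow> 'a set \<Rightarrow> ('a \<Rightarrow> complex) \<Rightarrow> bool" where
  "holomorphic_fun M S f \<longleftrightarrow>
     (\<forall>(U, \<phi>)\<in>atlas M. (f \<circ> inv_into U \<phi>) holomorphic_on \<phi> ` (U \<inter> S))"

text \<open>Being \<^emph>\<open>nicely\<close> meromorphic means that the function has its limit as value at every point
  that is not a pole (and, by convention, the value \<open>0\<close> at a pole), so that values
  at points are meaningful.\<close>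

definition meromorphic_fun :: "'a surface \<Rightarrow> ('a \<Rightarrow> complex) \<Rightarrow> bool" where
  "meromorphic_fun M f \<longleftrightarrow>
     (\<forall>(U, \<phi>)\<in>atlas M. (f \<circ> inv_into U \<phi>) nicely_meromorphic_on \<phi> ` U)"

text \<open>The condition that \<open>f\<close> does not vanish identically is needed because \<open>zorder\<close> is
  unspecified for the zero function.\<close>

definition has_divisor :: "'a surface \<Rightarrow> ('a \<Rightarrow> complex) \<Rightarrow> ('a \<Rightarrow> int) \<Rightarrow> bool" where
  "has_divisor M f d \<longleftrightarrow>
     meromorphic_fun M f \<and> (\<exists>x\<in>points M. f x \<noteq> 0) \<and>
     (\<forall>(U, \<phi>)\<in>atlas M. \<forall>x\<in>U. zorder (f \<circ> inv_into U \<phi>) (\<phi> x) = d x)"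

text \<open>The divisor \<open>n(p - q)\<close>.\<close>

definition diff_divisor :: "nat \<Rightarrow> 'a \<Rightarrow> 'a \<Rightarrow> 'a \<Rightarrow> int" where
  "diff_divisor n p q = (\<lambda>x. int n * (of_bool (x = p) - of_bool (x = q)))"

text \<open>The genus is the dimension of the space of holomorphic differentials. A differential
  is given by its coefficients: on the chart \<open>(U, \<phi>)\<close> it reads \<open>\<omega> (U, \<phi>) d\<phi>\<close>. The first
  condition makes the coefficient functions unique.\<close>

definition holomorphic_form :: "'a surface \<Rightarrow> ('a chart \<Rightarrow> 'a \<Rightarrow> complex) \<Rightarrow> bool" where
  "holomorphic_form M \<omega> \<longleftrightarrow>
     (\<forall>k p. \<not> (k \<in> atlas M \<and> p \<in> fst k) \<longrightarrow> \<omega> k p = 0) \<and>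
     (\<forall>(U, \<phi>)\<in>atlas M. (\<omega> (U, \<phi>) \<circ> inv_into U \<phi>) holomorphic_on \<phi> ` U) \<and>
     (\<forall>(U, \<phi>)\<in>atlas M. \<forall>(V, \<psi>)\<in>atlas M. \<forall>p\<in>U \<inter> V.
        \<omega> (U, \<phi>) p = \<omega> (V, \<psi>) p * deriv (\<psi> \<circ> inv_into U \<phi>) (\<phi> p))"

definition has_genus :: "'a surface \<Rightarrow> nat \<Rightarrow> bool" where
  "has_genus M g \<longleftrightarrow>
     (\<exists>b. (\<forall>i<g. holomorphic_form M (b i)) \<and>
        (\<forall>\<omega>. holomorphic_form M \<omega> \<longrightarrow>
           (\<exists>!c :: nat \<Rightarrow> complex. (\<forall>i\<ge>g. c i = 0) \<and> \<omega> = (\<lambda>k p. \<Sum>i<g. c i * b i k p))))"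

definition riemann_sphere :: "complex option surface" where
  "riemann_sphere =
     \<lparr>top_space = Alexandroff_compactification euclidean,
      atlas = {(range Some, the),
               (- {Some 0}, \<lambda>z. case z of None \<Rightarrow> 0 | Some a \<Rightarrow> 1 / a)}\<rparr>"

section \<open>Hyperelliptic surfaces and torsion pairs\<close>

text \<open>\<open>\<pi>\<close> exhibits the quotient \<open>M/J\<close> as the Riemann sphere: a surjective holomorphic map
  whose fibres are the orbits of \<open>J\<close> induces a biholomorphism from \<open>M/J\<close> to the sphere.\<close>

definition quotient_to_sphere ::
    "'a surface \<Rightarrow> ('a \<Rightarrow> 'a) \<Rightarrow> ('a \<Rightarrow> complex option) \<Rightarrow> bool" where
  "quotient_to_sphere M J \<pi> \<longleftrightarrow>
     holomorphic_map M riemann_sphere \<pi> \<and> \<pi> ` points M = points riemann_sphere \<and>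
     (\<forall>p\<in>points M. \<forall>q\<in>points M. \<pi> p = \<pi> q \<longleftrightarrow> q = p \<or> q = J p)"

definition hyperelliptic :: "nat \<Rightarrow> 'a surface \<Rightarrow> ('a \<Rightarrow> 'a) \<Rightarrow> bool" where
  "hyperelliptic g M J \<longleftrightarrow>
     compact_riemann_surface M \<and> has_genus M g \<and>
     holomorphic_map M M J \<and> (\<forall>p\<in>points M. J (J p) = p) \<and> (\<exists>p\<in>points M. J p \<noteq> p) \<and>
     (\<exists>\<pi>. quotient_to_sphere M J \<pi>)"

definition primitive_torsion_pair ::
    "nat \<Rightarrow> 'a surface \<Rightarrow> ('a \<Rightarrow> 'a) \<Rightarrow> 'a set \<Rightarrow> bool" where
  "primitive_torsion_pair n M J A \<longleftrightarrow>
     (\<exists>p\<in>points M. J p \<noteq> p \<and> A = {p, J p} \<and> n \<ge> 1 \<and>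
        (\<exists>f. has_divisor M f (diff_divisor n p (J p))) \<and>
        (\<forall>m. 1 \<le> m \<and> m < n \<longrightarrow> \<not> (\<exists>f. has_divisor M f (diff_divisor m p (J p)))))"

section \<open>The moduli space\<close>

text \<open>The final topology with respect to \<open>q\<close> on the image of \<open>q\<close>.\<close>

definition quotient_topology :: "'a topology \<Rightarrow> ('a \<Rightarrow> 'b) \<Rightarrow> 'b topology" where
  "quotient_topology X q =
     topology (\<lambda>U. U \<subseteq> q ` topspace X \<and> openin X {x \<in> topspace X. q x \<in> U})"

lemma openin_quotient_topology:
  "openin (quotient_topology X q) U \<longleftrightarrow>
     U \<subseteq> q ` topspace X \<and> openin X {x \<in> topspace X. q x \<in> U}"
proof -
  have inter: "{x \<in> topspace X. q x \<in> S \<inter> T}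
      = {x \<in> topspace X. q x \<in> S} \<inter> {x \<in> topspace X. q x \<in> T}" for S T
    by blast
  have union: "{x \<in> topspace X. q x \<in> \<Union>\<K>} = (\<Union>K\<in>\<K>. {x \<in> topspace X. q x \<in> K})" for \<K>
    by blast
  have "istopology (\<lambda>U. U \<subseteq> q ` topspace X \<and> openin X {x \<in> topspace X. q x \<in> U})"
    unfolding istopology_def inter union by (blast intro: openin_Int openin_Union)
  then show ?thesis
    by (simp add: quotient_topology_def)
qed

text \<open>To have a set of isomorphism classes, the points of the surfaces are taken from a fixed
  type. Every compact Riemann surface has the cardinality of the continuum, hence
  an isomorphic copy on this type.\<close>

type_synonym pt = "complex \<times> complex + bool"

type_synonym pointed_surface = "pt surface \<times> (pt \<Rightarrow> pt) \<times> pt set"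

definition isomorphic :: "pointed_surface \<Rightarrow> pointed_surface \<Rightarrow> bool" where
  "isomorphic = (\<lambda>(M, J, A) (M', J', A').
     \<exists>h. biholomorphic_map M M' h \<and> (\<forall>p\<in>points M. h (J p) = J' (h p)) \<and> h ` A = A')"

definition torsion_surfaces :: "nat \<Rightarrow> nat \<Rightarrow> pointed_surface set" where
  "torsion_surfaces g n =
     {(M, J, A). hyperelliptic g M J \<and> primitive_torsion_pair n M J A}"

text \<open>The topology on the moduli space is the usual one for hyperelliptic surfaces: that of the
  branch data. A hyperelliptic surface of genus \<open>g\<close> with a pair \<open>{p, J p}\<close> determines, and up
  to isomorphism is determined by, the \<open>2g + 2\<close> branch points (in no particular order) of
  \<open>M \<rightarrow> M/J\<close> and the image of the pair, considered up to automorphisms of the sphere \<open>M/J\<close>.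
  Here such a configuration is written \<open>(B, {q})\<close>, and \<open>configuration_space g\<close> is the quotient of
  the space of ordered configurations of distinct points.\<close>

definition ordered_configurations ::
    "nat \<Rightarrow> ((nat \<Rightarrow> complex option) \<times> complex option) topology" where
  "ordered_configurations g =
     subtopology
       (prod_topology (product_topology (\<lambda>_. top_space riemann_sphere) {..<2 * g + 2})
          (top_space riemann_sphere))
       {(b, q). inj_on b {..<2 * g + 2} \<and> q \<notin> b ` {..<2 * g + 2}}"

definition configuration_orbit ::
    "nat \<Rightarrow> (nat \<Rightarrow> complex option) \<times> complex option
      \<Rightarrow> (complex option set \<times> complex option set) set" where
  "configuration_orbit g = (\<lambda>(b, q).
     {(\<sigma> ` b ` {..<2 * g + 2}, {\<sigma> q}) | \<sigma>. biholomorphic_map riemann_sphere riemann_sphere \<sigma>})"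

definition configuration_space ::
    "nat \<Rightarrow> (complex option set \<times> complex option set) set topology" where
  "configuration_space g = quotient_topology (ordered_configurations g) (configuration_orbit g)"

text \<open>The possible \<open>\<pi>\<close> differ by automorphisms of the sphere, so the branch data form one orbit.\<close>

definition branch_data ::
    "pointed_surface \<Rightarrow> (complex option set \<times> complex option set) set" where
  "branch_data = (\<lambda>(M, J, A).
     {(\<pi> ` {p \<in> points M. J p = p}, \<pi> ` A) | \<pi>. quotient_to_sphere M J \<pi>})"

definition torsion_moduli :: "nat \<Rightarrow> nat \<Rightarrow> pointed_surface set topology" where
  "torsion_moduli g n =
     quotient_topology
       (pullback_topology (torsion_surfaces g n) branch_data (configuration_space g))
       (\<lambda>X. {Y \<in> torsion_surfaces g n. isomorphic X Y})"

section \<open>The Pell-Abel equation\<close>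

definition primitive_solution :: "complex poly \<Rightarrow> complex poly \<Rightarrow> complex poly \<Rightarrow> bool" where
  "primitive_solution D P Q \<longleftrightarrow>
     P ^ 2 - D * Q ^ 2 = 1 \<and> degree P > 0 \<and>
     (\<forall>P' Q'. P' ^ 2 - D * Q' ^ 2 = 1 \<and> degree P' > 0 \<longrightarrow> degree P \<le> degree P')"

definition admissible :: "nat \<Rightarrow> complex poly \<Rightarrow> bool" where
  "admissible g D \<longleftrightarrow> lead_coeff D = 1 \<and> squarefree D \<and> degree D = 2 * g + 2"

definition pell_abel_set :: "nat \<Rightarrow> nat \<Rightarrow> complex poly set" where
  "pell_abel_set g n =
     {D. admissible g D \<and> (\<exists>P Q. primitive_solution D P Q \<and> degree P = n)}"

definition affine_orbit :: "complex poly \<Rightarrow> complex poly set" where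
  "affine_orbit D = {smult (inverse (a ^ degree D)) (pcompose D [:b, a:]) | a b. a \<noteq> 0}"

text \<open>\<open>euclidean\<close> on \<open>nat \<Rightarrow> complex\<close> is the product topology; on polynomials of fixed degree
  it induces the topology of \<open>\<complex>\<^sup>m\<close> on the coefficients.\<close>

definition pell_abel_space :: "nat \<Rightarrow> nat \<Rightarrow> complex poly set topology" where
  "pell_abel_space g n =
     quotient_topology (pullback_topology (pell_abel_set g n) coeff euclidean) affine_orbit"

definition roots :: "complex poly \<Rightarrow> complex set" where
  "roots D = {e. poly D e = 0}"

text \<open>Unordered pairs are multisets. The choice of \<open>P\<close> does not matter, since a
  primitive \<open>P\<close> is unique up to sign.\<close>

definition degree_partition :: "complex poly \<Rightarrow> nat multiset" where
  "degree_partition D = (THE N. \<exists>P Q. primitive_solution D P Q \<and>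
     N = {#card {e \<in> roots D. poly P e = -1}, card {e \<in> roots D. poly P e = 1}#})"

section \<open>The surface of \<open>w\<^sup>2 = D(x)\<close>\<close>

definition affine_curve :: "complex poly \<Rightarrow> (complex \<times> complex) set" where
  "affine_curve D = {(x, w). w ^ 2 = poly D x}"

text \<open>\<open>M\<close> is the compactification of the affine curve by the points \<open>pinf\<close> and \<open>minf\<close>
  (the points at infinity with index plus and minus), and \<open>\<psi>\<close> is the
  embedding of the curve. It suffices to ask that \<open>x\<close> and \<open>w\<close> are holomorphic on the image
  of \<open>\<psi>\<close>, because an injective holomorphic map between Riemann surfaces is biholomorphic
  onto its image.\<close>

definition curve_compactification ::
    "nat \<Rightarrow> complex poly \<Rightarrow> 'a surface \<Rightarrow> ('a \<Rightarrow> 'a) \<Rightarrow> (complex \<times> complex \<Rightarrow> 'a)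
      \<Rightarrow> 'a \<Rightarrow> 'a \<Rightarrow> bool" where
  "curve_compactification g D M J \<psi> pinf minf \<longleftrightarrow>
     compact_riemann_surface M \<and>
     pinf \<in> points M \<and> minf \<in> points M \<and> pinf \<noteq> minf \<and>
     bij_betw \<psi> (affine_curve D) (points M - {pinf, minf}) \<and>
     (let x = fst \<circ> inv_into (affine_curve D) \<psi>; w = snd \<circ> inv_into (affine_curve D) \<psi> in
        holomorphic_fun M (points M - {pinf, minf}) x \<and>
        holomorphic_fun M (points M - {pinf, minf}) w \<and>
        limitin euclidean (\<lambda>p. x p ^ (g + 1) / w p) 1 (atin (top_space M) pinf) \<and>
        limitin euclidean (\<lambda>p. x p ^ (g + 1) / w p) (-1) (atin (top_space M) minf)) \<and>
     (\<forall>(x, w)\<in>affine_curve D. J (\<psi> (x, w)) = \<psi> (x, -w)) \<and> J pinf = minf \<and> J minf = pinf"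

end

theory Submission
  imports Defs "HOL-Computational_Algebra.Fundamental_Theorem_Algebra"
begin

text \<open>Let \<open>f\<close> have divisor \<open>n(p - J p)\<close> and let \<open>X\<close> be the coordinate \<open>M \<rightarrow> M/J\<close> with \<open>p\<close> and
  \<open>J p\<close> over infinity. Then \<open>f \<cdot> (f \<circ> J)\<close> is constant, and \<open>f\<close> can be scaled to make it \<open>1\<close>; the function
  \<open>(f + f \<circ> J)/2\<close> descends to a polynomial \<open>P\<close> in \<open>X\<close> of degree \<open>n\<close>, and \<open>(f - f \<circ> J)\<^sup>2/4\<close> to \<open>D Q\<^sup>2\<close>, so
  \<open>P\<^sup>2 - D Q\<^sup>2 = 1\<close> and \<open>f = P = \<plusminus>1\<close> at the branch points. Conversely \<open>P + w Q\<close> has divisor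
  \<open>n(p - J p)\<close>. Thus surfaces with a primitive \<open>n\<close>-torsion pair correspond to polynomials with a
  primitive solution of degree \<open>n\<close>.

  The topology of the moduli space is pulled back from the configurations of branch points. A
  configuration with its marked point at infinity is the root set of a polynomial up to affine maps,
  so the moduli space maps onto the space of polynomials in such a way that its open sets are
  exactly the preimages of open sets; such a map induces a bijection of components. In particular it is not
  needed that the branch data determine the surface up to isomorphism.\<close>

section \<open>Functions on Riemann surfaces\<close>

text \<open>Three obstacles shape the proof. A point of the moduli space is an abstract surface,
  known only through a function \<open>X\<close> whose fibres are the orbits of \<open>J\<close>; no
  \<open>w\<close> with w^2 = D(X) is given. Holomorphy is therefore transferred through local
  sections of \<open>X\<close>, and \<open>w\<close> has to be recovered as (c f - P(X)) / Q(X)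
  before a shorter solution can be turned into a divisor that contradicts minimality. That P + w Q
  has its zero and its pole at opposite ends is not read off from an expansion: P + w Q and P - w Q
  have product 1 and a sum that tends to infinity, so near each end exactly one of them is large,
  and neither is large at both ends. Conversely, each polynomial has to be realised by a surface
  that satisfies the definition literally, including the dimension of the space of differentials;
  hence the explicit gluing and the analysis of x^i dx / w. Finally, the topologies are compared
  through roots: roots depend continuously on coefficients, and coefficients on configurations even
  while the marked point leaves infinity.\<close>

locale riemann_surface =
  fixes M :: "'a surface"
  assumes crs: "compact_riemann_surface M"
begin

section \<open>Charts, neighbourhoods and limits read in a chart\<close>

lemma ex_chart:
  assumes "y \<in> points M"
  obtains U \<phi> where "(U, \<phi>) \<in> atlas M" "y \<in> U"
  using assms crs unfolding compact_riemann_surface_def by blast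

lemma Hausdorff: "Hausdorff_space (top_space M)"
  and compact: "compact_space (top_space M)"
  and connected: "connected_space (top_space M)"
  using crs by (auto simp: compact_riemann_surface_def)

lemma separate:
  assumes "y \<in> points M" "z \<in> points M" "y \<noteq> z"
  obtains V W where "openin (top_space M) V" "openin (top_space M) W" "y \<in> V" "z \<in> W" "V \<inter> W = {}"
  using Hausdorff assms unfolding Hausdorff_space_def disjnt_def by metis

lemma transition:
  assumes "(U, \<phi>) \<in> atlas M" "(V, \<psi>) \<in> atlas M"
  shows "(\<psi> \<circ> inv_into U \<phi>) holomorphic_on \<phi> ` (U \<inter> V)"
  using crs assms unfolding compact_riemann_surface_def by blast

lemma openin_Diff_finite:
  assumes "openin (top_space M) V" "finite K" "K \<subseteq> points M"
  shows "openin (top_space M) (V - K)"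
  using Hausdorff assms
  by (meson Hausdorff_imp_t1_space closedin_t1_singleton closedin_Hausdorff_finite openin_diff)

context
  fixes U \<phi>
  assumes chart: "(U, \<phi>) \<in> atlas M"
begin

lemma chart_open: "openin (top_space M) U" "open (\<phi> ` U)"
  and chart_homeo: "homeomorphic_map (subtopology (top_space M) U) (top_of_set (\<phi> ` U)) \<phi>"
  using crs chart unfolding compact_riemann_surface_def by auto

lemma chart_subset: "U \<subseteq> points M"
  by (rule openin_subset[OF chart_open(1)])

lemma chart_inj: "inj_on \<phi> U"
  using homeomorphic_imp_injective_map[OF chart_homeo] chart_subset
  by (simp add: Int_absorb1)

lemma chart_inv [simp]: "y \<in> U \<Longrightarrow> inv_into U \<phi> (\<phi> y) = y"
  using chart_inj by simp

lemma chart_image_open: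
  assumes "openin (top_space M) V"
  shows "open (\<phi> ` (U \<inter> V))"
proof -
  have "openin (subtopology (top_space M) U) (U \<inter> V)"
    using assms by (simp add: openin_subtopology_Int2 Int_commute)
  then have "openin (top_of_set (\<phi> ` U)) (\<phi> ` (U \<inter> V))"
    using homeomorphic_imp_open_map[OF chart_homeo] by (auto simp: open_map_def)
  then show ?thesis
    using chart_open(2) openin_open_eq by blast
qed

lemma chart_preimage_open:
  assumes "open W"
  shows "openin (top_space M) {y \<in> U. \<phi> y \<in> W}"
proof -
  have "openin (subtopology (top_space M) U) {y \<in> topspace (subtopology (top_space M) U). \<phi> y \<in> W \<inter> \<phi> ` U}"
    by (intro openin_continuous_map_preimage[OF homeomorphic_imp_continuous_map[OF chart_homeo]])
      (use assms openin_open_Int[of W "\<phi> ` U"] in \<open>simp add: Int_commute\<close>)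
  also have "{y \<in> topspace (subtopology (top_space M) U). \<phi> y \<in> W \<inter> \<phi> ` U} = {y \<in> U. \<phi> y \<in> W}"
    using chart_subset by auto
  finally show ?thesis
    using chart_open(1) openin_trans_full by blast
qed

text \<open>A chart matches punctured neighbourhoods of \<open>y\<close> with punctured
  neighbourhoods of \<open>\<phi> y\<close>. Every limit on the surface thereby becomes a limit at a
  point of the plane.\<close>

lemma atin_chart:
  assumes "y \<in> U"
  shows "atin (top_space M) y = filtermap (inv_into U \<phi>) (at (\<phi> y))"
unfolding filter_eq_iff
proof
  fix P
  have y: "y \<in> points M"
    using assms chart_subset by blast
  have "eventually P (atin (top_space M) y) \<longleftrightarrow>
      (\<exists>V. openin (top_space M) V \<and> y \<in> V \<and> (\<forall>x\<in>V - {y}. P x))"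
    using y by (simp add: eventually_atin)
  also have "\<dots> \<longleftrightarrow> (\<exists>S. open S \<and> \<phi> y \<in> S \<and> (\<forall>x\<in>S. x \<noteq> \<phi> y \<longrightarrow> P (inv_into U \<phi> x)))"
  proof safe
    fix V assume V: "openin (top_space M) V" "y \<in> V" "\<forall>x\<in>V - {y}. P x"
    show "\<exists>S. open S \<and> \<phi> y \<in> S \<and> (\<forall>x\<in>S. x \<noteq> \<phi> y \<longrightarrow> P (inv_into U \<phi> x))"
      by (rule exI[of _ "\<phi> ` (U \<inter> V)"]) (use V chart_image_open assms in auto)
  next
    fix S assume S: "open S" "\<phi> y \<in> S" "\<forall>x\<in>S. x \<noteq> \<phi> y \<longrightarrow> P (inv_into U \<phi> x)"
    have "P x" if "x \<in> {y \<in> U. \<phi> y \<in> S} - {y}" for x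
      using that S(3) inj_onD[OF chart_inj, of x y] assms by force
    then show "\<exists>V. openin (top_space M) V \<and> y \<in> V \<and> (\<forall>x\<in>V - {y}. P x)"
      using chart_preimage_open[OF S(1)] S(2) assms by blast
  qed
  also have "\<dots> \<longleftrightarrow> eventually P (filtermap (inv_into U \<phi>) (at (\<phi> y)))"
    by (simp add: eventually_filtermap eventually_at_topological)
  finally show "eventually P (atin (top_space M) y) \<longleftrightarrow> eventually P (filtermap (inv_into U \<phi>) (at (\<phi> y)))" .
qed

lemma filterlim_atin_chart:
  assumes "y \<in> U"
  shows "filterlim f F (atin (top_space M) y) \<longleftrightarrow> filterlim (f \<circ> inv_into U \<phi>) F (at (\<phi> y))"
  by (simp add: atin_chart[OF assms] filterlim_filtermap comp_def)

lemma holomorphic_fun_chart: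
  "holomorphic_fun M S f \<Longrightarrow> (f \<circ> inv_into U \<phi>) holomorphic_on \<phi> ` (U \<inter> S)"
  using chart unfolding holomorphic_fun_def by blast

lemma chart_ball:
  assumes "openin (top_space M) V" "y \<in> U" "y \<in> V"
  obtains r where "r > 0" "ball (\<phi> y) r \<subseteq> \<phi> ` (U \<inter> V)"
  using chart_image_open[OF assms(1)] assms(2,3) by (metis IntI imageI openE)

end

text \<open>A point of a surface is not isolated, as seen in a chart. Uniqueness of limits on the
  surface rests on this.\<close>

lemma atin_nontrivial:
  assumes "y \<in> points M"
  shows "atin (top_space M) y \<noteq> bot"
proof -
  obtain U \<phi> where "(U, \<phi>) \<in> atlas M" "y \<in> U"
    using ex_chart[OF assms] .
  then show ?thesis
    by (simp add: atin_chart filtermap_bot_iff)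
qed

text \<open>Transition maps are holomorphic, so holomorphy in one chart around each point passes to
  every other chart, as \<open>holomorphic_fun\<close> demands.\<close>

lemma holomorphic_funI:
  assumes S: "openin (top_space M) S"
    and loc: "\<And>y. y \<in> S \<Longrightarrow> \<exists>U \<phi> W. (U, \<phi>) \<in> atlas M \<and> y \<in> U \<and> open W \<and> \<phi> y \<in> W \<and>
      (f \<circ> inv_into U \<phi>) holomorphic_on W"
  shows "holomorphic_fun M S f"
  unfolding holomorphic_fun_def
proof safe
  fix V \<psi> assume V: "(V, \<psi>) \<in> atlas M"
  have "(f \<circ> inv_into V \<psi>) field_differentiable at z" if z: "z \<in> \<psi> ` (V \<inter> S)" for z
  proof -
    obtain y where y: "y \<in> V" "y \<in> S" "z = \<psi> y"
      using z by blast
    obtain U \<phi> W where U: "(U, \<phi>) \<in> atlas M" "y \<in> U" "open W" "\<phi> y \<in> W"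
        "(f \<circ> inv_into U \<phi>) holomorphic_on W"
      using loc[OF y(2)] by blast
    let ?O = "{x \<in> U. \<phi> x \<in> W}"
    have op: "open (\<psi> ` (V \<inter> ?O))"
      by (rule chart_image_open[OF V chart_preimage_open[OF U(1,3)]])
    have "((f \<circ> inv_into U \<phi>) \<circ> (\<phi> \<circ> inv_into V \<psi>)) holomorphic_on \<psi> ` (V \<inter> ?O)"
    proof (rule holomorphic_on_compose_gen[OF _ U(5)])
      show "(\<phi> \<circ> inv_into V \<psi>) holomorphic_on \<psi> ` (V \<inter> ?O)"
        by (rule holomorphic_on_subset[OF transition[OF V U(1)]]) blast
    qed (use V in auto)
    then have "(f \<circ> inv_into V \<psi>) holomorphic_on \<psi> ` (V \<inter> ?O)"
      by (rule holomorphic_transform) (use V U(1) in auto)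
    moreover have "z \<in> \<psi> ` (V \<inter> ?O)"
      using y U by blast
    ultimately show ?thesis
      using op holomorphic_on_imp_differentiable_at by blast
  qed
  then show "(f \<circ> inv_into V \<psi>) holomorphic_on \<psi> ` (V \<inter> S)"
    by (simp add: field_differentiable_at_within holomorphic_on_def)
qed

section \<open>Closure properties, continuity and removable singularities of holomorphic
  functions\<close>

lemma holomorphic_fun_subset:
  "holomorphic_fun M S f \<Longrightarrow> T \<subseteq> S \<Longrightarrow> holomorphic_fun M T f"
  unfolding holomorphic_fun_def
  by (smt (verit, best) Int_mono case_prodD case_prodI2 holomorphic_on_subset image_mono order_refl)

lemma holomorphic_fun_cong:
  assumes "holomorphic_fun M S f" "\<And>y. y \<in> S \<Longrightarrow> f y = h y"
  shows "holomorphic_fun M S h"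
  unfolding holomorphic_fun_def
proof safe
  fix U \<phi> assume U: "(U, \<phi>) \<in> atlas M"
  show "(h \<circ> inv_into U \<phi>) holomorphic_on \<phi> ` (U \<inter> S)"
    by (rule holomorphic_transform[OF holomorphic_fun_chart[OF U assms(1)]]) (use U assms(2) in auto)
qed

lemma holomorphic_fun_const: "holomorphic_fun M S (\<lambda>_. c)"
  unfolding holomorphic_fun_def by (auto simp: comp_def)

lemma holomorphic_fun_comp:
  assumes "holomorphic_fun M S f" "h holomorphic_on T" "f ` S \<subseteq> T"
  shows "holomorphic_fun M S (\<lambda>y. h (f y))"
  unfolding holomorphic_fun_def
proof safe
  fix U \<phi> assume U: "(U, \<phi>) \<in> atlas M"
  have "(h \<circ> (f \<circ> inv_into U \<phi>)) holomorphic_on \<phi> ` (U \<inter> S)"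
    by (rule holomorphic_on_compose_gen[OF holomorphic_fun_chart[OF U assms(1)] assms(2)])
      (use U assms(3) in auto)
  then show "((\<lambda>y. h (f y)) \<circ> inv_into U \<phi>) holomorphic_on \<phi> ` (U \<inter> S)"
    by (simp add: comp_def)
qed

lemma holomorphic_fun_poly: "holomorphic_fun M S f \<Longrightarrow> holomorphic_fun M S (\<lambda>y. poly P (f y))"
  by (rule holomorphic_fun_comp[where T = UNIV and h = "poly P"]) (auto intro: poly_holomorphic_on)

lemma holomorphic_fun_add:
  "holomorphic_fun M S f \<Longrightarrow> holomorphic_fun M S h \<Longrightarrow> holomorphic_fun M S (\<lambda>y. f y + h y)"
  and holomorphic_fun_mult:
  "holomorphic_fun M S f \<Longrightarrow> holomorphic_fun M S h \<Longrightarrow> holomorphic_fun M S (\<lambda>y. f y * h y)"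
  and holomorphic_fun_diff:
  "holomorphic_fun M S f \<Longrightarrow> holomorphic_fun M S h \<Longrightarrow> holomorphic_fun M S (\<lambda>y. f y - h y)"
  unfolding holomorphic_fun_def comp_def
  by (auto intro!: holomorphic_intros)

lemma holomorphic_fun_inverse:
  "holomorphic_fun M S f \<Longrightarrow> (\<And>y. y \<in> S \<Longrightarrow> f y \<noteq> 0) \<Longrightarrow> holomorphic_fun M S (\<lambda>y. inverse (f y))"
  by (rule holomorphic_fun_comp[where T = "- {0}"]) (auto intro!: holomorphic_intros)

lemma holomorphic_fun_continuous:
  assumes f: "holomorphic_fun M S f" and S: "openin (top_space M) S"
  shows "continuous_map (subtopology (top_space M) S) euclidean f"
proof -
  have "openin (top_space M) {y \<in> S. f y \<in> O'}" if O': "open O'" for O'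
  proof (subst openin_subopen, safe)
    fix y assume y: "y \<in> S" "f y \<in> O'"
    obtain U \<phi> where U: "(U, \<phi>) \<in> atlas M" "y \<in> U"
      using ex_chart[of y] y(1) openin_subset[OF S] by blast
    have "continuous_on (\<phi> ` (U \<inter> S)) (f \<circ> inv_into U \<phi>)"
      by (rule holomorphic_on_imp_continuous_on[OF holomorphic_fun_chart[OF U(1) f]])
    then have "open ((f \<circ> inv_into U \<phi>) -` O' \<inter> \<phi> ` (U \<inter> S))"
      using O' chart_image_open[OF U(1) S] by (metis continuous_on_open_vimage)
    then have "openin (top_space M) ({x \<in> U. \<phi> x \<in> (f \<circ> inv_into U \<phi>) -` O' \<inter> \<phi> ` (U \<inter> S)})" (is "openin _ ?T")
      by (rule chart_preimage_open[OF U(1)])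
    moreover have "y \<in> ?T" "?T \<subseteq> {y \<in> S. f y \<in> O'}"
      using y U by auto (metis chart_inv[OF U(1)])+
    ultimately show "\<exists>T. openin (top_space M) T \<and> y \<in> T \<and> T \<subseteq> {y \<in> S. f y \<in> O'}"
      by blast
  qed
  then show ?thesis
    using S openin_subset[OF S] 
    by (auto simp: continuous_map_def openin_open_subtopology Int_absorb1)
qed

lemma holomorphic_fun_open_preimage:
  assumes "holomorphic_fun M S f" "openin (top_space M) S" "open W"
  shows "openin (top_space M) {y \<in> S. f y \<in> W}"
  using openin_continuous_map_preimage[OF holomorphic_fun_continuous[OF assms(1,2)], of W] assms
    openin_subset[OF assms(2)]
  by (simp add: openin_open_subtopology Int_absorb1)

lemma holomorphic_fun_tendsto:
  assumes "holomorphic_fun M S f" "openin (top_space M) S" "y \<in> S"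
  shows "(f \<longlongrightarrow> f y) (atin (top_space M) y)"
  unfolding tendsto_def eventually_atin
proof (intro allI impI disjI2)
  fix O' assume "open O'" "f y \<in> O'"
  then show "\<exists>U. openin (top_space M) U \<and> y \<in> U \<and> (\<forall>x\<in>U - {y}. f x \<in> O')"
    using holomorphic_fun_open_preimage[OF assms(1,2)] assms(3)
    by (intro exI[of _ "{y \<in> S. f y \<in> O'}"]) auto
qed

lemma holomorphic_fun_removable:
  assumes S: "openin (top_space M) S" and K: "finite K" "K \<subseteq> points M"
    and f: "holomorphic_fun M (S - K) f"
    and lim: "\<And>y. y \<in> S \<inter> K \<Longrightarrow> (f \<longlongrightarrow> f y) (atin (top_space M) y)"
  shows "holomorphic_fun M S f"
  unfolding holomorphic_fun_def
proof safe
  fix U \<phi> assume U: "(U, \<phi>) \<in> atlas M"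
  show "(f \<circ> inv_into U \<phi>) holomorphic_on \<phi> ` (U \<inter> S)"
  proof (rule no_isolated_singularity')
    show "open (\<phi> ` (U \<inter> S))"
      by (rule chart_image_open[OF U S])
    show "finite (\<phi> ` (U \<inter> S \<inter> K))"
      using K by blast
    have "\<phi> ` (U \<inter> S) - \<phi> ` (U \<inter> S \<inter> K) \<subseteq> \<phi> ` (U \<inter> (S - K))"
      by blast
    then show "(f \<circ> inv_into U \<phi>) holomorphic_on \<phi> ` (U \<inter> S) - \<phi> ` (U \<inter> S \<inter> K)"
      using holomorphic_fun_chart[OF U f] holomorphic_on_subset by blast
    fix z assume "z \<in> \<phi> ` (U \<inter> S \<inter> K)"
    then obtain y where y: "y \<in> U" "y \<in> S \<inter> K" "z = \<phi> y"
      by blast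
    then show "((f \<circ> inv_into U \<phi>) \<longlongrightarrow> (f \<circ> inv_into U \<phi>) z) (at z within \<phi> ` (U \<inter> S))"
      using lim[OF y(2)] U by (auto simp: filterlim_atin_chart[OF U y(1)] intro: tendsto_within_subset)
  qed
qed

end

section \<open>Two-sheeted covers of the plane\<close>

text \<open>The open mapping theorem in a chart. Finiteness of the fibres excludes constancy: a
  nonempty open set of the plane is infinite and would lie in one fibre.\<close>

lemma (in riemann_surface) open_map_finite_fibres:
  assumes f: "holomorphic_fun M S f" and fin: "\<And>c. finite {y \<in> S. f y = c}"
    and V: "openin (top_space M) V" "V \<subseteq> S"
  shows "open (f ` V)"
proof (subst open_subopen, safe)
  fix y assume y: "y \<in> V"
  then obtain U \<phi> where U: "(U, \<phi>) \<in> atlas M" "y \<in> U"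
    using ex_chart openin_subset[OF V(1)] by blast
  let ?O = "\<phi> ` (U \<inter> V)" and ?g = "inv_into U \<phi>"
  have g: "?g t \<in> V \<and> \<phi> (?g t) = t" if "t \<in> ?O" for t
    using that chart_inv[OF U(1)] by auto
  have op: "open ?O"
    by (rule chart_image_open[OF U(1) V(1)])
  have "open ((f \<circ> ?g) ` ?O)"
  proof (rule open_mapping_thm2[OF _ op op])
    show "(f \<circ> ?g) holomorphic_on ?O"
      by (rule holomorphic_on_subset[OF holomorphic_fun_chart[OF U(1) f]]) (use V in blast)
    fix T assume T: "open T" "T \<subseteq> ?O" "T \<noteq> {}"
    show "\<not> (f \<circ> ?g) constant_on T"
    proof
      assume "(f \<circ> ?g) constant_on T"
      then obtain c where c: "\<And>t. t \<in> T \<Longrightarrow> f (?g t) = c"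
        by (auto simp: constant_on_def)
      have "?g ` T \<subseteq> {y \<in> S. f y = c}"
      proof (rule image_subsetI)
        fix t assume t: "t \<in> T"
        then show "?g t \<in> {y \<in> S. f y = c}"
          using g[of t] T(2) V(2) c[OF t] by blast
      qed
      then have "finite (\<phi> ` ?g ` T)"
        using fin finite_subset by blast
      moreover have "\<phi> ` ?g ` T = T"
        using g T(2) by force
      ultimately have "finite T"
        by simp
      then show False
        using T finite_imp_not_open by blast
    qed
  qed auto
  moreover have "(f \<circ> ?g) ` ?O = f ` (U \<inter> V)"
    using chart_inv[OF U(1)] by (auto simp: image_image)
  ultimately show "\<exists>T. open T \<and> f y \<in> T \<and> T \<subseteq> f ` V"
    using y U(2) by (metis IntI Int_lower2 imageI image_mono)
qed

text \<open>The map M -> M/J away from infinity, with \<open>X\<close> as coordinate and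
  \<open>p\<close>, \<open>q\<close> as the two points over infinity. The axioms constrain
  \<open>J\<close> only on the affine part and are symmetric in \<open>p\<close> and
  \<open>q\<close>, so that \<open>swap\<close> turns a statement about one end into one about the
  other. At a fixed point of \<open>J\<close> the fibre axiom says that the fibre is a single
  point.\<close>

locale double_cover = riemann_surface M for M :: "'a surface" +
  fixes J :: "'a \<Rightarrow> 'a" and X :: "'a \<Rightarrow> complex" and p q :: 'a
  assumes p: "p \<in> points M" and q: "q \<in> points M" and pq: "p \<noteq> q"
    and X_hol: "holomorphic_fun M (points M - {p, q}) X"
    and X_surj: "X ` (points M - {p, q}) = UNIV"
    and J_aff: "y \<in> points M - {p, q} \<Longrightarrow> J y \<in> points M - {p, q}"
    and fibre: "y \<in> points M - {p, q} \<Longrightarrow> z \<in> points M - {p, q} \<Longrightarrow> X y = X z \<longleftrightarrow> z = y \<or> z = J y"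
    and X_inf: "filterlim X at_infinity (atin (top_space M) p)"
      "filterlim X at_infinity (atin (top_space M) q)"
    and fin_fix: "finite {y \<in> points M - {p, q}. J y = y}"
begin

abbreviation (input) aff :: "'a set" where "aff \<equiv> points M - {p, q}"

lemma swap: "double_cover M J X q p"
  by unfold_locales (use p q pq X_hol X_surj J_aff fibre X_inf fin_fix in \<open>simp_all add: insert_commute\<close>)

lemma open_aff: "openin (top_space M) aff"
  by (rule openin_Diff_finite) (use p q in auto)

lemma fibre_cases: "y \<in> aff \<Longrightarrow> z \<in> aff \<Longrightarrow> X y = X z \<Longrightarrow> y \<noteq> z \<Longrightarrow> z = J y"
  using fibre by metis

lemma fibre_three: "a \<in> aff \<Longrightarrow> b \<in> aff \<Longrightarrow> c \<in> aff \<Longrightarrow> X a = X b \<Longrightarrow> X c = X b \<Longrightarrow> a \<noteq> b \<Longrightarrow> b \<noteq> c \<Longrightarrow> a = c"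
  using fibre by metis

lemma X_J: "y \<in> aff \<Longrightarrow> X (J y) = X y"
  using fibre J_aff by metis

lemma J_J: "y \<in> aff \<Longrightarrow> J (J y) = y"
  using fibre J_aff by metis

lemma X_pre_open: "open W \<Longrightarrow> openin (top_space M) {y \<in> aff. X y \<in> W}"
  by (rule holomorphic_fun_open_preimage[OF X_hol open_aff])

lemma X_open_map:
  assumes V: "openin (top_space M) V" "V \<subseteq> aff"
  shows "open (X ` V)"
proof (rule open_map_finite_fibres[OF X_hol _ V])
  fix c
  show "finite {y \<in> aff. X y = c}"
  proof (cases "\<exists>z\<in>aff. X z = c")
    case True
    then obtain z where z: "z \<in> aff" "X z = c"
      by blast
    have "{y \<in> aff. X y = c} \<subseteq> {z, J z}"
    proof (rule subsetI)
      fix y assume "y \<in> {y \<in> aff. X y = c}"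
      then show "y \<in> {z, J z}"
        using fibre[of z y] z by simp
    qed
    then show ?thesis
      by (rule finite_subset) simp
  next
    case False
    then have "{y \<in> aff. X y = c} = {}"
      by blast
    then show ?thesis
      by (simp only: finite.emptyI)
  qed
qed

text \<open>Near a point that \<open>J\<close> moves, the two sheets separate and \<open>X\<close>
  is invertible on each of them. The locale has no regularity axiom for \<open>J\<close>; that
  \<open>h \<circ> J\<close> is holomorphic along the section comes from recognising
  \<open>J (s x)\<close> as the section of the other sheet.\<close>

lemma local_section:
  assumes y: "y \<in> aff" "J y \<noteq> y"
  obtains W s where "open W" "X y \<in> W" "s (X y) = y" "\<And>x. x \<in> W \<Longrightarrow> s x \<in> aff" "\<And>x. x \<in> W \<Longrightarrow> X (s x) = x"
    "\<And>h. holomorphic_fun M aff h \<Longrightarrow> (h \<circ> s) holomorphic_on W"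
    "\<And>h. holomorphic_fun M aff h \<Longrightarrow> (h \<circ> J \<circ> s) holomorphic_on W"
proof -
  obtain V1 V2 where V: "openin (top_space M) V1" "openin (top_space M) V2" "y \<in> V1" "J y \<in> V2" "V1 \<inter> V2 = {}"
    using separate[OF _ _ y(2)[symmetric]] y(1) J_aff[OF y(1)] by blast
  have Jy: "J y \<in> aff" "X (J y) = X y"
    by (fact J_aff[OF y(1)] X_J[OF y(1)])+
  obtain U1 \<phi>1 where U1: "(U1, \<phi>1) \<in> atlas M" "y \<in> U1"
    using ex_chart y(1) by blast
  obtain U2 \<phi>2 where U2: "(U2, \<phi>2) \<in> atlas M" "J y \<in> U2"
    using ex_chart Jy(1) by blast
  note U = U1 U2
  define N1 where "N1 = V1 \<inter> U1 \<inter> aff"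
  define N2 where "N2 = V2 \<inter> U2 \<inter> aff"
  have N: "openin (top_space M) N1" "openin (top_space M) N2" "N1 \<subseteq> aff" "N2 \<subseteq> aff"
    unfolding N1_def N2_def
    by (intro openin_Int V chart_open(1)[OF U(1)] chart_open(1)[OF U(3)] open_aff | blast)+
  \<comment> \<open>Over \<open>W\<close> a fibre meets both of the disjoint sets \<open>N1\<close>
    and \<open>N2\<close>. A fibre has at most two points, so it meets each set exactly
    once.\<close>
  define W where "W = X ` N1 \<inter> X ` N2"
  have W: "open W"
    unfolding W_def using X_open_map N by (intro open_Int) auto
  have y12: "y \<in> N1" "J y \<in> N2"
    using V U y Jy by (auto simp: N1_def N2_def)
  have XW: "X y \<in> W"
    unfolding W_def using y12 Jy(2) by (metis IntI imageI)
  have N12: "N1 \<inter> N2 = {}"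
    using V(5) unfolding N1_def N2_def by blast
  have partner: "b = J a" if "a \<in> N1" "b \<in> N2" "X a = X b" for a b
    by (rule fibre_cases) (use that N N12 in auto)
  have ex1: "\<exists>!a. a \<in> N1 \<and> X a = x" if x: "x \<in> W" for x
  proof -
    obtain a b where ab: "a \<in> N1" "b \<in> N2" "X a = x" "X b = x"
      using x unfolding W_def by (metis IntE imageE)
    have "a = c" if c: "c \<in> N1" "X c = x" for c
      by (rule fibre_three[of a b c]) (use c ab N N12 in auto)
    then show ?thesis
      using ab by metis
  qed
  have ex2: "\<exists>!b. b \<in> N2 \<and> X b = x" if x: "x \<in> W" for x
  proof -
    obtain a b where ab: "a \<in> N1" "b \<in> N2" "X a = x" "X b = x"
      using x unfolding W_def by (metis IntE imageE)
    have "c = b" if c: "c \<in> N2" "X c = x" for c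
      using partner[OF ab(1,2)] partner[OF ab(1) c(1)] c ab by metis
    then show ?thesis
      using ab by metis
  qed
  define s where "s x = (THE a. a \<in> N1 \<and> X a = x)" for x
  define s2 where "s2 x = (THE a. a \<in> N2 \<and> X a = x)" for x
  have s: "s x \<in> N1" "X (s x) = x" "s2 x \<in> N2" "X (s2 x) = x" if "x \<in> W" for x
    using theI'[OF ex1[OF that]] theI'[OF ex2[OF that]] unfolding s_def s2_def by auto
  have s2J: "s2 x = J (s x)" if "x \<in> W" for x
    using partner s[OF that] by metis
  \<comment> \<open>On the part of \<open>N\<close> over \<open>W\<close> the function
    \<open>X\<close> is injective, so in the chart it has a holomorphic inverse \<open>g\<close>;
    the section is this inverse, whichever sheet it runs in.\<close>
  have key: "(h \<circ> t) holomorphic_on W"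
    if h: "holomorphic_fun M aff h" and U: "(U, \<phi>) \<in> atlas M" and N: "openin (top_space M) N" "N \<subseteq> U" "N \<subseteq> aff"
      and t: "\<And>x. x \<in> W \<Longrightarrow> t x \<in> N" "\<And>x. x \<in> W \<Longrightarrow> X (t x) = x" and ex: "\<And>x. x \<in> W \<Longrightarrow> \<exists>!a. a \<in> N \<and> X a = x"
    for h t U \<phi> N
  proof -
    define N' where "N' = {a \<in> aff. X a \<in> W} \<inter> N"
    have N': "openin (top_space M) N'" "N' \<subseteq> U" "N' \<subseteq> aff"
      unfolding N'_def using N X_pre_open[OF W] by (auto intro!: openin_Int)
    let ?f = "X \<circ> inv_into U \<phi>" and ?S = "\<phi> ` (U \<inter> N')"
    have "?f holomorphic_on ?S"
      by (rule holomorphic_on_subset[OF holomorphic_fun_chart[OF U X_hol]]) (use N' in blast)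
    moreover have "open ?S"
      by (rule chart_image_open[OF U N'(1)])
    moreover have "inj_on ?f ?S"
    proof (rule inj_onI)
      fix z z' assume z: "z \<in> ?S" "z' \<in> ?S" "?f z = ?f z'"
      then obtain a a' where a: "a \<in> U" "a \<in> N'" "z = \<phi> a" "a' \<in> U" "a' \<in> N'" "z' = \<phi> a'"
        by blast
      have "X a = X a'"
        using z(3) a chart_inv[OF U] by simp
      then have "a = a'"
        using ex[of "X a"] a(2,5) by (metis (no_types, lifting) IntE N'_def mem_Collect_eq)
      then show "z = z'"
        using a by simp
    qed
    ultimately obtain g where g: "g holomorphic_on (?f ` ?S)" "\<And>z. z \<in> ?S \<Longrightarrow> g (?f z) = z"
      using holomorphic_has_inverse by metis
    have gt: "g x = \<phi> (t x)" "t x \<in> N'" "x \<in> ?f ` ?S" if x: "x \<in> W" for x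
    proof -
      show tN: "t x \<in> N'"
        using t[OF x] N x unfolding N'_def by auto
      have "x = ?f (\<phi> (t x))"
        using t[OF x] chart_inv[OF U subsetD[OF N(2) t(1)[OF x]]] by simp
      moreover have "\<phi> (t x) \<in> ?S"
        using tN N' by blast
      ultimately show "g x = \<phi> (t x)" "x \<in> ?f ` ?S"
        using g(2)[of "\<phi> (t x)"] by (metis, metis imageI)
    qed
    have "((h \<circ> inv_into U \<phi>) \<circ> g) holomorphic_on W"
    proof (rule holomorphic_on_compose_gen[OF _ holomorphic_fun_chart[OF U h]])
      show "g holomorphic_on W"
        using g(1) by (rule holomorphic_on_subset) (use gt in blast)
      show "g ` W \<subseteq> \<phi> ` (U \<inter> (points M - {p, q}))"
      proof safe
        fix x assume x: "x \<in> W"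
        show "g x \<in> \<phi> ` (U \<inter> (points M - {p, q}))"
          unfolding gt(1)[OF x] using gt(2)[OF x] N' by (intro imageI) blast
      qed
    qed
    then show ?thesis
      by (rule holomorphic_transform)
        (simp add: gt(1) chart_inv[OF U subsetD[OF N'(2) gt(2)]])
  qed
  show thesis
  proof (rule that[of W s])
    show "open W" "X y \<in> W"
      by fact+
    show "s (X y) = y"
      using ex1[OF XW] s[OF XW] y12 by (metis (no_types))
    show "s x \<in> aff" "X (s x) = x" if "x \<in> W" for x
      using s[OF that] N by auto
    show "(h \<circ> s) holomorphic_on W" if "holomorphic_fun M aff h" for h
      by (rule key[OF that U(1) N(1)]) (use s ex1 N in \<open>auto simp: N1_def\<close>)
    show "(h \<circ> J \<circ> s) holomorphic_on W" if "holomorphic_fun M aff h" for h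
    proof -
      have "(h \<circ> s2) holomorphic_on W"
        by (rule key[OF that U(3) N(2)]) (use s ex2 N in \<open>auto simp: N2_def\<close>)
      then show ?thesis
        by (rule holomorphic_transform) (simp add: s2J)
    qed
  qed
qed

section \<open>The cover near its branch points and near its two ends\<close>

lemma X_compact_image:
  assumes "compactin (top_space M) K" "K \<subseteq> aff"
  shows "compact (X ` K)"
proof -
  have "compactin (subtopology (top_space M) aff) K"
    using assms by (simp add: compactin_subtopology)
  then show ?thesis
    using image_compactin[OF _ holomorphic_fun_continuous[OF X_hol open_aff]] by fastforce
qed

text \<open>A fixed point is alone in its fibre. The complement of \<open>V\<close> and of
  neighbourhoods of both ends is compact, so its image under \<open>X\<close> is closed and misses
  \<open>X y\<close>; values close to \<open>X y\<close> are then taken only in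
  \<open>V\<close>.\<close>

lemma near_fixed:
  assumes y: "y \<in> aff" "J y = y" and V: "openin (top_space M) V" "y \<in> V"
  obtains d where "d > 0" "\<And>z. z \<in> aff \<Longrightarrow> dist (X z) (X y) < d \<Longrightarrow> z \<in> V"
proof -
  have ev: "eventually (\<lambda>x. norm x > norm (X y) + 1) (at_infinity :: complex filter)"
    unfolding eventually_at_infinity
    by (rule exI[of _ "norm (X y) + 2"]) auto
  obtain V1 where V1: "openin (top_space M) V1" "p \<in> V1" "\<forall>x\<in>V1 - {p}. norm (X x) > norm (X y) + 1"
    using X_inf(1) ev p unfolding filterlim_iff eventually_atin by blast
  obtain V2 where V2: "openin (top_space M) V2" "q \<in> V2" "\<forall>x\<in>V2 - {q}. norm (X x) > norm (X y) + 1"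
    using X_inf(2) ev q unfolding filterlim_iff eventually_atin by blast
  let ?K = "points M - (V \<union> V1 \<union> V2)"
  have "compactin (top_space M) ?K"
    using V V1 V2 compact by (intro closedin_compact_space closedin_diff) auto
  then have "compact (X ` ?K)"
    by (rule X_compact_image) (use V1 V2 in auto)
  then have "open (- (X ` ?K))"
    by (simp add: compact_imp_closed open_Compl)
  moreover have "X y \<notin> X ` ?K"
    using fibre[OF y(1)] y V V1(2) V2(2) by auto
  ultimately obtain e where e: "e > 0" "ball (X y) e \<subseteq> - (X ` ?K)"
    by (metis ComplI openE)
  \<comment> \<open>The bound 1 keeps \<open>z\<close> out of \<open>V1\<close> and
    \<open>V2\<close>, where the modulus of \<open>X\<close> exceeds that of \<open>X y\<close> by
    more than 1; the bound \<open>e\<close> keeps it out of the compact set.\<close>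
  show thesis
  proof (rule that[of "min e 1"])
    show "min e 1 > 0"
      using e by simp
    fix z assume z: "z \<in> aff" "dist (X z) (X y) < min e 1"
    have "norm (X z) \<le> norm (X y) + dist (X z) (X y)"
      by (metis dist_norm norm_triangle_sub add.commute)
    then have "z \<notin> V1 \<union> V2"
      using z V1(3) V2(3) by (smt (verit, best) DiffE DiffI UnE insertCI singletonD)
    moreover have "z \<notin> ?K"
    proof
      assume "z \<in> ?K"
      then have "X z \<notin> ball (X y) e"
        using e(2) by blast
      then show False
        using z(2) by (simp add: dist_commute)
    qed
    ultimately show "z \<in> V"
      using z by blast
  qed
qed

text \<open>\<open>u\<close> is 1 / X, extended by 0 at \<open>p\<close>. Since \<open>X\<close>
  tends to infinity the singularity is removable; since \<open>u\<close> vanishes only at the centre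
  it is nonconstant, hence open.\<close>

lemma end_coordinate_aux:
  assumes V: "openin (top_space M) V" "p \<in> V" and U: "(U, \<phi>) \<in> atlas M" "p \<in> U"
  obtains r u where "r > 0" "ball (\<phi> p) r \<subseteq> \<phi> ` (U \<inter> (V - {q}))"
    "u holomorphic_on ball (\<phi> p) r" "u (\<phi> p) = 0"
    "\<And>z. z \<in> ball (\<phi> p) r - {\<phi> p} \<Longrightarrow> u z \<noteq> 0 \<and> X (inv_into U \<phi> z) = inverse (u z)"
    "open (u ` ball (\<phi> p) r)"
proof -
  have "eventually (\<lambda>x::complex. norm x > 0) at_infinity"
    unfolding eventually_at_infinity by (rule exI[of _ 1]) auto
  then obtain V1 where V1: "openin (top_space M) V1" "p \<in> V1" "\<forall>x\<in>V1 - {p}. norm (X x) > 0"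
    using X_inf(1) p unfolding filterlim_iff eventually_atin by blast
  have "openin (top_space M) (V \<inter> V1 - {q})"
    using V V1 q by (intro openin_Diff_finite openin_Int) auto
  then obtain r where r: "r > 0" "ball (\<phi> p) r \<subseteq> \<phi> ` (U \<inter> (V \<inter> V1 - {q}))"
    using chart_ball[OF U(1) _ U(2)] V V1 pq by blast
  let ?g = "inv_into U \<phi>"
  define u where "u z = (if z = \<phi> p then 0 else inverse (X (?g z)))" for z
  have g: "?g z \<in> V \<inter> V1 - {q} \<and> ?g z \<in> U \<and> ?g z \<noteq> p \<and> ?g z \<in> aff" if z: "z \<in> ball (\<phi> p) r - {\<phi> p}" for z
  proof -
    obtain a where a: "a \<in> U" "a \<in> V \<inter> V1 - {q}" "z = \<phi> a"
      using r(2) z by blast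
    moreover have "a \<noteq> p"
      using a(3) z by blast
    ultimately show ?thesis
      using chart_inv[OF U(1) a(1)] chart_subset[OF U(1)] by auto
  qed
  have u: "u z \<noteq> 0 \<and> X (?g z) = inverse (u z)" if z: "z \<in> ball (\<phi> p) r - {\<phi> p}" for z
    using V1(3) g[OF z] z by (auto simp: u_def)
  have "u holomorphic_on ball (\<phi> p) r"
  proof (rule no_isolated_singularity'[where K = "{\<phi> p}"])
    have "(\<lambda>z. inverse ((X \<circ> ?g) z)) holomorphic_on ball (\<phi> p) r - {\<phi> p}"
    proof (intro holomorphic_intros)
      have "z \<in> \<phi> ` (U \<inter> aff)" if z: "z \<in> ball (\<phi> p) r - {\<phi> p}" for z
      proof -
        obtain a where a: "a \<in> U" "z = \<phi> a"
          using r(2) z by blast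
        then show ?thesis
          using g[OF z] chart_inv[OF U(1) a(1)] by auto
      qed
      then show "(X \<circ> ?g) holomorphic_on ball (\<phi> p) r - {\<phi> p}"
        using holomorphic_fun_chart[OF U(1) X_hol] holomorphic_on_subset by blast
      show "(X \<circ> ?g) z \<noteq> 0" if "z \<in> ball (\<phi> p) r - {\<phi> p}" for z
        using u[OF that] by simp
    qed
    then show "u holomorphic_on ball (\<phi> p) r - {\<phi> p}"
      by (rule holomorphic_transform) (auto simp: u_def)
    fix z assume "z \<in> {\<phi> p}"
    have "((\<lambda>z. inverse ((X \<circ> ?g) z)) \<longlongrightarrow> 0) (at (\<phi> p))"
      using X_inf(1) unfolding filterlim_atin_chart[OF U(1,2)]
      by (rule filterlim_compose[OF tendsto_inverse_0])
    then have "(u \<longlongrightarrow> 0) (at (\<phi> p))"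
      by (rule Lim_transform_eventually) (auto simp: u_def eventually_at_filter)
    then show "(u \<longlongrightarrow> u z) (at z within ball (\<phi> p) r)"
      using \<open>z \<in> {\<phi> p}\<close> by (auto simp: u_def intro: tendsto_within_subset)
  qed auto
  moreover have "open (u ` ball (\<phi> p) r)"
  proof (rule open_mapping_thm[OF calculation open_ball connected_ball open_ball order_refl])
    show "\<not> u constant_on ball (\<phi> p) r"
    proof
      assume "u constant_on ball (\<phi> p) r"
      then obtain c where c: "\<And>z. z \<in> ball (\<phi> p) r \<Longrightarrow> u z = c"
        by (auto simp: constant_on_def)
      have "u (\<phi> p) = 0"
        by (simp add: u_def)
      moreover have "\<phi> p + of_real (r/2) \<in> ball (\<phi> p) r - {\<phi> p}"
        using r(1) by (auto simp: dist_norm)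
      ultimately show False
        using c u r(1) by (metis DiffD1 centre_in_ball)
    qed
  qed
  moreover have "ball (\<phi> p) r \<subseteq> \<phi> ` (U \<inter> (V - {q}))"
    using r(2) by blast
  moreover have "u (\<phi> p) = 0"
    by (simp add: u_def)
  ultimately show thesis
    using that[OF r(1) _ _ _ u] by blast
qed

text \<open>For large \<open>x\<close> the number 1 / x lies in the open image of \<open>u\<close>
  around 0, which yields a preimage of \<open>x\<close> near \<open>p\<close>.\<close>

lemma end_section_aux:
  assumes V: "openin (top_space M) V" "p \<in> V"
  obtains R where "\<And>x. norm x > R \<Longrightarrow> \<exists>y\<in>V \<inter> aff. X y = x"
proof -
  obtain U \<phi> where chart: "(U, \<phi>) \<in> atlas M" "p \<in> U"
    using ex_chart p by blast
  obtain r u where coord: "r > 0" "ball (\<phi> p) r \<subseteq> \<phi> ` (U \<inter> (V - {q}))"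
    "u holomorphic_on ball (\<phi> p) r" "u (\<phi> p) = 0"
    "\<And>z. z \<in> ball (\<phi> p) r - {\<phi> p} \<Longrightarrow> u z \<noteq> 0 \<and> X (inv_into U \<phi> z) = inverse (u z)"
    "open (u ` ball (\<phi> p) r)"
    using end_coordinate_aux[OF V chart] by metis
  note U = chart coord
  have "0 \<in> u ` ball (\<phi> p) r"
    using U(3,6) by (metis centre_in_ball imageI)
  then obtain e where e: "e > 0" "ball 0 e \<subseteq> u ` ball (\<phi> p) r"
    using U(8) openE by blast
  show thesis
  proof (rule that[of "inverse e"])
    fix x :: complex assume x: "norm x > inverse e"
    then have x0: "x \<noteq> 0"
      using e(1) by (smt (verit) norm_zero positive_imp_inverse_positive)
    have "norm (inverse x) < e"
      using less_imp_inverse_less[OF x] e(1) by (simp add: norm_inverse)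
    then obtain z where z: "z \<in> ball (\<phi> p) r" "u z = inverse x"
      using e(2) by (auto simp: subset_iff image_iff)
    then have z': "z \<in> ball (\<phi> p) r - {\<phi> p}"
      using U(6) x0 by auto
    then obtain a where a: "a \<in> U" "a \<in> V - {q}" "z = \<phi> a"
      using U(4) by blast
    have "a \<noteq> p"
      using a z' by blast
    then show "\<exists>y\<in>V \<inter> aff. X y = x"
    proof (intro bexI[of _ a])
      show "X a = x"
        using a(3) U(7)[OF z'] z(2) chart_inv[OF U(1) a(1)] by simp
      show "a \<in> V \<inter> aff"
        using a \<open>a \<noteq> p\<close> chart_subset[OF U(1)] by blast
    qed
  qed
qed

end

text \<open>A large value is taken near \<open>p\<close> and also near \<open>q\<close>. These two
  points exhaust the fibre, so the value is taken only once near \<open>p\<close>, and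
  \<open>J\<close> carries one end to the other.\<close>

lemma (in double_cover) ends:
  assumes V: "openin (top_space M) V" "p \<in> V" "openin (top_space M) V'" "q \<in> V'" "V \<inter> V' = {}"
  obtains R where "\<And>x. norm x > R \<Longrightarrow> \<exists>!y. y \<in> V \<inter> aff \<and> X y = x" 
    "\<And>y. norm (X y) > R \<Longrightarrow> y \<in> V \<inter> aff \<Longrightarrow> J y \<in> V'"
proof -
  obtain R1 where R1: "\<And>x. norm x > R1 \<Longrightarrow> \<exists>y\<in>V \<inter> aff. X y = x"
    using end_section_aux[OF V(1,2)] by metis
  obtain R2 where R2: "\<And>x. norm x > R2 \<Longrightarrow> \<exists>y\<in>V' \<inter> aff. X y = x"
    using double_cover.end_section_aux[OF swap V(3,4)] by (metis insert_commute)
  have *: "J y \<in> V'" if y: "norm (X y) > R2" "y \<in> V \<inter> aff" for y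
  proof -
    obtain z where z: "z \<in> V' \<inter> aff" "X z = X y"
      using R2[OF y(1)] by blast
    then have "z = J y"
      by (intro fibre_cases) (use y V(5) in auto)
    then show ?thesis
      using z by blast
  qed
  show thesis
  proof (rule that[of "max R1 R2"])
    fix x :: complex assume x: "norm x > max R1 R2"
    then obtain y where y: "y \<in> V \<inter> aff" "X y = x"
      using R1 by (metis max_less_iff_conj)
    have "z = y" if z: "z \<in> V \<inter> aff \<and> X z = x" for z
    proof (rule ccontr)
      assume "z \<noteq> y"
      then have "z = J y"
        by (intro fibre_cases) (use z y in auto)
      then show False
        using *[of y] x y z V(5) by auto
    qed
    then show "\<exists>!y. y \<in> V \<inter> aff \<and> X y = x"
      using y by blast
  qed (use * in auto)
qed

section \<open>Entire functions, squares and orders of vanishing\<close>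

lemma tendsto_power_ratio_at_infinity:
  assumes "k \<le> n"
  shows "((\<lambda>x::complex. x ^ k / x ^ n) \<longlongrightarrow> (if k = n then 1 else 0)) at_infinity"
proof -
  have nz: "eventually (\<lambda>x::complex. x \<noteq> 0) at_infinity"
    unfolding eventually_at_infinity by (rule exI[of _ 1]) auto
  have lim: "((\<lambda>x::complex. inverse x ^ (n - k)) \<longlongrightarrow> 0 ^ (n - k)) at_infinity"
    by (intro tendsto_power tendsto_inverse_0)
  have z: "(0::complex) ^ (n - k) = (if k = n then 1 else 0)"
    using assms by (auto simp: power_0_left)
  have "eventually (\<lambda>x::complex. inverse x ^ (n - k) = x ^ k / x ^ n) at_infinity"
    using nz
  proof eventually_elim
    case (elim x)
    have "x ^ n = x ^ k * x ^ (n - k)"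
      using assms by (simp flip: power_add)
    then show ?case
      using elim by (simp add: power_inverse field_simps)
  qed
  from Lim_transform_eventually[OF lim this] show ?thesis
    by (simp only: z)
qed

lemma poly_ratio_at_infinity:
  assumes "degree P \<le> n"
  shows "((\<lambda>x::complex. poly P x / x ^ n) \<longlongrightarrow> coeff P n) at_infinity"
proof -
  have "((\<lambda>x. \<Sum>k\<le>n. coeff P k * (x ^ k / x ^ n)) \<longlongrightarrow> (\<Sum>k\<le>n. coeff P k * (if k = n then 1 else 0))) at_infinity"
    by (intro tendsto_sum tendsto_mult tendsto_const tendsto_power_ratio_at_infinity) auto
  moreover have "poly P x / x ^ n = (\<Sum>k\<le>n. coeff P k * (x ^ k / x ^ n))" for x
  proof -
    have "poly P x = (\<Sum>k\<le>n. coeff P k * x ^ k)"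
      unfolding poly_altdef
      by (rule sum.mono_neutral_left) (use assms in \<open>auto simp: coeff_eq_0\<close>)
    then show ?thesis
      by (simp add: sum_divide_distrib)
  qed
  ultimately show ?thesis
    by (simp add: if_distrib[of "\<lambda>t. _ * t"] cong: if_cong)
qed

lemma entire_is_poly:
  assumes S: "S holomorphic_on UNIV" and bd: "eventually (\<lambda>x. norm (S x) \<le> B * norm x ^ k) at_infinity"
  obtains P where "degree P \<le> k" "\<And>x. S x = poly P x"
proof -
  obtain A where A: "\<And>x. A \<le> norm x \<Longrightarrow> norm (S x) \<le> B * norm x ^ k"
    using bd unfolding eventually_at_infinity by blast
  define P where "P = (\<Sum>i\<le>k. monom ((deriv ^^ i) S 0 / fact i) i)"
  have "S x = poly P x" for x
    using Liouville_polynomial[OF S A] by (simp add: P_def poly_sum poly_monom)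
  moreover have "degree P \<le> k"
    unfolding P_def by (intro degree_sum_le) (auto intro: order_trans[OF degree_monom_le])
  ultimately show thesis
    using that by blast
qed

text \<open>The limit also identifies the coefficient of x^k. A limit 0 is allowed and then lowers
  the degree bound by one, which is what the count of differentials needs.\<close>

lemma entire_is_poly_limit:
  assumes S: "S holomorphic_on UNIV" and lim: "((\<lambda>x. S x / x ^ k) \<longlongrightarrow> L) at_infinity"
  obtains P where "degree P \<le> k" "coeff P k = L" "\<And>x. S x = poly P x"
proof -
  have "eventually (\<lambda>x. norm (S x / x ^ k) < norm L + 1) at_infinity"
    using order_tendstoD(2)[OF tendsto_norm[OF lim]] by simp
  moreover have "eventually (\<lambda>x::complex. x \<noteq> 0) at_infinity"
    unfolding eventually_at_infinity by (rule exI[of _ 1]) auto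
  ultimately have "eventually (\<lambda>x. norm (S x) \<le> (norm L + 1) * norm x ^ k) at_infinity"
    by eventually_elim (simp add: norm_divide norm_power field_simps)
  then obtain P where P: "degree P \<le> k" "\<And>x. S x = poly P x"
    using entire_is_poly[OF S] by metis
  have "((\<lambda>x. S x / x ^ k) \<longlongrightarrow> coeff P k) at_infinity"
    using poly_ratio_at_infinity[OF P(1)] P(2) by simp
  then have "coeff P k = L"
    using lim tendsto_unique trivial_limit_at_infinity by blast
  then show thesis
    using that P by blast
qed

lemma poly_order_factor:
  fixes R :: "complex poly"
  assumes "R \<noteq> 0"
  obtains h where "R = [:-a, 1:] ^ order a R * h" "poly h a \<noteq> 0"
  using order_decomp[OF assms, of a] poly_eq_0_iff_dvd by metis

text \<open>The order of a square is twice the order of its root, and the order of \<open>R\<close>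
  as a function at \<open>a\<close> is its multiplicity there.\<close>

lemma even_order_if_local_square:
  assumes W: "open W" "a \<in> W" and g: "g holomorphic_on W"
    and sq: "\<And>x. x \<in> W \<Longrightarrow> g x ^ 2 = poly R x" and R: "R \<noteq> 0"
  shows "even (order a R)"
proof -
  obtain h where h: "R = [:-a, 1:] ^ order a R * h" "poly h a \<noteq> 0"
    using poly_order_factor[OF R] by blast
  have "zorder (poly R) a = int (order a R)"
  proof (rule zorder_eqI[where S = UNIV and g = "poly h"])
    fix w show "poly R w = poly h w * (w - a) powi int (order a R)"
      by (subst h(1)) (simp add: poly_power)
  qed (use h(2) in \<open>auto intro: poly_holomorphic_on\<close>)
  moreover have "zorder (\<lambda>z. g z ^ 2) a = zorder (poly R) a"
    by (rule zorder_cong) (use W sq in \<open>auto simp: eventually_at_filter intro: eventually_nhds_in_open[THEN eventually_mono]\<close>)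
  moreover have "zorder (\<lambda>z. g z ^ 2) a = 2 * zorder g a"
  proof (rule zorder_power[of g a 2, simplified])
    have "g analytic_on {a}"
      using W g holomorphic_on_imp_analytic_at by blast
    then show "g meromorphic_on {a}"
      by (rule analytic_on_imp_meromorphic_on)
    have "eventually (\<lambda>z. z \<in> W - {z. poly R z = 0} \<or> z = a) (nhds a)"
    proof -
      have "open (W - ({z. poly R z = 0} - {a}))"
        using W(1) poly_roots_finite[OF R] by (intro open_Diff finite_imp_closed) auto
      moreover have "a \<in> W - ({z. poly R z = 0} - {a})"
        using W(2) by blast
      ultimately show ?thesis
        by (rule eventually_nhds_in_open[THEN eventually_mono]) auto
    qed
    then have "eventually (\<lambda>z. g z \<noteq> 0) (at a)"
      unfolding eventually_at_filter
    proof (rule eventually_mono)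
      show "x \<noteq> a \<longrightarrow> x \<in> UNIV \<longrightarrow> g x \<noteq> 0" if "x \<in> W - {z. poly R z = 0} \<or> x = a" for x
        using sq[of x] that by auto
    qed
    then show "frequently (\<lambda>z. g z \<noteq> 0) (at a)"
      by (rule eventually_frequently[rotated]) simp
  qed
  ultimately show ?thesis
    by presburger
qed

text \<open>Every root enters the square with half its multiplicity, rounded down; the roots of odd
  multiplicity each leave one linear factor.\<close>

lemma poly_squarefree_part:
  fixes R :: "complex poly"
  assumes R: "R \<noteq> 0" and E: "\<And>e. odd (order e R) \<longleftrightarrow> e \<in> E"
  obtains Q where "R = (\<Prod>e\<in>E. [:-e, 1:]) * Q ^ 2"
proof -
  let ?Z = "{z. poly R z = 0}"
  let ?l = "\<lambda>z::complex. [:-z, 1:]"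
  have fin: "finite ?Z"
    by (rule poly_roots_finite[OF R])
  have sub: "E \<subseteq> ?Z"
    using E R order_root by (metis (mono_tags, lifting) even_zero mem_Collect_eq subsetI)
  define T where "T = (\<Prod>z\<in>?Z. ?l z ^ (order z R div 2))"
  have "(\<Prod>z\<in>?Z. ?l z ^ order z R) = (\<Prod>z\<in>?Z. (if z \<in> E then ?l z else 1) * (?l z ^ (order z R div 2)) ^ 2)"
  proof (rule prod.cong[OF refl])
    fix z
    have "?l z ^ order z R = ?l z ^ (order z R mod 2 + order z R div 2 * 2)"
      by (simp add: mult.commute)
    then show "?l z ^ order z R = (if z \<in> E then ?l z else 1) * (?l z ^ (order z R div 2)) ^ 2"
      using E[of z] by (simp only: power_add power_mult) (auto simp: odd_iff_mod_2_eq_one even_iff_mod_2_eq_zero)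
  qed
  also have "\<dots> = (\<Prod>z\<in>?Z. if z \<in> E then ?l z else 1) * T ^ 2"
    by (simp add: prod.distrib T_def prod_power_distrib)
  also have "(\<Prod>z\<in>?Z. if z \<in> E then ?l z else 1) = (\<Prod>z\<in>E. ?l z)"
    using prod.inter_restrict[OF fin, of ?l E] sub by (simp add: Int_absorb1)
  finally have "R = (\<Prod>z\<in>E. ?l z) * smult (lead_coeff R) (T ^ 2)"
    by (subst complex_poly_decompose[of R, symmetric]) simp
  \<comment> \<open>The leading coefficient has a complex square root and is absorbed into the
    square.\<close>
  also have "smult (lead_coeff R) (T ^ 2) = smult (csqrt (lead_coeff R)) T ^ 2"
    by (simp add: smult_power)
  finally show thesis
    by (rule that)
qed

text \<open>A zero-free function on a disc has a holomorphic square root; of its two signs the one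
  with value \<open>w\<close> at the centre is taken.\<close>

lemma holomorphic_sqrt_near:
  assumes "poly D a = w ^ 2" "w \<noteq> 0"
  obtains r s where "r > 0" "s holomorphic_on ball a r" "s a = w" "\<And>x. x \<in> ball a r \<Longrightarrow> s x ^ 2 = poly D x"
    "\<And>x. x \<in> ball a r \<Longrightarrow> s x \<noteq> 0"
proof -
  have "open {x. poly D x \<noteq> 0}"
    by (intro open_Collect_neq continuous_intros)
  moreover have "a \<in> {x. poly D x \<noteq> 0}"
    using assms by simp
  ultimately obtain r where r: "r > 0" "ball a r \<subseteq> {x. poly D x \<noteq> 0}"
    using openE by blast
  obtain g where g: "g holomorphic_on ball a r" "\<And>z. z \<in> ball a r \<Longrightarrow> poly D z = g z ^ 2"
    by (rule contractible_imp_holomorphic_sqrt[of "poly D" "ball a r"])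
      (use r in \<open>auto intro: poly_holomorphic_on convex_imp_contractible\<close>)
  have "g a ^ 2 = w ^ 2"
    using g(2)[of a] assms r(1) by simp
  then have "g a = w \<or> - g a = w"
    by (metis minus_minus power2_eq_iff)
  then show thesis
  proof
    assume "g a = w"
    show thesis
      by (rule that[of r g]) (use r g \<open>g a = w\<close> in auto)
  next
    assume "- g a = w"
    show thesis
      by (rule that[of r "\<lambda>x. - g x"]) (use r g \<open>- g a = w\<close> in \<open>auto intro!: holomorphic_intros\<close>)
  qed
qed

section \<open>Divisors\<close>

context riemann_surface
begin

text \<open>An identity theorem: the set \<open>Z\<close> of points near which \<open>f\<close>
  vanishes is open and closed. \<open>has_divisor\<close> only asks for one nonzero value, and
  \<open>zorder\<close> carries no information where a function vanishes identically, so this case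
  must be excluded before orders can be used.\<close>

lemma has_divisor_not_locally_zero:
  assumes f: "has_divisor M f d" and y: "y \<in> points M"
  shows "\<not> eventually (\<lambda>x. f x = 0) (atin (top_space M) y)"
proof
  assume y0: "eventually (\<lambda>x. f x = 0) (atin (top_space M) y)"
  define Z where "Z = {y \<in> points M. eventually (\<lambda>x. f x = 0) (atin (top_space M) y)}"
  have nm: "(f \<circ> inv_into U \<phi>) nicely_meromorphic_on \<phi> ` U" if "(U, \<phi>) \<in> atlas M" for U \<phi>
    using f that unfolding has_divisor_def meromorphic_fun_def by blast
  have "openin (top_space M) Z"
  proof (subst openin_subopen, safe)
    fix z assume z: "z \<in> Z"
    then obtain V where V: "openin (top_space M) V" "z \<in> V" "\<forall>x\<in>V - {z}. f x = 0"
      unfolding Z_def eventually_atin by blast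
    have "x \<in> Z" if x: "x \<in> V" for x
    proof (cases "x = z")
      case False
      have "openin (top_space M) (V - {z})"
        using V openin_subset[OF V(1)] by (intro openin_Diff_finite) auto
      then show ?thesis
        unfolding Z_def eventually_atin using x False V openin_subset[OF V(1)] by blast
    qed (use z in simp)
    then show "\<exists>T. openin (top_space M) T \<and> z \<in> T \<and> T \<subseteq> Z"
      using V by blast
  qed
  \<comment> \<open>A function meromorphic at a point either vanishes on a punctured neighbourhood
    or is zero-free on one; the second alternative is an open condition.\<close>
  moreover have "openin (top_space M) (points M - Z)"
  proof (subst openin_subopen, rule ballI)
    fix z assume z: "z \<in> points M - Z"
    then obtain U \<phi> where U: "(U, \<phi>) \<in> atlas M" "z \<in> U"
      using ex_chart by blast
    have "not_essential (f \<circ> inv_into U \<phi>) (\<phi> z)" "isolated_singularity_at (f \<circ> inv_into U \<phi>) (\<phi> z)"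
      using nm[OF U(1)] U(2) unfolding nicely_meromorphic_on_def meromorphic_on_altdef by auto
    moreover have "\<not> eventually (\<lambda>x. (f \<circ> inv_into U \<phi>) x = 0) (at (\<phi> z))"
      using z unfolding Z_def by (auto simp: atin_chart[OF U] eventually_filtermap)
    ultimately have "eventually (\<lambda>x. (f \<circ> inv_into U \<phi>) x \<noteq> 0) (at (\<phi> z))"
      using non_zero_neighbour[of "f \<circ> inv_into U \<phi>" "\<phi> z"] by (simp add: frequently_def)
    then have "eventually (\<lambda>x. f x \<noteq> 0) (atin (top_space M) z)"
      unfolding atin_chart[OF U] by (simp add: eventually_filtermap)
    then obtain V where V: "openin (top_space M) V" "z \<in> V" "\<forall>x\<in>V - {z}. f x \<noteq> 0"
      using z unfolding eventually_atin by blast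
    have "x \<notin> Z" if x: "x \<in> V" for x
    proof (cases "x = z")
      case False
      have "openin (top_space M) (V - {z})"
        using V openin_subset[OF V(1)] by (intro openin_Diff_finite) auto
      then have "eventually (\<lambda>x. f x \<noteq> 0) (atin (top_space M) x)"
        unfolding eventually_atin using x False V by blast
      moreover have "\<not> eventually (\<lambda>_. False) (atin (top_space M) x)"
        using atin_nontrivial x openin_subset[OF V(1)] by (auto simp: eventually_False)
      ultimately show ?thesis
        unfolding Z_def using eventually_elim2 by (smt (verit, best) mem_Collect_eq)
    qed (use z in simp)
    then show "\<exists>T. openin (top_space M) T \<and> z \<in> T \<and> T \<subseteq> points M - Z"
      using V openin_subset[OF V(1)] by blast
  qed
  moreover have "y \<in> Z" "Z \<subseteq> points M"
    using y y0 unfolding Z_def by auto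
  ultimately have Z: "Z = points M"
    using connected unfolding connected_space_clopen_in closedin_def by blast
  \<comment> \<open>Vanishing around a point extends to the point itself: its value is either the
    limit or the conventional 0 of a pole.\<close>
  have "f x = 0" if x: "x \<in> points M" for x
  proof -
    obtain U \<phi> where U: "(U, \<phi>) \<in> atlas M" "x \<in> U"
      using ex_chart x by blast
    have ev: "eventually (\<lambda>t. (f \<circ> inv_into U \<phi>) t = 0) (at (\<phi> x))"
    proof -
      have "x \<in> Z"
        using x Z by simp
      then show ?thesis
        unfolding Z_def by (simp add: atin_chart[OF U] eventually_filtermap)
    qed
    have "(f \<circ> inv_into U \<phi>) (\<phi> x) = 0 \<or> ((f \<circ> inv_into U \<phi>) \<longlongrightarrow> (f \<circ> inv_into U \<phi>) (\<phi> x)) (at (\<phi> x))"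
      using nm[OF U(1)] U(2) unfolding nicely_meromorphic_on_def by blast
    moreover have "((f \<circ> inv_into U \<phi>) \<longlongrightarrow> 0) (at (\<phi> x))"
      using ev by (rule tendsto_eventually)
    ultimately have "(f \<circ> inv_into U \<phi>) (\<phi> x) = 0"
      using tendsto_unique[OF at_neq_bot] by blast
    then show ?thesis
      using U by simp
  qed
  then show False
    using f unfolding has_divisor_def by blast
qed

lemma has_divisor_local:
  assumes f: "has_divisor M f d" and U: "(U, \<phi>) \<in> atlas M" "y \<in> U"
  obtains F r where "r > 0" "F holomorphic_on ball (\<phi> y) r" "F (\<phi> y) \<noteq> 0"
    "\<And>z. z \<in> ball (\<phi> y) r - {\<phi> y} \<Longrightarrow> f (inv_into U \<phi> z) = F z * (z - \<phi> y) powi d y"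
proof -
  let ?f = "f \<circ> inv_into U \<phi>"
  have nm: "?f nicely_meromorphic_on \<phi> ` U" and d: "zorder ?f (\<phi> y) = d y"
    using f U unfolding has_divisor_def meromorphic_fun_def by blast+
  have "isolated_singularity_at ?f (\<phi> y)" "not_essential ?f (\<phi> y)"
    using nm U(2) unfolding nicely_meromorphic_on_def meromorphic_on_altdef by auto
  moreover have "frequently (\<lambda>w. ?f w \<noteq> 0) (at (\<phi> y))"
    using has_divisor_not_locally_zero[OF f, of y] chart_subset[OF U(1)] U(2)
    by (auto simp: frequently_def atin_chart[OF U] eventually_filtermap)
  ultimately obtain r where r: "r > 0" "zor_poly ?f (\<phi> y) (\<phi> y) \<noteq> 0"
    "zor_poly ?f (\<phi> y) holomorphic_on cball (\<phi> y) r"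
    "\<forall>w\<in>cball (\<phi> y) r - {\<phi> y}. ?f w = zor_poly ?f (\<phi> y) w * (w - \<phi> y) powi zorder ?f (\<phi> y)"
    using zorder_exist by blast
  show thesis
    by (rule that[of r "zor_poly ?f (\<phi> y)"])
      (use r d in \<open>auto intro: holomorphic_on_subset\<close>)
qed

text \<open>Order 0 makes \<open>f\<close> agree with a nonvanishing holomorphic function on a
  punctured disc. That \<open>f\<close> is nicely meromorphic forces the same value at the
  centre.\<close>

lemma has_divisor_zero:
  assumes f: "has_divisor M f d" and V: "openin (top_space M) V" "\<And>y. y \<in> V \<Longrightarrow> d y = 0"
  shows "holomorphic_fun M V f" "\<And>y. y \<in> V \<Longrightarrow> f y \<noteq> 0"
proof -
  have loc: "\<exists>r F. r > 0 \<and> F holomorphic_on ball (\<phi> y) r \<and> F (\<phi> y) \<noteq> 0 \<and> 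
      (\<forall>z\<in>ball (\<phi> y) r. (f \<circ> inv_into U \<phi>) z = F z)"
    if y: "y \<in> V" "(U, \<phi>) \<in> atlas M" "y \<in> U" for y U \<phi>
  proof -
    obtain F r where F: "r > 0" "F holomorphic_on ball (\<phi> y) r" "F (\<phi> y) \<noteq> 0"
      "\<And>z. z \<in> ball (\<phi> y) r - {\<phi> y} \<Longrightarrow> f (inv_into U \<phi> z) = F z * (z - \<phi> y) powi d y"
      using has_divisor_local[OF f y(2,3)] by metis
    let ?f = "f \<circ> inv_into U \<phi>"
    have eq: "?f z = F z" if "z \<in> ball (\<phi> y) r - {\<phi> y}" for z
      using F(4)[OF that] V(2)[OF y(1)] by simp
    have "(F \<longlongrightarrow> F (\<phi> y)) (at (\<phi> y))"
      using F(1,2) by (metis centre_in_ball continuous_on_def holomorphic_on_imp_continuous_on open_ball at_within_open)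
    then have lim: "(?f \<longlongrightarrow> F (\<phi> y)) (at (\<phi> y))"
      by (rule Lim_transform_eventually)
        (use eq F(1) in \<open>auto simp: eventually_at dist_commute intro!: exI[of _ r]\<close>)
    have "is_pole ?f (\<phi> y) \<or> (?f \<longlongrightarrow> ?f (\<phi> y)) (at (\<phi> y))"
      using f y(2,3) unfolding has_divisor_def meromorphic_fun_def nicely_meromorphic_on_def by blast
    moreover have "\<not> is_pole ?f (\<phi> y)"
      using lim unfolding is_pole_def by (metis at_neq_bot not_tendsto_and_filterlim_at_infinity)
    ultimately have "?f (\<phi> y) = F (\<phi> y)"
      using lim tendsto_unique[OF at_neq_bot] by blast
    then show ?thesis
      using F eq by (metis DiffI singletonD)
  qed
  show "holomorphic_fun M V f"
  proof (rule holomorphic_funI[OF V(1)])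
    fix y assume y: "y \<in> V"
    then obtain U \<phi> where U: "(U, \<phi>) \<in> atlas M" "y \<in> U"
      using ex_chart openin_subset[OF V(1)] by blast
    then obtain r F where F: "r > 0" "F holomorphic_on ball (\<phi> y) r" "\<forall>z\<in>ball (\<phi> y) r. (f \<circ> inv_into U \<phi>) z = F z"
      using loc[OF y] by blast
    then have "(f \<circ> inv_into U \<phi>) holomorphic_on ball (\<phi> y) r"
      using holomorphic_transform by (metis (no_types, lifting))
    then show "\<exists>U \<phi> W. (U, \<phi>) \<in> atlas M \<and> y \<in> U \<and> open W \<and> \<phi> y \<in> W \<and> (f \<circ> inv_into U \<phi>) holomorphic_on W"
      using U F(1) by (metis centre_in_ball open_ball)
  qed
  fix y assume y: "y \<in> V"
  then obtain U \<phi> where U: "(U, \<phi>) \<in> atlas M" "y \<in> U"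
    using ex_chart openin_subset[OF V(1)] by blast
  then obtain r F where F: "r > 0" "F (\<phi> y) \<noteq> 0" "\<forall>z\<in>ball (\<phi> y) r. (f \<circ> inv_into U \<phi>) z = F z"
    using loc[OF y] by blast
  then have "(f \<circ> inv_into U \<phi>) (\<phi> y) \<noteq> 0"
    by (metis centre_in_ball)
  then show "f y \<noteq> 0"
    using U by simp
qed

end

section \<open>From torsion pairs to the Pell-Abel equation\<close>

context double_cover
begin

text \<open>By \<open>ends\<close> the function \<open>X\<close> is injective near \<open>p\<close>,
  hence so is 1 / X, and an injective holomorphic function has nonzero derivative. So 1 / X is a
  local coordinate at \<open>p\<close>.\<close>

lemma end_coordinate:
  assumes chart: "(U, \<phi>) \<in> atlas M" "p \<in> U"
  obtains r u where "r > 0" "ball (\<phi> p) r \<subseteq> \<phi> ` (U - {q})"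
    "u holomorphic_on ball (\<phi> p) r" "u (\<phi> p) = 0" "deriv u (\<phi> p) \<noteq> 0"
    "\<And>z. z \<in> ball (\<phi> p) r - {\<phi> p} \<Longrightarrow> u z \<noteq> 0 \<and> X (inv_into U \<phi> z) = inverse (u z) \<and> inv_into U \<phi> z \<in> aff"
proof -
  obtain V V' where V: "openin (top_space M) V" "openin (top_space M) V'" "p \<in> V" "q \<in> V'" "V \<inter> V' = {}"
    using separate[OF p q pq] by blast
  obtain R where R: "\<And>x. norm x > R \<Longrightarrow> \<exists>!y. y \<in> V \<inter> aff \<and> X y = x"
    using ends[OF V(1,3,2,4,5)] by metis
  have "eventually (\<lambda>x::complex. norm x > R) at_infinity"
    unfolding eventually_at_infinity by (rule exI[of _ "R + 1"]) auto
  then obtain V1 where V1: "openin (top_space M) V1" "p \<in> V1" "\<forall>x\<in>V1 - {p}. norm (X x) > R"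
    using X_inf(1) p unfolding filterlim_iff eventually_atin by blast
  have "openin (top_space M) (V \<inter> V1)" "p \<in> V \<inter> V1"
    using V V1 by auto
  then obtain r u where coord: "r > 0" "ball (\<phi> p) r \<subseteq> \<phi> ` (U \<inter> (V \<inter> V1 - {q}))"
    "u holomorphic_on ball (\<phi> p) r" "u (\<phi> p) = 0"
    "\<And>z. z \<in> ball (\<phi> p) r - {\<phi> p} \<Longrightarrow> u z \<noteq> 0 \<and> X (inv_into U \<phi> z) = inverse (u z)"
    using end_coordinate_aux[OF _ _ chart] by metis
  note U = chart coord
  let ?g = "inv_into U \<phi>"
  have g: "?g z \<in> V \<inter> V1 - {p, q} \<and> \<phi> (?g z) = z" if z: "z \<in> ball (\<phi> p) r - {\<phi> p}" for z
  proof -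
    obtain a where a: "a \<in> U" "a \<in> V \<inter> V1 - {q}" "z = \<phi> a"
      using U(4) z by blast
    moreover have "a \<noteq> p"
      using a(3) z by blast
    ultimately show ?thesis
      using chart_inv[OF U(1) a(1)] by auto
  qed
  have inj: "inj_on u (ball (\<phi> p) r)"
  proof (rule inj_onI)
    fix z z' assume z: "z \<in> ball (\<phi> p) r" "z' \<in> ball (\<phi> p) r" "u z = u z'"
    show "z = z'"
    proof (cases "z = \<phi> p \<or> z' = \<phi> p")
      case True
      then show ?thesis
        using U(6,7) z by (metis DiffI singletonD)
    next
      case False
      then have z': "z \<in> ball (\<phi> p) r - {\<phi> p}" "z' \<in> ball (\<phi> p) r - {\<phi> p}"
        using z by auto
      have "X (?g z) = X (?g z')" "norm (X (?g z)) > R"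
        using U(7)[OF z'(1)] U(7)[OF z'(2)] z(3) bspec[OF V1(3), of "?g z"] g[OF z'(1)] by simp_all
      moreover have "?g z \<in> V \<inter> aff" "?g z' \<in> V \<inter> aff"
        using g[OF z'(1)] g[OF z'(2)] openin_subset[OF V(1)] by auto
      ultimately have "?g z = ?g z'"
        using R by metis
      then show ?thesis
        using g[OF z'(1)] g[OF z'(2)] by metis
    qed
  qed
  have "deriv u (\<phi> p) \<noteq> 0"
    by (rule holomorphic_injective_imp_regular[OF U(5) open_ball inj]) (use U(3) in simp)
  moreover have "u z \<noteq> 0 \<and> X (?g z) = inverse (u z) \<and> ?g z \<in> aff" if z: "z \<in> ball (\<phi> p) r - {\<phi> p}" for z
    using U(7)[OF z] g[OF z] openin_subset[OF V(1)] by blast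
  moreover have "ball (\<phi> p) r \<subseteq> \<phi> ` (U - {q})"
    using U(4) by blast
  ultimately show thesis
    using that[OF U(3) _ U(5,6)] by blast
qed

text \<open>Since 1 / X is a local coordinate at \<open>p\<close>, order \<open>d p\<close> means
  that \<open>f\<close> is asymptotic to a nonzero multiple of X^(- d p). Orders at the ends become
  growth rates in \<open>X\<close>.\<close>

lemma divisor_end_limit:
  assumes f: "has_divisor M f d"
  obtains L where "L \<noteq> 0" "((\<lambda>y. f y * X y powi d p) \<longlongrightarrow> L) (atin (top_space M) p)"
proof -
  obtain U \<phi> where chart: "(U, \<phi>) \<in> atlas M" "p \<in> U"
    using ex_chart p by blast
  obtain r u where coord: "r > 0" "ball (\<phi> p) r \<subseteq> \<phi> ` (U - {q})"
    "u holomorphic_on ball (\<phi> p) r" "u (\<phi> p) = 0" "deriv u (\<phi> p) \<noteq> 0"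
    "\<And>z. z \<in> ball (\<phi> p) r - {\<phi> p} \<Longrightarrow> u z \<noteq> 0 \<and> X (inv_into U \<phi> z) = inverse (u z) \<and> inv_into U \<phi> z \<in> aff"
    using end_coordinate[OF chart] by metis
  note U = chart coord
  obtain F r' where F: "r' > 0" "F holomorphic_on ball (\<phi> p) r'" "F (\<phi> p) \<noteq> 0"
    "\<And>z. z \<in> ball (\<phi> p) r' - {\<phi> p} \<Longrightarrow> f (inv_into U \<phi> z) = F z * (z - \<phi> p) powi d p"
    using has_divisor_local[OF f U(1,2)] by metis
  have Flim: "(F \<longlongrightarrow> F (\<phi> p)) (at (\<phi> p))"
    using F(1,2) by (metis centre_in_ball continuous_on_def holomorphic_on_imp_continuous_on open_ball at_within_open)
  have "(u has_field_derivative deriv u (\<phi> p)) (at (\<phi> p))"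
    using U(3,5) by (simp add: holomorphic_derivI)
  then have "((\<lambda>z. u z / (z - \<phi> p)) \<longlongrightarrow> deriv u (\<phi> p)) (at (\<phi> p))"
    using U(6) by (simp add: has_field_derivative_iff)
  then have "((\<lambda>z. inverse (u z / (z - \<phi> p))) \<longlongrightarrow> inverse (deriv u (\<phi> p))) (at (\<phi> p))"
    by (rule tendsto_inverse) (use U(7) in simp)
  then have "((\<lambda>z. F z * inverse (u z / (z - \<phi> p)) powi d p) \<longlongrightarrow> F (\<phi> p) * inverse (deriv u (\<phi> p)) powi d p) (at (\<phi> p))"
    by (intro tendsto_mult Flim tendsto_power_int) (use U(7) in simp_all)
  moreover have "eventually (\<lambda>z. F z * inverse (u z / (z - \<phi> p)) powi d p
      = ((\<lambda>y. f y * X y powi d p) \<circ> inv_into U \<phi>) z) (at (\<phi> p))"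
    unfolding eventually_at
  proof (intro exI[of _ "min r r'"] conjI ballI impI)
    show "min r r' > 0"
      using U(3) F(1) by simp
    fix z assume z: "z \<noteq> \<phi> p \<and> dist z (\<phi> p) < min r r'"
    then have "z \<in> ball (\<phi> p) r - {\<phi> p}" "z \<in> ball (\<phi> p) r' - {\<phi> p}"
      by (auto simp: dist_commute)
    then show "F z * inverse (u z / (z - \<phi> p)) powi d p = ((\<lambda>y. f y * X y powi d p) \<circ> inv_into U \<phi>) z"
      using F(4) U(8)[of z] z
      by (simp add: divide_inverse power_int_mult_distrib power_int_inverse mult_ac)
  qed
  ultimately have "((\<lambda>y. f y * X y powi d p) \<longlongrightarrow> F (\<phi> p) * inverse (deriv u (\<phi> p)) powi d p) (atin (top_space M) p)"
    unfolding filterlim_atin_chart[OF U(1,2)] by (rule Lim_transform_eventually)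
  then show thesis
    using that[of "F (\<phi> p) * inverse (deriv u (\<phi> p)) powi d p"] F(3) U(7) by simp
qed

text \<open>\<open>s x\<close> is the point over \<open>x\<close> in one fixed neighbourhood of
  \<open>p\<close>. Applying \<open>ends\<close> inside smaller neighbourhoods gives a point that
  must equal \<open>s x\<close> by uniqueness, so \<open>s\<close> tends to \<open>p\<close> and
  \<open>J \<circ> s\<close> to \<open>q\<close>. Statements about both ends become limits in the
  plane.\<close>

lemma section_at_infinity:
  obtains s where "eventually (\<lambda>x. s x \<in> aff \<and> X (s x) = x) at_infinity"
    "filterlim s (atin (top_space M) p) at_infinity"
    "filterlim (\<lambda>x. J (s x)) (atin (top_space M) q) at_infinity"
proof -
  obtain V V' where V: "openin (top_space M) V" "openin (top_space M) V'" "p \<in> V" "q \<in> V'" "V \<inter> V' = {}"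
    using separate[OF p q pq] by blast
  define s where "s x = (SOME y. y \<in> V \<inter> aff \<and> X y = x)" for x
  obtain R where R: "\<And>x. norm x > R \<Longrightarrow> \<exists>!y. y \<in> V \<inter> aff \<and> X y = x"
    using ends[OF V(1,3,2,4,5)] by metis
  have s: "s x \<in> V \<inter> aff \<and> X (s x) = x" if "norm x > R" for x
    unfolding s_def by (rule someI_ex[OF ex1_implies_ex[OF R[OF that]]])
  have gt: "eventually (\<lambda>x::complex. norm x > R) at_infinity" for R
    unfolding eventually_at_infinity by (rule exI[of _ "R + 1"]) auto
  have *: "eventually (\<lambda>x. s x \<in> N - {p} \<and> J (s x) \<in> N' - {q}) at_infinity"
    if N: "openin (top_space M) N" "p \<in> N" "openin (top_space M) N'" "q \<in> N'" for N N'
  proof -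
    have op: "openin (top_space M) (V \<inter> N)" "p \<in> V \<inter> N" "openin (top_space M) (V' \<inter> N')" "q \<in> V' \<inter> N'"
      "(V \<inter> N) \<inter> (V' \<inter> N') = {}"
      using V N by auto
    obtain R' where R': "\<And>x. norm x > R' \<Longrightarrow> \<exists>!y. y \<in> (V \<inter> N) \<inter> aff \<and> X y = x"
      "\<And>y. norm (X y) > R' \<Longrightarrow> y \<in> (V \<inter> N) \<inter> aff \<Longrightarrow> J y \<in> V' \<inter> N'"
    proof (rule ends[OF op], goal_cases)
      case (1 R')
      show ?case
        by (rule 1(1)[OF 1(2,3)])
    qed
    show ?thesis
      using gt[of R] gt[of R']
    proof eventually_elim
      case (elim x)
      obtain y where y: "y \<in> (V \<inter> N) \<inter> aff" "X y = x"
        using R'(1)[OF elim(2)] by blast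
      then have "y = s x"
        using R[OF elim(1)] s[OF elim(1)] by blast
      then show ?case
        using R'(2)[of y] y elim(2) J_aff[of y] by simp
    qed
  qed
  show thesis
  proof (rule that)
    show "eventually (\<lambda>x. s x \<in> aff \<and> X (s x) = x) at_infinity"
      using gt[of R] by eventually_elim (use s in blast)
    show "filterlim s (atin (top_space M) p) at_infinity"
      unfolding filterlim_iff
    proof safe
      fix P assume "eventually P (atin (top_space M) p)"
      then obtain N where "openin (top_space M) N" "p \<in> N" "\<forall>x\<in>N - {p}. P x"
        using p unfolding eventually_atin by blast
      then show "eventually (\<lambda>x. P (s x)) at_infinity"
        using *[of N V'] V by (auto elim: eventually_mono)
    qed
    show "filterlim (\<lambda>x. J (s x)) (atin (top_space M) q) at_infinity"
      unfolding filterlim_iff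
    proof safe
      fix P assume "eventually P (atin (top_space M) q)"
      then obtain N where "openin (top_space M) N" "q \<in> N" "\<forall>x\<in>N - {q}. P x"
        using q unfolding eventually_atin by blast
      then show "eventually (\<lambda>x. P (J (s x))) at_infinity"
        using *[of V N] V by (auto elim: eventually_mono)
    qed
  qed
qed

section \<open>Descent of symmetric expressions along the cover, and parity of orders at branch
  values\<close>

abbreviation branch :: "complex set" where "branch \<equiv> X ` {y \<in> points M - {p, q}. J y = y}"

text \<open>A symmetric expression in the two values of \<open>h\<close> on a fibre depends only on
  \<open>X\<close>. Off the branch values it is holomorphic by the local sections of both sheets; at
  a branch value it is continuous because both points of a nearby fibre are close to the fixed
  point. Removing the finitely many singularities leaves an entire function.\<close>

lemma symmetric_descent:
  assumes h: "holomorphic_fun M aff h"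
    and sym: "\<And>a b. T a b = T b a"
    and hol: "\<And>W f g. f holomorphic_on W \<Longrightarrow> g holomorphic_on W \<Longrightarrow> (\<lambda>x. T (f x) (g x)) holomorphic_on W"
    and cont: "continuous_on UNIV (\<lambda>(a, b). T a b)"
  obtains S where "S holomorphic_on UNIV" "\<And>y. y \<in> aff \<Longrightarrow> S (X y) = (T (h y) (h (J y)) :: complex)"
proof -
  define k where "k y = T (h y) (h (J y))" for y
  have kJ: "k (J y) = k y" if "y \<in> aff" for y
    unfolding k_def J_J[OF that] by (rule sym)
  define S where "S x = k (SOME y. y \<in> aff \<and> X y = x)" for x
  have SX: "S (X y) = k y" if y: "y \<in> aff" for y
  proof -
    let ?z = "SOME z. z \<in> aff \<and> X z = X y"
    have z: "?z \<in> aff \<and> X ?z = X y"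
      by (rule someI_ex) (use y in blast)
    have "k z = k y" if "z \<in> aff \<and> X z = X y" for z
    proof (cases "z = y")
      case False
      then have "z = J y"
        using fibre_cases[of y z] y that by auto
      then show ?thesis
        using kJ[OF y] by simp
    qed simp
    then show ?thesis
      unfolding S_def using z by blast
  qed
  have "S holomorphic_on UNIV"
  proof (rule no_isolated_singularity')
    show "finite branch"
      using fin_fix by blast
    have "S field_differentiable at x" if x: "x \<notin> branch" for x
    proof -
      obtain y where y: "y \<in> aff" "X y = x"
        using X_surj by (metis UNIV_I imageE)
      have "J y \<noteq> y"
        using x y by auto
      then obtain W s where W: "open W" "X y \<in> W" "\<And>x. x \<in> W \<Longrightarrow> s x \<in> aff" "\<And>x. x \<in> W \<Longrightarrow> X (s x) = x"
        "\<And>h. holomorphic_fun M aff h \<Longrightarrow> (h \<circ> s) holomorphic_on W"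
        "\<And>h. holomorphic_fun M aff h \<Longrightarrow> (h \<circ> J \<circ> s) holomorphic_on W"
        using local_section[OF y(1)] by metis
      have "(\<lambda>x. T ((h \<circ> s) x) ((h \<circ> J \<circ> s) x)) holomorphic_on W"
        by (intro hol W h)
      then have "S holomorphic_on W"
      proof (rule holomorphic_transform)
        fix x assume "x \<in> W"
        then show "T ((h \<circ> s) x) ((h \<circ> J \<circ> s) x) = S x"
          using SX[OF W(3)] W(4) by (simp add: k_def)
      qed
      then show ?thesis
        using W(1,2) y(2) holomorphic_on_imp_differentiable_at by blast
    qed
    then show "S holomorphic_on UNIV - branch"
      by (auto simp: holomorphic_on_def intro: field_differentiable_at_within)
    fix e assume "e \<in> branch"
    then obtain y where y: "y \<in> aff" "J y = y" "e = X y"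
      by blast
    show "(S \<longlongrightarrow> S e) (at e within UNIV)"
      unfolding tendsto_def
    proof safe
      fix O' assume O': "open O'" "S e \<in> O'"
      have "open ((\<lambda>(a, b). T a b) -` O')"
        using cont O'(1) by (simp add: continuous_on_open_vimage)
      moreover have "(h y, h y) \<in> (\<lambda>(a, b). T a b) -` O'"
        using O'(2) SX[OF y(1)] y by (simp add: k_def)
      ultimately obtain A B where AB: "open A" "open B" "h y \<in> A" "h y \<in> B" "A \<times> B \<subseteq> (\<lambda>(a, b). T a b) -` O'"
        by (metis open_prod_elim mem_Sigma_iff)
      define V where "V = {z \<in> aff. h z \<in> A \<inter> B}"
      have "openin (top_space M) V"
        unfolding V_def by (rule holomorphic_fun_open_preimage[OF h open_aff]) (use AB in auto)
      moreover have "y \<in> V"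
        using y AB by (simp add: V_def)
      ultimately obtain d where d: "d > 0" "\<And>z. z \<in> aff \<Longrightarrow> dist (X z) (X y) < d \<Longrightarrow> z \<in> V"
        using near_fixed[OF y(1,2)] by metis
      \<comment> \<open>Over \<open>x\<close> close to \<open>e\<close> both \<open>z\<close> and
        \<open>J z\<close> lie in \<open>V\<close>, so the pair of values lies in the box A \<times>
        B.\<close>
      have "S x \<in> O'" if x: "dist x e < d" for x
      proof -
        obtain z where z: "z \<in> aff" "X z = x"
          using X_surj by (metis UNIV_I imageE)
        have dz: "dist (X z) (X y) < d"
          using x unfolding z(2) y(3) .
        have "z \<in> V"
          by (rule d(2)[OF z(1) dz])
        moreover have "J z \<in> V"
          by (rule d(2)[OF J_aff[OF z(1)]]) (unfold X_J[OF z(1)], rule dz)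
        ultimately have "h z \<in> A" "h (J z) \<in> B"
          unfolding V_def by simp_all
        then have "T (h z) (h (J z)) \<in> O'"
          using subsetD[OF AB(5), of "(h z, h (J z))"] by simp
        then show ?thesis
          using SX[OF z(1)] unfolding z(2) k_def by simp
      qed
      then show "eventually (\<lambda>x. S x \<in> O') (at e)"
        unfolding eventually_at using d(1) by blast
    qed
  qed auto
  then show thesis
    by (rule that) (use SX in \<open>simp add: k_def\<close>)
qed

text \<open>At a branch point \<open>e\<close> with even order of vanishing, \<open>G / (X - e) ^ j\<close> would be a continuous
  nonvanishing function near the fixed point that is antiinvariant under \<open>J\<close>.\<close>

lemma odd_order_at_branch:
  assumes G: "holomorphic_fun M aff G" "\<And>y. y \<in> aff \<Longrightarrow> G y ^ 2 = poly R (X y)" "\<And>y. y \<in> aff \<Longrightarrow> G (J y) = - G y"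
    and R: "R \<noteq> 0" and e: "e \<in> branch"
  shows "odd (order e R)"
proof
  assume ev: "even (order e R)"
  obtain h where h: "R = [:-e, 1:] ^ order e R * h" "poly h e \<noteq> 0"
    using poly_order_factor[OF R] by blast
  define j where "j = order e R div 2"
  have R_eq: "poly R x = ((x - e) ^ j) ^ 2 * poly h x" for x
  proof -
    have "order e R = j * 2"
      using ev by (simp add: j_def)
    then show ?thesis
      by (subst h(1)) (simp add: poly_power power_mult)
  qed
  obtain y where y: "y \<in> aff" "J y = y" "e = X y"
    using e by blast
  obtain \<rho> t where t: "\<rho> > 0" "t holomorphic_on ball e \<rho>" "\<And>x. x \<in> ball e \<rho> \<Longrightarrow> t x ^ 2 = poly h x"
    "\<And>x. x \<in> ball e \<rho> \<Longrightarrow> t x \<noteq> 0"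
    using holomorphic_sqrt_near[of h e "csqrt (poly h e)"] h(2) by (metis csqrt_eq_0 power2_csqrt)
  obtain U \<phi> where U: "(U, \<phi>) \<in> atlas M" "y \<in> U"
    using ex_chart y(1) by blast
  define V where "V = {z \<in> aff. X z \<in> ball e \<rho>}"
  have V: "openin (top_space M) V" "y \<in> V" "V \<subseteq> aff"
    unfolding V_def by (rule X_pre_open[OF open_ball]) (use y t(1) in auto)
  obtain r where r: "r > 0" "ball (\<phi> y) r \<subseteq> \<phi> ` (U \<inter> V)"
    using chart_ball[OF U(1) V(1) U(2) V(2)] by blast
  let ?g = "inv_into U \<phi>"
  let ?B = "ball (\<phi> y) r - {\<phi> y}"
  \<comment> \<open>\<open>s\<close> is \<open>G\<close> divided by a candidate for the square root
    of R(X). Its square is 1 away from \<open>y\<close>, so it is constant on a punctured disc,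
    which is connected.\<close>
  define s where "s z = G z / ((X z - e) ^ j * t (X z))" for z
  have g: "?g z \<in> V \<and> ?g z \<noteq> y" if z: "z \<in> ?B" for z
  proof -
    obtain a where "a \<in> U \<inter> V" "z = \<phi> a"
      using r(2) z by blast
    then show ?thesis
      using z chart_inv[OF U(1)] by auto
  qed
  have Xne: "X z \<noteq> e" if "z \<in> aff" "z \<noteq> y" for z
    using fibre[OF y(1) that(1)] that(2) y by metis
  have s2: "s z ^ 2 = 1" if z: "z \<in> V" "z \<noteq> y" for z
  proof -
    have zz: "z \<in> aff" "X z \<in> ball e \<rho>" "X z \<noteq> e"
      using z Xne unfolding V_def by auto
    then have "G z ^ 2 = ((X z - e) ^ j * t (X z)) ^ 2" "((X z - e) ^ j * t (X z)) \<noteq> 0"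
      using G(2) t(3,4) R_eq by (auto simp: power_mult_distrib)
    then show ?thesis
      by (simp add: s_def power_divide)
  qed
  have "continuous_on ?B (s \<circ> ?g)"
  proof -
    have sub: "?B \<subseteq> \<phi> ` (U \<inter> aff)"
      using r(2) V(3) by blast
    have cG: "continuous_on ?B (\<lambda>z. G (?g z))" "continuous_on ?B (\<lambda>z. X (?g z))"
      using holomorphic_on_imp_continuous_on[OF holomorphic_on_subset[OF holomorphic_fun_chart[OF U(1) G(1)] sub]]
        holomorphic_on_imp_continuous_on[OF holomorphic_on_subset[OF holomorphic_fun_chart[OF U(1) X_hol] sub]]
      by (simp_all add: comp_def)
    have ct: "continuous_on ?B (\<lambda>z. t (X (?g z)))"
      by (rule continuous_on_compose2[OF holomorphic_on_imp_continuous_on[OF t(2)] cG(2)])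
        (use g in \<open>unfold V_def, blast\<close>)
    have "(X (?g z) - e) ^ j * t (X (?g z)) \<noteq> 0" if "z \<in> ?B" for z
      using g[OF that] Xne[of "?g z"] t(4) unfolding V_def by auto
    then show ?thesis
      unfolding s_def comp_def by (intro continuous_intros cG ct) auto
  qed
  moreover have "connected ?B"
    by (rule connected_punctured_ball) simp
  moreover have "(s \<circ> ?g) ` ?B \<subseteq> {1, -1}"
  proof (rule image_subsetI)
    fix z assume z: "z \<in> ?B"
    then show "(s \<circ> ?g) z \<in> {1, -1}"
      using s2[of "?g z"] g[OF z] by (simp add: power2_eq_1_iff)
  qed
  ultimately have "(s \<circ> ?g) constant_on ?B"
    using continuous_finite_range_constant finite_subset by (metis finite.emptyI finite.insertI)
  then obtain c where c: "\<And>z. z \<in> ?B \<Longrightarrow> s (?g z) = c"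
    by (auto simp: constant_on_def)
  define N where "N = {a \<in> U. \<phi> a \<in> ball (\<phi> y) r}"
  have N: "openin (top_space M) N" "y \<in> N"
    unfolding N_def using chart_preimage_open[OF U(1) open_ball] U(2) r(1) by (blast, simp)
  obtain d where d: "d > 0" "\<And>z. z \<in> aff \<Longrightarrow> dist (X z) (X y) < d \<Longrightarrow> z \<in> N"
    using near_fixed[OF y(1,2) N] by metis
  have sc: "s z = c" "z \<in> V" if z: "z \<in> N" "z \<noteq> y" for z
  proof -
    have "\<phi> z \<noteq> \<phi> y"
      using z U(2) inj_onD[OF chart_inj[OF U(1)]] unfolding N_def by blast
    then have B: "\<phi> z \<in> ?B" and zU: "z \<in> U"
      using z unfolding N_def by auto
    show "s z = c" "z \<in> V"
      using c[OF B] g[OF B] chart_inv[OF U(1) zU] by auto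
  qed
  \<comment> \<open>Both points over e + d/2 lie in the punctured disc, where \<open>s\<close> has
    one value, while \<open>J\<close> changes the sign of \<open>s\<close>.\<close>
  obtain z where z: "z \<in> aff" "X z = e + of_real (d / 2)"
    using X_surj by (metis UNIV_I imageE)
  have "z \<noteq> y" "J z \<noteq> y"
    using z d(1) y X_J[OF z(1)] by auto
  moreover have "z \<in> N" "J z \<in> N"
    using d z y(3) J_aff[OF z(1)] X_J[OF z(1)] by (auto simp: dist_norm)
  ultimately have "s z = c" "s (J z) = c" "s z ^ 2 = 1"
    using sc s2 by blast+
  moreover have "s (J z) = - s z"
    unfolding s_def using G(3) X_J z(1) by simp
  ultimately show False
    by simp
qed

text \<open>Off the branch values \<open>G\<close> along a local section is a holomorphic square
  root of \<open>R\<close>, so multiplicities are even; at branch values they are odd. The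
  squarefree part of \<open>R\<close> is thus the polynomial of the branch values.\<close>

lemma antiinvariant_square:
  assumes G: "holomorphic_fun M aff G" "\<And>y. y \<in> aff \<Longrightarrow> G y ^ 2 = poly R (X y)" "\<And>y. y \<in> aff \<Longrightarrow> G (J y) = - G y"
    and R: "R \<noteq> 0"
  obtains Q where "R = (\<Prod>e\<in>branch. [:-e, 1:]) * Q ^ 2"
proof (rule poly_squarefree_part[OF R])
  fix e
  show "odd (order e R) \<longleftrightarrow> e \<in> branch"
  proof
    assume "odd (order e R)"
    show "e \<in> branch"
    proof (rule ccontr)
      assume e: "e \<notin> branch"
      obtain y where y: "y \<in> aff" "X y = e"
        using X_surj by (metis UNIV_I imageE)
      then have "J y \<noteq> y"
        using e by blast
      then obtain W s where W: "open W" "X y \<in> W" "\<And>x. x \<in> W \<Longrightarrow> s x \<in> aff" "\<And>x. x \<in> W \<Longrightarrow> X (s x) = x"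
        "\<And>h. holomorphic_fun M aff h \<Longrightarrow> (h \<circ> s) holomorphic_on W"
        using local_section[OF y(1)] by metis
      have "even (order e R)"
      proof (rule even_order_if_local_square[OF W(1) _ W(5)[OF G(1)] _ R])
        show "((G \<circ> s) x)\<^sup>2 = poly R x" if "x \<in> W" for x
          using G(2)[OF W(3)[OF that]] W(4)[OF that] by simp
      qed (use W(2) y(2) in simp)
      then show False
        using \<open>odd (order e R)\<close> by simp
    qed
  qed (rule odd_order_at_branch[OF G R])
qed (rule that)

text \<open>The degree of \<open>P\<close> is exactly \<open>n\<close> because along the section at
  \<open>p\<close> the function \<open>f\<close> decays like x^(-n) while \<open>f \<circ> J\<close>
  grows like x^n. The values of \<open>f\<close> are retained in the conclusion because
  \<open>f = P\<close> at fixed points yields the degree partition.\<close>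

theorem pell_abel_of_divisor:
  assumes n: "n \<ge> 1" and f: "has_divisor M f (diff_divisor n p q)"
  obtains P Q c where "c \<noteq> 0" "degree P = n" "P ^ 2 - (\<Prod>e\<in>branch. [:-e, 1:]) * Q ^ 2 = 1"
    "holomorphic_fun M aff f" "\<And>y. y \<in> aff \<Longrightarrow> f y \<noteq> 0"
    "\<And>y. y \<in> aff \<Longrightarrow> c * f y + c * f (J y) = 2 * poly P (X y)"
    "\<And>y. y \<in> aff \<Longrightarrow> c * f y * (c * f (J y)) = 1"
proof -
  have dz: "diff_divisor n p q y = 0" if "y \<in> aff" for y
    using that by (auto simp: diff_divisor_def)
  have fh: "holomorphic_fun M aff f" and fn: "\<And>y. y \<in> aff \<Longrightarrow> f y \<noteq> 0"
    using has_divisor_zero[OF f open_aff dz] by auto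
  have dpq: "diff_divisor n p q p = int n" "diff_divisor n p q q = - int n"
    using pq by (auto simp: diff_divisor_def)
  obtain L1 where L1: "L1 \<noteq> 0" "((\<lambda>y. f y * X y powi int n) \<longlongrightarrow> L1) (atin (top_space M) p)"
    using divisor_end_limit[OF f] dpq by metis
  obtain L2 where L2: "L2 \<noteq> 0" "((\<lambda>y. f y * X y powi - int n) \<longlongrightarrow> L2) (atin (top_space M) q)"
    using double_cover.divisor_end_limit[OF swap f] dpq by metis
  obtain s where s: "eventually (\<lambda>x. s x \<in> aff \<and> X (s x) = x) at_infinity"
    "filterlim s (atin (top_space M) p) at_infinity"
    "filterlim (\<lambda>x. J (s x)) (atin (top_space M) q) at_infinity"
    by (rule section_at_infinity)
  have nz: "eventually (\<lambda>x::complex. x \<noteq> 0) at_infinity"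
    unfolding eventually_at_infinity by (rule exI[of _ 1]) auto
  have l1: "((\<lambda>x. f (s x) * x ^ n) \<longlongrightarrow> L1) at_infinity"
    using filterlim_compose[OF L1(2) s(2)]
    by (rule Lim_transform_eventually) (use s(1) in eventually_elim, auto)
  have l2: "((\<lambda>x. f (J (s x)) / x ^ n) \<longlongrightarrow> L2) at_infinity"
    using filterlim_compose[OF L2(2) s(3)]
    by (rule Lim_transform_eventually)
      (use s(1) in eventually_elim, use X_J in \<open>auto simp: power_int_minus divide_inverse\<close>)
  obtain N where N: "N holomorphic_on UNIV" "\<And>y. y \<in> aff \<Longrightarrow> N (X y) = f y * f (J y)"
  proof (rule symmetric_descent[OF fh, of "(*)"])
    show "(\<lambda>x. f x * g x) holomorphic_on W" if "f holomorphic_on W" "g holomorphic_on W" for W and f g :: "complex \<Rightarrow> complex"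
      using that by (rule holomorphic_on_mult)
    show "continuous_on UNIV (\<lambda>(a, b). a * b :: complex)"
      unfolding case_prod_unfold by (intro continuous_intros)
  qed (simp_all add: mult.commute)
  obtain S where S: "S holomorphic_on UNIV" "\<And>y. y \<in> aff \<Longrightarrow> S (X y) = f y + f (J y)"
  proof (rule symmetric_descent[OF fh, of "(+)"])
    show "(\<lambda>x. f x + g x) holomorphic_on W" if "f holomorphic_on W" "g holomorphic_on W" for W and f g :: "complex \<Rightarrow> complex"
      using that by (rule holomorphic_on_add)
    show "continuous_on UNIV (\<lambda>(a, b). a + b :: complex)"
      unfolding case_prod_unfold by (intro continuous_intros)
  qed (simp_all add: add.commute)
  \<comment> \<open>The powers x^n and x^(-n) from the two ends cancel, so the norm has a finite
    limit at infinity and Liouville makes it constant.\<close>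
  have "(N \<longlongrightarrow> L1 * L2) at_infinity"
    using tendsto_mult[OF l1 l2]
  proof (rule Lim_transform_eventually)
    show "eventually (\<lambda>x. f (s x) * x ^ n * (f (J (s x)) / x ^ n) = N x) at_infinity"
      using s(1) nz
    proof eventually_elim
      case (elim x)
      then show ?case
        using N(2)[of "s x"] by simp
    qed
  qed
  then have NK: "N x = L1 * L2" for x
    by (rule Liouville_weak[OF N(1)])
  define K where "K = L1 * L2"
  have K: "K \<noteq> 0" "\<And>y. y \<in> aff \<Longrightarrow> f y * f (J y) = K"
    using L1 L2 N(2) NK by (auto simp: K_def)
  \<comment> \<open>With this scaling the norm of \<open>c f\<close> is c^2 K = 1.\<close>
  define c where "c = inverse (csqrt K)"
  have c: "c \<noteq> 0" "c ^ 2 * K = 1"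
    using K(1) by (auto simp: c_def power_inverse)
  \<comment> \<open>The decaying summand contributes L1 x^(-2n), which is where n > 0 enters; the
    leading coefficient of the sum is \<open>L2\<close>.\<close>
  have "((\<lambda>x. f (s x) * x ^ n * (inverse x ^ n * inverse x ^ n) + f (J (s x)) / x ^ n) \<longlongrightarrow> L1 * (0 ^ n * 0 ^ n) + L2) at_infinity"
    by (intro tendsto_intros l1 l2 tendsto_inverse_0)
  then have "((\<lambda>x. S x / x ^ n) \<longlongrightarrow> L1 * (0 ^ n * 0 ^ n) + L2) at_infinity"
  proof (rule Lim_transform_eventually)
    show "eventually (\<lambda>x. f (s x) * x ^ n * (inverse x ^ n * inverse x ^ n) + f (J (s x)) / x ^ n = S x / x ^ n) at_infinity"
      using s(1) nz
    proof eventually_elim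
      case (elim x)
      then have "S x = f (s x) + f (J (s x))"
        using S(2)[of "s x"] by simp
      then show ?case
        using elim(2) by (simp add: field_simps power_inverse)
    qed
  qed
  then have "((\<lambda>x. S x / x ^ n) \<longlongrightarrow> L2) at_infinity"
    using n by (simp add: power_0_left)
  then obtain P0 where P0: "degree P0 \<le> n" "coeff P0 n = L2" "\<And>x. S x = poly P0 x"
    using entire_is_poly_limit[OF S(1)] by metis
  have deg0: "degree P0 = n"
    using P0(1,2) L2(1) le_degree by (metis le_antisym)
  define P where "P = smult (c / 2) P0"
  have degP: "degree P = n"
    using deg0 c(1) by (simp add: P_def)
  have sumP: "c * f y + c * f (J y) = 2 * poly P (X y)" if "y \<in> aff" for y
    using S(2)[OF that] P0(3) by (simp add: P_def algebra_simps)
  have prodP: "c * f y * (c * f (J y)) = 1" if "y \<in> aff" for y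
    using K(2)[OF that] c(2) by (simp add: power2_eq_square mult_ac)
  \<comment> \<open>\<open>G\<close> is half of the difference of \<open>c f\<close> and
    \<open>c (f \<circ> J)\<close>, the antiinvariant part of \<open>c f\<close>.\<close>
  define G where "G y = c * f y - poly P (X y)" for y
  have G: "holomorphic_fun M aff G"
    unfolding G_def
    by (intro holomorphic_fun_diff holomorphic_fun_mult holomorphic_fun_const holomorphic_fun_poly fh X_hol)
  have G2: "G y ^ 2 = poly (P ^ 2 - 1) (X y)" if y: "y \<in> aff" for y
  proof -
    define a where "a = c * f y"
    define b where "b = c * f (J y)"
    have ab: "b = 2 * poly P (X y) - a" "a * b = 1"
      using sumP[OF y] prodP[OF y] unfolding a_def b_def by (auto simp: algebra_simps)
    then have "a * (2 * poly P (X y) - a) = 1"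
      by simp
    then show ?thesis
      unfolding G_def a_def[symmetric] by (simp add: power2_eq_square algebra_simps)
  qed
  have GJ: "G (J y) = - G y" if "y \<in> aff" for y
    using sumP[OF that] X_J[OF that] unfolding G_def by (simp add: algebra_simps)
  have "P ^ 2 - 1 \<noteq> 0"
  proof
    assume "P ^ 2 - 1 = 0"
    then have "degree (P ^ 2) = 0"
      by simp
    moreover have "degree (P ^ 2) = 2 * n"
      using degP n by (subst degree_power_eq) auto
    ultimately show False
      using n by simp
  qed
  then obtain Q where "P ^ 2 - 1 = (\<Prod>e\<in>branch. [:-e, 1:]) * Q ^ 2"
    using antiinvariant_square[OF G G2 GJ] by metis
  then have "P ^ 2 - (\<Prod>e\<in>branch. [:-e, 1:]) * Q ^ 2 = 1"
    by (simp add: algebra_simps)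
  then show thesis
    using that[OF c(1) degP _ fh fn sumP prodP] by blast
qed

end

section \<open>From the Pell-Abel equation to torsion pairs\<close>

context double_cover
begin

text \<open>The converse of \<open>divisor_end_limit\<close>: growth like X^(-k) at \<open>p\<close>
  is order \<open>k\<close>. The value 0 at \<open>p\<close> is right for both signs of
  \<open>k\<close>, being the limit at a zero and the conventional value at a pole.\<close>

lemma local_at_end:
  assumes f: "holomorphic_fun M aff f" and lim: "((\<lambda>y. f y * X y powi k) \<longlongrightarrow> L) (atin (top_space M) p)"
    and L: "L \<noteq> 0" and k: "k \<noteq> 0" and fp: "f p = 0" and U: "(U, \<phi>) \<in> atlas M" "p \<in> U"
  shows "zorder (f \<circ> inv_into U \<phi>) (\<phi> p) = k" "(f \<circ> inv_into U \<phi>) nicely_meromorphic_on {\<phi> p}"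
proof -
  let ?f = "f \<circ> inv_into U \<phi>" and ?a = "\<phi> p"
  obtain r u where u: "r > 0" "ball ?a r \<subseteq> \<phi> ` (U - {q})"
    "u holomorphic_on ball ?a r" "u ?a = 0" "deriv u ?a \<noteq> 0"
    "\<And>z. z \<in> ball ?a r - {?a} \<Longrightarrow> u z \<noteq> 0 \<and> X (inv_into U \<phi> z) = inverse (u z) \<and> inv_into U \<phi> z \<in> aff"
    using end_coordinate[OF U] by metis
  \<comment> \<open>With \<open>u\<close> the coordinate 1 / X, \<open>v\<close> is the zero-free
    quotient u / (z - a) and \<open>F\<close> extends f X^k with value \<open>L\<close>. Then
    \<open>G\<close> = F v^k is the unit in front of (z - a)^k.\<close>
  define v where "v z = (if z = ?a then deriv u ?a else u z / (z - ?a))" for z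
  have "(\<lambda>z. if z = ?a then deriv u ?a else (u z - u ?a) / (z - ?a)) holomorphic_on ball ?a r"
    by (rule pole_lemma_open[OF u(3) open_ball])
  then have v: "v holomorphic_on ball ?a r"
    unfolding v_def u(4) diff_zero .
  have v0: "v z \<noteq> 0" if "z \<in> ball ?a r" for z
    using u(5,6) that by (auto simp: v_def)
  define F where "F z = (if z = ?a then L else ?f z * inverse (u z) powi k)" for z
  have sub: "ball ?a r - {?a} \<subseteq> \<phi> ` (U \<inter> aff)"
  proof
    fix z assume z: "z \<in> ball ?a r - {?a}"
    then obtain a where "a \<in> U" "z = \<phi> a"
      using u(2) by blast
    then show "z \<in> \<phi> ` (U \<inter> aff)"
      using u(6)[OF z] chart_inv[OF U(1)] by (metis IntI imageI)
  qed
  have hf: "?f holomorphic_on ball ?a r - {?a}"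
    by (rule holomorphic_on_subset[OF holomorphic_fun_chart[OF U(1) f] sub])
  have F: "F holomorphic_on ball ?a r"
  proof (rule no_isolated_singularity'[where K = "{?a}"])
    have "(\<lambda>z. ?f z * inverse (u z) powi k) holomorphic_on ball ?a r - {?a}"
      by (intro holomorphic_intros hf holomorphic_on_subset[OF u(3)]) (use u(6) in auto)
    then show "F holomorphic_on ball ?a r - {?a}"
      by (rule holomorphic_transform) (simp add: F_def)
    have "((\<lambda>z. ?f z * X (inv_into U \<phi> z) powi k) \<longlongrightarrow> L) (at ?a)"
      using lim unfolding filterlim_atin_chart[OF U] by (simp add: comp_def)
    then have "(F \<longlongrightarrow> L) (at ?a)"
    proof (rule Lim_transform_eventually)
      show "eventually (\<lambda>z. ?f z * X (inv_into U \<phi> z) powi k = F z) (at ?a)"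
        unfolding eventually_at
      proof (intro exI[of _ r] conjI ballI impI)
        fix z assume "z \<noteq> ?a \<and> dist z ?a < r"
        then show "?f z * X (inv_into U \<phi> z) powi k = F z"
          using u(6)[of z] by (simp add: F_def dist_commute)
      qed (rule u(1))
    qed
    then show "(F \<longlongrightarrow> F z) (at z within ball ?a r)" if "z \<in> {?a}" for z
      using that by (auto simp: F_def intro: tendsto_within_subset)
  qed auto
  define G where "G z = F z * v z powi k" for z
  have G: "G holomorphic_on ball ?a r"
    unfolding G_def using F v v0 by (intro holomorphic_intros) auto
  have Ga: "G ?a \<noteq> 0"
    unfolding G_def F_def v_def using L u(5) by simp
  have eq: "?f z = G z * (z - ?a) powi k" if z: "z \<in> ball ?a r" "z \<noteq> ?a" for z
  proof -
    have "v z * (z - ?a) = u z" "u z \<noteq> 0"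
      using z u(6)[of z] by (auto simp: v_def)
    then have "v z powi k * (z - ?a) powi k = u z powi k"
      by (metis power_int_mult_distrib)
    moreover have "F z * u z powi k = ?f z"
      using z \<open>u z \<noteq> 0\<close> by (simp add: F_def power_int_inverse)
    ultimately show ?thesis
      unfolding G_def by (metis mult.assoc)
  qed
  have zo: "zorder ?f ?a = k"
    by (rule zorder_eqI[OF open_ball _ G Ga eq]) (use u(1) in auto)
  have ev: "eventually (\<lambda>z. ?f z = G z * (z - ?a) powi k) (at ?a)"
    unfolding eventually_at by (rule exI[of _ r]) (use eq u(1) in \<open>auto simp: dist_commute\<close>)
  have "G analytic_on {?a}"
    using G u(1) by (metis centre_in_ball holomorphic_on_imp_analytic_at open_ball)
  then have "(\<lambda>z. G z * (z - ?a) powi k) meromorphic_on {?a}"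
    by (intro meromorphic_intros analytic_on_imp_meromorphic_on) auto
  then have mer: "?f meromorphic_on {?a}"
    using ev by (subst meromorphic_on_cong[where g = "\<lambda>z. G z * (z - ?a) powi k"]) auto
  have Glim: "(G \<longlongrightarrow> G ?a) (at ?a)"
    using G u(1) by (metis centre_in_ball continuous_on_def holomorphic_on_imp_continuous_on open_ball at_within_open)
  have fa: "?f ?a = 0"
    using U fp by simp
  have "(is_pole ?f ?a \<and> ?f ?a = 0) \<or> (?f \<longlongrightarrow> ?f ?a) (at ?a)"
  proof (cases "k > 0")
    case True
    have "((\<lambda>z. G z * (z - ?a) ^ nat k) \<longlongrightarrow> G ?a * (?a - ?a) ^ nat k) (at ?a)"
      by (intro tendsto_intros Glim)
    also have "G ?a * (?a - ?a) ^ nat k = ?f ?a"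
      using True fa by (simp add: power_0_left)
    finally have "(?f \<longlongrightarrow> ?f ?a) (at ?a)"
      by (rule Lim_transform_eventually)
        (use ev True in \<open>auto elim!: eventually_mono simp: power_int_def\<close>)
    then show ?thesis ..
  next
    case False
    have "eventually (\<lambda>z. G z \<noteq> 0) (at ?a)"
      using tendsto_imp_eventually_ne[OF Glim Ga] .
    moreover have "eventually (\<lambda>z. z \<noteq> ?a) (at ?a)"
      by (simp add: eventually_at_filter)
    ultimately have "eventually (\<lambda>z. ?f z \<noteq> 0) (at ?a)"
      using ev by eventually_elim simp
    then have "is_pole ?f ?a"
      using zorder_neg_imp_is_pole[OF mer] False k zo by auto
    then show ?thesis
      using fa by blast
  qed
  then show "zorder ?f ?a = k" "?f nicely_meromorphic_on {?a}"
    using zo mer by (auto simp: nicely_meromorphic_on_def)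
qed

lemma has_divisor_diffI:
  assumes f: "holomorphic_fun M aff f" "\<And>y. y \<in> aff \<Longrightarrow> f y \<noteq> 0" "f p = 0" "f q = 0" and m: "m \<ge> 1"
    and lim: "((\<lambda>y. f y * X y powi int m) \<longlongrightarrow> L1) (atin (top_space M) p)" "L1 \<noteq> 0"
      "((\<lambda>y. f y * X y powi - int m) \<longlongrightarrow> L2) (atin (top_space M) q)" "L2 \<noteq> 0"
  shows "has_divisor M f (diff_divisor m p q)"
proof -
  have f': "holomorphic_fun M (points M - {q, p}) f"
    using f(1) by (simp add: insert_commute)
  have key: "zorder (f \<circ> inv_into U \<phi>) (\<phi> y) = diff_divisor m p q y \<and> (f \<circ> inv_into U \<phi>) nicely_meromorphic_on {\<phi> y}"
    if U: "(U, \<phi>) \<in> atlas M" "y \<in> U" for U \<phi> y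
  proof -
    consider "y = p" | "y = q" | "y \<in> aff"
      using chart_subset[OF U(1)] U(2) by blast
    then show ?thesis
    proof cases
      case 1
      have "diff_divisor m p q y = int m"
        using 1 pq by (simp add: diff_divisor_def)
      then show ?thesis
        using local_at_end[OF f(1) lim(1,2) _ f(3) U(1)] U(2) m 1 by simp
    next
      case 2
      have "diff_divisor m p q y = - int m"
        using 2 pq by (simp add: diff_divisor_def)
      then show ?thesis
        using double_cover.local_at_end[OF swap f' lim(3,4) _ f(4) U(1)] U(2) m 2 by simp
    next
      case 3
      have "open (\<phi> ` (U \<inter> aff))" "\<phi> y \<in> \<phi> ` (U \<inter> aff)"
        using chart_image_open[OF U(1) open_aff] 3 U(2) by blast+
      then have an: "(f \<circ> inv_into U \<phi>) analytic_on {\<phi> y}"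
        using holomorphic_fun_chart[OF U(1) f(1)] holomorphic_on_imp_analytic_at by blast
      moreover have "(f \<circ> inv_into U \<phi>) (\<phi> y) \<noteq> 0"
        using f(2)[OF 3] U by simp
      moreover have "diff_divisor m p q y = 0"
        using 3 by (auto simp: diff_divisor_def)
      ultimately show ?thesis
        using zorder_eq_0I analytic_on_imp_nicely_meromorphic_on by metis
    qed
  qed
  have "meromorphic_fun M f"
    unfolding meromorphic_fun_def
  proof safe
    fix U \<phi> assume U: "(U, \<phi>) \<in> atlas M"
    have "(f \<circ> inv_into U \<phi>) nicely_meromorphic_on {z}" if z: "z \<in> \<phi> ` U" for z
      using key[OF U] z by blast
    then show "(f \<circ> inv_into U \<phi>) nicely_meromorphic_on \<phi> ` U"
      unfolding nicely_meromorphic_on_def by (subst meromorphic_on_meromorphic_at) simp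
  qed
  moreover have "\<exists>x\<in>points M. f x \<noteq> 0"
  proof -
    obtain y where "y \<in> aff"
      using X_surj by (metis UNIV_I imageE)
    then show ?thesis
      using f(2) by blast
  qed
  ultimately show ?thesis
    unfolding has_divisor_def using key by blast
qed

text \<open>The product of \<open>h\<close> and \<open>h'\<close> is 1 and their sum tends to
  infinity at \<open>p\<close>. Hence the modulus of \<open>h\<close> is never 1 on a punctured
  disc, and by connectedness it stays on one side of 1. The small function is then negligible and
  the other one is asymptotic to 2 P(X).\<close>

lemma unit_dichotomy:
  assumes h: "holomorphic_fun M aff h" "holomorphic_fun M aff h'"
    and prod: "\<And>y. y \<in> aff \<Longrightarrow> h y * h' y = 1" and sum: "\<And>y. y \<in> aff \<Longrightarrow> h y + h' y = 2 * poly P (X y)"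
    and P: "degree P = m" "m \<ge> 1"
  shows "((\<lambda>y. h y * X y powi - int m) \<longlongrightarrow> 2 * lead_coeff P) (atin (top_space M) p) \<or>
         ((\<lambda>y. h' y * X y powi - int m) \<longlongrightarrow> 2 * lead_coeff P) (atin (top_space M) p)"
proof -
  \<comment> \<open>Stated for arbitrary \<open>h\<close> and \<open>h'\<close> because the two
    alternatives use it with the roles exchanged.\<close>
  have small: "((\<lambda>y. h y * X y powi - int m) \<longlongrightarrow> 2 * lead_coeff P) (atin (top_space M) p)"
    if ev: "eventually (\<lambda>y. norm (h' y) \<le> 1) (atin (top_space M) p)"
      and sum: "\<And>y. y \<in> aff \<Longrightarrow> h y + h' y = 2 * poly P (X y)" for h h' :: "'a \<Rightarrow> complex"
  proof -
    have "((\<lambda>y. inverse (X y) ^ m) \<longlongrightarrow> 0 ^ m) (atin (top_space M) p)"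
      by (intro tendsto_power filterlim_compose[OF tendsto_inverse_0 X_inf(1)])
    then have inv0: "((\<lambda>y. inverse (X y) ^ m) \<longlongrightarrow> 0) (atin (top_space M) p)"
      using P(2) by (simp add: power_0_left)
    have h'0: "((\<lambda>y. h' y * inverse (X y) ^ m) \<longlongrightarrow> 0) (atin (top_space M) p)"
    proof (rule Lim_null_comparison[OF _ tendsto_norm_zero[OF inv0]])
      show "eventually (\<lambda>y. norm (h' y * inverse (X y) ^ m) \<le> norm (inverse (X y) ^ m)) (atin (top_space M) p)"
        using ev by eventually_elim (simp add: norm_mult mult_left_le_one_le)
    qed
    have "((\<lambda>y. poly P (X y) / X y ^ m) \<longlongrightarrow> lead_coeff P) (atin (top_space M) p)"
      using filterlim_compose[OF poly_ratio_at_infinity[of P m] X_inf(1)] P(1) by simp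
    then have "((\<lambda>y. 2 * (poly P (X y) / X y ^ m) - h' y * inverse (X y) ^ m) \<longlongrightarrow> 2 * lead_coeff P - 0) (atin (top_space M) p)"
      by (intro tendsto_diff tendsto_mult tendsto_const h'0)
    then have "((\<lambda>y. 2 * (poly P (X y) / X y ^ m) - h' y * inverse (X y) ^ m) \<longlongrightarrow> 2 * lead_coeff P) (atin (top_space M) p)"
      by simp
    moreover have "eventually (\<lambda>y. 2 * (poly P (X y) / X y ^ m) - h' y * inverse (X y) ^ m = h y * X y powi - int m) (atin (top_space M) p)"
      unfolding eventually_atin
    proof (intro disjI2 exI[of _ "points M - {q}"] conjI ballI)
      fix y assume "y \<in> points M - {q} - {p}"
      then have "h y = 2 * poly P (X y) - h' y"
        using sum[of y] by (simp add: algebra_simps)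
      then show "2 * (poly P (X y) / X y ^ m) - h' y * inverse (X y) ^ m = h y * X y powi - int m"
        by (simp add: power_int_minus divide_inverse power_inverse algebra_simps flip: distrib_right)
    qed (use p q pq openin_Diff_finite[of "points M" "{q}"] in auto)
    ultimately show ?thesis
      by (rule Lim_transform_eventually)
  qed
  have big: "eventually (\<lambda>y. norm (h y + h' y) > 2) (atin (top_space M) p)"
  proof -
    have "filterlim (\<lambda>y. poly P (X y)) at_infinity (atin (top_space M) p)"
      by (rule filterlim_compose[OF filterlim_poly_at_infinity X_inf(1)]) (use P in auto)
    moreover have "eventually (\<lambda>x::complex. norm x > 1) at_infinity"
      unfolding eventually_at_infinity by (rule exI[of _ 2]) auto
    ultimately have "eventually (\<lambda>y. norm (poly P (X y)) > 1) (atin (top_space M) p)"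
      unfolding filterlim_iff by (elim allE[of _ "\<lambda>x. norm x > 1"]) blast
    moreover have "eventually (\<lambda>y. y \<in> aff) (atin (top_space M) p)"
      unfolding eventually_atin
      by (intro disjI2 exI[of _ "points M - {q}"])
        (use p q pq openin_Diff_finite[of "points M" "{q}"] in auto)
    ultimately show ?thesis
      by eventually_elim (simp add: sum norm_mult)
  qed
  obtain U \<phi> where U: "(U, \<phi>) \<in> atlas M" "p \<in> U"
    using ex_chart p by blast
  let ?g = "inv_into U \<phi>" and ?a = "\<phi> p"
  obtain V where V: "openin (top_space M) V" "p \<in> V" "\<forall>y\<in>V - {p}. norm (h y + h' y) > 2"
    using big p unfolding eventually_atin by blast
  have "openin (top_space M) (V - {q})"
    using V q by (intro openin_Diff_finite) auto
  then obtain r where r: "r > 0" "ball ?a r \<subseteq> \<phi> ` (U \<inter> (V - {q}))"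
    using chart_ball[OF U(1) _ U(2)] V(2) pq by blast
  let ?B = "ball ?a r - {?a}"
  have g: "?g z \<in> V - {p} \<and> ?g z \<in> aff \<and> ?g z \<in> U \<and> \<phi> (?g z) = z" if z: "z \<in> ?B" for z
  proof -
    obtain a where a: "a \<in> U \<inter> (V - {q})" "z = \<phi> a"
      using r(2) z by blast
    then show ?thesis
      using z chart_inv[OF U(1), of a] openin_subset[OF V(1)] by auto
  qed
  have sub: "?B \<subseteq> \<phi> ` (U \<inter> aff)"
  proof
    fix z assume "z \<in> ?B"
    then show "z \<in> \<phi> ` (U \<inter> aff)"
      using g[of z] by (metis IntI imageI)
  qed
  have cont: "continuous_on ?B (\<lambda>z. norm (h (?g z)))"
    using holomorphic_on_imp_continuous_on[OF holomorphic_on_subset[OF holomorphic_fun_chart[OF U(1) h(1)] sub]]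
    by (intro continuous_intros) (simp add: comp_def)
  have "connected ((\<lambda>z. norm (h (?g z))) ` ?B)"
    by (rule connected_continuous_image[OF cont]) (simp add: connected_punctured_ball)
  then have iv: "\<And>a b c. a \<in> (\<lambda>z. norm (h (?g z))) ` ?B \<Longrightarrow> b \<in> (\<lambda>z. norm (h (?g z))) ` ?B \<Longrightarrow> a \<le> c \<Longrightarrow> c \<le> b \<Longrightarrow> c \<in> (\<lambda>z. norm (h (?g z))) ` ?B"
    unfolding connected_iff_interval by blast
  \<comment> \<open>If \<open>h\<close> had modulus 1, so would \<open>h'\<close>, and the sum would
    have modulus at most 2, against the choice of \<open>V\<close>.\<close>
  have ne1: "norm (h (?g z)) \<noteq> 1" if z: "z \<in> ?B" for z
  proof
    assume 1: "norm (h (?g z)) = 1"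
    then have "norm (h' (?g z)) = 1"
      using prod[of "?g z"] g[OF z] by (metis mult_1 norm_mult norm_one)
    then have "norm (h (?g z) + h' (?g z)) \<le> 2"
      using 1 norm_triangle_ineq[of "h (?g z)" "h' (?g z)"] by simp
    then show False
      using V(3) g[OF z] by (meson not_less)
  qed
  have dich: "(\<forall>z\<in>?B. norm (h (?g z)) \<ge> 1) \<or> (\<forall>z\<in>?B. norm (h (?g z)) \<le> 1)"
  proof (rule ccontr)
    assume "\<not> ?thesis"
    then obtain z z' where z: "z \<in> ?B" "z' \<in> ?B" "norm (h (?g z)) \<le> 1" "1 \<le> norm (h (?g z'))"
      by (meson less_imp_le not_le)
    then have "1 \<in> (\<lambda>z. norm (h (?g z))) ` ?B"
      using iv[OF imageI[OF z(1)] imageI[OF z(2)]] by blast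
    then show False
      using ne1 by (metis (no_types, lifting) imageE)
  qed
  have ev: "eventually P (atin (top_space M) p)" if P: "\<And>z. z \<in> ?B \<Longrightarrow> P (?g z)" for P
    unfolding atin_chart[OF U] eventually_filtermap eventually_at
    by (rule exI[of _ r]) (use P r(1) in \<open>auto simp: dist_commute\<close>)
  show ?thesis
    using dich
  proof
    assume 1: "\<forall>z\<in>?B. norm (h (?g z)) \<ge> 1"
    have "eventually (\<lambda>y. norm (h' y) \<le> 1) (atin (top_space M) p)"
    proof (rule ev)
      fix z assume z: "z \<in> ?B"
      have "norm (h (?g z)) * norm (h' (?g z)) = 1"
        using prod[of "?g z"] g[OF z] by (metis norm_mult norm_one)
      moreover have "norm (h (?g z)) \<ge> 1"
        using 1 z by blast
      ultimately show "norm (h' (?g z)) \<le> 1"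
        by (metis mult_left_mono mult_1 mult.commute norm_ge_zero)
    qed
    then show ?thesis
      using small[OF _ sum] by blast
  next
    assume "\<forall>z\<in>?B. norm (h (?g z)) \<le> 1"
    then have "eventually (\<lambda>y. norm (h y) \<le> 1) (atin (top_space M) p)"
      by (intro ev) blast
    then show ?thesis
      using small[of h h'] sum by (simp add: add.commute)
  qed
qed

text \<open>Growth at both ends would make the norm of \<open>h\<close> grow like X^(2m), while the
  norm is 1. Comparing limits along the section at infinity forces \<open>c\<close> = 0.\<close>

lemma unit_both_ends:
  assumes prod: "\<And>y. y \<in> aff \<Longrightarrow> h y * h (J y) = 1" and m: "m \<ge> 1"
    and lim: "((\<lambda>y. h y * X y powi - int m) \<longlongrightarrow> c) (atin (top_space M) p)"
      "((\<lambda>y. h y * X y powi - int m) \<longlongrightarrow> c) (atin (top_space M) q)"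
  shows "c = 0"
proof -
  obtain s where s: "eventually (\<lambda>x. s x \<in> aff \<and> X (s x) = x) at_infinity"
    "filterlim s (atin (top_space M) p) at_infinity"
    "filterlim (\<lambda>x. J (s x)) (atin (top_space M) q) at_infinity"
    by (rule section_at_infinity)
  have "((\<lambda>x. (h (s x) * X (s x) powi - int m) * (h (J (s x)) * X (J (s x)) powi - int m)) \<longlongrightarrow> c * c) at_infinity"
    by (intro tendsto_mult filterlim_compose[OF lim(1) s(2)] filterlim_compose[OF lim(2) s(3)])
  moreover have "eventually (\<lambda>x. (h (s x) * X (s x) powi - int m) * (h (J (s x)) * X (J (s x)) powi - int m) = inverse x ^ m * inverse x ^ m) at_infinity"
    using s(1)
  proof eventually_elim
    case (elim x)
    then have "h (s x) * h (J (s x)) = 1" "X (J (s x)) = x"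
      using prod X_J by auto
    moreover have "(h (s x) * x powi - int m) * (h (J (s x)) * x powi - int m) =
        (h (s x) * h (J (s x))) * (inverse x ^ m * inverse x ^ m)"
      by (simp add: power_int_minus power_inverse)
    ultimately show ?case
      using elim by simp
  qed
  ultimately have "((\<lambda>x::complex. inverse x ^ m * inverse x ^ m) \<longlongrightarrow> c * c) at_infinity"
    by (rule Lim_transform_eventually)
  moreover have "((\<lambda>x::complex. inverse x ^ m * inverse x ^ m) \<longlongrightarrow> 0 ^ m * 0 ^ m) at_infinity"
    by (intro tendsto_intros tendsto_inverse_0)
  ultimately have "c * c = 0 ^ m * 0 ^ m"
    using tendsto_unique trivial_limit_at_infinity by blast
  then show ?thesis
    using m by (simp add: power_0_left)
qed

text \<open>Where \<open>h'\<close> grows, \<open>h\<close> = 1 / h' has a zero of the same order;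
  so \<open>h\<close> has its zero at \<open>p\<close> and its pole at \<open>q\<close>. The values
  at the ends are set to 0 to make the function nicely meromorphic.\<close>

lemma has_divisor_of_unit:
  assumes h: "holomorphic_fun M aff h" "holomorphic_fun M aff h'"
    and prod: "\<And>y. y \<in> aff \<Longrightarrow> h y * h' y = 1" and m: "m \<ge> 1"
    and lim: "((\<lambda>y. h' y * X y powi - int m) \<longlongrightarrow> c) (atin (top_space M) p)"
      "((\<lambda>y. h y * X y powi - int m) \<longlongrightarrow> c) (atin (top_space M) q)" and c: "c \<noteq> 0"
  shows "\<exists>f. has_divisor M f (diff_divisor m p q)"
proof -
  define f where "f y = (if y \<in> aff then h y else 0)" for y
  have ev: "eventually (\<lambda>y. y \<in> aff) (atin (top_space M) p)" "eventually (\<lambda>y. y \<in> aff) (atin (top_space M) q)"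
    unfolding eventually_atin
    by (intro disjI2 exI[of _ "points M - {q}"], use p q pq openin_Diff_finite[of "points M" "{q}"] in force,
        intro disjI2 exI[of _ "points M - {p}"], use p q pq openin_Diff_finite[of "points M" "{p}"] in force)
  have "((\<lambda>y. inverse (h' y * X y powi - int m)) \<longlongrightarrow> inverse c) (atin (top_space M) p)"
    by (rule tendsto_inverse[OF lim(1) c])
  then have flim1: "((\<lambda>y. f y * X y powi int m) \<longlongrightarrow> inverse c) (atin (top_space M) p)"
  proof (rule Lim_transform_eventually)
    show "eventually (\<lambda>y. inverse (h' y * X y powi - int m) = f y * X y powi int m) (atin (top_space M) p)"
      using ev(1)
    proof eventually_elim
      case (elim y)
      have "inverse (h' y) = h y"
        using prod[OF elim] by (metis inverse_unique mult.commute)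
      then show ?case
        using elim by (simp add: f_def power_int_minus)
    qed
  qed
  have flim2: "((\<lambda>y. f y * X y powi - int m) \<longlongrightarrow> c) (atin (top_space M) q)"
    using lim(2) by (rule Lim_transform_eventually) (use ev(2) in eventually_elim, simp add: f_def)
  have "holomorphic_fun M aff f"
    by (rule holomorphic_fun_cong[OF h(1)]) (simp add: f_def)
  moreover have "f y \<noteq> 0" if "y \<in> aff" for y
    using prod[OF that] that by (auto simp: f_def)
  ultimately have "has_divisor M f (diff_divisor m p q)"
    by (rule has_divisor_diffI[OF _ _ _ _ m flim1 _ flim2 c]) (use c in \<open>auto simp: f_def\<close>)
  then show ?thesis
    by blast
qed

text \<open>At each end one of P + w Q and P - w Q is large, and neither is large at both ends.
  Which of them has its zero at \<open>p\<close> depends on the sign of \<open>w\<close> near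
  \<open>p\<close>, so the two cases are symmetric.\<close>

theorem divisor_of_pell_abel:
  assumes w: "holomorphic_fun M aff w" "\<And>y. y \<in> aff \<Longrightarrow> w y ^ 2 = poly D (X y)" "\<And>y. y \<in> aff \<Longrightarrow> w (J y) = - w y"
    and PQ: "P ^ 2 - D * Q ^ 2 = 1" and deg: "degree P = m" "m \<ge> 1"
  shows "\<exists>f. has_divisor M f (diff_divisor m p q)"
proof -
  define h where "h y = poly P (X y) + w y * poly Q (X y)" for y
  define h' where "h' y = poly P (X y) - w y * poly Q (X y)" for y
  have hol: "holomorphic_fun M aff h" "holomorphic_fun M aff h'"
    unfolding h_def h'_def
    by (intro holomorphic_fun_add holomorphic_fun_diff holomorphic_fun_mult holomorphic_fun_poly w(1) X_hol)+
  have hol2: "holomorphic_fun M (points M - {q, p}) h" "holomorphic_fun M (points M - {q, p}) h'"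
    using hol by (simp_all add: insert_commute)
  have prod: "h y * h' y = 1" if y: "y \<in> aff" for y
  proof -
    have "h y * h' y = poly P (X y) ^ 2 - w y ^ 2 * poly Q (X y) ^ 2"
      unfolding h_def h'_def by (simp add: power2_eq_square algebra_simps)
    also have "\<dots> = poly (P ^ 2 - D * Q ^ 2) (X y)"
      by (simp add: w(2)[OF y])
    finally show ?thesis
      by (simp add: PQ)
  qed
  have sum: "h y + h' y = 2 * poly P (X y)" for y
    by (simp add: h_def h'_def)
  have hJ: "h (J y) = h' y" "h' (J y) = h y" if "y \<in> aff" for y
    using w(3)[OF that] X_J[OF that] by (simp_all add: h_def h'_def)
  let ?c = "2 * lead_coeff P"
  have c: "?c \<noteq> 0"
    using deg by auto
  have P1: "((\<lambda>y. h y * X y powi - int m) \<longlongrightarrow> ?c) (atin (top_space M) p) \<or>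
         ((\<lambda>y. h' y * X y powi - int m) \<longlongrightarrow> ?c) (atin (top_space M) p)"
    by (rule unit_dichotomy[OF hol prod sum deg])
  have P2: "((\<lambda>y. h y * X y powi - int m) \<longlongrightarrow> ?c) (atin (top_space M) q) \<or>
         ((\<lambda>y. h' y * X y powi - int m) \<longlongrightarrow> ?c) (atin (top_space M) q)"
    by (rule double_cover.unit_dichotomy[OF swap hol2 prod sum deg]) blast
  have prodJ: "h y * h (J y) = 1" "h' y * h' (J y) = 1" if "y \<in> aff" for y
    using prod[OF that] hJ[OF that] by (simp_all add: mult.commute)
  have prod': "h' y * h y = 1" if "y \<in> aff" for y
    using prod[OF that] by (simp add: mult.commute)
  note both = unit_both_ends[where h = h, OF prodJ(1) deg(2)] unit_both_ends[where h = h', OF prodJ(2) deg(2)]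
  show ?thesis
    using P1
  proof
    assume 1: "((\<lambda>y. h y * X y powi - int m) \<longlongrightarrow> ?c) (atin (top_space M) p)"
    then have "\<not> ((\<lambda>y. h y * X y powi - int m) \<longlongrightarrow> ?c) (atin (top_space M) q)"
      using both(1) c by blast
    then show ?thesis
      using has_divisor_of_unit[OF hol(2,1) prod' deg(2) 1] P2 c by blast
  next
    assume 1: "((\<lambda>y. h' y * X y powi - int m) \<longlongrightarrow> ?c) (atin (top_space M) p)"
    then have "\<not> ((\<lambda>y. h' y * X y powi - int m) \<longlongrightarrow> ?c) (atin (top_space M) q)"
      using both(2) c by blast
    then show ?thesis
      using has_divisor_of_unit[OF hol prod deg(2) 1] P2 c by blast
  qed
qed

text \<open>Supplies \<open>w\<close> on a surface that is not given as a curve. The quotient G /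
  Q(X) is singular only over the finitely many roots of \<open>Q\<close>, and it stays bounded there
  because its square is D(X).\<close>

lemma square_root_extends:
  assumes G: "holomorphic_fun M aff G" "\<And>y. y \<in> aff \<Longrightarrow> G (J y) = - G y"
    and G2: "\<And>y. y \<in> aff \<Longrightarrow> G y ^ 2 = poly D (X y) * poly Q (X y) ^ 2" and Q: "Q \<noteq> 0"
  obtains w where "holomorphic_fun M aff w" "\<And>y. y \<in> aff \<Longrightarrow> w y ^ 2 = poly D (X y)"
    "\<And>y. y \<in> aff \<Longrightarrow> w (J y) = - w y"
proof -
  define K where "K = {y \<in> aff. poly Q (X y) = 0}"
  have "finite K"
  proof -
    have "K \<subseteq> (\<Union>x\<in>{x. poly Q x = 0}. {y \<in> aff. X y = x})"
      unfolding K_def by blast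
    moreover have "finite {y \<in> aff. X y = x}" for x
    proof -
      obtain z where z: "z \<in> aff" "X z = x"
        using X_surj by (metis UNIV_I imageE)
      have "{y \<in> aff. X y = x} \<subseteq> {z, J z}"
      proof
        fix y assume "y \<in> {y \<in> aff. X y = x}"
        then show "y \<in> {z, J z}"
          using fibre[OF z(1), of y] z(2) by simp
      qed
      then show ?thesis
        using finite_subset by blast
    qed
    ultimately show ?thesis
      using poly_roots_finite[OF Q] by (meson finite_UN finite_subset)
  qed
  have KM: "K \<subseteq> points M"
    unfolding K_def by blast
  define w0 where "w0 y = G y * inverse (poly Q (X y))" for y
  define w where "w y = (if y \<in> K then Lim (atin (top_space M) y) w0 else w0 y)" for y
  have op: "openin (top_space M) (aff - K)"
    by (rule openin_Diff_finite[OF open_aff \<open>finite K\<close> KM])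
  have w0: "holomorphic_fun M (aff - K) w0"
    unfolding w0_def
  proof (intro holomorphic_fun_mult holomorphic_fun_inverse holomorphic_fun_poly)
    show "holomorphic_fun M (aff - K) G" "holomorphic_fun M (aff - K) X"
      by (rule holomorphic_fun_subset[OF G(1)] holomorphic_fun_subset[OF X_hol], blast)+
  qed (auto simp: K_def)
  have w02: "w0 y ^ 2 = poly D (X y)" if y: "y \<in> aff - K" for y
  proof -
    have "poly Q (X y) \<noteq> 0"
      using y by (auto simp: K_def)
    then show ?thesis
      using G2[of y] y unfolding w0_def power_mult_distrib power_inverse[symmetric] by (simp add: field_simps)
  qed
  have evK: "eventually (\<lambda>z. z \<in> aff - K) (atin (top_space M) y)" if "y \<in> aff" for y
  proof -
    have "openin (top_space M) (aff - (K - {y}))"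
      by (rule openin_Diff_finite[OF open_aff]) (use \<open>finite K\<close> KM in auto)
    then show ?thesis
      unfolding eventually_atin using that by (intro disjI2 exI[of _ "aff - (K - {y})"]) auto
  qed
  have ex: "\<exists>l. (w0 \<longlongrightarrow> l) (atin (top_space M) y)" if y: "y \<in> K" for y
  proof -
    have ya: "y \<in> aff"
      using y by (simp add: K_def)
    obtain U \<phi> where U: "(U, \<phi>) \<in> atlas M" "y \<in> U"
      using ex_chart ya by blast
    let ?g = "inv_into U \<phi>"
    have "openin (top_space M) (aff - (K - {y}))"
      by (rule openin_Diff_finite[OF open_aff]) (use \<open>finite K\<close> KM in auto)
    then obtain r where r: "r > 0" "ball (\<phi> y) r \<subseteq> \<phi> ` (U \<inter> (aff - (K - {y})))"
      using chart_ball[OF U(1) _ U(2)] ya by blast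
    have sub: "ball (\<phi> y) r - {\<phi> y} \<subseteq> \<phi> ` (U \<inter> (aff - K))"
      using r(2) by blast
    have hol: "(w0 \<circ> ?g) holomorphic_on ball (\<phi> y) r - {\<phi> y}"
      by (rule holomorphic_on_subset[OF holomorphic_fun_chart[OF U(1) w0] sub])
    have "(X \<longlongrightarrow> X y) (atin (top_space M) y)"
      by (rule holomorphic_fun_tendsto[OF X_hol open_aff ya])
    then have "((\<lambda>z. norm (poly D (X z))) \<longlongrightarrow> norm (poly D (X y))) (atin (top_space M) y)"
      by (intro tendsto_intros)
    then have "eventually (\<lambda>z. norm (poly D (X z)) < norm (poly D (X y)) + 1) (atin (top_space M) y)"
      by (rule order_tendstoD) simp
    \<comment> \<open>From |w0|^2 < b with b \<ge> 1 follows |w0| \<le> b, which saves a square root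
      in the bound.\<close>
    then have "eventually (\<lambda>z. norm (w0 z) \<le> norm (poly D (X y)) + 1) (atin (top_space M) y)"
      using evK[OF ya]
    proof eventually_elim
      case (elim z)
      define b where "b = norm (poly D (X y)) + 1"
      have "norm (w0 z) ^ 2 \<le> b"
        using w02[OF elim(2)] elim(1) unfolding b_def by (metis less_imp_le norm_power)
      also have "b \<le> b ^ 2"
        unfolding b_def power2_eq_square by (simp add: algebra_simps)
      finally show ?case
        unfolding b_def[symmetric] by (rule power2_le_imp_le) (simp add: b_def)
    qed
    then have bd: "eventually (\<lambda>z. norm ((w0 \<circ> ?g) z) \<le> norm (poly D (X y)) + 1) (at (\<phi> y))"
      unfolding atin_chart[OF U] by (simp add: eventually_filtermap)
    have "\<phi> y \<in> interior (ball (\<phi> y) r)"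
      using r(1) by simp
    then obtain k where k: "k holomorphic_on ball (\<phi> y) r" "\<forall>z\<in>ball (\<phi> y) r - {\<phi> y}. k z = (w0 \<circ> ?g) z"
      using holomorphic_on_extend_bounded[OF hol] bd by blast
    have "(k \<longlongrightarrow> k (\<phi> y)) (at (\<phi> y))"
      using k(1) r(1) by (metis centre_in_ball continuous_on_def holomorphic_on_imp_continuous_on open_ball at_within_open)
    then have "((w0 \<circ> ?g) \<longlongrightarrow> k (\<phi> y)) (at (\<phi> y))"
      by (rule Lim_transform_eventually)
        (use k(2) r(1) in \<open>auto simp: eventually_at dist_commute intro!: exI[of _ r]\<close>)
    then show ?thesis
      unfolding filterlim_atin_chart[OF U] by blast
  qed
  have limw0: "(w0 \<longlongrightarrow> w y) (atin (top_space M) y)" if y: "y \<in> aff" for y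
  proof (cases "y \<in> K")
    case True
    then obtain l where l: "(w0 \<longlongrightarrow> l) (atin (top_space M) y)"
      using ex by blast
    have "atin (top_space M) y \<noteq> bot"
      using atin_nontrivial y by blast
    then have "w y = l"
      using True tendsto_Lim[OF _ l] by (simp add: w_def)
    then show ?thesis
      using l by simp
  next
    case False
    then have "w y = w0 y" "y \<in> aff - K"
      using y by (simp_all add: w_def)
    then show ?thesis
      using holomorphic_fun_tendsto[OF w0 op] by simp
  qed
  have limw: "(w \<longlongrightarrow> w y) (atin (top_space M) y)" if y: "y \<in> aff" for y
    using limw0[OF y] by (rule Lim_transform_eventually) (use evK[OF y] in eventually_elim, simp add: w_def)
  have w: "holomorphic_fun M aff w"
  proof (rule holomorphic_fun_removable[OF open_aff \<open>finite K\<close> KM])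
    show "holomorphic_fun M (aff - K) w"
      by (rule holomorphic_fun_cong[OF w0]) (simp add: w_def)
  qed (use limw in blast)
  have w2: "w y ^ 2 = poly D (X y)" if y: "y \<in> aff" for y
  proof -
    have "((\<lambda>z. w0 z ^ 2) \<longlongrightarrow> w y ^ 2) (atin (top_space M) y)"
      by (intro tendsto_power limw0 y)
    moreover have "((\<lambda>z. poly D (X z)) \<longlongrightarrow> poly D (X y)) (atin (top_space M) y)"
      by (intro tendsto_intros holomorphic_fun_tendsto[OF X_hol open_aff y])
    then have "((\<lambda>z. w0 z ^ 2) \<longlongrightarrow> poly D (X y)) (atin (top_space M) y)"
      by (rule Lim_transform_eventually) (use evK[OF y] in eventually_elim, simp add: w02)
    ultimately show ?thesis
      using tendsto_unique atin_nontrivial y by (metis DiffD1)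
  qed
  \<comment> \<open>Antiinvariance is clear only where \<open>Q\<close> does not vanish. The sum w +
    w \<circ> J descends to an entire function that vanishes off the roots of \<open>Q\<close>,
    hence everywhere.\<close>
  obtain S where S: "S holomorphic_on UNIV" "\<And>y. y \<in> aff \<Longrightarrow> S (X y) = w y + w (J y)"
  proof (rule symmetric_descent[OF w, of "(+)"])
    show "(\<lambda>x. f x + g x) holomorphic_on W" if "f holomorphic_on W" "g holomorphic_on W" for W and f g :: "complex \<Rightarrow> complex"
      using that by (rule holomorphic_on_add)
    show "continuous_on UNIV (\<lambda>(a, b). a + b :: complex)"
      unfolding case_prod_unfold by (intro continuous_intros)
  qed (simp_all add: add.commute)
  have S0: "S x * poly Q x = 0" for x
  proof -
    obtain y where y: "y \<in> aff" "X y = x"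
      using X_surj by (metis UNIV_I imageE)
    have "S x = 0" if "poly Q x \<noteq> 0"
    proof -
      have "y \<notin> K" "J y \<notin> K"
        using that y X_J[OF y(1)] by (auto simp: K_def)
      then show ?thesis
        using S(2)[OF y(1)] y(2) G(2)[OF y(1)] X_J[OF y(1)] by (simp add: w_def w0_def)
    qed
    then show ?thesis
      by (cases "poly Q x = 0") auto
  qed
  have "S x = 0" for x
  proof -
    have "eventually (\<lambda>z. poly Q z \<noteq> 0) (at x)"
    proof -
      have "open (- ({z. poly Q z = 0} - {x}))"
        using poly_roots_finite[OF Q] by (intro open_Compl finite_imp_closed) auto
      then have "eventually (\<lambda>z. z \<in> - ({z. poly Q z = 0} - {x})) (nhds x)"
        by (intro eventually_nhds_in_open) auto
      then show ?thesis
        unfolding eventually_at_filter by (rule eventually_mono) auto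
    qed
    then have "eventually (\<lambda>z. S z = 0) (at x)"
      by (rule eventually_mono) (use S0 in \<open>metis mult_eq_0_iff\<close>)
    then have "(S \<longlongrightarrow> 0) (at x)"
      by (rule tendsto_eventually)
    moreover have "(S \<longlongrightarrow> S x) (at x)"
      using holomorphic_on_imp_continuous_on[OF S(1)] by (simp add: continuous_on_def)
    ultimately show ?thesis
      using tendsto_unique[OF at_neq_bot] by blast
  qed
  then have "w (J y) = - w y" if "y \<in> aff" for y
    using S(2)[OF that] by (simp add: eq_neg_iff_add_eq_0 add.commute)
  then show thesis
    using that w w2 by blast
qed

text \<open>The solution found for \<open>n\<close> has minimal degree: with the recovered
  \<open>w\<close>, a solution of smaller positive degree m would produce a function with divisor m
  (p - q).\<close>

theorem pell_abel_primitive: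
  assumes n: "n \<ge> 1" and f: "\<exists>f. has_divisor M f (diff_divisor n p q)"
    and min: "\<And>m. 1 \<le> m \<Longrightarrow> m < n \<Longrightarrow> \<not> (\<exists>f. has_divisor M f (diff_divisor m p q))"
  shows "\<exists>P Q. primitive_solution (\<Prod>e\<in>branch. [:-e, 1:]) P Q \<and> degree P = n"
proof -
  let ?D = "\<Prod>e\<in>branch. [:-e, 1:]"
  obtain f where "has_divisor M f (diff_divisor n p q)"
    using f by blast
  then obtain P Q c where PQ: "c \<noteq> 0" "degree P = n" "P ^ 2 - ?D * Q ^ 2 = 1"
    "holomorphic_fun M aff f" "\<And>y. y \<in> aff \<Longrightarrow> f y \<noteq> 0"
    "\<And>y. y \<in> aff \<Longrightarrow> c * f y + c * f (J y) = 2 * poly P (X y)"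
    "\<And>y. y \<in> aff \<Longrightarrow> c * f y * (c * f (J y)) = 1"
  proof (rule pell_abel_of_divisor[OF n], goal_cases)
    case (1 P Q c)
    show ?case
      by (rule 1(1)[OF 1(2-8)])
  qed
  define G where "G y = c * f y - poly P (X y)" for y
  have G: "holomorphic_fun M aff G"
    unfolding G_def
    by (intro holomorphic_fun_diff holomorphic_fun_mult holomorphic_fun_const holomorphic_fun_poly PQ(4) X_hol)
  have GJ: "G (J y) = - G y" if "y \<in> aff" for y
    using PQ(6)[OF that] X_J[OF that] unfolding G_def by (simp add: algebra_simps)
  have G2: "G y ^ 2 = poly ?D (X y) * poly Q (X y) ^ 2" if y: "y \<in> aff" for y
  proof -
    define a where "a = c * f y"
    have "a * (2 * poly P (X y) - a) = 1"
      using PQ(6,7)[OF y] unfolding a_def by (metis add_diff_cancel_left')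
    then have "G y ^ 2 = poly P (X y) ^ 2 - 1"
      unfolding G_def a_def[symmetric] by (simp add: power2_eq_square algebra_simps)
    also have "\<dots> = poly (P ^ 2 - 1) (X y)"
      by simp
    also have "P ^ 2 - 1 = ?D * Q ^ 2"
      using PQ(3) by (simp add: algebra_simps)
    finally show ?thesis
      by simp
  qed
  have "Q \<noteq> 0"
  proof
    assume "Q = 0"
    then have "P ^ 2 = 1"
      using PQ(3) by simp
    then have "degree (P ^ 2) = 0"
      by simp
    moreover have "degree (P ^ 2) = 2 * n"
      using PQ(2) n by (subst degree_power_eq) auto
    ultimately show False
      using n by simp
  qed
  obtain w where w: "holomorphic_fun M aff w" "\<And>y. y \<in> aff \<Longrightarrow> w y ^ 2 = poly ?D (X y)"
    "\<And>y. y \<in> aff \<Longrightarrow> w (J y) = - w y"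
    using square_root_extends[OF G GJ G2 \<open>Q \<noteq> 0\<close>] by blast
  have "degree P \<le> degree P'" if P': "P' ^ 2 - ?D * Q' ^ 2 = 1" "degree P' > 0" for P' Q'
  proof (rule ccontr)
    assume "\<not> degree P \<le> degree P'"
    then show False
      using min[of "degree P'"] divisor_of_pell_abel[OF w P'(1) refl] P'(2) PQ(2) by simp
  qed
  then show ?thesis
    using PQ(2,3) n unfolding primitive_solution_def by (intro exI[of _ P] exI[of _ Q]) auto
qed

end

section \<open>Primitive solutions\<close>

lemma pderiv_nonzero_at_root:
  fixes D :: "complex poly"
  assumes "squarefree D" "poly D a = 0"
  shows "poly (pderiv D) a \<noteq> 0"
proof
  assume d: "poly (pderiv D) a = 0"
  obtain q where q: "D = [:-a, 1:] * q"
    using assms(2) poly_eq_0_iff_dvd by (metis dvdE)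
  have "poly q a = 0"
    using d unfolding q pderiv_mult by (simp add: pderiv_pCons)
  then have "[:-a, 1:] ^ 2 dvd D"
    using q poly_eq_0_iff_dvd[of q a] by (metis dvd_refl mult_dvd_mono power2_eq_square)
  then have "[:-a, 1:] dvd 1"
    using assms(1) unfolding squarefree_def by blast
  then have "degree [:-a, 1:] \<le> degree (1 :: complex poly)"
    by (rule dvd_imp_degree_le) simp
  then show False
    by simp
qed

lemma prod_roots_squarefree:
  fixes D :: "complex poly"
  assumes "lead_coeff D = 1" "squarefree D"
  shows "(\<Prod>e\<in>roots D. [:-e, 1:]) = D"
proof -
  have "rsquarefree D"
    using pderiv_nonzero_at_root[OF assms(2)] unfolding rsquarefree_roots by blast
  then show ?thesis
    using complex_poly_decompose_rsquarefree[of D] assms(1) by (simp add: roots_def)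
qed

text \<open>With \<open>R = P P' - D Q Q'\<close> and \<open>R' = P P' + D Q Q'\<close> one has \<open>R R' = P\<^sup>2 + P'\<^sup>2 - 1\<close>, so
  that one of the two factors, which are again first components of solutions, is constant.\<close>

lemma primitive_solution_unique:
  assumes D: "degree D > 0" and 1: "primitive_solution D P Q" and 2: "primitive_solution D P' Q'"
  shows "P' = P \<or> P' = - P"
proof -
  define n where "n = degree P"
  have n: "n > 0" "degree P' = n"
    using 1 2 unfolding primitive_solution_def n_def by (auto intro: antisym)
  have DQ: "D * Q ^ 2 = P ^ 2 - 1" "D * Q' ^ 2 = P' ^ 2 - 1"
    using 1 2 unfolding primitive_solution_def by (auto simp: algebra_simps)
  have P0: "P \<noteq> 0" "P' \<noteq> 0"
    using n n_def by auto
  have main: "P' = P \<or> P' = - P" if T: "T ^ 2 = Q ^ 2" and deg: "degree (P * P' - D * T * Q') = 0" for T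
  proof -
    \<comment> \<open>\<open>R\<close> and \<open>S\<close> are the components of (P - T sqrt D)(P'
      + Q' sqrt D), and the norm is multiplicative.\<close>
    define R where "R = P * P' - D * T * Q'"
    define S where "S = P * Q' - P' * T"
    have "R ^ 2 - D * S ^ 2 = (P ^ 2 - D * T ^ 2) * (P' ^ 2 - D * Q' ^ 2)"
      unfolding R_def S_def by (simp add: power2_eq_square algebra_simps)
    also have "\<dots> = 1"
      by (simp add: T DQ)
    finally have RS: "D * S ^ 2 = R ^ 2 - 1"
      by (simp add: algebra_simps)
    have "degree (R ^ 2 - 1) = 0"
    proof -
      have "degree (R ^ 2 - 1) \<le> 0"
        using degree_power_le[of R 2] deg unfolding R_def[symmetric] by (intro degree_diff_le) auto
      then show ?thesis
        by simp
    qed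
    \<comment> \<open>D S^2 = R^2 - 1 is constant while \<open>D\<close> is not.\<close>
    then have "S = 0"
      using RS D by (metis add_is_0 degree_mult_eq mult_eq_0_iff power_eq_0_iff not_gr_zero degree_0)
    then have "P * Q' = P' * T"
      unfolding S_def by simp
    then have "D * (P * Q') ^ 2 = D * (P' * T) ^ 2"
      by simp
    then have "P ^ 2 * (D * Q' ^ 2) = P' ^ 2 * (D * T ^ 2)"
      by (simp add: power_mult_distrib mult_ac)
    then have "P ^ 2 = P' ^ 2"
      unfolding T DQ by (simp add: algebra_simps)
    then show ?thesis
      by (metis power2_eq_iff)
  qed
  define A where "A = P * P' - D * Q * Q'"
  define B where "B = P * P' - D * (- Q) * Q'"
  have AB: "A * B = P ^ 2 + P' ^ 2 - 1"
  proof -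
    have "A * B = P ^ 2 * P' ^ 2 - (D * Q ^ 2) * (D * Q' ^ 2)"
      unfolding A_def B_def by (simp add: power2_eq_square algebra_simps)
    then show ?thesis
      unfolding DQ by (simp add: algebra_simps)
  qed
  have "degree (A * B) \<le> 2 * n"
    unfolding AB using degree_power_le[of P 2] degree_power_le[of P' 2] n n_def
    by (intro degree_diff_le degree_add_le) auto
  moreover have "degree (A + B) = 2 * n"
  proof -
    have "A + B = smult 2 (P * P')"
      unfolding A_def B_def by (simp add: numeral_mult_conv_smult)
    then show ?thesis
      using P0 n n_def by (simp add: degree_mult_eq)
  qed
  moreover have "A * B \<noteq> 0 \<Longrightarrow> degree (A * B) = degree A + degree B"
    by (intro degree_mult_eq) auto
  moreover have "degree (A + B) \<le> max (degree A) (degree B)"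
    by (rule degree_add_le_max)
  moreover have "A * B = 0 \<Longrightarrow> degree A = 0 \<or> degree B = 0"
    by auto
  \<comment> \<open>The sum has degree 2n, so one factor has degree at least 2n; the product has
    degree at most 2n, which leaves degree 0 for the other.\<close>
  ultimately have "degree A = 0 \<or> degree B = 0"
    using n(1) by (metis add_is_0 add_le_same_cancel1 add_le_same_cancel2 le_max_iff_disj le_zero_eq max.absorb1 max.absorb2 nle_le order_trans)
  then show ?thesis
    using main[of Q] main[of "- Q"] unfolding A_def B_def by auto
qed

text \<open>Replacing \<open>P\<close> by \<open>- P\<close> exchanges the two counts, which the
  multiset does not see; this makes the definite description in \<open>degree_partition\<close>
  meaningful.\<close>

lemma degree_partition_eq:
  assumes "degree D > 0" "primitive_solution D P Q"
  shows "degree_partition D = {#card {e \<in> roots D. poly P e = -1}, card {e \<in> roots D. poly P e = 1}#}"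
  unfolding degree_partition_def
proof (rule the_equality)
  show "\<exists>P' Q'. primitive_solution D P' Q' \<and>
      {#card {e \<in> roots D. poly P e = -1}, card {e \<in> roots D. poly P e = 1}#} =
      {#card {e \<in> roots D. poly P' e = -1}, card {e \<in> roots D. poly P' e = 1}#}"
    using assms(2) by blast
  fix N assume "\<exists>P' Q'. primitive_solution D P' Q' \<and>
      N = {#card {e \<in> roots D. poly P' e = -1}, card {e \<in> roots D. poly P' e = 1}#}"
  then obtain P' Q' where P': "primitive_solution D P' Q'"
    "N = {#card {e \<in> roots D. poly P' e = -1}, card {e \<in> roots D. poly P' e = 1}#}"
    by blast
  have "P' = P \<or> P' = - P"
    by (rule primitive_solution_unique[OF assms P'(1)])
  then show "N = {#card {e \<in> roots D. poly P e = -1}, card {e \<in> roots D. poly P e = 1}#}"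
  proof
    assume "P' = - P"
    then have "{e \<in> roots D. poly P' e = -1} = {e \<in> roots D. poly P e = 1}"
      "{e \<in> roots D. poly P' e = 1} = {e \<in> roots D. poly P e = -1}"
      by (auto simp: minus_equation_iff)
    then show ?thesis
      unfolding P'(2) by (simp add: add_mset_commute)
  qed (simp add: P'(2))
qed

section \<open>The compactified curve\<close>

lemma affine_curve_iff: "c \<in> affine_curve D \<longleftrightarrow> snd c ^ 2 = poly D (fst c)"
  by (auto simp: affine_curve_def case_prod_unfold)

text \<open>w^2 = D(x) bounds \<open>w\<close> in terms of \<open>x\<close>. This properness later
  identifies the two added points with the places where \<open>x\<close> becomes infinite.\<close>

lemma compact_affine_curve_part: "compact {c \<in> affine_curve D. norm (fst c) \<le> B}"
proof -
  let ?C = "{c \<in> affine_curve D. norm (fst c) \<le> B}"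
  have "bounded (poly D ` cball 0 B)"
    by (intro compact_imp_bounded compact_continuous_image continuous_intros compact_cball)
  then obtain K where K: "\<forall>z\<in>poly D ` cball 0 B. norm z \<le> K"
    unfolding bounded_iff by blast
  have "?C = {c. snd c ^ 2 = poly D (fst c)} \<inter> {c. norm (fst c) \<le> B}"
    by (auto simp: affine_curve_iff)
  moreover have "closed {c :: complex \<times> complex. snd c ^ 2 = poly D (fst c)}"
    by (intro closed_Collect_eq continuous_intros)
  moreover have "closed {c :: complex \<times> complex. norm (fst c) \<le> B}"
    by (intro closed_Collect_le continuous_intros)
  ultimately have "closed ?C"
    by auto
  moreover have "bounded ?C"
    unfolding bounded_iff
  proof (intro exI[of _ "B + (K + 1)"] ballI)
    fix c assume c: "c \<in> ?C"
    then have "norm (snd c) ^ 2 \<le> K"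
      using K by (auto simp: affine_curve_iff simp flip: norm_power)
    then have "norm (snd c) \<le> K + 1"
      by (smt (verit, best) norm_ge_zero power2_eq_square mult_left_mono mult_le_cancel_right1)
    moreover have "norm c \<le> norm (fst c) + norm (snd c)"
      by (metis norm_Pair_le prod.collapse)
    ultimately show "norm c \<le> B + (K + 1)"
      using c by auto
  qed
  ultimately show ?thesis
    by (simp add: compact_eq_bounded_closed)
qed

locale curve = riemann_surface M for M :: "'a surface" +
  fixes g D J \<psi> pinf minf
  assumes adm: "admissible g D" and comp: "curve_compactification g D M J \<psi> pinf minf"
begin

definition x :: "'a \<Rightarrow> complex" where "x = fst \<circ> inv_into (affine_curve D) \<psi>"
definition w :: "'a \<Rightarrow> complex" where "w = snd \<circ> inv_into (affine_curve D) \<psi>"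

lemma bij: "bij_betw \<psi> (affine_curve D) (points M - {pinf, minf})"
  and ends_in: "pinf \<in> points M" "minf \<in> points M" "pinf \<noteq> minf"
  and x_hol: "holomorphic_fun M (points M - {pinf, minf}) x"
  and w_hol: "holomorphic_fun M (points M - {pinf, minf}) w"
  and J_psi: "(a, b) \<in> affine_curve D \<Longrightarrow> J (\<psi> (a, b)) = \<psi> (a, -b)"
  and J_ends: "J pinf = minf" "J minf = pinf"
  using comp unfolding curve_compactification_def Let_def x_def w_def by auto

lemma psi_in: "c \<in> affine_curve D \<Longrightarrow> \<psi> c \<in> points M - {pinf, minf}"
  using bij unfolding bij_betw_def by blast

lemma xw_psi: "(a, b) \<in> affine_curve D \<Longrightarrow> x (\<psi> (a, b)) = a" "(a, b) \<in> affine_curve D \<Longrightarrow> w (\<psi> (a, b)) = b"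
  using bij unfolding x_def w_def bij_betw_def by auto

lemma psi_xw: "y \<in> points M - {pinf, minf} \<Longrightarrow> (x y, w y) \<in> affine_curve D"
  "y \<in> points M - {pinf, minf} \<Longrightarrow> \<psi> (x y, w y) = y"
  using bij unfolding x_def w_def bij_betw_def by (auto simp: inv_into_into f_inv_into_f)

lemma w_square: "y \<in> points M - {pinf, minf} \<Longrightarrow> w y ^ 2 = poly D (x y)"
  using psi_xw(1) by (auto simp: affine_curve_def)

lemma neg_in: "(a, b) \<in> affine_curve D \<Longrightarrow> (a, -b) \<in> affine_curve D"
  by (simp add: affine_curve_def)

lemma D_props: "D \<noteq> 0" "degree D > 0" "lead_coeff D = 1" "squarefree D" "finite (roots D)"
proof -
  show D0: "D \<noteq> 0" "degree D > 0" "lead_coeff D = 1" "squarefree D"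
    using adm unfolding admissible_def by auto
  show "finite (roots D)"
    using poly_roots_finite[OF D0(1)] by (simp add: roots_def)
qed

lemma open_aff: "openin (top_space M) (points M - {pinf, minf})"
  by (rule openin_Diff_finite) (use ends_in in auto)

section \<open>Topology of an arbitrary compactification of the curve\<close>

lemma finite_fibres:
  "finite {y \<in> points M - {pinf, minf}. x y = c}" "finite {y \<in> points M - {pinf, minf}. w y = c}"
proof -
  have "{y \<in> points M - {pinf, minf}. x y = c} \<subseteq> \<psi> ` {(c, csqrt (poly D c)), (c, - csqrt (poly D c))}"
  proof
    fix y assume y: "y \<in> {y \<in> points M - {pinf, minf}. x y = c}"
    then have "w y ^ 2 = csqrt (poly D c) ^ 2" "\<psi> (c, w y) = y"
      using w_square psi_xw by auto
    then show "y \<in> \<psi> ` {(c, csqrt (poly D c)), (c, - csqrt (poly D c))}"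
      unfolding power2_eq_iff by auto
  qed
  then show "finite {y \<in> points M - {pinf, minf}. x y = c}"
    by (rule finite_subset) simp
  have "finite {a. poly (D - [:c ^ 2:]) a = 0}"
  proof (rule poly_roots_finite)
    have "D \<noteq> [:c ^ 2:]"
      using D_props(2) by auto
    then show "D - [:c ^ 2:] \<noteq> 0"
      by simp
  qed
  moreover have "{y \<in> points M - {pinf, minf}. w y = c} \<subseteq> (\<lambda>a. \<psi> (a, c)) ` {a. poly (D - [:c ^ 2:]) a = 0}"
  proof
    fix y assume y: "y \<in> {y \<in> points M - {pinf, minf}. w y = c}"
    then have "c ^ 2 = poly D (x y)" "\<psi> (x y, c) = y"
      using w_square psi_xw by auto
    then show "y \<in> (\<lambda>a. \<psi> (a, c)) ` {a. poly (D - [:c ^ 2:]) a = 0}"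
      by (intro image_eqI[of _ _ "x y"]) auto
  qed
  ultimately show "finite {y \<in> points M - {pinf, minf}. w y = c}"
    using finite_surj by blast
qed

text \<open>The definition makes \<open>x\<close> and \<open>w\<close> holomorphic on the surface
  but says nothing on the continuity of \<open>\<psi>\<close>. It comes from the open mapping
  theorem: where \<open>w\<close> is nonzero \<open>x\<close> is open and the point over a value is
  singled out by its \<open>w\<close>; where \<open>w\<close> is zero the root of \<open>D\<close>
  is simple, \<open>w\<close> is open and singles out \<open>x\<close>.\<close>

lemma psi_near:
  assumes y: "y \<in> points M - {pinf, minf}" and N: "openin (top_space M) N" "y \<in> N"
  obtains d where "d > 0" "\<And>a b. (a, b) \<in> affine_curve D \<Longrightarrow> dist a (x y) < d \<Longrightarrow> dist b (w y) < d \<Longrightarrow> \<psi> (a, b) \<in> N"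
proof (cases "w y = 0")
  case False
  \<comment> \<open>In the disc of radius |w y| about \<open>w y\<close> no two values are opposite,
    so the square of \<open>w\<close> determines \<open>w\<close>.\<close>
  define V where "V = {z \<in> points M - {pinf, minf}. w z \<in> ball (w y) (norm (w y))} \<inter> N"
  have V: "openin (top_space M) V" "V \<subseteq> points M - {pinf, minf}" "y \<in> V"
    unfolding V_def using holomorphic_fun_open_preimage[OF w_hol open_aff open_ball] N y False by auto
  have "open (x ` V)"
    by (rule open_map_finite_fibres[OF x_hol finite_fibres(1) V(1,2)])
  then obtain d where d: "d > 0" "ball (x y) d \<subseteq> x ` V"
    using V(3) by (metis imageI openE)
  show thesis
  proof (rule that[of "min d (norm (w y))"])
    fix a b assume ab: "(a, b) \<in> affine_curve D" "dist a (x y) < min d (norm (w y))" "dist b (w y) < min d (norm (w y))"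
    then have "a \<in> ball (x y) d"
      by (simp add: dist_commute)
    then obtain z where z: "z \<in> V" "x z = a"
      using d(2) by blast
    have "w z ^ 2 = b ^ 2"
      using w_square[of z] z V(2) ab(1) by (auto simp: affine_curve_def)
    moreover have "w z \<noteq> - b"
    proof
      assume "w z = - b"
      then have "norm (w y + b) < norm (w y)" "norm (b - w y) < norm (w y)"
        using z(1) ab(3) unfolding V_def by (auto simp: dist_norm)
      moreover have "norm (2 * w y) \<le> norm (w y + b) + norm (b - w y)"
        using norm_triangle_ineq4[of "w y + b" "b - w y"] by (simp add: algebra_simps mult_2[symmetric])
      ultimately show False
        by (simp add: norm_mult)
    qed
    ultimately have "w z = b"
      by (simp add: power2_eq_iff)
    then have "\<psi> (a, b) = z"
      using psi_xw(2)[of z] z V(2) by auto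
    then show "\<psi> (a, b) \<in> N"
      using z(1) by (simp add: V_def)
  qed (use d(1) False in simp)
next
  case True
  have "poly D (x y) = 0"
    using w_square[OF y] True by simp
  then have d: "deriv (poly D) (x y) \<noteq> 0"
    using pderiv_nonzero_at_root[OF D_props(4)] by (simp add: DERIV_imp_deriv[OF poly_DERIV])
  \<comment> \<open>At a simple root \<open>D\<close> is injective nearby, so w^2 = D(x) determines
    \<open>x\<close>.\<close>
  obtain r where r: "r > 0" "inj_on (poly D) (ball (x y) r)"
    using has_complex_derivative_locally_injective[OF poly_holomorphic_on[OF holomorphic_on_ident] UNIV_I open_UNIV d] by blast
  define V where "V = {z \<in> points M - {pinf, minf}. x z \<in> ball (x y) r} \<inter> N"
  have V: "openin (top_space M) V" "V \<subseteq> points M - {pinf, minf}" "y \<in> V"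
    unfolding V_def using holomorphic_fun_open_preimage[OF x_hol open_aff open_ball] N y r(1) by auto
  have "open (w ` V)"
    by (rule open_map_finite_fibres[OF w_hol finite_fibres(2) V(1,2)])
  then obtain d where d: "d > 0" "ball (w y) d \<subseteq> w ` V"
    using V(3) by (metis imageI openE)
  show thesis
  proof (rule that[of "min d r"])
    fix a b assume ab: "(a, b) \<in> affine_curve D" "dist a (x y) < min d r" "dist b (w y) < min d r"
    then have "b \<in> ball (w y) d"
      by (simp add: dist_commute)
    then obtain z where z: "z \<in> V" "w z = b"
      using d(2) by blast
    have "poly D (x z) = poly D a"
      using w_square[OF subsetD[OF V(2) z(1)]] z(2) ab(1) by (simp add: affine_curve_def)
    moreover have "x z \<in> ball (x y) r" "a \<in> ball (x y) r"
      using z(1) ab(2) unfolding V_def by (auto simp: dist_commute)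
    ultimately have "x z = a"
      using r(2) by (meson inj_onD)
    then have "\<psi> (a, b) = z"
      using psi_xw(2)[of z] z V(2) by auto
    then show "\<psi> (a, b) \<in> N"
      using z(1) by (simp add: V_def)
  qed (use d(1) r(1) in simp)
qed

lemma psi_continuous: "continuous_map (top_of_set (affine_curve D)) (top_space M) \<psi>"
proof -
  have "openin (top_of_set (affine_curve D)) {c \<in> affine_curve D. \<psi> c \<in> N}" if N: "openin (top_space M) N" for N
    unfolding openin_euclidean_subtopology_iff
  proof (intro conjI ballI)
    fix c assume c: "c \<in> {c \<in> affine_curve D. \<psi> c \<in> N}"
    obtain a0 b0 where c0: "c = (a0, b0)"
      by fastforce
    have y: "\<psi> c \<in> points M - {pinf, minf}"
      using psi_in c by blast
    obtain d where d: "d > 0" "\<And>a b. (a, b) \<in> affine_curve D \<Longrightarrow> dist a (x (\<psi> c)) < d \<Longrightarrow> dist b (w (\<psi> c)) < d \<Longrightarrow> \<psi> (a, b) \<in> N"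
      using psi_near[OF y N] c by blast
    have xw: "x (\<psi> c) = a0" "w (\<psi> c) = b0"
      using xw_psi c c0 by auto
    show "\<exists>e>0. \<forall>c'\<in>affine_curve D. dist c' c < e \<longrightarrow> c' \<in> {c \<in> affine_curve D. \<psi> c \<in> N}"
    proof (intro exI[of _ d] conjI ballI impI)
      fix c' assume c': "c' \<in> affine_curve D" "dist c' c < d"
      obtain a b where ab: "c' = (a, b)"
        by fastforce
      have "dist a a0 < d" "dist b b0 < d"
        using c'(2) dist_fst_le[of c' c] dist_snd_le[of c' c] unfolding ab c0 by simp_all
      then show "c' \<in> {c \<in> affine_curve D. \<psi> c \<in> N}"
        using d(2) c'(1) xw unfolding ab by auto
    qed (rule d(1))
  qed auto
  then show ?thesis
    unfolding continuous_map_def using psi_in by auto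
qed

text \<open>The part of the curve with bounded \<open>x\<close> is compact, so its image is closed
  and its complement is a neighbourhood of the added points.\<close>

lemma x_at_end:
  assumes P: "P = {pinf, minf}" "p \<in> P"
  shows "filterlim x at_infinity (atin (top_space M) p)"
  unfolding filterlim_at_infinity[OF order_refl]
proof (intro allI impI)
  fix B :: real assume "B > 0"
  define C where "C = {c \<in> affine_curve D. norm (fst c) \<le> B}"
  have "compact C"
    unfolding C_def by (rule compact_affine_curve_part)
  then have "compactin (top_of_set (affine_curve D)) C"
    by (auto simp: compactin_subtopology C_def)
  then have "compactin (top_space M) (\<psi> ` C)"
    by (rule image_compactin[OF _ psi_continuous])
  then have "closedin (top_space M) (\<psi> ` C)"
    using Hausdorff compactin_imp_closedin by blast
  then have "openin (top_space M) (points M - \<psi> ` C)"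
    by blast
  then have "openin (top_space M) (points M - \<psi> ` C - (P - {p}))"
    by (rule openin_Diff_finite) (use P ends_in in auto)
  moreover have "p \<in> points M - \<psi> ` C - (P - {p})"
    using P ends_in psi_in unfolding C_def by auto
  moreover have "B \<le> norm (x z)" if "z \<in> points M - \<psi> ` C - (P - {p}) - {p}" for z
  proof (rule ccontr)
    assume B: "\<not> B \<le> norm (x z)"
    have z: "z \<in> points M - {pinf, minf}"
      using that P by auto
    then have "(x z, w z) \<in> C"
      using psi_xw(1) B unfolding C_def by simp
    then show False
      using psi_xw(2)[OF z] that by (metis DiffD1 DiffD2 imageI)
  qed
  ultimately show "eventually (\<lambda>y. B \<le> norm (x y)) (atin (top_space M) p)"
    unfolding eventually_atin by blast
qed

lemma J_xw:
  assumes y: "y \<in> points M - {pinf, minf}"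
  shows "J y \<in> points M - {pinf, minf}" "x (J y) = x y" "w (J y) = - w y"
proof -
  have c: "(x y, w y) \<in> affine_curve D" "\<psi> (x y, w y) = y"
    using psi_xw[OF y] by auto
  then have J: "J y = \<psi> (x y, - w y)"
    using J_psi by metis
  show "J y \<in> points M - {pinf, minf}" "x (J y) = x y" "w (J y) = - w y"
    unfolding J using neg_in[OF c(1)] psi_in xw_psi by auto
qed

lemma fixed_iff:
  assumes y: "y \<in> points M - {pinf, minf}"
  shows "J y = y \<longleftrightarrow> w y = 0"
proof
  assume "J y = y"
  then show "w y = 0"
    using J_xw(3)[OF y] by simp
next
  assume "w y = 0"
  then show "J y = y"
    using J_psi[OF psi_xw(1)[OF y]] psi_xw(2)[OF y] by simp
qed

lemma cover: "double_cover M J x pinf minf"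
proof
  show "x ` (points M - {pinf, minf}) = UNIV"
  proof (intro equalityI subsetI)
    fix a
    have "(a, csqrt (poly D a)) \<in> affine_curve D"
      by (simp add: affine_curve_def)
    then show "a \<in> x ` (points M - {pinf, minf})"
      using psi_in xw_psi(1) by (metis imageI)
  qed auto
  fix y assume y: "y \<in> points M - {pinf, minf}"
  show "J y \<in> points M - {pinf, minf}"
    by (rule J_xw(1)[OF y])
  fix z assume z: "z \<in> points M - {pinf, minf}"
  show "x y = x z \<longleftrightarrow> z = y \<or> z = J y"
  proof
    assume eq: "x y = x z"
    then have "w z ^ 2 = w y ^ 2"
      using w_square y z by simp
    then have "w z = w y \<or> w z = - w y"
      by (simp add: power2_eq_iff)
    moreover have "z = \<psi> (x y, w z)" "y = \<psi> (x y, w y)" "J y = \<psi> (x y, - w y)"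
      using psi_xw[OF z] psi_xw[OF y] eq J_psi by metis+
    ultimately show "z = y \<or> z = J y"
      by metis
  qed (use J_xw[OF y] in auto)
next
  have "{y \<in> points M - {pinf, minf}. J y = y} \<subseteq> {y \<in> points M - {pinf, minf}. w y = 0}"
    using fixed_iff by blast
  then show "finite {y \<in> points M - {pinf, minf}. J y = y}"
    using finite_fibres(2) finite_subset by blast
qed (use ends_in x_hol x_at_end in auto)

lemma branch_eq: "x ` {y \<in> points M - {pinf, minf}. J y = y} = roots D"
proof (intro equalityI subsetI)
  fix e assume "e \<in> x ` {y \<in> points M - {pinf, minf}. J y = y}"
  then obtain y where y: "y \<in> points M - {pinf, minf}" "J y = y" "e = x y"
    by blast
  then have "w y = 0"
    using fixed_iff by simp
  then show "e \<in> roots D"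
    using w_square[OF y(1)] y(3) by (simp add: roots_def)
next
  fix e assume "e \<in> roots D"
  then have "(e, 0) \<in> affine_curve D"
    by (simp add: roots_def affine_curve_def)
  then have "\<psi> (e, 0) \<in> points M - {pinf, minf}" "w (\<psi> (e, 0)) = 0" "e = x (\<psi> (e, 0))"
    using psi_in xw_psi by auto
  then show "e \<in> x ` {y \<in> points M - {pinf, minf}. J y = y}"
    using fixed_iff by blast
qed

section \<open>Divisors supported at the points at infinity, and the degree partition\<close>

lemma divisor_exists:
  assumes "P ^ 2 - D * Q ^ 2 = 1" "degree P = m" "m \<ge> 1" "{p, J p} = {pinf, minf}"
  shows "\<exists>f. has_divisor M f (diff_divisor m p (J p))"
proof -
  interpret double_cover M J x pinf minf
    by (rule cover)
  consider "p = pinf" "J p = minf" | "p = minf" "J p = pinf"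
    using assms(4) J_ends by (metis doubleton_eq_iff)
  then show ?thesis
  proof cases
    case 1
    then show ?thesis
      using divisor_of_pell_abel[OF w_hol w_square J_xw(3) assms(1-3)] by simp
  next
    case 2
    have "\<exists>f. has_divisor M f (diff_divisor m minf pinf)"
      by (rule double_cover.divisor_of_pell_abel[OF swap _ _ _ assms(1-3), of w])
        (use w_hol w_square J_xw(3) in \<open>auto simp: insert_commute\<close>)
    then show ?thesis
      using 2 by simp
  qed
qed

text \<open>At a branch point \<open>J\<close> fixes the point, so c f + c (f \<circ> J) = 2 P and
  the norm equation become c f = P(e) and (c f)^2 = 1.\<close>

lemma solution_of_divisor:
  assumes f: "has_divisor M f (diff_divisor n p (J p))" and n: "n \<ge> 1" and p: "{p, J p} = {pinf, minf}"
  obtains P Q c where "c \<noteq> 0" "degree P = n" "P ^ 2 - D * Q ^ 2 = 1"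
    "\<And>e. e \<in> roots D \<Longrightarrow> c * f (\<psi> (e, 0)) = poly P e \<and> (c * f (\<psi> (e, 0))) ^ 2 = 1"
proof -
  have D: "(\<Prod>e\<in>roots D. [:-e, 1:]) = D"
    by (rule prod_roots_squarefree) (use D_props in auto)
  consider "p = pinf" "J p = minf" | "p = minf" "J p = pinf"
    using p J_ends by (metis doubleton_eq_iff)
  then have dc: "double_cover M J x p (J p)"
    using cover double_cover.swap[OF cover] by cases auto
  have br: "x ` {y \<in> points M - {p, J p}. J y = y} = roots D"
    using branch_eq p by simp
  obtain P Q c where PQ: "c \<noteq> 0" "degree P = n" "P ^ 2 - D * Q ^ 2 = 1"
    and sum: "\<And>y. y \<in> points M - {p, J p} \<Longrightarrow> c * f y + c * f (J y) = 2 * poly P (x y)"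
    and prod: "\<And>y. y \<in> points M - {p, J p} \<Longrightarrow> c * f y * (c * f (J y)) = 1"
    using double_cover.pell_abel_of_divisor[OF dc n f] unfolding br D by blast
  have "c * f (\<psi> (e, 0)) = poly P e \<and> (c * f (\<psi> (e, 0))) ^ 2 = 1" if e: "e \<in> roots D" for e
  proof -
    have c: "(e, 0) \<in> affine_curve D"
      using e by (simp add: roots_def affine_curve_def)
    then have "\<psi> (e, 0) \<in> points M - {p, J p}" "J (\<psi> (e, 0)) = \<psi> (e, 0)" "x (\<psi> (e, 0)) = e"
      using psi_in[OF c] xw_psi[OF c] J_psi[OF c] p by auto
    then show ?thesis
      using sum[of "\<psi> (e, 0)"] prod[of "\<psi> (e, 0)"] by (simp add: power2_eq_square)
  qed
  then show thesis
    using that PQ by blast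
qed

text \<open>The torsion pair is unordered, so the point \<open>p'\<close> at which minimality is
  known may be the end opposite to \<open>p\<close>. This does no harm:
  \<open>divisor_exists\<close> produces the divisor for either order of the ends.\<close>

theorem degree_partition_of_divisor:
  assumes tors: "primitive_torsion_pair n M J {pinf, minf}" and p: "{p, J p} = {pinf, minf}"
    and f: "has_divisor M f (diff_divisor n p (J p))"
  shows "\<exists>c. c \<noteq> 0 \<and> (\<forall>e\<in>roots D. c * f (\<psi> (e, 0)) \<in> {1, -1}) \<and>
    degree_partition D = {#card {e \<in> roots D. c * f (\<psi> (e, 0)) = -1}, card {e \<in> roots D. c * f (\<psi> (e, 0)) = 1}#}"
proof -
  obtain p' where p': "{p', J p'} = {pinf, minf}" "n \<ge> 1"
    "\<And>m. 1 \<le> m \<Longrightarrow> m < n \<Longrightarrow> \<not> (\<exists>f. has_divisor M f (diff_divisor m p' (J p')))"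
    using tors unfolding primitive_torsion_pair_def by metis
  obtain P Q c where PQ: "c \<noteq> 0" "degree P = n" "P ^ 2 - D * Q ^ 2 = 1"
    and val: "\<And>e. e \<in> roots D \<Longrightarrow> c * f (\<psi> (e, 0)) = poly P e \<and> (c * f (\<psi> (e, 0))) ^ 2 = 1"
    using solution_of_divisor[OF f p'(2) p] by metis
  have "primitive_solution D P Q"
    unfolding primitive_solution_def
  proof (intro conjI allI impI)
    fix P' Q' :: "complex poly" assume "P' ^ 2 - D * Q' ^ 2 = 1 \<and> degree P' > 0"
    then show "degree P \<le> degree P'"
      using divisor_exists[of P' Q' "degree P'" p'] p'(1) p'(3)[of "degree P'"] PQ(2)
      by (metis One_nat_def Suc_leI not_le)
  qed (use PQ p'(2) in auto)
  then have dp: "degree_partition D = {#card {e \<in> roots D. poly P e = -1}, card {e \<in> roots D. poly P e = 1}#}"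
    by (rule degree_partition_eq[OF D_props(2)])
  have "{e \<in> roots D. poly P e = t} = {e \<in> roots D. c * f (\<psi> (e, 0)) = t}" for t
    using val by auto
  then have "degree_partition D = {#card {e \<in> roots D. c * f (\<psi> (e, 0)) = -1}, card {e \<in> roots D. c * f (\<psi> (e, 0)) = 1}#}"
    using dp by simp
  moreover have "\<forall>e\<in>roots D. c * f (\<psi> (e, 0)) \<in> {1, -1}"
    using val by (metis insertCI power2_eq_1_iff)
  ultimately show ?thesis
    using PQ(1) by blast
qed

theorem torsion_of_primitive_solution:
  assumes PQ: "primitive_solution D P Q"
  shows "primitive_torsion_pair (degree P) M J {pinf, minf}"
  unfolding primitive_torsion_pair_def
proof (intro bexI[of _ pinf] conjI allI impI)
  have sol: "P ^ 2 - D * Q ^ 2 = 1" "degree P \<ge> 1"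
    using PQ unfolding primitive_solution_def by auto
  show "\<exists>f. has_divisor M f (diff_divisor (degree P) pinf (J pinf))"
    by (rule divisor_exists[OF sol(1) refl sol(2)]) (use J_ends in simp)
  fix m assume m: "1 \<le> m \<and> m < degree P"
  show "\<not> (\<exists>f. has_divisor M f (diff_divisor m pinf (J pinf)))"
  proof
    assume "\<exists>f. has_divisor M f (diff_divisor m pinf (J pinf))"
    then obtain f where f: "has_divisor M f (diff_divisor m pinf (J pinf))"
      by blast
    have m1: "m \<ge> 1" and pp: "{pinf, J pinf} = {pinf, minf}"
      using m J_ends by auto
    obtain P' Q' where "degree P' = m" "P' ^ 2 - D * Q' ^ 2 = 1"
      using solution_of_divisor[OF f m1 pp] by metis
    then show False
      using PQ m unfolding primitive_solution_def by (metis not_le less_le_trans zero_less_one)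
  qed
qed (use ends_in J_ends PQ in \<open>auto simp: primitive_solution_def\<close>)

end

section \<open>Plane curves\<close>

text \<open>All open pieces to which the implicit function theorem applies with an injective
  coordinate: \<open>x\<close> where \<open>w\<close> is nonzero, \<open>w\<close> where D'(x) is
  nonzero. Both kinds together cover the curve when the roots of \<open>D\<close> are
  simple.\<close>

definition curve_charts :: "complex poly \<Rightarrow> (complex \<times> complex) chart set" where
  "curve_charts D =
     {(W, fst) | W. openin (top_of_set (affine_curve D)) W \<and> inj_on fst W \<and> (\<forall>c\<in>W. snd c \<noteq> 0)} \<union>
     {(W, snd) | W. openin (top_of_set (affine_curve D)) W \<and> inj_on snd W \<and> (\<forall>c\<in>W. poly (pderiv D) (fst c) \<noteq> 0)}"

lemma dist_Pair_le: "dist (a, b) (c, d) \<le> dist a c + dist b d"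
  unfolding dist_Pair_Pair by (rule sqrt_sum_squares_le_sum) simp_all

text \<open>The solution is the local inverse of \<open>D\<close> applied to z^2.\<close>

lemma holomorphic_root_near:
  assumes "poly D a = b ^ 2" "poly (pderiv D) a \<noteq> 0"
  obtains r t where "r > 0" "t holomorphic_on ball b r" "t b = a" "\<And>z. z \<in> ball b r \<Longrightarrow> poly D (t z) = z ^ 2"
proof -
  have hD: "poly D holomorphic_on S" for S
    by (rule poly_holomorphic_on[OF holomorphic_on_ident])
  have "deriv (poly D) a \<noteq> 0"
    using assms(2) by (simp add: DERIV_imp_deriv[OF poly_DERIV])
  then obtain \<rho> where \<rho>: "\<rho> > 0" "open (poly D ` ball a \<rho>)" "inj_on (poly D) (ball a \<rho>)"
    using has_complex_derivative_locally_invertible[OF hD UNIV_I open_UNIV] by blast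
  obtain h where h: "h holomorphic_on poly D ` ball a \<rho>" "\<And>z. z \<in> ball a \<rho> \<Longrightarrow> h (poly D z) = z"
    using holomorphic_has_inverse[OF hD open_ball \<rho>(3)] by metis
  have "open ((\<lambda>z. z ^ 2) -` (poly D ` ball a \<rho>))"
    using \<rho>(2) by (intro open_vimage continuous_intros)
  moreover have "b \<in> (\<lambda>z. z ^ 2) -` (poly D ` ball a \<rho>)"
    using assms(1) \<rho>(1) by (auto intro!: image_eqI[of _ _ a])
  ultimately obtain r where r: "r > 0" "ball b r \<subseteq> (\<lambda>z. z ^ 2) -` (poly D ` ball a \<rho>)"
    using openE by blast
  show thesis
  proof (rule that[of r "\<lambda>z. h (z ^ 2)"])
    have "(h \<circ> (\<lambda>z. z ^ 2)) holomorphic_on ball b r"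
      by (rule holomorphic_on_compose_gen[OF _ h(1)]) (use r(2) in \<open>auto intro!: holomorphic_intros\<close>)
    then show "(\<lambda>z. h (z ^ 2)) holomorphic_on ball b r"
      by (simp add: comp_def)
    show "h (b ^ 2) = a"
      using h(2)[of a] assms(1) \<rho>(1) by simp
    fix z assume "z \<in> ball b r"
    then obtain y where "y \<in> ball a \<rho>" "z ^ 2 = poly D y"
      using r(2) by blast
    then show "poly D (h (z ^ 2)) = z ^ 2"
      using h(2) by simp
  qed (rule r(1))
qed

text \<open>Each chart has a local inverse given by a square root of \<open>D\<close> or by a local
  inverse of \<open>D\<close>. Shrinking the disc keeps its values in \<open>W\<close>, as
  \<open>W\<close> is open in the curve.\<close>

lemma curve_chart_local:
  assumes W: "(W, \<phi>) \<in> curve_charts D" and c: "c \<in> W"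
  obtains r s where "r > 0" "\<And>z. z \<in> ball (\<phi> c) r \<Longrightarrow> s z \<in> W \<and> \<phi> (s z) = z"
    "(fst \<circ> s) holomorphic_on ball (\<phi> c) r" "(snd \<circ> s) holomorphic_on ball (\<phi> c) r"
proof -
  note result = that
  have op: "openin (top_of_set (affine_curve D)) W"
    using W by (auto simp: curve_charts_def)
  then have cC: "c \<in> affine_curve D"
    using c openin_imp_subset by blast
  obtain O' where O': "open O'" "W = affine_curve D \<inter> O'"
    using op by (auto simp: openin_open)
  have key: thesis
    if s: "\<rho> > 0" "(fst \<circ> s) holomorphic_on ball (\<phi> c) \<rho>" "(snd \<circ> s) holomorphic_on ball (\<phi> c) \<rho>" "s (\<phi> c) = c"
      "\<And>z. z \<in> ball (\<phi> c) \<rho> \<Longrightarrow> s z \<in> affine_curve D \<and> \<phi> (s z) = z" for \<rho> s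
  proof -
    have "continuous_on (ball (\<phi> c) \<rho>) (\<lambda>z. ((fst \<circ> s) z, (snd \<circ> s) z))"
      by (intro continuous_on_Pair holomorphic_on_imp_continuous_on s)
    then have "continuous_on (ball (\<phi> c) \<rho>) s"
      by simp
    then have "open (ball (\<phi> c) \<rho> \<inter> s -` O')"
      by (rule continuous_open_preimage[OF _ open_ball O'(1)])
    moreover have "\<phi> c \<in> ball (\<phi> c) \<rho> \<inter> s -` O'"
      using s(1,4) c O'(2) by auto
    ultimately obtain r where r: "r > 0" "ball (\<phi> c) r \<subseteq> ball (\<phi> c) \<rho> \<inter> s -` O'"
      using openE by blast
    show thesis
    proof (rule result[of r s])
      show "s z \<in> W \<and> \<phi> (s z) = z" if "z \<in> ball (\<phi> c) r" for z
        using s(5)[of z] r(2) that O'(2) by blast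
      show "(fst \<circ> s) holomorphic_on ball (\<phi> c) r" "(snd \<circ> s) holomorphic_on ball (\<phi> c) r"
        using s(2,3) r(2) by (auto intro: holomorphic_on_subset)
    qed (rule r(1))
  qed
  consider "\<phi> = fst" "snd c \<noteq> 0" | "\<phi> = snd" "poly (pderiv D) (fst c) \<noteq> 0"
    using W c by (auto simp: curve_charts_def)
  then show thesis
  proof cases
    case 1
    obtain r s where s: "r > 0" "s holomorphic_on ball (fst c) r" "s (fst c) = snd c"
      "\<And>x. x \<in> ball (fst c) r \<Longrightarrow> s x ^ 2 = poly D x"
      using holomorphic_sqrt_near[of D "fst c" "snd c"] cC 1(2) unfolding affine_curve_iff by metis
    show thesis
      by (rule key[where \<rho> = r and s = "\<lambda>z. (z, s z)"])
        (use s 1(1) in \<open>auto simp: comp_def affine_curve_iff intro: holomorphic_intros\<close>)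
  next
    case 2
    obtain r t where t: "r > 0" "t holomorphic_on ball (snd c) r" "t (snd c) = fst c"
      "\<And>z. z \<in> ball (snd c) r \<Longrightarrow> poly D (t z) = z ^ 2"
      using holomorphic_root_near[of D "fst c" "snd c"] cC 2(2) unfolding affine_curve_iff by metis
    show thesis
      by (rule key[where \<rho> = r and s = "\<lambda>z. (t z, z)"])
        (use t 2(1) in \<open>auto simp: comp_def affine_curve_iff intro: holomorphic_intros\<close>)
  qed
qed

lemma curve_chart:
  assumes W: "(W, \<phi>) \<in> curve_charts D"
  shows "openin (top_of_set (affine_curve D)) W" "inj_on \<phi> W" "open (\<phi> ` W)"
    "(fst \<circ> inv_into W \<phi>) holomorphic_on \<phi> ` W" "(snd \<circ> inv_into W \<phi>) holomorphic_on \<phi> ` W"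
    "continuous_on (\<phi> ` W) (inv_into W \<phi>)" "\<phi> = fst \<or> \<phi> = snd"
proof -
  show 1: "openin (top_of_set (affine_curve D)) W" "inj_on \<phi> W" "\<phi> = fst \<or> \<phi> = snd"
    using W by (auto simp: curve_charts_def)
  have loc: "\<exists>r>0. ball z r \<subseteq> \<phi> ` W \<and> (fst \<circ> inv_into W \<phi>) holomorphic_on ball z r \<and>
      (snd \<circ> inv_into W \<phi>) holomorphic_on ball z r" if z: "z \<in> \<phi> ` W" for z
  proof -
    obtain c where c: "c \<in> W" "z = \<phi> c"
      using z by blast
    obtain r s where s: "r > 0" "\<And>z. z \<in> ball (\<phi> c) r \<Longrightarrow> s z \<in> W \<and> \<phi> (s z) = z"
      "(fst \<circ> s) holomorphic_on ball (\<phi> c) r" "(snd \<circ> s) holomorphic_on ball (\<phi> c) r"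
      using curve_chart_local[OF W c(1)] by metis
    have eq: "inv_into W \<phi> z = s z" if "z \<in> ball (\<phi> c) r" for z
      using s(2)[OF that] 1(2) by (metis inv_into_f_f)
    have "ball (\<phi> c) r \<subseteq> \<phi> ` W"
      using s(2) by (metis imageI subsetI)
    moreover have "(fst \<circ> inv_into W \<phi>) holomorphic_on ball (\<phi> c) r"
      by (rule holomorphic_transform[OF s(3)]) (simp add: eq)
    moreover have "(snd \<circ> inv_into W \<phi>) holomorphic_on ball (\<phi> c) r"
      by (rule holomorphic_transform[OF s(4)]) (simp add: eq)
    ultimately show ?thesis
      using s(1) c(2) by blast
  qed
  show "open (\<phi> ` W)"
    unfolding open_contains_ball using loc by blast
  have "(fst \<circ> inv_into W \<phi>) field_differentiable at z \<and> (snd \<circ> inv_into W \<phi>) field_differentiable at z"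
    if z: "z \<in> \<phi> ` W" for z
    using loc[OF z] by (meson centre_in_ball holomorphic_on_imp_differentiable_at open_ball)
  then show h: "(fst \<circ> inv_into W \<phi>) holomorphic_on \<phi> ` W" "(snd \<circ> inv_into W \<phi>) holomorphic_on \<phi> ` W"
    by (auto simp: holomorphic_on_def intro: field_differentiable_at_within)
  have "continuous_on (\<phi> ` W) (\<lambda>z. ((fst \<circ> inv_into W \<phi>) z, (snd \<circ> inv_into W \<phi>) z))"
    by (intro continuous_on_Pair holomorphic_on_imp_continuous_on h)
  then show "continuous_on (\<phi> ` W) (inv_into W \<phi>)"
    by simp
qed

text \<open>|y - b| |y + b| < e^2 makes one factor smaller than \<open>e\<close>: the unordered pair
  of square roots depends continuously on the square.\<close>

lemma curve_root_near:
  fixes b y d :: complex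
  assumes "norm (y ^ 2 - b ^ 2) < e ^ 2" "e > 0"
  shows "dist y b < e \<or> dist (- y) b < e"
proof (rule ccontr)
  assume "\<not> ?thesis"
  then have "e \<le> norm (y - b)" "e \<le> norm (y + b)"
    by (auto simp: dist_norm norm_minus_commute[of "- y"] add.commute)
  then have "e * e \<le> norm (y - b) * norm (y + b)"
    using assms(2) by (intro mult_mono) auto
  also have "\<dots> = norm (y ^ 2 - b ^ 2)"
    by (simp add: power2_eq_square square_diff_square_factored mult.commute flip: norm_mult)
  finally show False
    using assms(1) by (simp add: power2_eq_square)
qed

text \<open>In the disc of radius |snd c| about \<open>snd c\<close> no two values are opposite, so
  the first coordinate is injective there.\<close>

lemma ex_fst_chart:
  assumes c: "c \<in> affine_curve D" "snd c \<noteq> 0" and N: "openin (top_of_set (affine_curve D)) N" "c \<in> N"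
  obtains W where "(W, fst) \<in> curve_charts D" "c \<in> W" "W \<subseteq> N"
proof (rule that[of "N \<inter> {z. dist (snd z) (snd c) < norm (snd c)}"])
  let ?W = "N \<inter> {z. dist (snd z) (snd c) < norm (snd c)}"
  have "open {z :: complex \<times> complex. dist (snd z) (snd c) < norm (snd c)}"
    by (intro open_Collect_less continuous_intros)
  then have "openin (top_of_set (affine_curve D)) ?W"
    using N(1) openin_Int_open by blast
  moreover have "inj_on fst ?W"
  proof (rule inj_onI)
    fix z z' assume z: "z \<in> ?W" "z' \<in> ?W" "fst z = fst z'"
    then have "z \<in> affine_curve D" "z' \<in> affine_curve D"
      using N(1) openin_imp_subset by blast+
    then have "snd z ^ 2 = snd z' ^ 2"
      using z(3) by (simp add: affine_curve_iff)
    moreover have "snd z \<noteq> - snd z'"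
    proof
      assume eq: "snd z = - snd z'"
      have "dist (snd z') (snd c) < norm (snd c)" "dist (- snd z') (snd c) < norm (snd c)"
        using z(1,2) eq by auto
      moreover have "norm (2 * snd c) \<le> norm (snd z' - snd c) + norm (- snd z' - snd c)"
        using norm_triangle_ineq[of "snd z' - snd c" "- snd z' - snd c"]
        by (simp add: algebra_simps flip: mult_2)
      ultimately show False
        by (simp add: dist_norm norm_mult)
    qed
    ultimately show "z = z'"
      using z(3) by (simp add: power2_eq_iff prod_eq_iff)
  qed
  moreover have "\<forall>z\<in>?W. snd z \<noteq> 0"
    by (auto simp: dist_norm)
  ultimately show "(?W, fst) \<in> curve_charts D"
    unfolding curve_charts_def by blast
qed (use N c in auto)

text \<open>\<open>D\<close> is injective near \<open>fst c\<close>, so the second coordinate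
  determines D(x) and with it the first.\<close>

lemma ex_snd_chart:
  assumes c: "c \<in> affine_curve D" "poly (pderiv D) (fst c) \<noteq> 0" and N: "openin (top_of_set (affine_curve D)) N" "c \<in> N"
  obtains W where "(W, snd) \<in> curve_charts D" "c \<in> W" "W \<subseteq> N"
proof -
  have hD: "poly D holomorphic_on S" for S
    by (rule poly_holomorphic_on[OF holomorphic_on_ident])
  have d: "deriv (poly D) (fst c) \<noteq> 0"
    using c(2) by (simp add: DERIV_imp_deriv[OF poly_DERIV])
  obtain r where r: "r > 0" "inj_on (poly D) (ball (fst c) r)"
    using has_complex_derivative_locally_injective[OF hD UNIV_I open_UNIV d] by blast
  let ?W = "N \<inter> {z. fst z \<in> ball (fst c) r}"
  have "open {z :: complex \<times> complex. fst z \<in> ball (fst c) r}"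
    unfolding mem_ball by (intro open_Collect_less continuous_intros)
  then have "openin (top_of_set (affine_curve D)) ?W"
    using N(1) openin_Int_open by blast
  moreover have "inj_on snd ?W"
  proof (rule inj_onI)
    fix z z' assume z: "z \<in> ?W" "z' \<in> ?W" "snd z = snd z'"
    then have "z \<in> affine_curve D" "z' \<in> affine_curve D"
      using N(1) openin_imp_subset by blast+
    then have "poly D (fst z) = poly D (fst z')"
      using z(3) by (simp add: affine_curve_iff)
    then have "fst z = fst z'"
      using z(1,2) inj_onD[OF r(2)] by blast
    then show "z = z'"
      using z(3) by (simp add: prod_eq_iff)
  qed
  moreover have "\<forall>z\<in>?W. poly (pderiv D) (fst z) \<noteq> 0"
    using holomorphic_injective_imp_regular[OF hD open_ball r(2)]
    by (auto simp: DERIV_imp_deriv[OF poly_DERIV])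
  ultimately have "(?W, snd) \<in> curve_charts D"
    unfolding curve_charts_def by blast
  then show thesis
    by (rule that) (use N(2) r(1) in auto)
qed

text \<open>For \<open>z\<close> close to the first coordinate of a point, one of the two square
  roots of D(z) is close to the second. This includes the branch points, where both are.\<close>

lemma fst_image_open:
  assumes W: "openin (top_of_set (affine_curve D)) W"
  shows "open (fst ` W)"
  unfolding open_dist
proof (rule ballI)
  fix a assume "a \<in> fst ` W"
  then obtain c where c: "c \<in> W" "a = fst c"
    by blast
  obtain e where e: "e > 0" "\<And>c'. c' \<in> affine_curve D \<Longrightarrow> dist c' c < e \<Longrightarrow> c' \<in> W"
    using W c(1) unfolding openin_euclidean_subtopology_iff by metis
  have cC: "snd c ^ 2 = poly D a"
    using W c openin_imp_subset affine_curve_iff by blast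
  have "isCont (poly D) a"
    by simp
  then obtain d where d: "d > 0" "\<And>z. dist z a < d \<Longrightarrow> dist (poly D z) (poly D a) < (e/2) ^ 2"
    unfolding continuous_at_eps_delta using e(1) by (metis half_gt_zero zero_less_power)
  show "\<exists>d>0. \<forall>z. dist z a < d \<longrightarrow> z \<in> fst ` W"
  proof (intro exI[of _ "min d (e/2)"] conjI allI impI)
    fix z assume z: "dist z a < min d (e/2)"
    define y where "y = csqrt (poly D z)"
    have "norm (y ^ 2 - snd c ^ 2) < (e/2) ^ 2"
      using d(2)[of z] z by (simp add: y_def cC dist_norm)
    then have "dist y (snd c) < e/2 \<or> dist (- y) (snd c) < e/2"
      by (rule curve_root_near) (use e(1) in simp)
    then obtain t where t: "t = y \<or> t = - y" "dist t (snd c) < e/2"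
      by blast
    have "(z, t) \<in> affine_curve D"
      using t(1) by (auto simp: affine_curve_iff y_def)
    moreover have "dist (z, t) c \<le> dist z a + dist t (snd c)"
      using dist_Pair_le[of z t "fst c" "snd c"] c(2) by simp
    ultimately have "(z, t) \<in> W"
      using e(2)[of "(z, t)"] z t(2) by auto
    then show "z \<in> fst ` W"
      by force
  qed (use d(1) e(1) in auto)
qed

text \<open>Of a clopen set and its complement, one contains the branch point over \<open>e\<close>.
  Call it \<open>T\<close>. The projection \<open>B\<close> of the complement of \<open>T\<close> is
  open, and so is the set of points whose whole fibre lies in \<open>T\<close>. The plane is
  connected and \<open>e\<close> is not in \<open>B\<close>, having a single point over it, so
  \<open>B\<close> is empty.\<close>

lemma connected_affine_curve:
  assumes e: "poly D e = 0"
  shows "connected (affine_curve D)"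
  unfolding connected_clopen
proof (intro allI impI)
  let ?C = "affine_curve D"
  have one: "T = ?C" if T: "openin (top_of_set ?C) T" "openin (top_of_set ?C) (?C - T)" "(e, 0) \<in> T" for T
  proof -
    define B where "B = fst ` (?C - T)"
    have "open B"
      unfolding B_def by (rule fst_image_open[OF T(2)])
    moreover have "open (- B)"
      unfolding open_dist
    proof (rule ballI)
      fix a assume a: "a \<in> - B"
      define b where "b = csqrt (poly D a)"
      have "(a, b) \<in> ?C" "(a, - b) \<in> ?C"
        by (auto simp: affine_curve_iff b_def)
      then have bT: "(a, b) \<in> T" "(a, - b) \<in> T"
        using a unfolding B_def by force+
      obtain r1 where r1: "r1 > 0" "\<And>c'. c' \<in> ?C \<Longrightarrow> dist c' (a, b) < r1 \<Longrightarrow> c' \<in> T"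
        using T(1) bT(1) unfolding openin_euclidean_subtopology_iff by metis
      obtain r2 where r2: "r2 > 0" "\<And>c'. c' \<in> ?C \<Longrightarrow> dist c' (a, - b) < r2 \<Longrightarrow> c' \<in> T"
        using T(1) bT(2) unfolding openin_euclidean_subtopology_iff by metis
      define r where "r = min r1 r2 / 2"
      have r: "r > 0"
        using r1(1) r2(1) by (simp add: r_def)
      have "isCont (poly D) a"
        by simp
      then obtain d where d: "d > 0" "\<And>z. dist z a < d \<Longrightarrow> dist (poly D z) (poly D a) < r ^ 2"
        unfolding continuous_at_eps_delta using r by (metis zero_less_power)
      show "\<exists>d>0. \<forall>z. dist z a < d \<longrightarrow> z \<in> - B"
      proof (intro exI[of _ "min d r"] conjI allI impI)
        fix z assume z: "dist z a < min d r"
        have "(z, y) \<in> T" if y: "(z, y) \<in> ?C" for y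
        proof -
          have "norm (y ^ 2 - b ^ 2) < r ^ 2"
            using d(2)[of z] z y by (simp add: b_def dist_norm affine_curve_iff)
          then have "dist y b < r \<or> dist (- y) b < r"
            by (rule curve_root_near) (rule r)
          then show ?thesis
          proof
            assume "dist y b < r"
            then have "dist (z, y) (a, b) < r1"
              using dist_Pair_le[of z y a b] z by (auto simp: r_def)
            then show ?thesis
              using r1(2) y by blast
          next
            assume "dist (- y) b < r"
            then have "dist y (- b) < r"
              by (metis dist_minus minus_minus)
            then have "dist (z, y) (a, - b) < r2"
              using dist_Pair_le[of z y a "- b"] z by (auto simp: r_def)
            then show ?thesis
              using r2(2) y by blast
          qed
        qed
        then show "z \<in> - B"
          unfolding B_def by auto
      qed (use d(1) r in auto)
    qed
    ultimately have "B = {} \<or> B = UNIV"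
      using connected_UNIV[where 'a = complex] unfolding connected_clopen
      by (metis Compl_eq_Diff_UNIV closed_closedin closed_def open_openin subtopology_UNIV)
    moreover have "e \<notin> B"
      using e T(3) unfolding B_def by (auto simp: affine_curve_iff)
    ultimately have "?C - T = {}"
      unfolding B_def by blast
    then show ?thesis
      using T(1) openin_imp_subset by blast
  qed
  fix T assume T: "openin (top_of_set ?C) T \<and> closedin (top_of_set ?C) T"
  then have T': "openin (top_of_set ?C) (?C - T)" "?C - (?C - T) = T"
    unfolding closedin_def by (auto dest: openin_imp_subset)
  have "(e, 0) \<in> ?C"
    using e by (simp add: affine_curve_iff)
  then show "T = {} \<or> T = ?C"
    using one[of T] one[of "?C - T"] T T' by auto
qed

section \<open>Construction of the compactified curve\<close>

text \<open>The surface is glued from the curves \<open>w\<^sup>2 = D(x)\<close> and \<open>v\<^sup>2 = D\<^sup>*(u)\<close> with \<open>D\<^sup>*\<close> the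
  reflected polynomial, along \<open>u = 1/x\<close> and \<open>v = w/x\<^bsup>g+1\<^esup>\<close>; the index \<open>True\<close> stands for
  the former.\<close>

definition side_poly :: "complex poly \<Rightarrow> bool \<Rightarrow> complex poly" where
  "side_poly D b = (if b then D else reflect_poly D)"

text \<open>Both affine pieces are mapped into one type: a point with u nonzero is named by its (x,
  w), and the two points with u = 0, where v = 1 or v = -1, become \<open>Inr True\<close> and
  \<open>Inr False\<close>. Glued points are thus literally equal and no quotient is formed.\<close>

definition side_point :: "nat \<Rightarrow> bool \<Rightarrow> complex \<times> complex \<Rightarrow> pt" where
  "side_point g b c = (if b then Inl c else if fst c = 0 then Inr (snd c = 1)
     else Inl (inverse (fst c), snd c / fst c ^ (g + 1)))"

text \<open>The change of coordinates between the pieces. The formula is its own inverse where the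
  first coordinate is nonzero, so it serves in both directions.\<close>

definition flip_side :: "nat \<Rightarrow> complex \<times> complex \<Rightarrow> complex \<times> complex" where
  "flip_side g c = (inverse (fst c), snd c / fst c ^ (g + 1))"

text \<open>The final topology for the two side maps.\<close>

definition hyp_topology :: "nat \<Rightarrow> complex poly \<Rightarrow> pt topology" where
  "hyp_topology g D = topology (\<lambda>U. U \<subseteq> Inl ` affine_curve D \<union> range Inr \<and>
     (\<forall>b. openin (top_of_set (affine_curve (side_poly D b))) {c \<in> affine_curve (side_poly D b). side_point g b c \<in> U}))"

definition hyp_surface :: "nat \<Rightarrow> complex poly \<Rightarrow> pt surface" where
  "hyp_surface g D = \<lparr>top_space = hyp_topology g D,
     atlas = {(side_point g b ` W, \<phi> \<circ> inv_into (affine_curve (side_poly D b)) (side_point g b)) | b W \<phi>.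
       (W, \<phi>) \<in> curve_charts (side_poly D b)}\<rparr>"

fun hyp_involution :: "pt \<Rightarrow> pt" where
  "hyp_involution (Inl c) = Inl (fst c, - snd c)"
| "hyp_involution (Inr b) = Inr (\<not> b)"

fun hyp_proj :: "pt \<Rightarrow> complex option" where
  "hyp_proj (Inl c) = Some (fst c)"
| "hyp_proj (Inr b) = None"

lemma openin_hyp_topology:
  "openin (hyp_topology g D) U \<longleftrightarrow> U \<subseteq> Inl ` affine_curve D \<union> range Inr \<and>
     (\<forall>b. openin (top_of_set (affine_curve (side_poly D b))) {c \<in> affine_curve (side_poly D b). side_point g b c \<in> U})"
proof -
  have int: "{c \<in> A. f c \<in> S \<inter> T} = {c \<in> A. f c \<in> S} \<inter> {c \<in> A. f c \<in> T}" for A S T and f :: "complex \<times> complex \<Rightarrow> pt"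
    by blast
  have un: "{c \<in> A. f c \<in> \<Union>\<K>} = (\<Union>K\<in>\<K>. {c \<in> A. f c \<in> K})" for A \<K> and f :: "complex \<times> complex \<Rightarrow> pt"
    by blast
  have "istopology (\<lambda>U. U \<subseteq> Inl ` affine_curve D \<union> range Inr \<and>
     (\<forall>b. openin (top_of_set (affine_curve (side_poly D b))) {c \<in> affine_curve (side_poly D b). side_point g b c \<in> U}))"
    unfolding istopology_def int un by (auto intro!: openin_Int openin_Union)
  then show ?thesis
    by (simp add: hyp_topology_def)
qed

section \<open>The glued surface is a compact Riemann surface\<close>

locale hyp =
  fixes g :: nat and D :: "complex poly"
  assumes adm: "admissible g D"
begin

abbreviation C :: "bool \<Rightarrow> (complex \<times> complex) set" where "C b \<equiv> affine_curve (side_poly D b)"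
abbreviation a :: "bool \<Rightarrow> complex \<times> complex \<Rightarrow> pt" where "a \<equiv> side_point g"
abbreviation M :: "pt surface" where "M \<equiv> hyp_surface g D"
abbreviation \<kappa> :: "bool \<Rightarrow> pt \<Rightarrow> complex \<times> complex" where "\<kappa> b \<equiv> inv_into (C b) (a b)"
abbreviation P :: "bool \<Rightarrow> pt set" where "P b \<equiv> a b ` C b"

lemma D_props: "D \<noteq> 0" "degree D = 2 * (g + 1)" "lead_coeff D = 1" "squarefree D"
  using adm unfolding admissible_def by auto

lemma card_roots: "card (roots D) = 2 * (g + 1)"
proof -
  have "degree (\<Prod>e\<in>roots D. [:-e, 1:]) = card (roots D)"
    by (subst degree_prod_sum_eq) auto
  then show ?thesis
    using prod_roots_squarefree[OF D_props(3,4)] D_props(2) by simp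
qed

lemma reflect_at: "u \<noteq> 0 \<Longrightarrow> poly (reflect_poly D) u = (u ^ (g + 1)) ^ 2 * poly D (inverse u)"
  by (subst poly_reflect_poly_nz) (simp_all only: D_props(2) mult.commute[of 2] power_mult not_False_eq_True)

lemma reflect_at_0: "poly (reflect_poly D) 0 = 1"
  using D_props(3) by (simp add: poly_0_coeff_0)

text \<open>The reflected polynomial is 1 at 0, so its roots are nonzero. Differentiating u^(2g+2)
  D(1/u) at such a root leaves only the term with D'(1/u).\<close>

lemma side_poly_simple:
  assumes "poly (side_poly D b) z = 0"
  shows "poly (pderiv (side_poly D b)) z \<noteq> 0"
proof (cases b)
  case True
  then show ?thesis
    using assms pderiv_nonzero_at_root[OF D_props(4)] by (simp add: side_poly_def)
next
  case False
  then have z: "poly (reflect_poly D) z = 0"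
    using assms by (simp add: side_poly_def)
  then have z0: "z \<noteq> 0"
    using reflect_at_0 by auto
  then have Dz: "poly D (inverse z) = 0"
    using z reflect_at by simp
  have "((\<lambda>u. (u ^ (g + 1)) ^ 2 * poly D (inverse u)) has_field_derivative
      (z ^ (g + 1)) ^ 2 * (poly (pderiv D) (inverse z) * - (inverse z * inverse z))) (at z)"
    by (rule derivative_eq_intros DERIV_chain2[OF poly_DERIV] refl z0 | simp add: Dz power2_eq_square)+
  moreover have "eventually (\<lambda>u. u \<in> - {0}) (nhds z)"
    using z0 by (intro eventually_nhds_in_open) auto
  then have "eventually (\<lambda>u. (u ^ (g + 1)) ^ 2 * poly D (inverse u) = poly (reflect_poly D) u) (nhds z)"
    by (rule eventually_mono) (simp add: reflect_at)
  ultimately have "(poly (reflect_poly D) has_field_derivative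
      (z ^ (g + 1)) ^ 2 * (poly (pderiv D) (inverse z) * - (inverse z * inverse z))) (at z)"
    by (subst (asm) DERIV_cong_ev[OF refl _ refl]) auto
  then have "poly (pderiv (reflect_poly D)) z = (z ^ (g + 1)) ^ 2 * (poly (pderiv D) (inverse z) * - (inverse z * inverse z))"
    using DERIV_unique poly_DERIV by blast
  then show ?thesis
    using z0 pderiv_nonzero_at_root[OF D_props(4) Dz] False by (simp add: side_poly_def)
qed

lemma side_point_inj: "inj_on (a b) (C b)"
proof (rule inj_onI)
  fix c c' assume c: "c \<in> C b" "c' \<in> C b" "a b c = a b c'"
  show "c = c'"
  proof (cases "b \<or> fst c \<noteq> 0 \<or> fst c' \<noteq> 0")
    case True
    then show ?thesis
      using c by (cases b; cases "fst c = 0"; cases "fst c' = 0") (auto simp: side_point_def prod_eq_iff)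
  next
    case False
    then have "snd c ^ 2 = 1" "snd c' ^ 2 = 1" "(snd c = 1) = (snd c' = 1)"
      using c reflect_at_0 by (auto simp: side_point_def side_poly_def affine_curve_iff)
    then show ?thesis
      using False by (auto simp: power2_eq_1_iff prod_eq_iff)
  qed
qed

lemma \<kappa>_side [simp]: "c \<in> C b \<Longrightarrow> \<kappa> b (a b c) = c"
  using side_point_inj by simp

lemma \<kappa>_in: "p \<in> P b \<Longrightarrow> \<kappa> b p \<in> C b" "p \<in> P b \<Longrightarrow> a b (\<kappa> b p) = p"
  by (auto simp: inv_into_into f_inv_into_f)

lemma flip_side:
  assumes c: "c \<in> C b" "fst c \<noteq> 0"
  shows "flip_side g c \<in> C (\<not> b)" "a (\<not> b) (flip_side g c) = a b c"
proof -
  have "poly (side_poly D (\<not> b)) (inverse (fst c)) = (inverse (fst c) ^ (g + 1)) ^ 2 * poly (side_poly D b) (fst c)"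
    using c(2) reflect_at[of "fst c"] reflect_at[of "inverse (fst c)"]
    by (cases b) (simp_all add: side_poly_def power_inverse field_simps)
  then show "flip_side g c \<in> C (\<not> b)"
    using c by (simp add: flip_side_def affine_curve_iff divide_inverse power_mult_distrib power_inverse)
  show "a (\<not> b) (flip_side g c) = a b c"
    using c(2) by (cases b) (simp_all add: flip_side_def side_point_def prod_eq_iff power_inverse field_simps)
qed

lemma side_point_eq:
  assumes c: "c \<in> C b" "c' \<in> C (\<not> b)" "a b c = a (\<not> b) c'"
  shows "fst c \<noteq> 0" "c' = flip_side g c"
proof -
  have "fst c \<noteq> 0"
    using c(3) by (cases b; cases "fst c = 0"; cases "fst c' = 0") (auto simp: side_point_def)
  then show "fst c \<noteq> 0" "c' = flip_side g c"
    using flip_side[OF c(1)] c inj_onD[OF side_point_inj, of "\<not> b" c' "flip_side g c"] by auto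
qed

lemma points_eq: "Inl ` affine_curve D \<union> range Inr = P True \<union> P False"
proof -
  have "Inr True = a False (0, 1)" "Inr False = a False (0, -1)" "(0, 1) \<in> C False" "(0, -1) \<in> C False"
    using reflect_at_0 by (auto simp: side_point_def side_poly_def affine_curve_iff)
  have gen: "A \<union> R = A \<union> B" if "R \<subseteq> B" "B \<subseteq> A \<union> R" for A B R :: "pt set"
    using that by blast
  have ends: "Inr i \<in> P False" for i
    using \<open>Inr True = a False (0, 1)\<close> \<open>Inr False = a False (0, -1)\<close> \<open>(0, 1) \<in> C False\<close> \<open>(0, -1) \<in> C False\<close>
    by (cases i) (metis imageI)+
  have left: "Inl ` affine_curve D = P True"
    by (simp add: side_point_def side_poly_def)
  have "P False \<subseteq> P True \<union> range Inr"
  proof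
    fix p assume "p \<in> P False"
    then obtain c where c: "c \<in> C False" "p = a False c"
      by blast
    show "p \<in> P True \<union> range Inr"
    proof (cases "fst c = 0")
      case False
      then show ?thesis
        using flip_side[OF c(1)] c(2) by (metis UnI1 imageI not_False_eq_True)
    qed (use c in \<open>simp add: side_point_def\<close>)
  qed
  with ends show ?thesis
    unfolding left by (intro gen) auto
qed

lemma openin_M:
  "openin (top_space M) U \<longleftrightarrow> U \<subseteq> P True \<union> P False \<and> (\<forall>b. openin (top_of_set (C b)) {c \<in> C b. a b c \<in> U})"
  by (simp add: hyp_surface_def openin_hyp_topology points_eq)

lemma points_M: "points M = P True \<union> P False"
proof -
  have "openin (top_space M) (P True \<union> P False)"
    unfolding openin_M
  proof (intro conjI allI)
    fix b
    have "{c \<in> C b. a b c \<in> P True \<union> P False} = C b"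
      by (cases b) auto
    then show "openin (top_of_set (C b)) {c \<in> C b. a b c \<in> P True \<union> P False}"
      by simp
  qed simp
  then show ?thesis
    by (intro subset_antisym conjunct1[OF iffD1[OF openin_M openin_topspace]] openin_subset)
qed

lemma P_points: "P b \<subseteq> points M"
  unfolding points_M by (cases b) auto

lemma side_continuous: "continuous_map (top_of_set (C b)) (top_space M) (a b)"
  unfolding continuous_map_def using P_points by (auto simp: openin_M)

text \<open>Seen from the other side, the image of \<open>W\<close> is the preimage of an open set
  under \<open>flip_side\<close>, which is continuous off the points with first coordinate 0. The
  pieces are therefore glued along open sets.\<close>

lemma side_open:
  assumes W: "openin (top_of_set (C b)) W"
  shows "openin (top_space M) (a b ` W)"
  unfolding openin_M
proof (intro conjI allI)
  have WC: "W \<subseteq> C b"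
    using W openin_imp_subset by blast
  then show "a b ` W \<subseteq> P True \<union> P False"
    by (cases b) auto
  fix b'
  show "openin (top_of_set (C b')) {c \<in> C b'. a b' c \<in> a b ` W}"
  proof (cases "b' = b")
    case True
    have "{c \<in> C b. a b c \<in> a b ` W} = W"
      using WC side_point_inj by (auto dest: inj_onD)
    then show ?thesis
      using W True by simp
  next
    case False
    then have b': "b' = (\<not> b)"
      by auto
    obtain O' where O': "open O'" "W = C b \<inter> O'"
      using W by (auto simp: openin_open)
    have eq: "{c \<in> C b'. a b' c \<in> a b ` W} = C b' \<inter> ({c. fst c \<noteq> 0} \<inter> flip_side g -` O')"
    proof (intro equalityI subsetI)
      fix c assume c: "c \<in> {c \<in> C b'. a b' c \<in> a b ` W}"
      then obtain c' where c': "c' \<in> W" "a b' c = a b c'" "c' \<in> C b"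
        using WC by blast
      then have "fst c \<noteq> 0" "c' = flip_side g c"
        using side_point_eq[of c b' c'] c b' by simp_all
      then show "c \<in> C b' \<inter> ({c. fst c \<noteq> 0} \<inter> flip_side g -` O')"
        using c c' O' by auto
    next
      fix c assume c: "c \<in> C b' \<inter> ({c. fst c \<noteq> 0} \<inter> flip_side g -` O')"
      then have "flip_side g c \<in> W" "a b' c = a b (flip_side g c)"
        using flip_side[of c b'] b' O'(2) by auto
      then show "c \<in> {c \<in> C b'. a b' c \<in> a b ` W}"
        using c by blast
    qed
    have "open {c :: complex \<times> complex. fst c \<noteq> 0}"
      by (intro open_Collect_neq continuous_intros)
    moreover have "continuous_on {c. fst c \<noteq> 0} (flip_side g)"
      unfolding flip_side_def by (intro continuous_intros) auto
    ultimately have "open ({c. fst c \<noteq> 0} \<inter> flip_side g -` O')"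
      using O'(1) continuous_open_preimage by blast
    then show ?thesis
      unfolding eq by (simp add: openin_open_Int)
  qed
qed

text \<open>Two points that share no side have x = 0 and u = 0 respectively. The sets |x| < 1 and
  |u| < 1 separate them, because x u = 1 on the overlap.\<close>

lemma Hausdorff_M: "Hausdorff_space (top_space M)"
  unfolding Hausdorff_space_def disjnt_def
proof (intro allI impI)
  fix p q assume pq: "p \<in> points M \<and> q \<in> points M \<and> p \<noteq> q"
  have same: "\<exists>U V. openin (top_space M) U \<and> openin (top_space M) V \<and> p \<in> U \<and> q \<in> V \<and> U \<inter> V = {}"
    if pq: "p \<noteq> q" "p \<in> P b" "q \<in> P b" for p q b
  proof -
    obtain c c' where c: "c \<in> C b" "p = a b c" "c' \<in> C b" "q = a b c'"
      using pq by blast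
    then obtain O1 O2 where O: "open O1" "open O2" "c \<in> O1" "c' \<in> O2" "O1 \<inter> O2 = {}"
      using pq(1) hausdorff[of c c'] by blast
    have "openin (top_space M) (a b ` (C b \<inter> O1))" "openin (top_space M) (a b ` (C b \<inter> O2))"
      using O by (auto intro!: side_open openin_open_Int)
    moreover have "a b ` (C b \<inter> O1) \<inter> a b ` (C b \<inter> O2) = {}"
      using O(5) inj_onD[OF side_point_inj[of b]] by blast
    ultimately show ?thesis
      using c O by blast
  qed
  have other: "\<exists>U V. openin (top_space M) U \<and> openin (top_space M) V \<and> p \<in> U \<and> q \<in> V \<and> U \<inter> V = {}"
    if pq: "p \<in> P b" "p \<notin> P (\<not> b)" "q \<in> P (\<not> b)" "q \<notin> P b" for p q b
  proof -
    obtain c c' where c: "c \<in> C b" "p = a b c" "c' \<in> C (\<not> b)" "q = a (\<not> b) c'"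
      using pq by blast
    have "fst c = 0"
      using flip_side[OF c(1)] c(2) pq(2) by (metis imageI)
    have "fst c' = 0"
      using flip_side[OF c(3)] c(4) pq(4) by (metis imageI not_not)
    let ?O = "{c :: complex \<times> complex. norm (fst c) < 1}"
    have "open ?O"
      by (intro open_Collect_less continuous_intros)
    then have "openin (top_space M) (a b ` (C b \<inter> ?O))" "openin (top_space M) (a (\<not> b) ` (C (\<not> b) \<inter> ?O))"
      by (auto intro!: side_open openin_open_Int)
    moreover have "a b ` (C b \<inter> ?O) \<inter> a (\<not> b) ` (C (\<not> b) \<inter> ?O) = {}"
    proof (rule ccontr)
      assume "a b ` (C b \<inter> ?O) \<inter> a (\<not> b) ` (C (\<not> b) \<inter> ?O) \<noteq> {}"
      then obtain z z' where z: "z \<in> C b" "z' \<in> C (\<not> b)" "a b z = a (\<not> b) z'" "norm (fst z) < 1" "norm (fst z') < 1"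
        by auto
      have "fst z \<noteq> 0" "fst z' = inverse (fst z)"
        using side_point_eq[OF z(1-3)] by (auto simp: flip_side_def)
      then have "norm (fst z') * norm (fst z) = 1"
        by (simp add: norm_inverse)
      then show False
        using mult_strict_mono[OF z(5,4)] by simp
    qed
    ultimately show ?thesis
      using c \<open>fst c = 0\<close> \<open>fst c' = 0\<close> by (intro exI[of _ "a b ` (C b \<inter> ?O)"] exI[of _ "a (\<not> b) ` (C (\<not> b) \<inter> ?O)"]) auto
  qed
  show "\<exists>U V. openin (top_space M) U \<and> openin (top_space M) V \<and> p \<in> U \<and> q \<in> V \<and> U \<inter> V = {}"
  proof (cases "\<exists>b. p \<in> P b \<and> q \<in> P b")
    case True
    then show ?thesis
      using same pq by metis
  next
    case False
    then obtain b where "p \<in> P b" "q \<in> P (\<not> b)"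
      using pq unfolding points_M by (metis (full_types) UnE)
    then show ?thesis
      using other[of p b q] False by metis
  qed
qed

text \<open>The surface is the union of the parts |x| \<le> 1 and |u| \<le> 1, each the continuous
  image of a compact piece of an affine curve.\<close>

lemma compact_M: "compact_space (top_space M)"
proof -
  let ?K = "\<lambda>b. {c \<in> C b. norm (fst c) \<le> 1}"
  have K: "compactin (top_space M) (a b ` ?K b)" for b
  proof (rule image_compactin[OF _ side_continuous])
    show "compactin (top_of_set (C b)) (?K b)"
      using compact_affine_curve_part by (auto simp: compactin_subtopology)
  qed
  have "points M \<subseteq> a True ` ?K True \<union> a False ` ?K False"
  proof
    fix p assume "p \<in> points M"
    then obtain b c where c: "c \<in> C b" "p = a b c"
      unfolding points_M by blast
    show "p \<in> a True ` ?K True \<union> a False ` ?K False"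
    proof (cases "norm (fst c) \<le> 1")
      case True
      then show ?thesis
        using c by (cases b) auto
    next
      case False
      then have n: "fst c \<noteq> 0" "norm (inverse (fst c)) \<le> 1"
        by (auto simp: norm_inverse inverse_le_1_iff)
      then have "flip_side g c \<in> ?K (\<not> b)" "p = a (\<not> b) (flip_side g c)"
        using flip_side[OF c(1) n(1)] c(2) by (auto simp: flip_side_def)
      then show ?thesis
        by (cases b) auto
    qed
  qed
  moreover have "a True ` ?K True \<union> a False ` ?K False \<subseteq> points M"
    unfolding points_M by blast
  ultimately show ?thesis
    unfolding compact_space_def using compactin_Un[OF K[of True] K[of False]] by (simp add: subset_antisym)
qed

lemma connected_M: "connected_space (top_space M)"
proof -
  have conn: "connected (C b)" for b
  proof -
    \<comment> \<open>A nonzero root \<open>e\<close> is wanted so that 1 / e is a root of the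
      reflected polynomial and both sides have a branch point; it exists since \<open>D\<close> has
      at least two roots.\<close>
    have "\<not> roots D \<subseteq> {0}"
      using card_mono[of "{0}" "roots D"] card_roots by auto
    then obtain e where e: "e \<noteq> 0" "poly D e = 0"
      unfolding roots_def by blast
    have "poly (side_poly D b) (if b then e else inverse e) = 0"
      using e reflect_at[of "inverse e"] by (simp add: side_poly_def)
    then show ?thesis
      by (rule connected_affine_curve)
  qed
  have "connectedin (top_space M) (P b)" for b
    by (rule connectedin_continuous_map_image[OF side_continuous]) (use conn in \<open>simp add: connectedin_subtopology\<close>)
  moreover have "P True \<inter> P False \<noteq> {}"
  proof -
    have "(1, csqrt (poly D 1)) \<in> C True"
      by (simp add: affine_curve_iff side_poly_def)
    then show ?thesis
      using flip_side[of "(1, csqrt (poly D 1))" True] by force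
  qed
  ultimately have "connectedin (top_space M) (points M)"
    unfolding points_M by (intro connectedin_Un) auto
  then show ?thesis
    by (simp add: connectedin_topspace)
qed

lemma atlas_cases:
  assumes "(U, \<phi>') \<in> atlas M"
  obtains b W \<phi> where "(W, \<phi>) \<in> curve_charts (side_poly D b)" "U = a b ` W" "\<phi>' = \<phi> \<circ> \<kappa> b" "W \<subseteq> C b"
    "\<phi>' ` U = \<phi> ` W" "\<And>z. z \<in> \<phi> ` W \<Longrightarrow> inv_into U \<phi>' z = a b (inv_into W \<phi> z)" "inj_on \<phi>' U"
proof -
  obtain b W \<phi> where W: "(W, \<phi>) \<in> curve_charts (side_poly D b)" "U = a b ` W" "\<phi>' = \<phi> \<circ> \<kappa> b"
    using assms unfolding hyp_surface_def by auto
  have WC: "W \<subseteq> C b"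
    using curve_chart(1)[OF W(1)] openin_imp_subset by blast
  have val: "\<phi>' (a b c) = \<phi> c" if "c \<in> W" for c
    using that WC W(3) by auto
  have inj: "inj_on \<phi>' U"
  proof (rule inj_onI)
    fix p q assume "p \<in> U" "q \<in> U" "\<phi>' p = \<phi>' q"
    then show "p = q"
      using val curve_chart(2)[OF W(1)] unfolding W(2) by (auto dest: inj_onD)
  qed
  have im: "\<phi>' ` U = \<phi> ` W"
    unfolding W(2) image_image using val by simp
  have "inv_into U \<phi>' z = a b (inv_into W \<phi> z)" if z: "z \<in> \<phi> ` W" for z
  proof (rule inv_into_f_eq[OF inj])
    have c: "inv_into W \<phi> z \<in> W" "\<phi> (inv_into W \<phi> z) = z"
      using z by (auto simp: inv_into_into f_inv_into_f)
    then show "a b (inv_into W \<phi> z) \<in> U" "\<phi>' (a b (inv_into W \<phi> z)) = z"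
      using val W(2) by auto
  qed
  then show thesis
    using that[OF W WC im _ inj] by blast
qed

text \<open>In a chart of the other side the coordinates are rational functions of that side's
  coordinates, by \<open>flip_side\<close>. Charts are restrictions of these coordinates, so all
  transition maps are covered at once.\<close>

lemma coordinate_holomorphic:
  shows "holomorphic_fun M (P j) (fst \<circ> \<kappa> j)" "holomorphic_fun M (P j) (snd \<circ> \<kappa> j)"
proof -
  have "(fst \<circ> \<kappa> j \<circ> inv_into U \<phi>') holomorphic_on \<phi>' ` (U \<inter> P j) \<and>
        (snd \<circ> \<kappa> j \<circ> inv_into U \<phi>') holomorphic_on \<phi>' ` (U \<inter> P j)" if U: "(U, \<phi>') \<in> atlas M" for U \<phi>'
  proof -
    obtain b W \<phi> where W: "(W, \<phi>) \<in> curve_charts (side_poly D b)" "U = a b ` W" "\<phi>' = \<phi> \<circ> \<kappa> b" "W \<subseteq> C b"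
      "\<phi>' ` U = \<phi> ` W" "\<And>z. z \<in> \<phi> ` W \<Longrightarrow> inv_into U \<phi>' z = a b (inv_into W \<phi> z)" "inj_on \<phi>' U"
      using atlas_cases[OF U] by metis
    let ?s = "inv_into W \<phi>" and ?T = "\<phi>' ` (U \<inter> P j)"
    have TW: "?T \<subseteq> \<phi> ` W"
      using W(5) by blast
    have hol: "(fst \<circ> ?s) holomorphic_on ?T" "(snd \<circ> ?s) holomorphic_on ?T"
      using curve_chart(4,5)[OF W(1)] TW holomorphic_on_subset by blast+
    have sW: "?s z \<in> W" "?s z \<in> C b" if z: "z \<in> ?T" for z
    proof -
      show "?s z \<in> W"
        by (rule inv_into_into[OF subsetD[OF TW z]])
      then show "?s z \<in> C b"
        by (rule subsetD[OF W(4)])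
    qed
    have inv: "inv_into U \<phi>' z = a b (?s z)" if "z \<in> ?T" for z
      using W(6) TW that by blast
    show ?thesis
    proof (cases "j = b")
      case True
      have "(\<kappa> j \<circ> inv_into U \<phi>') z = ?s z" if "z \<in> ?T" for z
        using inv[OF that] sW[OF that] True by simp
      then show ?thesis
        using holomorphic_transform[OF hol(1)] holomorphic_transform[OF hol(2)] by (simp add: comp_def)
    next
      case False
      then have j: "j = (\<not> b)"
        by auto
      have flip: "fst (?s z) \<noteq> 0 \<and> (\<kappa> j \<circ> inv_into U \<phi>') z = flip_side g (?s z)" if z: "z \<in> ?T" for z
      proof -
        have "inv_into U \<phi>' z \<in> P j"
          using z W(7) by auto
        then obtain c' where c': "c' \<in> C j" "a b (?s z) = a j c'"
          using inv[OF z] by auto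
        then have "fst (?s z) \<noteq> 0" "c' = flip_side g (?s z)"
          using side_point_eq[OF sW(2)[OF z], of c'] j by auto
        then show ?thesis
          using inv[OF z] c' by simp
      qed
      have "(\<lambda>z. inverse ((fst \<circ> ?s) z)) holomorphic_on ?T" "(\<lambda>z. (snd \<circ> ?s) z / (fst \<circ> ?s) z ^ (g + 1)) holomorphic_on ?T"
        using flip by (intro holomorphic_intros hol; simp)+
      then show ?thesis
        using flip by (intro conjI; elim holomorphic_transform) (simp_all add: flip_side_def)
    qed
  qed
  then show "holomorphic_fun M (P j) (fst \<circ> \<kappa> j)" "holomorphic_fun M (P j) (snd \<circ> \<kappa> j)"
    unfolding holomorphic_fun_def by auto
qed

lemma riemann_surface_M: "compact_riemann_surface M"
  unfolding compact_riemann_surface_def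
proof (intro conjI)
  have "(1, csqrt (poly D 1)) \<in> C True"
    by (simp add: affine_curve_iff side_poly_def)
  then show "points M \<noteq> {}"
    unfolding points_M by blast
  show "(\<Union>(U, \<phi>)\<in>atlas M. U) = points M"
  proof (intro equalityI subsetI)
    fix p assume "p \<in> (\<Union>(U, \<phi>)\<in>atlas M. U)"
    then obtain U \<phi>' where U: "(U, \<phi>') \<in> atlas M" "p \<in> U"
      by blast
    then obtain b W where "U = a b ` W" "W \<subseteq> C b"
      using atlas_cases[OF U(1)] by metis
    then show "p \<in> points M"
      using U(2) P_points[of b] by blast
  next
    fix p assume "p \<in> points M"
    then obtain b c where c: "c \<in> C b" "p = a b c"
      unfolding points_M by blast
    have "\<exists>W \<phi>. (W, \<phi>) \<in> curve_charts (side_poly D b) \<and> c \<in> W"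
    proof (cases "snd c = 0")
      case True
      then have "poly (pderiv (side_poly D b)) (fst c) \<noteq> 0"
        using c(1) side_poly_simple by (simp add: affine_curve_iff)
      then show ?thesis
        using ex_snd_chart[OF c(1) _ openin_topspace[of "top_of_set (C b)"]] c(1) by (metis topspace_euclidean_subtopology)
    next
      case False
      then show ?thesis
        using ex_fst_chart[OF c(1) _ openin_topspace[of "top_of_set (C b)"]] c(1) by (metis topspace_euclidean_subtopology)
    qed
    then obtain W \<phi> where "(W, \<phi>) \<in> curve_charts (side_poly D b)" "c \<in> W"
      by blast
    then have "(a b ` W, \<phi> \<circ> \<kappa> b) \<in> atlas M" "p \<in> a b ` W"
      unfolding hyp_surface_def c(2) by auto
    then show "p \<in> (\<Union>(U, \<phi>)\<in>atlas M. U)"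
      by blast
  qed
  show "\<forall>(U, \<phi>)\<in>atlas M. openin (top_space M) U \<and> open (\<phi> ` U) \<and>
        homeomorphic_map (subtopology (top_space M) U) (top_of_set (\<phi> ` U)) \<phi>"
  proof safe
    fix U \<phi>' assume U: "(U, \<phi>') \<in> atlas M"
    then obtain b W \<phi> where W: "(W, \<phi>) \<in> curve_charts (side_poly D b)" "U = a b ` W" "\<phi>' = \<phi> \<circ> \<kappa> b" "W \<subseteq> C b"
      "\<phi>' ` U = \<phi> ` W" "\<And>z. z \<in> \<phi> ` W \<Longrightarrow> inv_into U \<phi>' z = a b (inv_into W \<phi> z)" "inj_on \<phi>' U"
      using atlas_cases[OF U] by metis
    note cc = curve_chart[OF W(1)]
    show op: "openin (top_space M) U"
      unfolding W(2) by (rule side_open[OF cc(1)])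
    show "open (\<phi>' ` U)"
      using cc(3) W(5) by simp
    have UM: "U \<subseteq> points M"
      using W(2,4) P_points[of b] by blast
    have "homeomorphic_maps (subtopology (top_space M) U) (top_of_set (\<phi>' ` U)) \<phi>' (inv_into U \<phi>')"
      unfolding homeomorphic_maps_def
    proof (intro conjI ballI)
      have "openin (top_space M) {p \<in> U. \<phi>' p \<in> O'}" if O': "open O'" for O'
      proof -
        have "{p \<in> U. \<phi>' p \<in> O'} = a b ` (W \<inter> \<phi> -` O')"
          using W(2,3,4) by (auto simp: subset_iff)
        moreover have "open (\<phi> -` O')"
          using cc(7) O' by (auto intro!: open_vimage continuous_intros)
        ultimately show ?thesis
          using side_open[OF openin_Int_open[OF cc(1)]] by metis
      qed
      then have "continuous_map (subtopology (top_space M) U) euclidean \<phi>'"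
        using op UM by (auto simp: continuous_map_def openin_open_subtopology Int_absorb1)
      then show "continuous_map (subtopology (top_space M) U) (top_of_set (\<phi>' ` U)) \<phi>'"
        using UM by (auto simp: continuous_map_in_subtopology)
      have "continuous_map (top_of_set (\<phi> ` W)) (top_of_set (C b)) (inv_into W \<phi>)"
      proof -
        have "inv_into W \<phi> \<in> \<phi> ` W \<rightarrow> C b"
          by (rule Pi_I, rule subsetD[OF W(4) inv_into_into])
        then show ?thesis
          using cc(6) by (simp add: continuous_map_in_subtopology image_subset_iff_funcset)
      qed
      then have "continuous_map (top_of_set (\<phi> ` W)) (top_space M) (a b \<circ> inv_into W \<phi>)"
        using side_continuous continuous_map_compose by blast
      then have "continuous_map (top_of_set (\<phi> ` W)) (top_space M) (inv_into U \<phi>')"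
        by (rule continuous_map_eq) (use W(6) in auto)
      then show "continuous_map (top_of_set (\<phi>' ` U)) (subtopology (top_space M) U) (inv_into U \<phi>')"
        unfolding W(5)[symmetric] by (auto simp: continuous_map_in_subtopology inv_into_into)
    qed (use W(7) UM in \<open>auto simp: f_inv_into_f\<close>)
    then show "homeomorphic_map (subtopology (top_space M) U) (top_of_set (\<phi>' ` U)) \<phi>'"
      unfolding homeomorphic_map_maps by blast
  qed
  show "\<forall>(U, \<phi>)\<in>atlas M. \<forall>(V, \<psi>)\<in>atlas M. (\<psi> \<circ> inv_into U \<phi>) holomorphic_on \<phi> ` (U \<inter> V)"
  proof safe
    fix U \<phi> V \<psi> assume U: "(U, \<phi>) \<in> atlas M" and V: "(V, \<psi>) \<in> atlas M"
    obtain j W \<psi>' where W: "(W, \<psi>') \<in> curve_charts (side_poly D j)" "V = a j ` W" "\<psi> = \<psi>' \<circ> \<kappa> j" "W \<subseteq> C j"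
      using atlas_cases[OF V] by metis
    have "holomorphic_fun M (P j) \<psi>"
      using coordinate_holomorphic[of j] curve_chart(7)[OF W(1)] W(3) by auto
    then have "(\<psi> \<circ> inv_into U \<phi>) holomorphic_on \<phi> ` (U \<inter> P j)"
      using U unfolding holomorphic_fun_def by blast
    then show "(\<psi> \<circ> inv_into U \<phi>) holomorphic_on \<phi> ` (U \<inter> V)"
      by (rule holomorphic_on_subset) (use W in blast)
  qed
qed (fact connected_M compact_M Hausdorff_M)+

end

section \<open>The involution, the projection to the sphere and the points at infinity of the glued
  surface\<close>

lemma points_sphere: "points riemann_sphere = UNIV"
  by (auto simp: riemann_sphere_def) (metis notin_range_Some)

lemma continuous_inversion_to_sphere:
  "continuous_map euclidean (top_space riemann_sphere) (\<lambda>u::complex. if u = 0 then None else Some (inverse u))"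
proof -
  have "open {u::complex. (if u = 0 then None else Some (inverse u)) \<in> U}"
    if U: "openin (Alexandroff_compactification euclidean) U" for U
    using U unfolding openin_Alexandroff_compactification
  proof safe
    fix V :: "complex set" assume V: "openin euclidean V" "U = Some ` V"
    have "open ({u. u \<noteq> 0} \<inter> inverse -` V)"
      using V(1) by (intro continuous_open_preimage continuous_intros) (auto simp: open_Collect_neq)
    moreover have "{u. (if u = 0 then None else Some (inverse u)) \<in> Some ` V} = {u. u \<noteq> 0} \<inter> inverse -` V"
      by auto
    ultimately show "open {u. (if u = 0 then None else Some (inverse u)) \<in> Some ` V}"
      by simp
  next
    fix K :: "complex set" assume K: "compactin euclidean K" "closedin euclidean K"
    then obtain R where R: "R > 0" "\<And>z. z \<in> K \<Longrightarrow> norm z \<le> R"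
      using compact_imp_bounded bounded_pos by (metis compactin_euclidean_iff)
    have "open ({u. u \<noteq> 0} \<inter> inverse -` (- K))"
      using K(2) by (intro continuous_open_preimage continuous_intros) (auto simp: open_Collect_neq)
    then have "open (({u. u \<noteq> 0} \<inter> inverse -` (- K)) \<union> ball 0 (inverse R))"
      by (intro open_Un) auto
    moreover have "{u. (if u = 0 then None else Some (inverse u)) \<in> insert None (Some ` (topspace euclidean - K))} =
        ({u. u \<noteq> 0} \<inter> inverse -` (- K)) \<union> ball 0 (inverse R)"
    proof -
      have "inverse u \<notin> K" if "u \<noteq> 0" "norm u < inverse R" for u
        using R(2)[of "inverse u"] less_imp_inverse_less[OF that(2)] that(1) R(1) by (auto simp: norm_inverse)
      then show ?thesis
        using R(1) by auto
    qed
    ultimately show "open {u. (if u = 0 then None else Some (inverse u)) \<in> insert None (Some ` (topspace euclidean - K))}"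
      by simp
  qed
  then show ?thesis
    by (auto simp: continuous_map_def riemann_sphere_def)
qed

lemma continuous_Some_to_sphere: "continuous_map euclidean (top_space riemann_sphere) Some"
  by (simp add: riemann_sphere_def continuous_map_Some)

context hyp
begin

lemma continuous_map_on_sides:
  assumes "\<And>b. continuous_map (top_of_set (C b)) Y (f \<circ> a b)"
  shows "continuous_map (top_space M) Y f"
  unfolding continuous_map_def
proof safe
  fix p assume "p \<in> points M"
  then obtain b c where c: "c \<in> C b" "p = a b c"
    unfolding points_M by blast
  then show "f p \<in> topspace Y"
    using assms[of b] by (auto simp: continuous_map_def)
next
  fix U assume U: "openin Y U"
  show "openin (top_space M) {p \<in> points M. f p \<in> U}"
    unfolding openin_M
  proof (intro conjI allI)
    fix b
    have "{c \<in> C b. a b c \<in> {p \<in> points M. f p \<in> U}} = {c \<in> C b. (f \<circ> a b) c \<in> U}"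
      using P_points[of b] by auto
    then show "openin (top_of_set (C b)) {c \<in> C b. a b c \<in> {p \<in> points M. f p \<in> U}}"
      using openin_continuous_map_preimage[OF assms[of b] U] by simp
  qed (use points_M in blast)
qed

definition neg :: "complex \<times> complex \<Rightarrow> complex \<times> complex" where "neg c = (fst c, - snd c)"

lemma neg: "c \<in> C b \<Longrightarrow> neg c \<in> C b" "neg (neg c) = c" "fst (neg c) = fst c" "snd (neg c) = - snd c"
  by (auto simp: neg_def affine_curve_iff)

lemma involution_side:
  assumes "c \<in> C b"
  shows "hyp_involution (a b c) = a b (neg c)"
proof (cases "b \<or> fst c \<noteq> 0")
  case False
  then have "snd c = 1 \<or> snd c = - 1"
    using assms reflect_at_0 by (auto simp: side_poly_def affine_curve_iff power2_eq_1_iff)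
  then show ?thesis
    using False by (auto simp: side_point_def neg_def)
qed (auto simp: side_point_def neg_def)

lemma involution_P:
  assumes "p \<in> P b"
  shows "hyp_involution p \<in> P b" "\<kappa> b (hyp_involution p) = neg (\<kappa> b p)" "hyp_involution (hyp_involution p) = p"
proof -
  obtain c where c: "c \<in> C b" "p = a b c"
    using assms by blast
  show "hyp_involution p \<in> P b" "\<kappa> b (hyp_involution p) = neg (\<kappa> b p)" "hyp_involution (hyp_involution p) = p"
    using c involution_side neg(1)[OF c(1)] by (simp_all add: neg)
qed

lemma proj_side: "hyp_proj (a True c) = Some (fst c)"
  "hyp_proj (a False c) = (if fst c = 0 then None else Some (inverse (fst c)))"
  by (auto simp: side_point_def)

lemma holomorphic_map_involution: "holomorphic_map M M hyp_involution"
  unfolding holomorphic_map_def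
proof (intro conjI)
  show "continuous_map (top_space M) (top_space M) hyp_involution"
  proof (rule continuous_map_on_sides)
    fix b
    have "continuous_map (top_of_set (C b)) (top_of_set (C b)) neg"
      using neg(1) unfolding neg_def
      by (auto simp: continuous_map_in_subtopology intro!: continuous_intros)
    then have "continuous_map (top_of_set (C b)) (top_space M) (a b \<circ> neg)"
      using side_continuous continuous_map_compose by blast
    then show "continuous_map (top_of_set (C b)) (top_space M) (hyp_involution \<circ> a b)"
      by (rule continuous_map_eq) (simp add: involution_side)
  qed
  show "\<forall>(U, \<phi>)\<in>atlas M. \<forall>(V, \<psi>)\<in>atlas M.
      (\<psi> \<circ> hyp_involution \<circ> inv_into U \<phi>) holomorphic_on \<phi> ` (U \<inter> hyp_involution -` V)"
  proof safe
    fix U \<phi> V \<psi> assume U: "(U, \<phi>) \<in> atlas M" and V: "(V, \<psi>) \<in> atlas M"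
    obtain j W \<psi>' where W: "(W, \<psi>') \<in> curve_charts (side_poly D j)" "V = a j ` W" "\<psi> = \<psi>' \<circ> \<kappa> j" "W \<subseteq> C j"
      using atlas_cases[OF V] by metis
    have injU: "inj_on \<phi> U"
      using atlas_cases[OF U] by metis
    have UP: "U \<inter> hyp_involution -` V \<subseteq> U \<inter> P j"
    proof safe
      fix p assume p: "p \<in> U" "hyp_involution p \<in> V"
      have "hyp_involution p \<in> P j"
        using p(2) W(2,4) by blast
      moreover have "p \<in> points M"
        using p(1) U riemann_surface_M unfolding compact_riemann_surface_def by (blast dest: openin_subset)
      then obtain b where "p \<in> P b"
        unfolding points_M by blast
      ultimately show "p \<in> P j"
        using involution_P(1)[of "hyp_involution p" j] involution_P(3) by metis
    qed
    let ?T = "\<phi> ` (U \<inter> hyp_involution -` V)"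
    have hol: "(fst \<circ> \<kappa> j \<circ> inv_into U \<phi>) holomorphic_on ?T" "(\<lambda>z. - (snd \<circ> \<kappa> j \<circ> inv_into U \<phi>) z) holomorphic_on ?T"
    proof -
      have h: "(fst \<circ> \<kappa> j \<circ> inv_into U \<phi>) holomorphic_on \<phi> ` (U \<inter> P j)" "(snd \<circ> \<kappa> j \<circ> inv_into U \<phi>) holomorphic_on \<phi> ` (U \<inter> P j)"
        using coordinate_holomorphic[of j] U unfolding holomorphic_fun_def by blast+
      show "(fst \<circ> \<kappa> j \<circ> inv_into U \<phi>) holomorphic_on ?T" "(\<lambda>z. - (snd \<circ> \<kappa> j \<circ> inv_into U \<phi>) z) holomorphic_on ?T"
        by (rule holomorphic_on_subset[OF h(1) image_mono[OF UP]],
            rule holomorphic_on_minus[OF holomorphic_on_subset[OF h(2) image_mono[OF UP]]])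
    qed
    have inP: "inv_into U \<phi> z \<in> P j" if z: "z \<in> ?T" for z
    proof -
      obtain p where "p \<in> U" "p \<in> P j" "z = \<phi> p"
        using z UP by blast
      then show ?thesis
        using injU by simp
    qed
    show "(\<psi> \<circ> hyp_involution \<circ> inv_into U \<phi>) holomorphic_on ?T"
      using curve_chart(7)[OF W(1)]
    proof
      assume "\<psi>' = fst"
      then show ?thesis
        by (intro holomorphic_transform[OF hol(1)]) (simp add: W(3) involution_P(2)[OF inP] neg)
    next
      assume "\<psi>' = snd"
      then show ?thesis
        by (intro holomorphic_transform[OF hol(2)]) (simp add: W(3) involution_P(2)[OF inP] neg)
    qed
  qed
qed

lemma quotient_proj: "quotient_to_sphere M hyp_involution hyp_proj"
  unfolding quotient_to_sphere_def
proof (intro conjI)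
  \<comment> \<open>The two sides are the preimages of the two chart domains of the sphere, and on
    each side the projection read in the sphere's chart is the first coordinate.\<close>
  have PT: "p \<in> P True \<longleftrightarrow> hyp_proj p \<in> range Some" if p: "p \<in> points M" for p
  proof -
    obtain b c where c: "c \<in> C b" "p = a b c"
      using p unfolding points_M by blast
    show ?thesis
    proof (cases b)
      case True
      then show ?thesis
        using c proj_side(1)[of c] by auto
    next
      case False
      show ?thesis
      proof (cases "fst c = 0")
        case True
        have "p \<notin> P True"
          using True c False side_point_eq(1)[of c False] by auto
        then show ?thesis
          using True c(2) False proj_side(2)[of c] by auto
      next
        case f: False
        have "p \<in> P True"
          using flip_side[of c False] c False f by (metis imageI not_False_eq_True)
        then show ?thesis
          using f c(2) False proj_side(2)[of c] by auto
      qed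
    qed
  qed
  have PF: "p \<in> P False \<longleftrightarrow> hyp_proj p \<in> - {Some 0}" if p: "p \<in> points M" for p
  proof -
    obtain b c where c: "c \<in> C b" "p = a b c"
      using p unfolding points_M by blast
    show ?thesis
    proof (cases b)
      case False
      then show ?thesis
        using c proj_side(2)[of c] by auto
    next
      case True
      show ?thesis
      proof (cases "fst c = 0")
        case f: True
        have "p \<notin> P False"
          using f c True side_point_eq(1)[of c True] by auto
        then show ?thesis
          using f c(2) True proj_side(1)[of c] by auto
      next
        case f: False
        have "p \<in> P False"
          using flip_side[of c True] c True f by (metis imageI not_True_eq_False)
        then show ?thesis
          using f c(2) True proj_side(1)[of c] by auto
      qed
    qed
  qed
  show "holomorphic_map M riemann_sphere hyp_proj"
    unfolding holomorphic_map_def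
  proof (intro conjI)
    show "continuous_map (top_space M) (top_space riemann_sphere) hyp_proj"
    proof (rule continuous_map_on_sides)
      fix b
      have "continuous_map (top_of_set (C b)) euclidean fst"
        by (simp add: continuous_on_fst)
      then have "continuous_map (top_of_set (C b)) (top_space riemann_sphere) (Some \<circ> fst)"
        "continuous_map (top_of_set (C b)) (top_space riemann_sphere) ((\<lambda>u. if u = 0 then None else Some (inverse u)) \<circ> fst)"
        using continuous_Some_to_sphere continuous_inversion_to_sphere continuous_map_compose by blast+
      moreover have "hyp_proj \<circ> a b = (if b then Some \<circ> fst else (\<lambda>u. if u = 0 then None else Some (inverse u)) \<circ> fst)"
        by (cases b) (auto simp: proj_side)
      ultimately show "continuous_map (top_of_set (C b)) (top_space riemann_sphere) (hyp_proj \<circ> a b)"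
        by (cases b) simp_all
    qed
    have sub: "U \<subseteq> points M" "inj_on \<phi> U" if U: "(U, \<phi>) \<in> atlas M" for U \<phi>
      using U riemann_surface_M atlas_cases[OF U] unfolding compact_riemann_surface_def by (blast dest: openin_subset, metis)
    have 1: "(the \<circ> hyp_proj \<circ> inv_into U \<phi>) holomorphic_on \<phi> ` (U \<inter> hyp_proj -` range Some)" if U: "(U, \<phi>) \<in> atlas M" for U \<phi>
    proof -
      have eq: "U \<inter> hyp_proj -` range Some = U \<inter> P True"
        using PT sub(1)[OF U] by blast
      have "(fst \<circ> \<kappa> True \<circ> inv_into U \<phi>) holomorphic_on \<phi> ` (U \<inter> P True)"
        using coordinate_holomorphic(1)[of True] U unfolding holomorphic_fun_def by blast
      then show ?thesis
        unfolding eq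
      proof (rule holomorphic_transform)
        fix z assume "z \<in> \<phi> ` (U \<inter> P True)"
        then obtain p where p: "p \<in> U" "p \<in> P True" "z = \<phi> p"
          by blast
        then show "(fst \<circ> \<kappa> True \<circ> inv_into U \<phi>) z = (the \<circ> hyp_proj \<circ> inv_into U \<phi>) z"
          using sub(2)[OF U] proj_side(1)[of "\<kappa> True p"] \<kappa>_in(2)[OF p(2)] by simp
      qed
    qed
    have 2: "((\<lambda>z. case z of None \<Rightarrow> 0 | Some t \<Rightarrow> 1 / t) \<circ> hyp_proj \<circ> inv_into U \<phi>) holomorphic_on \<phi> ` (U \<inter> hyp_proj -` (- {Some 0}))"
      if U: "(U, \<phi>) \<in> atlas M" for U \<phi>
    proof -
      have eq: "U \<inter> hyp_proj -` (- {Some 0}) = U \<inter> P False"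
        using PF sub(1)[OF U] by blast
      have "(fst \<circ> \<kappa> False \<circ> inv_into U \<phi>) holomorphic_on \<phi> ` (U \<inter> P False)"
        using coordinate_holomorphic(1)[of False] U unfolding holomorphic_fun_def by blast
      then show ?thesis
        unfolding eq
      proof (rule holomorphic_transform)
        fix z assume "z \<in> \<phi> ` (U \<inter> P False)"
        then obtain p where p: "p \<in> U" "p \<in> P False" "z = \<phi> p"
          by blast
        then show "(fst \<circ> \<kappa> False \<circ> inv_into U \<phi>) z = ((\<lambda>z. case z of None \<Rightarrow> 0 | Some t \<Rightarrow> 1 / t) \<circ> hyp_proj \<circ> inv_into U \<phi>) z"
          using sub(2)[OF U] proj_side(2)[of "\<kappa> False p"] \<kappa>_in(2)[OF p(2)]
          by (cases "fst (\<kappa> False p) = 0") (simp_all add: divide_inverse)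
      qed
    qed
    show "\<forall>(U, \<phi>)\<in>atlas M. \<forall>(V, \<psi>)\<in>atlas riemann_sphere. (\<psi> \<circ> hyp_proj \<circ> inv_into U \<phi>) holomorphic_on \<phi> ` (U \<inter> hyp_proj -` V)"
      using 1 2 by (auto simp: riemann_sphere_def)
  qed
  show "hyp_proj ` points M = points riemann_sphere"
    unfolding points_sphere
  proof (intro equalityI subsetI)
    fix z :: "complex option"
    show "z \<in> hyp_proj ` points M"
    proof (cases z)
      case None
      have "(0, 1) \<in> C False"
        using reflect_at_0 by (simp add: side_poly_def affine_curve_iff)
      then have "a False (0, 1) \<in> points M" "hyp_proj (a False (0, 1)) = None"
        using P_points[of False] by (blast, simp add: proj_side)
      then show ?thesis
        using None by (metis imageI)
    next
      case (Some x)
      have "(x, csqrt (poly D x)) \<in> C True"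
        by (simp add: side_poly_def affine_curve_iff)
      then have "a True (x, csqrt (poly D x)) \<in> points M" "hyp_proj (a True (x, csqrt (poly D x))) = z"
        using P_points[of True] Some by (blast, simp add: proj_side)
      then show ?thesis
        by (metis imageI)
    qed
  qed auto
  show "\<forall>p\<in>points M. \<forall>q\<in>points M. hyp_proj p = hyp_proj q \<longleftrightarrow> q = p \<or> q = hyp_involution p"
  proof (intro ballI)
    fix p q assume "p \<in> points M" "q \<in> points M"
    moreover have "points M = Inl ` affine_curve D \<union> range Inr"
      unfolding points_M points_eq ..
    ultimately show "hyp_proj p = hyp_proj q \<longleftrightarrow> q = p \<or> q = hyp_involution p"
      by (auto simp: affine_curve_iff) (metis power2_eq_iff)+
  qed
qed

lemma affine_part: "points M - {Inr True, Inr False} = P True" "P True = Inl ` affine_curve D"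
proof -
  have "points M = Inl ` affine_curve D \<union> range Inr"
    unfolding points_M points_eq ..
  then show "points M - {Inr True, Inr False} = P True" "P True = Inl ` affine_curve D"
    by (auto simp: side_point_def side_poly_def)
qed

lemma \<kappa>_True: "\<kappa> True = inv_into (affine_curve D) Inl"
  by (simp add: side_poly_def side_point_def[abs_def])

lemma end_points: "Inr s = a False (0, if s then 1 else -1)" "(0, if s then 1 else -1) \<in> C False"
  using reflect_at_0 by (auto simp: side_point_def side_poly_def affine_curve_iff)

sublocale riemann_surface M
  by unfold_locales (rule riemann_surface_M)

lemma P_open: "openin (top_space M) (P b)"
  by (rule side_open) simp

text \<open>On the overlap x^(g+1) / w = 1 / v, and \<open>v\<close> is continuous at the ends with
  value 1 at \<open>Inr True\<close> and -1 at \<open>Inr False\<close>; this matches the prescribed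
  limits.\<close>

lemma curve_compactification_M:
  "curve_compactification g D M hyp_involution Inl (Inr True) (Inr False)"
proof -
  have ratio: "limitin euclidean (\<lambda>p. fst (\<kappa> True p) ^ (g + 1) / snd (\<kappa> True p)) (if s then 1 else -1) (atin (top_space M) (Inr s))" for s
  proof -
    have inP: "Inr s \<in> P False"
      using end_points by (metis imageI)
    have \<kappa>s: "\<kappa> False (Inr s) = (0, if s then 1 else -1)"
      using end_points[of s] by (metis \<kappa>_side)
    have "((snd \<circ> \<kappa> False) \<longlongrightarrow> (snd \<circ> \<kappa> False) (Inr s)) (atin (top_space M) (Inr s))"
      by (rule holomorphic_fun_tendsto[OF coordinate_holomorphic(2) P_open inP])
    then have "((\<lambda>p. inverse (snd (\<kappa> False p))) \<longlongrightarrow> inverse (if s then 1 else -1)) (atin (top_space M) (Inr s))"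
      using \<kappa>s by (intro tendsto_inverse) (auto simp: comp_def)
    also have "inverse (if s then 1 else -1) = (if s then 1 else -1 :: complex)"
      by simp
    finally have "((\<lambda>p. fst (\<kappa> True p) ^ (g + 1) / snd (\<kappa> True p)) \<longlongrightarrow> (if s then 1 else -1)) (atin (top_space M) (Inr s))"
    proof (rule Lim_transform_eventually)
      show "eventually (\<lambda>p. inverse (snd (\<kappa> False p)) = fst (\<kappa> True p) ^ (g + 1) / snd (\<kappa> True p)) (atin (top_space M) (Inr s))"
        unfolding eventually_atin
      proof (intro disjI2 exI[of _ "P False - {Inr (\<not> s)}"] conjI ballI)
        show "openin (top_space M) (P False - {Inr (\<not> s)})"
          using end_points[of "\<not> s"] P_points[of False] by (intro openin_Diff_finite P_open) (auto simp: image_iff)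
        fix p assume p: "p \<in> P False - {Inr (\<not> s)} - {Inr s}"
        then obtain c where c: "c \<in> C False" "p = a False c"
          by blast
        have c0: "fst c \<noteq> 0"
        proof
          assume "fst c = 0"
          then have "p = Inr (snd c = 1)"
            using c(2) by (simp add: side_point_def)
          then show False
            using p by auto
        qed
        then have "\<kappa> True p = flip_side g c" "\<kappa> False p = c"
          using flip_side[OF c(1)] c by (metis \<kappa>_side not_False_eq_True)+
        then show "inverse (snd (\<kappa> False p)) = fst (\<kappa> True p) ^ (g + 1) / snd (\<kappa> True p)"
          using c0 by (simp add: flip_side_def power_inverse field_simps)
      qed (use inP in auto)
    qed
    then show ?thesis
      by (simp add: limitin_canonical_iff)
  qed
  show ?thesis
    unfolding curve_compactification_def Let_def \<kappa>_True[symmetric]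
  proof (intro conjI)
    show "bij_betw Inl (affine_curve D) (points M - {Inr True, Inr False})"
      unfolding affine_part by (rule inj_on_imp_bij_betw) simp
    show "Inr True \<in> points M" "Inr False \<in> points M"
      unfolding points_M points_eq[symmetric] by (rule UnI2, rule rangeI)+
    show "holomorphic_fun M (points M - {Inr True, Inr False}) (fst \<circ> \<kappa> True)"
      "holomorphic_fun M (points M - {Inr True, Inr False}) (snd \<circ> \<kappa> True)"
      unfolding affine_part(1) by (rule coordinate_holomorphic)+
    show "limitin euclidean (\<lambda>p. (fst \<circ> \<kappa> True) p ^ (g + 1) / (snd \<circ> \<kappa> True) p) 1 (atin (top_space M) (Inr True))"
      "limitin euclidean (\<lambda>p. (fst \<circ> \<kappa> True) p ^ (g + 1) / (snd \<circ> \<kappa> True) p) (-1) (atin (top_space M) (Inr False))"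
      using ratio[of True] ratio[of False] by simp_all
  qed (auto simp: riemann_surface_M)
qed

sublocale curve M g D hyp_involution Inl "Inr True" "Inr False"
  by unfold_locales (fact adm curve_compactification_M)+

end

section \<open>Holomorphic differentials\<close>

text \<open>The chain rule in the shape of the transformation law of
  \<open>holomorphic_form\<close>: the derivatives of \<open>l\<close> in charts are the
  coefficients of the differential dl.\<close>

lemma (in riemann_surface) deriv_transition:
  assumes U: "(U, \<phi>) \<in> atlas M" and V: "(V, \<psi>) \<in> atlas M" and y: "y \<in> U \<inter> V \<inter> S"
    and l: "holomorphic_fun M S l" and S: "openin (top_space M) S"
  shows "deriv (l \<circ> inv_into U \<phi>) (\<phi> y) = deriv (l \<circ> inv_into V \<psi>) (\<psi> y) * deriv (\<psi> \<circ> inv_into U \<phi>) (\<phi> y)"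
proof -
  have opU: "open (\<phi> ` (U \<inter> (V \<inter> S)))" "open (\<psi> ` (V \<inter> S))"
    using chart_image_open[OF U openin_Int[OF chart_open(1)[OF V] S]] chart_image_open[OF V S] by auto
  have "(\<psi> \<circ> inv_into U \<phi>) holomorphic_on \<phi> ` (U \<inter> (V \<inter> S))"
    by (rule holomorphic_on_subset[OF transition[OF U V]]) blast
  then have d1: "(\<psi> \<circ> inv_into U \<phi>) field_differentiable at (\<phi> y)"
    using opU(1) y by (intro holomorphic_on_imp_differentiable_at) auto
  have val: "(\<psi> \<circ> inv_into U \<phi>) (\<phi> y) = \<psi> y"
    using y U by auto
  have "(l \<circ> inv_into V \<psi>) field_differentiable at (\<psi> y)"
    using holomorphic_fun_chart[OF V l] opU(2) y by (intro holomorphic_on_imp_differentiable_at) auto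
  then have d2: "(l \<circ> inv_into V \<psi>) field_differentiable at ((\<psi> \<circ> inv_into U \<phi>) (\<phi> y))"
    using val by simp
  have "deriv ((l \<circ> inv_into V \<psi>) \<circ> (\<psi> \<circ> inv_into U \<phi>)) (\<phi> y) =
      deriv (l \<circ> inv_into V \<psi>) (\<psi> y) * deriv (\<psi> \<circ> inv_into U \<phi>) (\<phi> y)"
    using deriv_chain[OF d1 d2] unfolding val .
  moreover have "eventually (\<lambda>z. z \<in> \<phi> ` (U \<inter> (V \<inter> S))) (nhds (\<phi> y))"
    using opU(1) y by (intro eventually_nhds_in_open) auto
  then have "eventually (\<lambda>z. ((l \<circ> inv_into V \<psi>) \<circ> (\<psi> \<circ> inv_into U \<phi>)) z = (l \<circ> inv_into U \<phi>) z) (nhds (\<phi> y))"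
    by (rule eventually_mono) (use U V in auto)
  then have "deriv ((l \<circ> inv_into V \<psi>) \<circ> (\<psi> \<circ> inv_into U \<phi>)) (\<phi> y) = deriv (l \<circ> inv_into U \<phi>) (\<phi> y)"
    by (rule deriv_cong_ev) simp
  ultimately show ?thesis
    by simp
qed

lemma (in riemann_surface) deriv_relation:
  assumes U: "(U, \<phi>) \<in> atlas M" "y \<in> U" and S: "openin (top_space M) S" "y \<in> S"
    and eq: "\<And>z. z \<in> S \<Longrightarrow> l z = m z"
  shows "deriv (l \<circ> inv_into U \<phi>) (\<phi> y) = deriv (m \<circ> inv_into U \<phi>) (\<phi> y)"
proof (rule deriv_cong_ev[OF _ refl])
  have "eventually (\<lambda>z. z \<in> \<phi> ` (U \<inter> S)) (nhds (\<phi> y))"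
    using chart_image_open[OF U(1) S(1)] U(2) S(2) by (intro eventually_nhds_in_open) auto
  then show "eventually (\<lambda>z. (l \<circ> inv_into U \<phi>) z = (m \<circ> inv_into U \<phi>) z) (nhds (\<phi> y))"
    by (rule eventually_mono) (use U eq in auto)
qed

context hyp
begin

definition u :: "pt \<Rightarrow> complex" where "u = fst \<circ> \<kappa> False"
definition v :: "pt \<Rightarrow> complex" where "v = snd \<circ> \<kappa> False"

text \<open>The coefficient of the differential dl in the chart \<open>k\<close>.\<close>

abbreviation dv :: "(pt \<Rightarrow> complex) \<Rightarrow> pt chart \<Rightarrow> pt \<Rightarrow> complex" where
  "dv l k y \<equiv> deriv (l \<circ> inv_into (fst k) (snd k)) (snd k y)"

lemma x_eq: "x = fst \<circ> \<kappa> True" and w_eq: "w = snd \<circ> \<kappa> True"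
  unfolding x_def w_def \<kappa>_True by simp_all

lemma hol: "holomorphic_fun M (P True) x" "holomorphic_fun M (P True) w"
  "holomorphic_fun M (P False) u" "holomorphic_fun M (P False) v"
  unfolding x_eq w_eq u_def v_def by (rule coordinate_holomorphic)+

lemma curve_eqs: "y \<in> P True \<Longrightarrow> w y ^ 2 = poly D (x y)"
  using w_square affine_part by simp

lemma overlap:
  assumes "y \<in> P True" "y \<in> P False"
  shows "u y \<noteq> 0" "x y \<noteq> 0" "x y = inverse (u y)" "w y = v y * x y ^ (g + 1)"
proof -
  obtain c where c: "c \<in> C True" "y = a True c"
    using assms(1) by blast
  obtain c' where c': "c' \<in> C False" "y = a False c'"
    using assms(2) by blast
  have *: "fst c \<noteq> 0" "c' = flip_side g c"
    using side_point_eq[of c True c'] c c' by auto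
  moreover have "\<kappa> True y = c" "\<kappa> False y = c'"
    using c c' by (metis \<kappa>_side)+
  ultimately show "u y \<noteq> 0" "x y \<noteq> 0" "x y = inverse (u y)" "w y = v y * x y ^ (g + 1)"
    unfolding x_eq w_eq u_def v_def by (simp_all add: flip_side_def)
qed

lemma at_end:
  assumes "y \<in> points M" "y \<notin> P True"
  shows "y \<in> P False" "u y = 0" "v y \<noteq> 0"
proof -
  show y: "y \<in> P False"
    using assms points_M by blast
  then obtain c where c: "c \<in> C False" "y = a False c"
    by blast
  have k: "\<kappa> False y = c"
    using c by (metis \<kappa>_side)
  have c0: "fst c = 0"
    using flip_side[OF c(1)] c(2) assms(2) by (metis imageI not_False_eq_True)
  then show "u y = 0"
    by (simp add: u_def k)
  have "snd c ^ 2 = 1"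
    using c(1) c0 reflect_at_0 by (simp add: affine_curve_iff side_poly_def)
  then show "v y \<noteq> 0"
    by (auto simp: v_def k)
qed

lemma w0_simple: "y \<in> P True \<Longrightarrow> w y = 0 \<Longrightarrow> poly (pderiv D) (x y) \<noteq> 0"
  using curve_eqs pderiv_nonzero_at_root[OF D_props(4)] by (metis zero_power2)

lemma chart_diff:
  assumes "k \<in> atlas M" "y \<in> fst k" "holomorphic_fun M (P b) l" "y \<in> P b"
  shows "(l \<circ> inv_into (fst k) (snd k)) field_differentiable at (snd k y)"
proof -
  have k: "(fst k, snd k) \<in> atlas M"
    using assms(1) by simp
  show ?thesis
    using holomorphic_fun_chart[OF k assms(3)] chart_image_open[OF k P_open] assms(2,4)
    by (intro holomorphic_on_imp_differentiable_at[of _ "snd k ` (fst k \<inter> P b)"]) auto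
qed

text \<open>The derivative of w^2 = D(x), that is 2 w dw = D'(x) dx.\<close>

lemma dv_w:
  assumes k: "k \<in> atlas M" "y \<in> fst k" and y: "y \<in> P True"
  shows "2 * w y * dv w k y = poly (pderiv D) (x y) * dv x k y"
proof -
  have k': "(fst k, snd k) \<in> atlas M"
    using k by simp
  let ?s = "inv_into (fst k) (snd k)" and ?z = "snd k y"
  have sz: "?s ?z = y"
    using k' k(2) by simp
  have dx: "((x \<circ> ?s) has_field_derivative dv x k y) (at ?z)" and dw: "((w \<circ> ?s) has_field_derivative dv w k y) (at ?z)"
    using chart_diff[OF k hol(1) y] chart_diff[OF k hol(2) y] by (auto simp: field_differentiable_derivI)
  have "((\<lambda>z. (w \<circ> ?s) z ^ 2) has_field_derivative 2 * w y * dv w k y) (at ?z)"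
    using DERIV_power[OF dw, of 2] sz by (simp add: mult_ac)
  then have 1: "deriv ((\<lambda>z. w z ^ 2) \<circ> ?s) ?z = 2 * w y * dv w k y"
    by (simp add: comp_def DERIV_imp_deriv)
  have "((\<lambda>z. poly D ((x \<circ> ?s) z)) has_field_derivative poly (pderiv D) ((x \<circ> ?s) ?z) * dv x k y) (at ?z)"
    by (rule DERIV_chain2[OF poly_DERIV dx])
  then have 2: "deriv ((\<lambda>z. poly D (x z)) \<circ> ?s) ?z = poly (pderiv D) (x y) * dv x k y"
    using sz by (simp add: comp_def DERIV_imp_deriv)
  have "deriv ((\<lambda>z. w z ^ 2) \<circ> ?s) ?z = deriv ((\<lambda>z. poly D (x z)) \<circ> ?s) ?z"
    by (rule deriv_relation[OF k' k(2) P_open y]) (rule curve_eqs)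
  then show ?thesis
    using 1 2 by simp
qed

text \<open>The derivative of x = 1 / u, that is dx = - x^2 du.\<close>

lemma dv_x_u:
  assumes k: "k \<in> atlas M" "y \<in> fst k" and y: "y \<in> P True" "y \<in> P False"
  shows "dv x k y = - (x y ^ 2) * dv u k y"
proof -
  have k': "(fst k, snd k) \<in> atlas M"
    using k by simp
  let ?s = "inv_into (fst k) (snd k)" and ?z = "snd k y"
  have sz: "?s ?z = y"
    using k' k(2) by simp
  have "((u \<circ> ?s) has_field_derivative dv u k y) (at ?z)"
    using chart_diff[OF k hol(3) y(2)] by (auto simp: field_differentiable_derivI)
  then have "((\<lambda>z. inverse ((u \<circ> ?s) z)) has_field_derivative - (inverse (u y) * dv u k y * inverse (u y))) (at ?z)"
    using DERIV_inverse'[of "u \<circ> ?s" "dv u k y" ?z UNIV] overlap(1)[OF y] sz by simp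
  then have "deriv ((\<lambda>z. inverse (u z)) \<circ> ?s) ?z = - (x y ^ 2) * dv u k y"
    using overlap(3)[OF y] by (simp add: comp_def DERIV_imp_deriv power2_eq_square mult_ac)
  moreover have "deriv (x \<circ> ?s) ?z = deriv ((\<lambda>z. inverse (u z)) \<circ> ?s) ?z"
    by (rule deriv_relation[OF k' k(2) openin_Int[OF P_open P_open]]) (rule IntI[OF y], erule IntE, rule overlap)
  ultimately show ?thesis
    by simp
qed

lemma chart_with:
  assumes y: "y \<in> P b" and l: "(l = fst \<and> snd (\<kappa> b y) \<noteq> 0) \<or> (l = snd \<and> poly (pderiv (side_poly D b)) (fst (\<kappa> b y)) \<noteq> 0)"
  obtains U where "(U, l \<circ> \<kappa> b) \<in> atlas M" "y \<in> U" "U \<subseteq> P b"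
    "\<And>z. z \<in> U \<Longrightarrow> (l = fst \<and> snd (\<kappa> b z) \<noteq> 0) \<or> (l = snd \<and> poly (pderiv (side_poly D b)) (fst (\<kappa> b z)) \<noteq> 0)"
proof -
  obtain c where c: "c \<in> C b" "y = a b c" "\<kappa> b y = c"
    using y by (metis \<kappa>_side imageE)
  have "openin (top_of_set (C b)) (C b)"
    by simp
  then obtain W where W: "(W, l) \<in> curve_charts (side_poly D b)" "c \<in> W" "W \<subseteq> C b"
    using l ex_fst_chart[OF c(1)] ex_snd_chart[OF c(1)] c(1,3) by metis
  show thesis
  proof (rule that[of "a b ` W"])
    show "(a b ` W, l \<circ> \<kappa> b) \<in> atlas M"
      using W(1) unfolding hyp_surface_def by auto
    show "y \<in> a b ` W" "a b ` W \<subseteq> P b"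
      using c W by auto
    fix z assume "z \<in> a b ` W"
    then obtain d where d: "d \<in> W" "z = a b d"
      by blast
    then have "\<kappa> b z = d"
      using W(3) by (metis \<kappa>_side subsetD)
    moreover have "fst \<noteq> (snd :: complex \<times> complex \<Rightarrow> complex)"
      by (metis fst_conv snd_conv zero_neq_one)
    ultimately show "(l = fst \<and> snd (\<kappa> b z) \<noteq> 0) \<or> (l = snd \<and> poly (pderiv (side_poly D b)) (fst (\<kappa> b z)) \<noteq> 0)"
      using W(1) d(1) by (auto simp: curve_charts_def)
  qed
qed

lemma dv_self:
  assumes U: "(U, l) \<in> atlas M" "y \<in> U"
  shows "dv l (U, l) y = 1"
proof -
  have "eventually (\<lambda>z. z \<in> l ` U) (nhds (l y))"
    using chart_open(2)[OF U(1)] U(2) by (intro eventually_nhds_in_open) auto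
  then have "eventually (\<lambda>z. (l \<circ> inv_into U l) z = z) (nhds (l y))"
    by (rule eventually_mono) (use U(1) in auto)
  then have "deriv (l \<circ> inv_into U l) (l y) = deriv (\<lambda>z. z) (l y)"
    by (rule deriv_cong_ev) simp
  then show ?thesis
    by simp
qed

lemma form_law:
  assumes \<omega>: "holomorphic_form M \<omega>" and k: "k \<in> atlas M" "y \<in> fst k" and U: "(U, l) \<in> atlas M" "y \<in> U"
  shows "\<omega> k y = \<omega> (U, l) y * dv l k y"
proof -
  have law: "\<forall>(U, \<phi>)\<in>atlas M. \<forall>(V, \<psi>)\<in>atlas M. \<forall>p\<in>U \<inter> V.
      \<omega> (U, \<phi>) p = \<omega> (V, \<psi>) p * deriv (\<psi> \<circ> inv_into U \<phi>) (\<phi> p)"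
    using \<omega> unfolding holomorphic_form_def by blast
  obtain V \<psi> where V: "k = (V, \<psi>)"
    by fastforce
  have "\<forall>p\<in>V \<inter> U. \<omega> (V, \<psi>) p = \<omega> (U, l) p * deriv (l \<circ> inv_into V \<psi>) (\<psi> p)"
    using bspec[OF law, of "(V, \<psi>)"] k(1) U(1) unfolding V by auto
  then show ?thesis
    using k(2) U(2) unfolding V by simp
qed

text \<open>The differential \<open>x\<^sup>i dx/w\<close> equals \<open>2 x\<^sup>i dw/D'(x)\<close> and \<open>- u\<^bsup>g-1-i\<^esup> du/v\<close>.\<close>

definition basis_form :: "nat \<Rightarrow> pt chart \<Rightarrow> pt \<Rightarrow> complex" where
  "basis_form i k y = (if k \<in> atlas M \<and> y \<in> fst k then
     if y \<in> P True then
       if w y \<noteq> 0 then x y ^ i / w y * dv x k y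
       else 2 * x y ^ i / poly (pderiv D) (x y) * dv w k y
     else - (u y ^ (g - 1 - i)) / v y * dv u k y
   else 0)"

lemma basis_form_x:
  assumes k: "k \<in> atlas M" "y \<in> fst k" and y: "y \<in> P True" "w y \<noteq> 0"
  shows "basis_form i k y = x y ^ i / w y * dv x k y"
  using assms by (simp add: basis_form_def)

lemma basis_form_w:
  assumes k: "k \<in> atlas M" "y \<in> fst k" and y: "y \<in> P True" "poly (pderiv D) (x y) \<noteq> 0"
  shows "basis_form i k y = 2 * x y ^ i / poly (pderiv D) (x y) * dv w k y"
proof (cases "w y = 0")
  case False
  then show ?thesis
    unfolding basis_form_x[OF k y(1) False] using dv_w[OF k y(1)] y(2) by (simp add: field_simps)
qed (use assms in \<open>simp add: basis_form_def\<close>)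

lemma basis_form_u:
  assumes i: "i < g" and k: "k \<in> atlas M" "y \<in> fst k" and y: "y \<in> P False" "v y \<noteq> 0"
  shows "basis_form i k y = - (u y ^ (g - 1 - i)) / v y * dv u k y"
proof (cases "y \<in> P True")
  case True
  note o = overlap[OF True y(1)]
  have w0: "w y \<noteq> 0"
    using o y(2) by simp
  \<comment> \<open>The powers match because g + 1 = (i + 2) + (g - 1 - i). The natural-number
    exponent g - 1 - i is a true difference only for i < g, and this is what makes the form regular
    at infinity.\<close>
  have key: "x y ^ i * x y ^ 2 = x y ^ (g + 1) * u y ^ (g - 1 - i)"
  proof -
    have "g + 1 = (i + 2) + (g - 1 - i)"
      using i by simp
    then have "x y ^ (g + 1) = x y ^ (i + 2) * x y ^ (g - 1 - i)"
      by (metis power_add)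
    then have "x y ^ (g + 1) * u y ^ (g - 1 - i) = x y ^ (i + 2) * (x y * u y) ^ (g - 1 - i)"
      by (simp only: power_mult_distrib mult_ac)
    also have "x y * u y = 1"
      using o by simp
    finally show ?thesis
      by (simp only: power_add power_one mult_1_right)
  qed
  have "x y ^ i * x y ^ 2 / (v y * x y ^ (g + 1)) = u y ^ (g - 1 - i) / v y"
    unfolding key using o(2) by simp
  then have fin: "x y ^ i / w y * - (x y ^ 2) = - (u y ^ (g - 1 - i)) / v y"
    unfolding o(4) by simp
  show ?thesis
    unfolding basis_form_x[OF k True w0] dv_x_u[OF k True y(1)] mult.assoc[symmetric] fin ..
qed (use assms in \<open>simp add: basis_form_def\<close>)

text \<open>At every point one of the three expressions of the differentials has a nonvanishing
  denominator: \<open>w\<close>, D'(x), or \<open>v\<close> at the ends.\<close>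

lemma point_cases:
  assumes "y \<in> points M"
  obtains "y \<in> P True" "w y \<noteq> 0" | "y \<in> P True" "poly (pderiv D) (x y) \<noteq> 0" | "y \<in> P False" "y \<notin> P True" "v y \<noteq> 0"
  using assms w0_simple at_end by metis

lemma holomorphic_basis_form:
  assumes i: "i < g"
  shows "holomorphic_form M (basis_form i)"
  unfolding holomorphic_form_def
proof (intro conjI)
  show "\<forall>k p. \<not> (k \<in> atlas M \<and> p \<in> fst k) \<longrightarrow> basis_form i k p = 0"
    by (simp add: basis_form_def)
  show "\<forall>(U, \<phi>)\<in>atlas M. \<forall>(V, \<psi>)\<in>atlas M. \<forall>p\<in>U \<inter> V.
      basis_form i (U, \<phi>) p = basis_form i (V, \<psi>) p * deriv (\<psi> \<circ> inv_into U \<phi>) (\<phi> p)"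
  proof safe
    fix U \<phi> V \<psi> p assume U: "(U, \<phi>) \<in> atlas M" and V: "(V, \<psi>) \<in> atlas M" and p: "p \<in> U" "p \<in> V"
    have "p \<in> points M"
      using chart_subset[OF U] p by blast
    then show "basis_form i (U, \<phi>) p = basis_form i (V, \<psi>) p * deriv (\<psi> \<circ> inv_into U \<phi>) (\<phi> p)"
    proof (cases rule: point_cases)
      case 1
      then show ?thesis
        using basis_form_x[OF U _ 1, of i] basis_form_x[OF V _ 1, of i] deriv_transition[OF U V _ hol(1) P_open] p by simp
    next
      case 2
      then show ?thesis
        using basis_form_w[OF U _ 2, of i] basis_form_w[OF V _ 2, of i] deriv_transition[OF U V _ hol(2) P_open] p by simp
    next
      case 3
      then show ?thesis
        using basis_form_u[OF i U _ 3(1,3)] basis_form_u[OF i V _ 3(1,3)] deriv_transition[OF U V _ hol(3) P_open] p by simp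
    qed
  qed
  show "\<forall>(U, \<phi>)\<in>atlas M. (basis_form i (U, \<phi>) \<circ> inv_into U \<phi>) holomorphic_on \<phi> ` U"
  proof safe
    fix U \<phi> assume U: "(U, \<phi>) \<in> atlas M"
    let ?s = "inv_into U \<phi>"
    have loc: "(basis_form i (U, \<phi>) \<circ> ?s) field_differentiable at (\<phi> y)"
      if S: "openin (top_space M) S" "y \<in> S" and y: "y \<in> U" and c: "holomorphic_fun M S c" and l: "holomorphic_fun M S l"
        and eq: "\<And>z. z \<in> U \<inter> S \<Longrightarrow> basis_form i (U, \<phi>) z = c z * dv l (U, \<phi>) z" for S c l y
    proof -
      let ?T = "\<phi> ` (U \<inter> S)"
      have T: "open ?T"
        by (rule chart_image_open[OF U S(1)])
      have "(\<lambda>z. (c \<circ> ?s) z * deriv (l \<circ> ?s) z) holomorphic_on ?T"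
        by (intro holomorphic_on_mult holomorphic_deriv T holomorphic_fun_chart[OF U] c l)
      then have "(basis_form i (U, \<phi>) \<circ> ?s) holomorphic_on ?T"
        by (rule holomorphic_transform) (use eq U in auto)
      then show ?thesis
        using T S(2) y by (intro holomorphic_on_imp_differentiable_at) auto
    qed
    have "(basis_form i (U, \<phi>) \<circ> ?s) field_differentiable at (\<phi> y)" if y: "y \<in> U" for y
    proof -
      have "y \<in> points M"
        using chart_subset[OF U] y by blast
      then show ?thesis
      proof (cases rule: point_cases)
        case 1
        show ?thesis
        proof (rule loc[OF _ _ y])
          show "openin (top_space M) {z \<in> P True. w z \<in> - {0}}"
            by (rule holomorphic_fun_open_preimage[OF hol(2) P_open]) auto
          show "holomorphic_fun M {z \<in> P True. w z \<in> - {0}} (\<lambda>z. x z ^ i * inverse (w z))"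
            by (intro holomorphic_fun_mult holomorphic_fun_inverse holomorphic_fun_comp[of _ x "\<lambda>t. t ^ i" UNIV]
                holomorphic_fun_subset[OF hol(1)] holomorphic_fun_subset[OF hol(2)]) (auto intro!: holomorphic_intros)
          show "holomorphic_fun M {z \<in> P True. w z \<in> - {0}} x"
            by (rule holomorphic_fun_subset[OF hol(1)]) blast
        qed (use 1 in \<open>simp_all add: basis_form_x U divide_inverse\<close>)
      next
        case 2
        show ?thesis
        proof (rule loc[OF _ _ y])
          show "openin (top_space M) {z \<in> P True. poly (pderiv D) (x z) \<in> - {0}}"
            by (rule holomorphic_fun_open_preimage[OF holomorphic_fun_poly[OF hol(1)] P_open]) auto
          show "holomorphic_fun M {z \<in> P True. poly (pderiv D) (x z) \<in> - {0}} (\<lambda>z. 2 * x z ^ i * inverse (poly (pderiv D) (x z)))"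
            by (intro holomorphic_fun_mult holomorphic_fun_inverse holomorphic_fun_comp[of _ x "\<lambda>t. t ^ i" UNIV] holomorphic_fun_const
                holomorphic_fun_poly holomorphic_fun_subset[OF hol(1)]) (auto intro!: holomorphic_intros)
          show "holomorphic_fun M {z \<in> P True. poly (pderiv D) (x z) \<in> - {0}} w"
            by (rule holomorphic_fun_subset[OF hol(2)]) blast
        qed (use 2 in \<open>simp_all add: basis_form_w U divide_inverse\<close>)
      next
        case 3
        show ?thesis
        proof (rule loc[OF _ _ y])
          show "openin (top_space M) {z \<in> P False. v z \<in> - {0}}"
            by (rule holomorphic_fun_open_preimage[OF hol(4) P_open]) auto
          show "holomorphic_fun M {z \<in> P False. v z \<in> - {0}} (\<lambda>z. - (u z ^ (g - 1 - i)) * inverse (v z))"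
            by (intro holomorphic_fun_mult holomorphic_fun_inverse holomorphic_fun_comp[of _ u "\<lambda>t. - (t ^ (g - 1 - i))" UNIV]
                holomorphic_fun_subset[OF hol(3)] holomorphic_fun_subset[OF hol(4)]) (auto intro!: holomorphic_intros)
          show "holomorphic_fun M {z \<in> P False. v z \<in> - {0}} u"
            by (rule holomorphic_fun_subset[OF hol(3)]) blast
        qed (use 3 i in \<open>simp_all add: basis_form_u[OF i] U divide_inverse\<close>)
      qed
    qed
    then show "(basis_form i (U, \<phi>) \<circ> ?s) holomorphic_on \<phi> ` U"
      by (auto simp: holomorphic_on_def intro: field_differentiable_at_within)
  qed
qed

end

section \<open>Every holomorphic differential is a combination of the basis, and the genus\<close>

context hyp
begin

text \<open>A differential is written as \<open>h dx/w\<close>. The functions \<open>h + h \<circ> J\<close> and \<open>(h - h \<circ> J)\<^sup>2\<close> descend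
  to polynomials in \<open>x\<close>, and the latter has more zeros than its degree allows.\<close>

lemma form_coefficient:
  assumes \<omega>: "holomorphic_form M \<omega>"
  obtains h where "holomorphic_fun M (P True) h"
    "\<And>k y. k \<in> atlas M \<Longrightarrow> y \<in> fst k \<Longrightarrow> y \<in> P True \<Longrightarrow> \<omega> k y * w y = h y * dv x k y"
    "\<And>k y. k \<in> atlas M \<Longrightarrow> y \<in> fst k \<Longrightarrow> y \<in> P True \<Longrightarrow> w y = 0 \<Longrightarrow> \<omega> k y * poly (pderiv D) (x y) = 2 * h y * dv w k y"
proof -
  have side: "side_poly D True = D"
    by (simp add: side_poly_def)
  have \<kappa>x: "fst (\<kappa> True y) = x y" "snd (\<kappa> True y) = w y" for y
    by (simp_all add: x_eq w_eq)
  have fs: "fst \<noteq> (snd :: complex \<times> complex \<Rightarrow> complex)"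
    by (metis fst_conv snd_conv zero_neq_one)
  have xchart: "\<exists>U. (U, x) \<in> atlas M \<and> y \<in> U \<and> U \<subseteq> P True \<and> (\<forall>z\<in>U. w z \<noteq> 0)" if y: "y \<in> P True" "w y \<noteq> 0" for y
  proof -
    have "(fst = fst \<and> snd (\<kappa> True y) \<noteq> 0) \<or> (fst = (snd :: complex \<times> complex \<Rightarrow> complex) \<and> poly (pderiv (side_poly D True)) (fst (\<kappa> True y)) \<noteq> 0)"
      using y(2) by (simp add: \<kappa>x)
    then show ?thesis
    proof (rule chart_with[OF y(1)], goal_cases)
      case (1 U)
      have "w z \<noteq> 0" if "z \<in> U" for z
        using 1(4)[OF that] fs unfolding \<kappa>x by simp
      then show ?case
        by (intro exI[of _ U]) (use 1(1-3) in \<open>simp add: x_eq\<close>)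
    qed
  qed
  have wchart: "\<exists>U. (U, w) \<in> atlas M \<and> y \<in> U \<and> U \<subseteq> P True \<and> (\<forall>z\<in>U. poly (pderiv D) (x z) \<noteq> 0)"
    if y: "y \<in> P True" "poly (pderiv D) (x y) \<noteq> 0" for y
  proof -
    have "(snd = fst \<and> snd (\<kappa> True y) \<noteq> 0) \<or> (snd = (snd :: complex \<times> complex \<Rightarrow> complex) \<and> poly (pderiv (side_poly D True)) (fst (\<kappa> True y)) \<noteq> 0)"
      unfolding \<kappa>x unfolding side using y(2) by simp
    then show ?thesis
    proof (rule chart_with[OF y(1)], goal_cases)
      case (1 U)
      have "poly (pderiv D) (x z) \<noteq> 0" if "z \<in> U" for z
        using 1(4)[OF that] fs unfolding \<kappa>x unfolding side by simp
      then show ?case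
        by (intro exI[of _ U]) (use 1(1-3) in \<open>simp add: w_eq\<close>)
    qed
  qed
  define ux where "ux y = (SOME U. (U, x) \<in> atlas M \<and> y \<in> U)" for y
  define uw where "uw y = (SOME U. (U, w) \<in> atlas M \<and> y \<in> U)" for y
  have ux: "(ux y, x) \<in> atlas M \<and> y \<in> ux y" if y: "y \<in> P True" "w y \<noteq> 0" for y
    unfolding ux_def by (rule someI_ex) (use xchart[OF y] in blast)
  have uw: "(uw y, w) \<in> atlas M \<and> y \<in> uw y" if y: "y \<in> P True" "w y = 0" for y
    unfolding uw_def by (rule someI_ex) (use wchart[OF y(1) w0_simple[OF y]] in blast)
  \<comment> \<open>Where \<open>w\<close> is nonzero, \<open>h\<close> is the coefficient in the
    chart \<open>x\<close> times \<open>w\<close>; at branch points dx / w = 2 dw / D'(x) gives the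
    other formula. The chosen charts do not matter, by the transformation law.\<close>
  define h where "h y = (if w y \<noteq> 0 then \<omega> (ux y, x) y * w y else \<omega> (uw y, w) y * poly (pderiv D) (x y) / 2)" for y
  have hx: "\<omega> k y * w y = h y * dv x k y" if k: "k \<in> atlas M" "y \<in> fst k" and y: "y \<in> P True" "w y \<noteq> 0" for k y
    using form_law[OF \<omega> k, of "ux y" x] ux[OF y] y(2) by (simp add: h_def)
  have hw: "\<omega> k y * poly (pderiv D) (x y) = 2 * h y * dv w k y"
    if k: "k \<in> atlas M" "y \<in> fst k" and y: "y \<in> P True" "w y = 0" for k y
    using form_law[OF \<omega> k, of "uw y" w] uw[OF y] y(2) by (simp add: h_def)
  \<comment> \<open>At a branch point both sides vanish: D'(x) dx = 2 w dw = 0 there and D'(x) is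
    nonzero.\<close>
  have hx0: "\<omega> k y * w y = h y * dv x k y" if k: "k \<in> atlas M" "y \<in> fst k" and y: "y \<in> P True" for k y
  proof (cases "w y = 0")
    case True
    have "poly (pderiv D) (x y) * dv x k y = 0"
      using dv_w[OF k y] True by simp
    then show ?thesis
      using w0_simple[OF y True] True by simp
  qed (rule hx[OF k y])
  have hw0: "\<omega> k y * poly (pderiv D) (x y) = 2 * h y * dv w k y" if k: "k \<in> atlas M" "y \<in> fst k" and y: "y \<in> P True" for k y
  proof (cases "w y = 0")
    case False
    have "\<omega> k y * poly (pderiv D) (x y) * w y = h y * (poly (pderiv D) (x y) * dv x k y)"
      using hx[OF k y False] by (simp add: mult_ac)
    also have "\<dots> = 2 * h y * dv w k y * w y"
      unfolding dv_w[OF k y, symmetric] by (simp add: mult_ac)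
    finally show ?thesis
      using False by simp
  qed (rule hw[OF k y])
  have "holomorphic_fun M (P True) h"
  proof (rule holomorphic_funI[OF P_open])
    fix y assume y: "y \<in> P True"
    have fh: "(\<omega> (U, l) \<circ> inv_into U l) holomorphic_on l ` U" if "(U, l) \<in> atlas M" for U l
      using \<omega> that unfolding holomorphic_form_def by blast
    show "\<exists>U \<phi> W. (U, \<phi>) \<in> atlas M \<and> y \<in> U \<and> open W \<and> \<phi> y \<in> W \<and> (h \<circ> inv_into U \<phi>) holomorphic_on W"
    proof (cases "w y = 0")
      case False
      then obtain U where U: "(U, x) \<in> atlas M" "y \<in> U" "U \<subseteq> P True"
        using xchart[OF y] by blast
      have hw: "(w \<circ> inv_into U x) holomorphic_on x ` U"
        using holomorphic_fun_chart[OF U(1) hol(2)] U(3) by (simp only: Int_absorb2)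
      have "(\<lambda>z. (\<omega> (U, x) \<circ> inv_into U x) z * (w \<circ> inv_into U x) z) holomorphic_on x ` U"
        by (rule holomorphic_on_mult[OF fh[OF U(1)] hw])
      then have "(h \<circ> inv_into U x) holomorphic_on x ` U"
      proof (rule holomorphic_transform)
        fix z assume "z \<in> x ` U"
        then obtain t where t: "t \<in> U" "z = x t"
          by blast
        then show "(\<omega> (U, x) \<circ> inv_into U x) z * (w \<circ> inv_into U x) z = (h \<circ> inv_into U x) z"
          using hx0[of "(U, x)" t] dv_self[OF U(1) t(1)] U by (auto simp: subset_iff)
      qed
      then show ?thesis
        using U chart_open(2)[OF U(1)] by blast
    next
      case True
      then obtain U where U: "(U, w) \<in> atlas M" "y \<in> U" "U \<subseteq> P True"
        using wchart[OF y w0_simple[OF y]] by blast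
      have hp: "((\<lambda>y. poly (pderiv D) (x y)) \<circ> inv_into U w) holomorphic_on w ` U"
        using holomorphic_fun_chart[OF U(1) holomorphic_fun_poly[OF hol(1), of "pderiv D"]] U(3) by (simp only: Int_absorb2)
      have "(\<lambda>z. (\<omega> (U, w) \<circ> inv_into U w) z * ((\<lambda>y. poly (pderiv D) (x y)) \<circ> inv_into U w) z / 2) holomorphic_on w ` U"
        by (rule holomorphic_on_divide[OF holomorphic_on_mult[OF fh[OF U(1)] hp] holomorphic_on_const]) simp
      then have "(h \<circ> inv_into U w) holomorphic_on w ` U"
      proof (rule holomorphic_transform)
        fix z assume "z \<in> w ` U"
        then obtain t where t: "t \<in> U" "z = w t"
          by blast
        then show "(\<omega> (U, w) \<circ> inv_into U w) z * ((\<lambda>y. poly (pderiv D) (x y)) \<circ> inv_into U w) z / 2 = (h \<circ> inv_into U w) z"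
          using hw0[of "(U, w)" t] dv_self[OF U(1) t(1)] U by (auto simp: subset_iff)
      qed
      then show ?thesis
        using U chart_open(2)[OF U(1)] by blast
    qed
  qed
  then show thesis
    using that hx0 hw by blast
qed

text \<open>Near an end dx / w = - u^(g-1) du / v in terms of powers of x = 1 / u. So h / x^g is
  minus the coefficient of the form in the chart \<open>u\<close> times v u, and \<open>u\<close>
  tends to 0.\<close>

lemma form_coefficient_end:
  assumes \<omega>: "holomorphic_form M \<omega>" and h: "holomorphic_fun M (P True) h"
    "\<And>k y. k \<in> atlas M \<Longrightarrow> y \<in> fst k \<Longrightarrow> y \<in> P True \<Longrightarrow> \<omega> k y * w y = h y * dv x k y"
    and p: "p \<in> points M" "p \<notin> P True"
  shows "((\<lambda>y. h y / x y ^ g) \<longlongrightarrow> 0) (atin (top_space M) p)"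
proof -
  note e = at_end[OF p]
  have "(fst = fst \<and> snd (\<kappa> False p) \<noteq> 0) \<or> (fst = (snd :: complex \<times> complex \<Rightarrow> complex) \<and> poly (pderiv (side_poly D False)) (fst (\<kappa> False p)) \<noteq> 0)"
    using e(3) by (simp add: v_def)
  from chart_with[OF e(1) this] obtain U where "(U, fst \<circ> \<kappa> False) \<in> atlas M" "p \<in> U" "U \<subseteq> P False"
    by metis
  then have U: "(U, u) \<in> atlas M" "p \<in> U" "U \<subseteq> P False"
    by (simp_all add: u_def)
  have "(\<omega> (U, u) \<circ> inv_into U u) holomorphic_on u ` U"
    using \<omega> U(1) unfolding holomorphic_form_def by blast
  then have "((\<omega> (U, u) \<circ> inv_into U u) \<longlongrightarrow> (\<omega> (U, u) \<circ> inv_into U u) (u p)) (at (u p))"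
    using chart_open(2)[OF U(1)] U(2)
    by (metis at_within_open continuous_on_def holomorphic_on_imp_continuous_on imageI)
  then have l\<omega>: "(\<omega> (U, u) \<longlongrightarrow> \<omega> (U, u) p) (atin (top_space M) p)"
    unfolding filterlim_atin_chart[OF U(1,2)] using U(1,2) by simp
  have lu: "(u \<longlongrightarrow> u p) (atin (top_space M) p)" and lv: "(v \<longlongrightarrow> v p) (atin (top_space M) p)"
    by (rule holomorphic_fun_tendsto[OF hol(3) P_open e(1)] holomorphic_fun_tendsto[OF hol(4) P_open e(1)])+
  have "((\<lambda>y. - \<omega> (U, u) y * v y * u y) \<longlongrightarrow> - \<omega> (U, u) p * v p * u p) (atin (top_space M) p)"
    by (intro tendsto_intros l\<omega> lu lv)
  then have "((\<lambda>y. - \<omega> (U, u) y * v y * u y) \<longlongrightarrow> 0) (atin (top_space M) p)"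
    by (simp add: e(2))
  then show ?thesis
  proof (rule Lim_transform_eventually)
    have fin: "finite (points M - P True)"
      unfolding affine_part(1)[symmetric] by (rule finite_subset[of _ "{Inr True, Inr False}"]) auto
    show "eventually (\<lambda>y. - \<omega> (U, u) y * v y * u y = h y / x y ^ g) (atin (top_space M) p)"
      unfolding eventually_atin
    proof (intro disjI2 exI[of _ "U - (points M - P True - {p})"] conjI ballI)
      show "openin (top_space M) (U - (points M - P True - {p}))"
        using fin by (intro openin_Diff_finite chart_open(1)[OF U(1)]) auto
      fix y assume y: "y \<in> U - (points M - P True - {p}) - {p}"
      then have yU: "y \<in> U" "y \<in> P True" "y \<in> P False"
        using U(3) chart_subset[OF U(1)] by auto
      note o = overlap[OF yU(2,3)]
      have "\<omega> (U, u) y * w y = h y * (- (x y ^ 2))"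
        using h(2)[of "(U, u)" y] dv_x_u[of "(U, u)" y] dv_self[OF U(1) yU(1)] yU U(1) by simp
      then have "x y ^ 2 * h y = - (\<omega> (U, u) y * (v y * x y ^ (g + 1)))"
        unfolding o(4) by (simp add: mult_ac)
      also have "\<dots> = (x y * u y) * - (\<omega> (U, u) y * (v y * x y ^ (g + 1)))"
        using o(1,3) by simp
      also have "\<dots> = x y ^ 2 * (- \<omega> (U, u) y * v y * u y * x y ^ g)"
        by (simp add: power2_eq_square mult_ac)
      finally have "x y ^ 2 * h y = x y ^ 2 * (- \<omega> (U, u) y * v y * u y * x y ^ g)" .
      then have "h y = - \<omega> (U, u) y * v y * u y * x y ^ g"
        using o(2) by (metis mult_left_cancel power_not_zero)
      then show "- \<omega> (U, u) y * v y * u y = h y / x y ^ g"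
        using o(2) by simp
    qed (use U p in auto)
  qed
qed

lemma form_coefficient_poly:
  assumes \<omega>: "holomorphic_form M \<omega>" and h: "holomorphic_fun M (P True) h"
    "\<And>k y. k \<in> atlas M \<Longrightarrow> y \<in> fst k \<Longrightarrow> y \<in> P True \<Longrightarrow> \<omega> k y * w y = h y * dv x k y"
  obtains c where "\<And>y. y \<in> P True \<Longrightarrow> h y = (\<Sum>i<g. c i * x y ^ i)"
proof -
  interpret dc: double_cover M hyp_involution x "Inr True" "Inr False"
    by (rule cover)
  have h': "holomorphic_fun M (points M - {Inr True, Inr False}) h"
    using h(1) affine_part by simp
  obtain s where s: "eventually (\<lambda>t. s t \<in> points M - {Inr True, Inr False} \<and> x (s t) = t) at_infinity"
    "filterlim s (atin (top_space M) (Inr True)) at_infinity"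
    "filterlim (\<lambda>t. hyp_involution (s t)) (atin (top_space M) (Inr False)) at_infinity"
    by (rule dc.section_at_infinity)
  have ends: "Inr b \<in> points M" "Inr b \<notin> P True" for b
    using ends_in(1,2) affine_part(2) by (cases b; force)+
  have l1: "((\<lambda>t. h (s t) / t ^ g) \<longlongrightarrow> 0) at_infinity"
    using filterlim_compose[OF form_coefficient_end[OF \<omega> h ends] s(2)]
  proof (rule Lim_transform_eventually)
    show "eventually (\<lambda>t. h (s t) / x (s t) ^ g = h (s t) / t ^ g) at_infinity"
      using s(1) by (rule eventually_mono) simp
  qed
  have l2: "((\<lambda>t. h (hyp_involution (s t)) / t ^ g) \<longlongrightarrow> 0) at_infinity"
    using filterlim_compose[OF form_coefficient_end[OF \<omega> h ends] s(3)]
  proof (rule Lim_transform_eventually)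
    show "eventually (\<lambda>t. h (hyp_involution (s t)) / x (hyp_involution (s t)) ^ g = h (hyp_involution (s t)) / t ^ g) at_infinity"
      using s(1) by (rule eventually_mono) (simp add: dc.X_J)
  qed
  obtain S where S: "S holomorphic_on UNIV" "\<And>y. y \<in> points M - {Inr True, Inr False} \<Longrightarrow> S (x y) = h y + h (hyp_involution y)"
  proof (rule dc.symmetric_descent[OF h', of "(+)"])
    show "(\<lambda>x. f x + g x) holomorphic_on W" if "f holomorphic_on W" "g holomorphic_on W" for W and f g :: "complex \<Rightarrow> complex"
      using that by (rule holomorphic_on_add)
    show "continuous_on UNIV (\<lambda>(a, b). a + b :: complex)"
      unfolding case_prod_unfold by (intro continuous_intros)
  qed (simp_all add: add.commute)
  obtain T where T: "T holomorphic_on UNIV" "\<And>y. y \<in> points M - {Inr True, Inr False} \<Longrightarrow> T (x y) = (h y - h (hyp_involution y)) ^ 2"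
  proof (rule dc.symmetric_descent[OF h', of "\<lambda>a b. (a - b) ^ 2"])
    show "(\<lambda>x. (f x - g x) ^ 2) holomorphic_on W" if "f holomorphic_on W" "g holomorphic_on W" for W and f g :: "complex \<Rightarrow> complex"
      using that by (intro holomorphic_intros)
    show "continuous_on UNIV (\<lambda>(a, b). (a - b) ^ 2 :: complex)"
      unfolding case_prod_unfold by (intro continuous_intros)
  qed (simp_all add: power2_commute)
  have "((\<lambda>t. h (s t) / t ^ g + h (hyp_involution (s t)) / t ^ g) \<longlongrightarrow> 0 + 0) at_infinity"
    by (rule tendsto_add[OF l1 l2])
  then have "((\<lambda>t. S t / t ^ g) \<longlongrightarrow> 0 + 0) at_infinity"
  proof (rule Lim_transform_eventually)
    show "eventually (\<lambda>t. h (s t) / t ^ g + h (hyp_involution (s t)) / t ^ g = S t / t ^ g) at_infinity"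
      using s(1)
    proof eventually_elim
      case (elim t)
      then show ?case
        using S(2)[of "s t"] by (simp add: add_divide_distrib)
    qed
  qed
  then obtain PS where PS: "degree PS \<le> g" "coeff PS g = 0" "\<And>t. S t = poly PS t"
    using entire_is_poly_limit[OF S(1)] by (metis add_0)
  have "((\<lambda>t. (h (s t) / t ^ g - h (hyp_involution (s t)) / t ^ g) ^ 2) \<longlongrightarrow> (0 - 0) ^ 2) at_infinity"
    by (intro tendsto_intros l1 l2)
  then have "((\<lambda>t. T t / t ^ (2 * g)) \<longlongrightarrow> (0 - 0) ^ 2) at_infinity"
  proof (rule Lim_transform_eventually)
    show "eventually (\<lambda>t. (h (s t) / t ^ g - h (hyp_involution (s t)) / t ^ g) ^ 2 = T t / t ^ (2 * g)) at_infinity"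
      using s(1)
    proof eventually_elim
      case (elim t)
      have "(h (s t) / t ^ g - h (hyp_involution (s t)) / t ^ g) ^ 2 = (h (s t) - h (hyp_involution (s t))) ^ 2 / t ^ (2 * g)"
        by (simp add: diff_divide_distrib[symmetric] power_divide power_mult[symmetric] mult.commute)
      then show ?case
        using T(2)[of "s t"] elim by simp
    qed
  qed
  then obtain PT where PT: "degree PT \<le> 2 * g" "\<And>t. T t = poly PT t"
    using entire_is_poly_limit[OF T(1)] by metis
  \<comment> \<open>At a fixed point the two values of \<open>h\<close> agree, so \<open>PT\<close>
    vanishes at the 2g + 2 roots of \<open>D\<close>, while its degree is at most 2g.\<close>
  have "PT = 0"
  proof (rule ccontr)
    assume "PT \<noteq> 0"
    then have "card {t. poly PT t = 0} \<le> 2 * g" "finite {t. poly PT t = 0}"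
      using card_poly_roots_bound[of PT] poly_roots_finite[of PT] PT(1) by auto
    moreover have "roots D \<subseteq> {t. poly PT t = 0}"
    proof
      fix e assume "e \<in> roots D"
      then have "e \<in> x ` {y \<in> points M - {Inr True, Inr False}. hyp_involution y = y}"
        using branch_eq by simp
      then obtain y where "y \<in> points M - {Inr True, Inr False}" "hyp_involution y = y" "e = x y"
        by blast
      then show "e \<in> {t. poly PT t = 0}"
        using T(2)[of y] PT(2) by simp
    qed
    ultimately have "card (roots D) \<le> 2 * g"
      using card_mono le_trans by blast
    then show False
      using card_roots by simp
  qed
  have "h y = (\<Sum>i<g. coeff PS i / 2 * x y ^ i)" if "y \<in> P True" for y
  proof -
    have y: "y \<in> points M - {Inr True, Inr False}"
      using that affine_part by simp
    have "h y = h (hyp_involution y)"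
      using T(2)[OF y] PT(2) \<open>PT = 0\<close> by simp
    then have "2 * h y = poly PS (x y)"
      using S(2)[OF y] PS(3) by simp
    also have "poly PS (x y) = (\<Sum>i<g. coeff PS i * x y ^ i)"
      unfolding poly_altdef
    proof (rule sum.mono_neutral_cong)
      fix i assume "i \<in> {..<g} - {..degree PS}"
      then show "coeff PS i * x y ^ i = 0"
        by (simp add: coeff_eq_0)
    next
      \<comment> \<open>The only index left is \<open>g\<close>, whose coefficient is the limit 0 at
        infinity.\<close>
      fix i assume "i \<in> {..degree PS} - {..<g}"
      then have "i = g"
        using PS(1) by auto
      then show "coeff PS i * x y ^ i = 0"
        using PS(2) by simp
    qed auto
    finally have "h y = (\<Sum>i<g. coeff PS i * x y ^ i) / 2"
      by (simp add: field_simps)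
    then show ?thesis
      by (simp add: sum_divide_distrib)
  qed
  then show thesis
    by (rule that)
qed

theorem genus: "has_genus M g"
  unfolding has_genus_def
proof (intro exI[of _ basis_form] conjI allI impI)
  show "holomorphic_form M (basis_form i)" if "i < g" for i
    by (rule holomorphic_basis_form[OF that])
  fix \<omega> assume \<omega>: "holomorphic_form M \<omega>"
  obtain h where h: "holomorphic_fun M (P True) h"
    "\<And>k y. k \<in> atlas M \<Longrightarrow> y \<in> fst k \<Longrightarrow> y \<in> P True \<Longrightarrow> \<omega> k y * w y = h y * dv x k y"
    "\<And>k y. k \<in> atlas M \<Longrightarrow> y \<in> fst k \<Longrightarrow> y \<in> P True \<Longrightarrow> w y = 0 \<Longrightarrow> \<omega> k y * poly (pderiv D) (x y) = 2 * h y * dv w k y"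
    using form_coefficient[OF \<omega>] by blast
  obtain c where c: "\<And>y. y \<in> P True \<Longrightarrow> h y = (\<Sum>i<g. c i * x y ^ i)"
    using form_coefficient_poly[OF \<omega> h(1,2)] by blast
  \<comment> \<open>\<open>has_genus\<close> requires the coefficients from index \<open>g\<close>
    on to be 0, while \<open>c\<close> is only determined below \<open>g\<close>.\<close>
  define c' where "c' i = (if i < g then c i else 0)" for i
  define B where "B k y = (\<Sum>i<g. c' i * basis_form i k y)" for k y
  have c'sum: "(\<Sum>i<g. c' i * t ^ i) = (\<Sum>i<g. c i * t ^ i)" for t
    by (simp add: c'_def)
  have aff: "\<omega> k y = B k y" if k: "k \<in> atlas M" "y \<in> fst k" and y: "y \<in> P True" for k y
  proof (cases "w y = 0")
    case True
    have "B k y = (\<Sum>i<g. c' i * x y ^ i) * (2 / poly (pderiv D) (x y) * dv w k y)"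
      unfolding B_def sum_distrib_right
      by (intro sum.cong refl) (simp add: basis_form_w[OF k y w0_simple[OF y True]])
    also have "\<dots> = h y * (2 / poly (pderiv D) (x y) * dv w k y)"
      by (simp only: c'sum c[OF y])
    finally have "B k y * poly (pderiv D) (x y) = \<omega> k y * poly (pderiv D) (x y)"
      using h(3)[OF k y True] w0_simple[OF y True] by simp
    then show ?thesis
      using w0_simple[OF y True] by simp
  next
    case False
    have "B k y = (\<Sum>i<g. c' i * x y ^ i) * (1 / w y * dv x k y)"
      unfolding B_def sum_distrib_right
      by (intro sum.cong refl) (simp add: basis_form_x[OF k y False])
    also have "\<dots> = h y * (1 / w y * dv x k y)"
      by (simp only: c'sum c[OF y])
    finally have "B k y * w y = \<omega> k y * w y"
      using h(2)[OF k y] False by simp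
    then show ?thesis
      using False by simp
  qed
  have eq: "\<omega> k y = B k y" for k y
  proof (cases "k \<in> atlas M \<and> y \<in> fst k")
    case False
    have "\<forall>k p. \<not> (k \<in> atlas M \<and> p \<in> fst k) \<longrightarrow> \<omega> k p = 0"
      using \<omega> unfolding holomorphic_form_def by blast
    then have "\<omega> k y = 0" "\<And>i. basis_form i k y = 0"
      using False by (blast, simp only: basis_form_def False if_False)
    then show ?thesis
      by (simp add: B_def)
  next
    case True
    show ?thesis
    proof (cases "y \<in> P True")
      case True
      then show ?thesis
        using aff \<open>k \<in> atlas M \<and> y \<in> fst k\<close> by blast
    next
      case False
      obtain U \<phi> where k: "k = (U, \<phi>)"
        by fastforce
      have U: "(U, \<phi>) \<in> atlas M" "y \<in> U"
        using True k by auto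
      \<comment> \<open>The expansion is known off the ends. In a fixed chart the coefficients of a
        holomorphic form are continuous, so the equality extends to the ends.\<close>
      have lim: "(\<eta> k \<longlongrightarrow> \<eta> k y) (atin (top_space M) y)" if \<eta>: "holomorphic_form M \<eta>" for \<eta>
      proof -
        have "(\<eta> k \<circ> inv_into U \<phi>) holomorphic_on \<phi> ` U"
          using \<eta> U(1) unfolding holomorphic_form_def k by blast
        then have "((\<eta> k \<circ> inv_into U \<phi>) \<longlongrightarrow> (\<eta> k \<circ> inv_into U \<phi>) (\<phi> y)) (at (\<phi> y))"
          using chart_open(2)[OF U(1)] U(2)
          by (metis at_within_open continuous_on_def holomorphic_on_imp_continuous_on imageI)
        then show ?thesis
          unfolding filterlim_atin_chart[OF U(1,2)] using U(1,2) by simp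
      qed
      have "(B k \<longlongrightarrow> B k y) (atin (top_space M) y)"
        unfolding B_def by (intro tendsto_sum tendsto_mult tendsto_const lim holomorphic_basis_form) simp
      moreover have "(B k \<longlongrightarrow> \<omega> k y) (atin (top_space M) y)"
        using lim[OF \<omega>]
      proof (rule Lim_transform_eventually)
        have fin: "finite (points M - P True)"
          unfolding affine_part(1)[symmetric] by (rule finite_subset[of _ "{Inr True, Inr False}"]) auto
        show "eventually (\<lambda>z. \<omega> k z = B k z) (atin (top_space M) y)"
          unfolding eventually_atin
        proof (intro disjI2 exI[of _ "U - (points M - P True - {y})"] conjI ballI)
          show "openin (top_space M) (U - (points M - P True - {y}))"
            using fin by (intro openin_Diff_finite chart_open(1)[OF U(1)]) auto
          fix z assume "z \<in> U - (points M - P True - {y}) - {y}"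
          then show "\<omega> k z = B k z"
            using chart_subset[OF U(1)] U(1) k by (intro aff) auto
        qed (use U in auto)
      qed
      moreover have "atin (top_space M) y \<noteq> bot"
        using atin_nontrivial chart_subset[OF U(1)] U(2) by blast
      ultimately show ?thesis
        using tendsto_unique by blast
    qed
  qed
  show "\<exists>!c. (\<forall>i\<ge>g. c i = 0) \<and> \<omega> = (\<lambda>k p. \<Sum>i<g. c i * basis_form i k p)"
  proof (rule ex1I[of _ c'])
    show "(\<forall>i\<ge>g. c' i = 0) \<and> \<omega> = (\<lambda>k p. \<Sum>i<g. c' i * basis_form i k p)"
    proof
      show "\<omega> = (\<lambda>k p. \<Sum>i<g. c' i * basis_form i k p)"
        using eq unfolding B_def by (intro ext)
    qed (simp add: c'_def)
    fix d assume d: "(\<forall>i\<ge>g. d i = 0) \<and> \<omega> = (\<lambda>k p. \<Sum>i<g. d i * basis_form i k p)"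
    \<comment> \<open>In the chart \<open>x\<close> the difference of two expansions is a polynomial
      in \<open>t\<close>, divided by \<open>w\<close>. It vanishes at every \<open>t\<close> that
      is not a root of \<open>D\<close>, hence at infinitely many points.\<close>
    define q where "q = (\<Sum>i<g. monom (d i - c' i) i)"
    have "poly q t = 0" if t: "t \<notin> roots D" for t
    proof -
      have "(t, csqrt (poly D t)) \<in> affine_curve D"
        by (simp add: affine_curve_iff)
      then obtain y where y: "y \<in> P True" "x y = t" "w y = csqrt (poly D t)"
        using xw_psi affine_part(2) by (metis imageI)
      then have w0: "w y \<noteq> 0"
        using t by (auto simp: roots_def)
      obtain k where k: "k \<in> atlas M" "y \<in> fst k" "dv x k y = 1"
      proof -
        have "(fst = fst \<and> snd (\<kappa> True y) \<noteq> 0) \<or> (fst = (snd :: complex \<times> complex \<Rightarrow> complex) \<and> poly (pderiv (side_poly D True)) (fst (\<kappa> True y)) \<noteq> 0)"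
          using w0 by (simp add: w_eq)
        from chart_with[OF y(1) this] obtain U where "(U, fst \<circ> \<kappa> True) \<in> atlas M" "y \<in> U"
          by metis
        then have U: "(U, x) \<in> atlas M" "y \<in> U"
          by (simp_all add: x_eq)
        show ?thesis
          by (rule that[of "(U, x)"]) (use U dv_self[OF U] in auto)
      qed
      have "(\<Sum>i<g. d i * basis_form i k y) = (\<Sum>i<g. c' i * basis_form i k y)"
        using d eq[of k y] unfolding B_def by metis
      then have "(\<Sum>i<g. (d i - c' i) * t ^ i) / w y = 0"
        using basis_form_x[OF k(1,2) y(1) w0] k(3) y(2)
        by (simp add: sum_divide_distrib left_diff_distrib sum_subtractf diff_divide_distrib)
      then show ?thesis
        using w0 by (simp add: q_def poly_sum poly_monom)
    qed
    then have "- roots D \<subseteq> {t. poly q t = 0}"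
      by blast
    moreover have "infinite (- roots D)"
      using finite_compl[of "roots D"] D_props(1) poly_roots_finite[of D] infinite_UNIV_char_0
      by (auto simp: roots_def)
    ultimately have "q = 0"
      using poly_roots_finite finite_subset by blast
    have "d i = c' i" if "i < g" for i
    proof -
      have "coeff q i = (\<Sum>j<g. if j = i then d j - c' j else 0)"
        by (simp add: q_def coeff_sum)
      also have "\<dots> = d i - c' i"
        using that by simp
      finally show ?thesis
        using \<open>q = 0\<close> by simp
    qed
    then show "d = c'"
      using d by (auto simp: c'_def fun_eq_iff)
  qed
qed

theorem hyperelliptic_M: "hyperelliptic g M hyp_involution"
  unfolding hyperelliptic_def
proof (intro conjI ballI)
  show "hyp_involution (hyp_involution p) = p" for p
    by (cases p) auto
  show "\<exists>p\<in>points M. hyp_involution p \<noteq> p"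
    using ends_in(1) by (intro bexI[of _ "Inr True"]) auto
  show "\<exists>\<pi>. quotient_to_sphere M hyp_involution \<pi>"
    using quotient_proj by blast
qed (fact riemann_surface_M genus holomorphic_map_involution)+

lemma branch_data_M: "(Some ` roots D, {None}) \<in> branch_data (M, hyp_involution, {Inr True, Inr False})"
proof -
  have pM: "points M = P True \<union> {Inr True, Inr False}"
  proof -
    have gen: "A = B \<union> E" if "A - E = B" "E \<subseteq> A" for A B E :: "pt set"
      using that by blast
    show ?thesis
      by (rule gen[OF affine_part(1)]) (use ends_in in simp)
  qed
  have "{p \<in> points M. hyp_involution p = p} = Inl ` (\<lambda>e. (e, 0)) ` roots D"
    unfolding pM affine_part(2) by (auto simp: affine_curve_iff roots_def image_iff)
  then have "hyp_proj ` {p \<in> points M. hyp_involution p = p} = Some ` roots D"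
    by (simp add: image_image)
  moreover have "hyp_proj ` {Inr True, Inr False} = {None}"
    by simp
  ultimately show ?thesis
    unfolding branch_data_def case_prod_conv mem_Collect_eq
    by (intro exI[of _ hyp_proj]) (simp add: quotient_proj)
qed

end

section \<open>The Riemann sphere and its automorphisms\<close>

text \<open>With \<open>to_inv\<close>, the chart of the sphere at infinity and its inverse; the
  values lie in the complement of \<open>Some 0\<close>.\<close>

definition from_inv :: "complex \<Rightarrow> complex option" where
  "from_inv u = (if u = 0 then None else Some (inverse u))"

definition to_inv :: "complex option \<Rightarrow> complex" where
  "to_inv z = (case z of None \<Rightarrow> 0 | Some t \<Rightarrow> 1 / t)"

lemma to_from_inv [simp]: "to_inv (from_inv u) = u"
  by (simp add: to_inv_def from_inv_def divide_inverse)

lemma from_to_inv: "z \<noteq> Some 0 \<Longrightarrow> from_inv (to_inv z) = z"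
  by (cases z) (auto simp: to_inv_def from_inv_def divide_inverse)

lemma from_inv_neq: "from_inv u \<noteq> Some 0"
  by (simp add: from_inv_def)

lemma atlas_sphere: "atlas riemann_sphere = {(range Some, the), (- {Some 0}, to_inv)}"
  by (simp add: riemann_sphere_def to_inv_def[abs_def])

text \<open>Compact complements are replaced by exteriors of discs, which makes continuity at
  infinity a statement about large moduli.\<close>

lemma openin_sphere:
  "openin (top_space riemann_sphere) V \<longleftrightarrow>
     open (Some -` V) \<and> (None \<in> V \<longrightarrow> (\<exists>R. \<forall>x. R < norm x \<longrightarrow> Some x \<in> V))"
proof -
  have "openin (top_space riemann_sphere) V \<longleftrightarrow> (\<exists>U. openin euclidean U \<and> V = Some ` U) \<or>
      (\<exists>C. compactin euclidean C \<and> closedin euclidean C \<and> V = insert None (Some ` (topspace euclidean - C)))"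
    by (simp add: riemann_sphere_def openin_Alexandroff_compactification)
  also have "\<dots> \<longleftrightarrow> open (Some -` V) \<and> (None \<in> V \<longrightarrow> (\<exists>R. \<forall>x. R < norm x \<longrightarrow> Some x \<in> V))"
  proof (intro iffI; (elim disjE exE conjE)?)
    fix U :: "complex set" assume U: "openin euclidean U" "V = Some ` U"
    moreover have "Some -` (Some ` U) = U"
      by auto
    ultimately show "open (Some -` V) \<and> (None \<in> V \<longrightarrow> (\<exists>R. \<forall>x. R < norm x \<longrightarrow> Some x \<in> V))"
      by auto
  next
    fix C :: "complex set" assume C: "compactin euclidean C" "closedin euclidean C" "V = insert None (Some ` (topspace euclidean - C))"
    moreover have "Some -` V = - C"
      using C(3) by auto
    moreover obtain R where "\<And>z. z \<in> C \<Longrightarrow> norm z \<le> R"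
      using C(1) compact_imp_bounded bounded_iff by (metis compactin_euclidean_iff)
    ultimately show "open (Some -` V) \<and> (None \<in> V \<longrightarrow> (\<exists>R. \<forall>x. R < norm x \<longrightarrow> Some x \<in> V))"
      by (auto intro!: exI[of _ R] simp: not_le[symmetric])
  next
    assume V: "open (Some -` V)" "None \<in> V \<longrightarrow> (\<exists>R. \<forall>x. R < norm x \<longrightarrow> Some x \<in> V)"
    show "(\<exists>U. openin euclidean U \<and> V = Some ` U) \<or>
      (\<exists>C. compactin euclidean C \<and> closedin euclidean C \<and> V = insert None (Some ` (topspace euclidean - C)))"
    proof (cases "None \<in> V")
      case False
      have "V = Some ` (Some -` V)"
      proof (intro equalityI subsetI)
        fix z assume "z \<in> V"
        then show "z \<in> Some ` (Some -` V)"
          using False by (cases z) auto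
      qed auto
      then show ?thesis
        using V(1) by (metis open_openin)
    next
      case True
      then obtain R where R: "\<And>x. R < norm x \<Longrightarrow> Some x \<in> V"
        using V(2) by blast
      have "V = insert None (Some ` (topspace euclidean - - (Some -` V)))"
      proof (intro equalityI subsetI)
        fix z assume "z \<in> V"
        then show "z \<in> insert None (Some ` (topspace euclidean - - (Some -` V)))"
          by (cases z) auto
      qed (use True in auto)
      moreover have "closed (- (Some -` V))"
        using V(1) by (simp add: closed_def)
      moreover have "bounded (- (Some -` V))"
        unfolding bounded_iff using R by (auto intro!: exI[of _ R] simp: not_le[symmetric])
      ultimately show ?thesis
        by (metis closed_closedin compact_eq_bounded_closed compactin_euclidean_iff)
    qed
  qed
  finally show ?thesis .
qed

lemma openin_sphere_near_infinity: "openin (top_space riemann_sphere) {z. z = None \<or> r < norm (the z)}"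
proof -
  have "Some -` {z. z = None \<or> r < norm (the z)} = {x :: complex. r < norm x}" for r
    by auto
  then show ?thesis
    unfolding openin_sphere by (auto intro!: open_Collect_less continuous_intros)
qed

lemma openin_sphere_Some: "open A \<Longrightarrow> openin (top_space riemann_sphere) (Some ` A)"
proof -
  have "Some -` (Some ` A) = A"
    by auto
  then show "open A \<Longrightarrow> openin (top_space riemann_sphere) (Some ` A)"
    by (auto simp: openin_sphere)
qed

lemma openin_sphere_from_inv:
  assumes B: "open B"
  shows "openin (top_space riemann_sphere) (from_inv ` B)"
proof -
  have "Some -` (from_inv ` B) = {x. x \<noteq> 0} \<inter> inverse -` B"
  proof (intro equalityI subsetI)
    fix x assume "x \<in> Some -` (from_inv ` B)"
    then obtain u where "u \<in> B" "Some x = from_inv u"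
      by auto
    then show "x \<in> {x. x \<noteq> 0} \<inter> inverse -` B"
      by (auto simp: from_inv_def split: if_splits)
  next
    fix x assume "x \<in> {x. x \<noteq> 0} \<inter> inverse -` B"
    then show "x \<in> Some -` (from_inv ` B)"
      by (auto simp: from_inv_def intro!: image_eqI[of _ _ "inverse x"])
  qed
  moreover have "open ({x. x \<noteq> 0} \<inter> inverse -` B)"
    using B by (intro continuous_open_preimage continuous_intros) (auto simp: open_Collect_neq)
  moreover have "\<exists>R. \<forall>x. R < norm x \<longrightarrow> Some x \<in> from_inv ` B" if "None \<in> from_inv ` B"
  proof -
    have "0 \<in> B"
      using that by (auto simp: from_inv_def split: if_splits)
    then obtain e where e: "e > 0" "ball 0 e \<subseteq> B"
      using B openE by blast
    have "Some x \<in> from_inv ` B" if x: "inverse e < norm x" for x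
    proof -
      have x0: "x \<noteq> 0"
        using x e(1) by (metis norm_zero not_less positive_imp_inverse_positive less_imp_le)
      have "norm (inverse x) < e"
        using less_imp_inverse_less[OF x] e(1) by (simp add: norm_inverse)
      then have "inverse x \<in> B"
        using e(2) by auto
      then show ?thesis
        using x0 by (auto simp: from_inv_def intro!: image_eqI[of _ _ "inverse x"])
    qed
    then show ?thesis
      by blast
  qed
  ultimately show ?thesis
    by (simp add: openin_sphere)
qed

lemma sphere_chart_inv [simp]: "inv_into (range Some) the z = Some z" "inv_into (- {Some 0}) to_inv u = from_inv u"
proof -
  show "inv_into (range Some) the z = Some z"
    by (rule inv_into_f_eq) (auto simp: inj_on_def)
  show "inv_into (- {Some 0}) to_inv u = from_inv u"
    by (rule inv_into_f_eq) (auto simp: from_inv_neq intro!: inj_on_inverseI[of _ from_inv] from_to_inv)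
qed

lemma sphere_chart_image: "the ` range Some = UNIV" "to_inv ` (- {Some 0}) = UNIV"
proof -
  show "the ` range Some = UNIV"
    by (simp add: image_image)
  have "u \<in> to_inv ` (- {Some 0})" for u
    by (rule image_eqI[of _ _ "from_inv u"]) (simp_all add: from_inv_neq)
  then show "to_inv ` (- {Some 0}) = UNIV"
    by blast
qed

lemma continuous_from_inv: "continuous_map euclidean (top_space riemann_sphere) from_inv"
  using continuous_inversion_to_sphere unfolding from_inv_def[abs_def] .

lemma compact_riemann_surface_sphere: "compact_riemann_surface riemann_sphere"
  unfolding compact_riemann_surface_def
proof (intro conjI)
  show "points riemann_sphere \<noteq> {}"
    by (simp add: points_sphere)
  show "compact_space (top_space riemann_sphere)"
    by (simp add: riemann_sphere_def)
  show "Hausdorff_space (top_space riemann_sphere)"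
    by (simp add: riemann_sphere_def Hausdorff_space_Alexandroff_compactification Hausdorff_space_euclidean locally_compact_space_euclidean)
  show "connected_space (top_space riemann_sphere)"
  proof -
    have half: "T = UNIV" if T: "openin (top_space riemann_sphere) T" "openin (top_space riemann_sphere) (UNIV - T)" "None \<in> T" for T
    proof -
      have "open (Some -` T)" "open (- (Some -` T))"
        using T(1,2) unfolding openin_sphere by (auto simp: vimage_Diff Compl_eq_Diff_UNIV)
      then have "Some -` T = {} \<or> Some -` T = UNIV"
        using connected_UNIV[where 'a = complex] unfolding connected_clopen
        by (metis Compl_eq_Diff_UNIV closed_closedin closed_def open_openin subtopology_UNIV)
      moreover have "Some -` T \<noteq> {}"
      proof -
        obtain R where R: "\<And>x. R < norm x \<Longrightarrow> Some x \<in> T"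
          using T(1,3) unfolding openin_sphere by blast
        have "R < norm (of_real (\<bar>R\<bar> + 1) :: complex)"
          by simp
        then show ?thesis
          using R by blast
      qed
      ultimately have "Some x \<in> T" for x
        by blast
      then have "t \<in> T" for t
        using T(3) by (cases t) auto
      then show ?thesis
        by blast
    qed
    show ?thesis
      unfolding connected_space_clopen_in closedin_def points_sphere
    proof (intro allI impI)
      fix T assume T: "openin (top_space riemann_sphere) T \<and> T \<subseteq> UNIV \<and> openin (top_space riemann_sphere) (UNIV - T)"
      show "T = {} \<or> T = UNIV"
        using half[of T] half[of "UNIV - T"] T by (cases "None \<in> T") (auto simp: Diff_Diff_Int)
    qed
  qed
  show "(\<Union>(U, \<phi>)\<in>atlas riemann_sphere. U) = points riemann_sphere"
    unfolding atlas_sphere points_sphere by auto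
  have h1: "homeomorphic_map (subtopology (top_space riemann_sphere) (range Some)) (top_of_set (the ` range Some)) the"
    unfolding homeomorphic_map_maps homeomorphic_maps_def sphere_chart_image
  proof (intro exI[of _ Some] conjI ballI)
    have "openin (top_space riemann_sphere) {z \<in> range Some. the z \<in> O'}" if "open O'" for O'
    proof -
      have "{z \<in> range Some. the z \<in> O'} = Some ` O'"
        by auto
      then show ?thesis
        using openin_sphere_Some[OF that] by simp
    qed
    then show "continuous_map (subtopology (top_space riemann_sphere) (range Some)) (top_of_set UNIV) the"
      using openin_sphere_Some[of UNIV]
      by (auto simp: continuous_map_def points_sphere openin_open_subtopology)
    show "continuous_map (top_of_set UNIV) (subtopology (top_space riemann_sphere) (range Some)) Some"
      using continuous_Some_to_sphere by (auto simp: continuous_map_in_subtopology)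
  qed auto
  have h2: "homeomorphic_map (subtopology (top_space riemann_sphere) (- {Some 0})) (top_of_set (to_inv ` (- {Some 0}))) to_inv"
    unfolding homeomorphic_map_maps homeomorphic_maps_def sphere_chart_image
  proof (intro exI[of _ from_inv] conjI ballI)
    have eq: "{z \<in> - {Some 0}. to_inv z \<in> O'} = from_inv ` O'" for O'
      by (auto simp: from_inv_neq image_iff) (metis from_to_inv)
    have op: "openin (top_space riemann_sphere) (- {Some 0})"
      using openin_sphere_from_inv[OF open_UNIV] from_inv_neq from_to_inv
      by (metis (no_types, lifting) ComplD ComplI eq UNIV_I mem_Collect_eq subsetI subset_antisym singletonI)
    have "openin (top_space riemann_sphere) {z \<in> - {Some 0}. to_inv z \<in> O'}" if "open O'" for O'
      unfolding eq by (rule openin_sphere_from_inv[OF that])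
    then show "continuous_map (subtopology (top_space riemann_sphere) (- {Some 0})) (top_of_set UNIV) to_inv"
      using op by (auto simp: continuous_map_def points_sphere openin_open_subtopology)
    show "continuous_map (top_of_set UNIV) (subtopology (top_space riemann_sphere) (- {Some 0})) from_inv"
      using continuous_from_inv by (auto simp: continuous_map_in_subtopology from_inv_neq)
  qed (auto simp: from_to_inv)
  have op: "openin (top_space riemann_sphere) (range Some)" "openin (top_space riemann_sphere) (- {Some 0})"
  proof -
    show "openin (top_space riemann_sphere) (range Some)"
      using openin_sphere_Some[of UNIV] by simp
    have "range from_inv = - {Some 0}"
      using from_inv_neq from_to_inv by (auto simp: image_iff) metis
    then show "openin (top_space riemann_sphere) (- {Some 0})"
      using openin_sphere_from_inv[OF open_UNIV] by metis
  qed
  show "\<forall>(U, \<phi>)\<in>atlas riemann_sphere. openin (top_space riemann_sphere) U \<and> open (\<phi> ` U) \<and>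
        homeomorphic_map (subtopology (top_space riemann_sphere) U) (top_of_set (\<phi> ` U)) \<phi>"
    unfolding atlas_sphere using h1 h2 op by (simp add: sphere_chart_image)
  have i: "the ` (range Some \<inter> - {Some (0 :: complex)}) = - {0}" "to_inv ` (- {Some 0} \<inter> range Some) = - {0}"
  proof -
    show "the ` (range Some \<inter> - {Some (0 :: complex)}) = - {0}"
    proof (intro equalityI subsetI)
      fix z :: complex assume "z \<in> - {0}"
      then show "z \<in> the ` (range Some \<inter> - {Some 0})"
        by (intro image_eqI[of _ _ "Some z"]) auto
    qed auto
    show "to_inv ` (- {Some 0} \<inter> range Some) = - {0}"
    proof (intro equalityI subsetI)
      fix z :: complex assume "z \<in> - {0}"
      then show "z \<in> to_inv ` (- {Some 0} \<inter> range Some)"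
        by (intro image_eqI[of _ _ "Some (inverse z)"]) (auto simp: to_inv_def divide_inverse)
    qed (auto simp: to_inv_def)
  qed
  have t: "(to_inv \<circ> Some) holomorphic_on - {0}" "(the \<circ> from_inv) holomorphic_on - {0}"
  proof -
    have "(\<lambda>z. 1 / z) holomorphic_on - {0 :: complex}" "(\<lambda>z. inverse z) holomorphic_on - {0 :: complex}"
      by (auto intro!: holomorphic_intros)
    then show "(to_inv \<circ> Some) holomorphic_on - {0}" "(the \<circ> from_inv) holomorphic_on - {0}"
      by (elim holomorphic_transform; simp add: to_inv_def from_inv_def divide_inverse)+
  qed
  have id: "(the \<circ> Some) holomorphic_on S" "(to_inv \<circ> from_inv) holomorphic_on S" for S
    by (simp_all add: comp_def)
  have e: "inv_into (range Some) the = Some" "inv_into (- {Some 0}) to_inv = from_inv"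
    by (rule ext, simp)+
  show "\<forall>(U, \<phi>)\<in>atlas riemann_sphere. \<forall>(V, \<psi>)\<in>atlas riemann_sphere. (\<psi> \<circ> inv_into U \<phi>) holomorphic_on \<phi> ` (U \<inter> V)"
    unfolding atlas_sphere using t id by (simp add: e i)
qed

interpretation sphere: riemann_surface riemann_sphere
  by unfold_locales (rule compact_riemann_surface_sphere)

section \<open>Composition of holomorphic maps and the automorphism group of the sphere\<close>

lemma holomorphic_map_compose:
  assumes A: "compact_riemann_surface A" and B: "compact_riemann_surface B"
    and h: "holomorphic_map A B h" and k: "holomorphic_map B C k"
  shows "holomorphic_map A C (k \<circ> h)"
  unfolding holomorphic_map_def
proof (intro conjI)
  interpret A: riemann_surface A by unfold_locales (rule A)
  interpret B: riemann_surface B by unfold_locales (rule B)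
  have ch: "continuous_map (top_space A) (top_space B) h" and ck: "continuous_map (top_space B) (top_space C) k"
    using h k by (auto simp: holomorphic_map_def)
  show "continuous_map (top_space A) (top_space C) (k \<circ> h)"
    by (rule continuous_map_compose[OF ch ck])
  show "\<forall>(U, \<phi>)\<in>atlas A. \<forall>(V, \<psi>)\<in>atlas C. (\<psi> \<circ> (k \<circ> h) \<circ> inv_into U \<phi>) holomorphic_on \<phi> ` (U \<inter> (k \<circ> h) -` V)"
  proof safe
    fix U \<phi> V \<psi> assume U: "(U, \<phi>) \<in> atlas A" and V: "(V, \<psi>) \<in> atlas C"
    let ?S = "\<phi> ` (U \<inter> (k \<circ> h) -` V)"
    have "(\<psi> \<circ> (k \<circ> h) \<circ> inv_into U \<phi>) field_differentiable (at z within ?S)" if z: "z \<in> ?S" for z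
    proof -
      obtain y where y: "y \<in> U" "k (h y) \<in> V" "z = \<phi> y"
        using z by auto
      have "h y \<in> points B"
        using y(1) A.chart_subset[OF U] ch by (auto simp: continuous_map_def)
      then obtain W \<eta> where W: "(W, \<eta>) \<in> atlas B" "h y \<in> W"
        using B.ex_chart by blast
      let ?N = "{t \<in> points A. h t \<in> W}"
      have N: "openin (top_space A) ?N"
        by (rule openin_continuous_map_preimage[OF ch B.chart_open(1)[OF W(1)]])
      have opN: "open (\<phi> ` (U \<inter> ?N))" "z \<in> \<phi> ` (U \<inter> ?N)"
        using A.chart_image_open[OF U N] y W(2) A.chart_subset[OF U] by auto
      let ?T = "\<phi> ` (U \<inter> ?N \<inter> (k \<circ> h) -` V)"
      have h1: "(\<eta> \<circ> h \<circ> inv_into U \<phi>) holomorphic_on ?T"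
      proof -
        have "(\<eta> \<circ> h \<circ> inv_into U \<phi>) holomorphic_on \<phi> ` (U \<inter> h -` W)"
          using h U W(1) unfolding holomorphic_map_def by blast
        then show ?thesis
          by (rule holomorphic_on_subset) blast
      qed
      have k1: "(\<psi> \<circ> k \<circ> inv_into W \<eta>) holomorphic_on \<eta> ` (W \<inter> k -` V)"
        using k W(1) V unfolding holomorphic_map_def by blast
      have "((\<psi> \<circ> k \<circ> inv_into W \<eta>) \<circ> (\<eta> \<circ> h \<circ> inv_into U \<phi>)) holomorphic_on ?T"
        by (rule holomorphic_on_compose_gen[OF h1 k1]) (use U in auto)
      then have T: "(\<psi> \<circ> (k \<circ> h) \<circ> inv_into U \<phi>) holomorphic_on ?T"
        by (rule holomorphic_transform) (use U W(1) in auto)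
      have zT: "z \<in> ?T"
        using y W(2) A.chart_subset[OF U] by auto
      \<comment> \<open>\<open>C\<close> is not assumed to be a surface, so \<open>V\<close> and
        with it \<open>?S\<close> need not be open. Derivatives are taken within \<open>?S\<close>,
        and only its part near \<open>z\<close> matters.\<close>
      have eq: "?S \<inter> \<phi> ` (U \<inter> ?N) = ?T"
        using inj_onD[OF A.chart_inj[OF U]] by auto
      have "(\<psi> \<circ> (k \<circ> h) \<circ> inv_into U \<phi>) field_differentiable (at z within ?S \<inter> \<phi> ` (U \<inter> ?N))"
        using T zT unfolding eq holomorphic_on_def by blast
      then show ?thesis
        using at_within_nhd[OF opN(2,1), of ?S "?S \<inter> \<phi> ` (U \<inter> ?N)"] by (simp add: Int_assoc)
    qed
    then show "(\<psi> \<circ> (k \<circ> h) \<circ> inv_into U \<phi>) holomorphic_on ?S"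
      unfolding holomorphic_on_def by blast
  qed
qed

abbreviation sphere_aut :: "(complex option \<Rightarrow> complex option) \<Rightarrow> bool" where
  "sphere_aut \<equiv> biholomorphic_map riemann_sphere riemann_sphere"

lemma sphere_autI:
  assumes "holomorphic_map riemann_sphere riemann_sphere \<sigma>" "holomorphic_map riemann_sphere riemann_sphere \<tau>"
    "\<And>z. \<tau> (\<sigma> z) = z" "\<And>z. \<sigma> (\<tau> z) = z"
  shows "sphere_aut \<sigma>"
proof -
  have "bij \<sigma>"
    using assms(3,4) by (metis bijI')
  moreover have "inv_into UNIV \<sigma> = \<tau>"
    using assms(3,4) by (metis inv_equality)
  ultimately show ?thesis
    using assms unfolding biholomorphic_map_def points_sphere by simp
qed

lemma sphere_autD:
  assumes "sphere_aut \<sigma>"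
  shows "bij \<sigma>" "holomorphic_map riemann_sphere riemann_sphere \<sigma>" "sphere_aut (inv \<sigma>)"
proof -
  show b: "bij \<sigma>" and h: "holomorphic_map riemann_sphere riemann_sphere \<sigma>"
    using assms unfolding biholomorphic_map_def points_sphere by auto
  have "holomorphic_map riemann_sphere riemann_sphere (inv \<sigma>)"
    using assms unfolding biholomorphic_map_def points_sphere by auto
  then show "sphere_aut (inv \<sigma>)"
    by (rule sphere_autI[OF _ h]) (use b in \<open>simp_all add: bij_is_surj surj_f_inv_f bij_is_inj inv_f_f\<close>)
qed

lemma sphere_aut_compose:
  assumes "sphere_aut \<sigma>" "sphere_aut \<tau>"
  shows "sphere_aut (\<tau> \<circ> \<sigma>)"
proof (rule sphere_autI[where \<tau> = "inv \<sigma> \<circ> inv \<tau>"])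
  note S = compact_riemann_surface_sphere
  show "holomorphic_map riemann_sphere riemann_sphere (\<tau> \<circ> \<sigma>)" "holomorphic_map riemann_sphere riemann_sphere (inv \<sigma> \<circ> inv \<tau>)"
    using assms sphere_autD sphere_autD(2)[OF sphere_autD(3)] by (auto intro!: holomorphic_map_compose[OF S S])
qed (use sphere_autD(1)[OF assms(1)] sphere_autD(1)[OF assms(2)] in \<open>simp_all add: bij_is_surj surj_f_inv_f bij_is_inj inv_f_f\<close>)

lemma holomorphic_map_sphereI:
  assumes "continuous_map (top_space riemann_sphere) (top_space riemann_sphere) \<sigma>"
    "(the \<circ> \<sigma> \<circ> Some) holomorphic_on {z. \<sigma> (Some z) \<noteq> None}"
    "(to_inv \<circ> \<sigma> \<circ> Some) holomorphic_on {z. \<sigma> (Some z) \<noteq> Some 0}"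
    "(the \<circ> \<sigma> \<circ> from_inv) holomorphic_on {z. \<sigma> (from_inv z) \<noteq> None}"
    "(to_inv \<circ> \<sigma> \<circ> from_inv) holomorphic_on {z. \<sigma> (from_inv z) \<noteq> Some 0}"
  shows "holomorphic_map riemann_sphere riemann_sphere \<sigma>"
proof -
  have e: "inv_into (range Some) the = Some" "inv_into (- {Some 0}) to_inv = from_inv"
    by (rule ext, simp)+
  have im: "the ` (range Some \<inter> \<sigma> -` V) = {z. \<sigma> (Some z) \<in> V}" for V
    by (force simp: image_iff)
  have im2: "to_inv ` (- {Some 0} \<inter> \<sigma> -` V) = {z. \<sigma> (from_inv z) \<in> V}" for V
    by (auto simp: from_to_inv from_inv_neq intro!: image_eqI[of _ _ "from_inv _"])
  have r: "z \<in> range Some \<longleftrightarrow> z \<noteq> None" for z :: "complex option"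
    by (cases z) auto
  show ?thesis
    unfolding holomorphic_map_def atlas_sphere using assms by (simp add: e im im2 r)
qed

definition sphere_affine :: "complex \<Rightarrow> complex \<Rightarrow> complex option \<Rightarrow> complex option" where
  "sphere_affine a b = map_option (\<lambda>x. a * x + b)"

definition sphere_inv :: "complex option \<Rightarrow> complex option" where
  "sphere_inv z = (case z of None \<Rightarrow> Some 0 | Some x \<Rightarrow> from_inv x)"

lemma sphere_aut_affine:
  assumes a: "a \<noteq> 0"
  shows "sphere_aut (sphere_affine a b)"
proof -
  have h: "holomorphic_map riemann_sphere riemann_sphere (sphere_affine a b)" if a: "a \<noteq> 0" for a b
  proof (rule holomorphic_map_sphereI)
    have "openin (top_space riemann_sphere) {z. sphere_affine a b z \<in> V}" if V: "openin (top_space riemann_sphere) V" for V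
      unfolding openin_sphere
    proof
      have "open ((\<lambda>x. a * x + b) -` (Some -` V))"
        using V unfolding openin_sphere by (intro open_vimage continuous_intros) auto
      then show "open (Some -` {z. sphere_affine a b z \<in> V})"
        by (simp add: sphere_affine_def vimage_def)
      show "None \<in> {z. sphere_affine a b z \<in> V} \<longrightarrow> (\<exists>R. \<forall>x. R < norm x \<longrightarrow> Some x \<in> {z. sphere_affine a b z \<in> V})"
      proof
        assume "None \<in> {z. sphere_affine a b z \<in> V}"
        then have "None \<in> V"
          by (simp add: sphere_affine_def)
        then obtain R where R: "\<And>x. R < norm x \<Longrightarrow> Some x \<in> V"
          using V unfolding openin_sphere by blast
        show "\<exists>R. \<forall>x. R < norm x \<longrightarrow> Some x \<in> {z. sphere_affine a b z \<in> V}"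
        proof (intro exI allI impI)
          fix x :: complex assume x: "(R + norm b) / norm a < norm x"
          then have "R + norm b < norm (a * x)"
            using a by (simp add: norm_mult field_simps)
          then have "R < norm (a * x + b)"
            using norm_triangle_ineq4[of "a * x + b" b] by simp
          then show "Some x \<in> {z. sphere_affine a b z \<in> V}"
            using R by (simp add: sphere_affine_def)
        qed
      qed
    qed
    then show "continuous_map (top_space riemann_sphere) (top_space riemann_sphere) (sphere_affine a b)"
      by (simp add: continuous_map_def points_sphere)
    have "(\<lambda>z. a * z + b) holomorphic_on {z. sphere_affine a b (Some z) \<noteq> None}"
      by (intro holomorphic_intros)
    then show "(the \<circ> sphere_affine a b \<circ> Some) holomorphic_on {z. sphere_affine a b (Some z) \<noteq> None}"
      by (rule holomorphic_transform) (simp add: sphere_affine_def)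
    have "(\<lambda>z. 1 / (a * z + b)) holomorphic_on {z. sphere_affine a b (Some z) \<noteq> Some 0}"
      by (intro holomorphic_intros) (simp add: sphere_affine_def)
    then show "(to_inv \<circ> sphere_affine a b \<circ> Some) holomorphic_on {z. sphere_affine a b (Some z) \<noteq> Some 0}"
      by (rule holomorphic_transform) (simp add: sphere_affine_def to_inv_def)
    have "(\<lambda>z. a * inverse z + b) holomorphic_on {z. sphere_affine a b (from_inv z) \<noteq> None}"
      by (intro holomorphic_intros) (auto simp: sphere_affine_def from_inv_def)
    then show "(the \<circ> sphere_affine a b \<circ> from_inv) holomorphic_on {z. sphere_affine a b (from_inv z) \<noteq> None}"
      by (rule holomorphic_transform) (auto simp: sphere_affine_def from_inv_def)
    have nz: "a + b * z \<noteq> 0" if "sphere_affine a b (from_inv z) \<noteq> Some 0" for z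
      using that a by (cases "z = 0") (auto simp: sphere_affine_def from_inv_def field_simps)
    then have "(\<lambda>z. z / (a + b * z)) holomorphic_on {z. sphere_affine a b (from_inv z) \<noteq> Some 0}"
      by (intro holomorphic_intros) auto
    then show "(to_inv \<circ> sphere_affine a b \<circ> from_inv) holomorphic_on {z. sphere_affine a b (from_inv z) \<noteq> Some 0}"
    proof (rule holomorphic_transform)
      fix z assume "z \<in> {z. sphere_affine a b (from_inv z) \<noteq> Some 0}"
      then have "a + b * z \<noteq> 0"
        using nz by blast
      moreover have "a * inverse z + b = (a + b * z) * inverse z" if "z \<noteq> 0"
        using that by (simp add: field_simps)
      ultimately show "z / (a + b * z) = (to_inv \<circ> sphere_affine a b \<circ> from_inv) z"
        by (simp add: sphere_affine_def to_inv_def from_inv_def divide_inverse mult.commute)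
    qed
  qed
  show ?thesis
  proof (rule sphere_autI[OF h[OF a] h[of "inverse a" "- b / a"]])
    show "sphere_affine (inverse a) (- b / a) (sphere_affine a b z) = z" "sphere_affine a b (sphere_affine (inverse a) (- b / a) z) = z" for z
      using a by (cases z; simp add: sphere_affine_def field_simps)+
  qed (use a in simp)
qed

lemma sphere_aut_inv: "sphere_aut sphere_inv"
proof -
  have inv: "sphere_inv (sphere_inv z) = z" for z
    by (cases z) (auto simp: sphere_inv_def from_inv_def)
  have si: "sphere_inv (Some z) = from_inv z" "sphere_inv (from_inv z) = Some z" for z
    using inv[of "Some z"] by (simp_all add: sphere_inv_def)
  have "holomorphic_map riemann_sphere riemann_sphere sphere_inv"
  proof (rule holomorphic_map_sphereI)
    have "openin (top_space riemann_sphere) {z. sphere_inv z \<in> V}" if V: "openin (top_space riemann_sphere) V" for V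
      unfolding openin_sphere
    proof
      have "open (from_inv -` V)"
        using openin_continuous_map_preimage[OF continuous_from_inv V] by (simp add: vimage_def)
      then show "open (Some -` {z. sphere_inv z \<in> V})"
        by (simp add: vimage_def si)
      show "None \<in> {z. sphere_inv z \<in> V} \<longrightarrow> (\<exists>R. \<forall>x. R < norm x \<longrightarrow> Some x \<in> {z. sphere_inv z \<in> V})"
      proof
        assume "None \<in> {z. sphere_inv z \<in> V}"
        then have "0 \<in> Some -` V"
          by (simp add: sphere_inv_def)
        then obtain e where e: "e > 0" "ball 0 e \<subseteq> Some -` V"
          using V unfolding openin_sphere by (meson openE)
        show "\<exists>R. \<forall>x. R < norm x \<longrightarrow> Some x \<in> {z. sphere_inv z \<in> V}"
        proof (intro exI allI impI)
          fix x :: complex assume x: "inverse e < norm x"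
          have x0: "x \<noteq> 0"
            using x e(1) by (metis norm_zero not_less positive_imp_inverse_positive less_imp_le)
          have "norm (inverse x) < e"
            using less_imp_inverse_less[OF x] e(1) by (simp add: norm_inverse)
          then show "Some x \<in> {z. sphere_inv z \<in> V}"
            using e(2) x0 by (auto simp: sphere_inv_def from_inv_def)
        qed
      qed
    qed
    then show "continuous_map (top_space riemann_sphere) (top_space riemann_sphere) sphere_inv"
      by (simp add: continuous_map_def points_sphere)
    have n: "from_inv z \<noteq> None \<longleftrightarrow> z \<noteq> 0" for z
      by (simp add: from_inv_def)
    have "(\<lambda>z. inverse z) holomorphic_on {z :: complex. z \<noteq> 0}" "(\<lambda>z. 1 / z) holomorphic_on {z :: complex. z \<noteq> 0}"
      by (auto intro!: holomorphic_intros)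
    then show "(the \<circ> sphere_inv \<circ> Some) holomorphic_on {z. sphere_inv (Some z) \<noteq> None}"
      "(to_inv \<circ> sphere_inv \<circ> from_inv) holomorphic_on {z. sphere_inv (from_inv z) \<noteq> Some 0}"
      unfolding si n by (auto elim!: holomorphic_transform simp: si from_inv_def to_inv_def divide_inverse)
    show "(to_inv \<circ> sphere_inv \<circ> Some) holomorphic_on {z. sphere_inv (Some z) \<noteq> Some 0}"
      "(the \<circ> sphere_inv \<circ> from_inv) holomorphic_on {z. sphere_inv (from_inv z) \<noteq> None}"
      by (simp_all add: comp_def si)
  qed
  then show ?thesis
    using inv by (intro sphere_autI)
qed

lemma ex_aut_to_None: "\<exists>\<sigma>. sphere_aut \<sigma> \<and> \<sigma> z = None"
proof (cases z)
  case None
  then show ?thesis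
    using sphere_aut_affine[of 1 0] by (auto simp: sphere_affine_def intro!: exI[of _ "sphere_affine 1 0"])
next
  case (Some c)
  have "sphere_aut (sphere_inv \<circ> sphere_affine 1 (- c))"
    by (rule sphere_aut_compose[OF sphere_aut_affine sphere_aut_inv]) simp
  then show ?thesis
    using Some by (intro exI[of _ "sphere_inv \<circ> sphere_affine 1 (- c)"]) (simp add: sphere_inv_def sphere_affine_def from_inv_def)
qed

text \<open>The pole at infinity makes \<open>f\<close> a polynomial; injectivity makes its
  derivative zero-free, hence constant by the fundamental theorem of algebra.\<close>

lemma injective_entire_proper_affine:
  assumes f: "f holomorphic_on UNIV" "inj f" and lim: "filterlim f at_infinity at_infinity"
  obtains a b where "a \<noteq> 0" "\<And>z. f z = a * z + b"
proof -
  have "((inverse \<circ> f) \<longlongrightarrow> 0) at_infinity"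
    using filterlim_compose[OF tendsto_inverse_0 lim] by (simp add: comp_def)
  then obtain c n where c: "\<And>z. f z = (\<Sum>i\<le>n. c i * z ^ i)"
    using pole_at_infinity[OF f(1)] by metis
  define P where "P = (\<Sum>i\<le>n. monom (c i) i)"
  have fP: "f z = poly P z" for z
    unfolding c P_def by (simp add: poly_sum poly_monom)
  have "poly (pderiv P) z \<noteq> 0" for z
    using holomorphic_injective_imp_regular[OF f(1) open_UNIV f(2), of z]
    unfolding fP[abs_def] by (simp add: DERIV_imp_deriv[OF poly_DERIV])
  then have "degree (pderiv P) = 0"
    using fundamental_theorem_of_algebra_alt[of "pderiv P"] by (metis degree_pCons_0)
  then have "degree P \<le> 1"
    by (simp add: degree_pderiv)
  then have eq: "P = [:coeff P 0, coeff P 1:]"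
    by (intro poly_eqI) (auto simp: coeff_pCons coeff_eq_0 split: nat.split)
  have "f z = coeff P 1 * z + coeff P 0" for z
    unfolding fP by (subst eq) simp
  moreover have "coeff P 1 \<noteq> 0"
    using calculation f(2) unfolding inj_on_def by (metis UNIV_I add_0 mult_zero_left zero_neq_one)
  ultimately show thesis
    using that by blast
qed

text \<open>In the finite chart the automorphism is an injective entire function, and continuity at
  infinity supplies its limit. This is why affine changes of the polynomial match automorphisms
  fixing the marked point.\<close>

lemma aut_None_affine:
  assumes \<sigma>: "sphere_aut \<sigma>" and N: "\<sigma> None = None"
  obtains a b where "a \<noteq> 0" "\<sigma> = sphere_affine a b"
proof -
  note S = sphere_autD[OF \<sigma>]
  have inj: "inj \<sigma>"
    using S(1) bij_is_inj by blast
  have ne: "\<sigma> (Some z) \<noteq> None" for z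
    using injD[OF inj, of "Some z" None] N by auto
  define f where "f z = the (\<sigma> (Some z))" for z
  have f: "\<sigma> (Some z) = Some (f z)" for z
    using ne[of z] by (auto simp: f_def)
  have e: "inv_into (range Some) the = Some"
    by (rule ext) simp
  have "(the \<circ> \<sigma> \<circ> inv_into (range Some) the) holomorphic_on the ` (range Some \<inter> \<sigma> -` range Some)"
    using S(2) unfolding holomorphic_map_def atlas_sphere by blast
  moreover have "the ` (range Some \<inter> \<sigma> -` range Some) = UNIV"
    using f by (force simp: image_iff)
  ultimately have hol: "f holomorphic_on UNIV"
    unfolding e f_def[abs_def] by (simp add: comp_def)
  have "inj f"
    by (rule injI) (metis f injD[OF inj] option.inject)
  moreover have "filterlim f at_infinity at_infinity"
    unfolding filterlim_at_infinity[OF order_refl]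
  proof (intro allI impI)
    fix r :: real
    let ?W = "{z. z = None \<or> r < norm (the z)}"
    have "openin (top_space riemann_sphere) ?W"
      by (rule openin_sphere_near_infinity)
    moreover have "continuous_map (top_space riemann_sphere) (top_space riemann_sphere) \<sigma>"
      using S(2) unfolding holomorphic_map_def by (rule conjunct1)
    ultimately have "openin (top_space riemann_sphere) {z \<in> points riemann_sphere. \<sigma> z \<in> ?W}"
      by (rule openin_continuous_map_preimage[rotated])
    moreover have "None \<in> {z \<in> points riemann_sphere. \<sigma> z \<in> ?W}"
      using N by (simp add: points_sphere)
    ultimately obtain R where R: "\<forall>x. R < norm x \<longrightarrow> Some x \<in> {z \<in> points riemann_sphere. \<sigma> z \<in> ?W}"
      unfolding openin_sphere by (elim conjE impE) (assumption, erule exE)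
    have R': "\<sigma> (Some x) \<in> ?W" if "R < norm x" for x
      using R that by simp
    have "r \<le> norm (f x)" if "R + 1 \<le> norm x" for x
    proof -
      have "\<sigma> (Some x) \<in> ?W"
        using that by (intro R') simp
      then show ?thesis
        unfolding f by simp
    qed
    then show "eventually (\<lambda>x. r \<le> norm (f x)) at_infinity"
      unfolding eventually_at_infinity by blast
  qed
  ultimately obtain a b where ab: "a \<noteq> 0" "\<And>z. f z = a * z + b"
    using injective_entire_proper_affine[OF hol] by metis
  have "\<sigma> z = sphere_affine a b z" for z
    using N f ab(2) by (cases z) (auto simp: sphere_affine_def)
  then show thesis
    using that ab(1) by blast
qed

section \<open>Configurations of branch points\<close>

definition root_poly :: "complex set \<Rightarrow> complex poly" where
  "root_poly S = (\<Prod>e\<in>S. [:-e, 1:])"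

lemma roots_root_poly: "finite S \<Longrightarrow> roots (root_poly S) = S"
  by (auto simp: roots_def root_poly_def poly_prod)

lemma degree_root_poly: "degree (root_poly S) = card S"
  unfolding root_poly_def by (subst degree_prod_sum_eq) auto

lemma root_poly_nonzero: "root_poly S \<noteq> 0"
  by (cases "finite S") (auto simp: root_poly_def)

lemma squarefree_root_poly:
  assumes S: "finite S"
  shows "squarefree (root_poly S)"
proof (rule squarefreeI)
  fix p assume p: "p ^ 2 dvd root_poly S"
  have p0: "p \<noteq> 0"
    using p root_poly_nonzero by auto
  show "p dvd 1"
  proof (rule ccontr)
    assume "\<not> p dvd 1"
    then have "degree p \<noteq> 0"
      using is_unit_iff_degree[OF p0] by blast
    then obtain e where "poly p e = 0"
      using fundamental_theorem_of_algebra constant_degree by metis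
    then have "[:-e, 1:] ^ 2 dvd p ^ 2"
      by (intro dvd_power_same) (simp add: poly_eq_0_iff_dvd)
    then have d: "[:-e, 1:] ^ 2 dvd root_poly S"
      using p by (rule dvd_trans)
    then have "[:-e, 1:] dvd root_poly S"
      unfolding power2_eq_square by (rule dvd_mult_left)
    then have "e \<in> roots (root_poly S)"
      by (simp add: roots_def poly_eq_0_iff_dvd)
    then have e: "e \<in> S"
      by (simp add: roots_root_poly[OF S])
    then have "root_poly S = [:-e, 1:] * root_poly (S - {e})"
      unfolding root_poly_def by (rule prod.remove[OF S])
    then have "[:-e, 1:] dvd root_poly (S - {e})"
      using d unfolding power2_eq_square by (metis dvd_times_left_cancel_iff one_neq_zero pCons_eq_0_iff)
    then have "e \<in> roots (root_poly (S - {e}))"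
      unfolding roots_def by (simp add: poly_eq_0_iff_dvd)
    then show False
      using roots_root_poly[of "S - {e}"] S by simp
  qed
qed

lemma admissible_root_poly:
  assumes "card S = 2 * g + 2"
  shows "admissible g (root_poly S)"
proof -
  have "finite S"
    using assms by (intro card_ge_0_finite) simp
  moreover have "lead_coeff (root_poly S) = 1"
    unfolding root_poly_def lead_coeff_prod by simp
  ultimately show ?thesis
    unfolding admissible_def using squarefree_root_poly degree_root_poly assms by metis
qed

lemma admissible_root_form:
  assumes "admissible g D"
  shows "root_poly (roots D) = D" "finite (roots D)" "card (roots D) = 2 * g + 2"
proof -
  show D: "root_poly (roots D) = D"
    unfolding root_poly_def by (rule prod_roots_squarefree) (use assms in \<open>auto simp: admissible_def\<close>)
  show c: "card (roots D) = 2 * g + 2"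
    using degree_root_poly[of "roots D"] D assms by (simp add: admissible_def)
  show "finite (roots D)"
    using c by (intro card_ge_0_finite) simp
qed

definition branch_orbit :: "complex option set \<Rightarrow> complex option \<Rightarrow> (complex option set \<times> complex option set) set" where
  "branch_orbit B q = {(\<sigma> ` B, {\<sigma> q}) | \<sigma>. sphere_aut \<sigma>}"

abbreviation root_orbit :: "complex poly \<Rightarrow> (complex option set \<times> complex option set) set" where
  "root_orbit D \<equiv> branch_orbit (Some ` roots D) None"

lemma configuration_orbit_eq: "configuration_orbit g (b, q) = branch_orbit (b ` {..<2 * g + 2}) q"
  by (simp add: configuration_orbit_def branch_orbit_def)

lemma sphere_aut_id: "sphere_aut id"
  using sphere_aut_affine[of 1 0] by (simp add: sphere_affine_def option.map_ident[unfolded id_def[symmetric]] id_def[symmetric] option.map_id0)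

lemma branch_orbit_self: "(B, {q}) \<in> branch_orbit B q"
  unfolding branch_orbit_def using sphere_aut_id by (auto intro!: exI[of _ id])

lemma branch_orbit_aut:
  assumes \<tau>: "sphere_aut \<tau>"
  shows "branch_orbit (\<tau> ` B) (\<tau> q) = branch_orbit B q"
proof -
  have sub: "branch_orbit (\<tau> ` B) (\<tau> q) \<subseteq> branch_orbit B q" if \<tau>: "sphere_aut \<tau>" for \<tau> B q
  proof
    fix x assume "x \<in> branch_orbit (\<tau> ` B) (\<tau> q)"
    then obtain \<sigma> where s: "x = (\<sigma> ` \<tau> ` B, {\<sigma> (\<tau> q)})" "sphere_aut \<sigma>"
      unfolding branch_orbit_def by blast
    have "x = ((\<sigma> \<circ> \<tau>) ` B, {(\<sigma> \<circ> \<tau>) q})"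
      unfolding s(1) by (simp add: image_comp)
    then show "x \<in> branch_orbit B q"
      unfolding branch_orbit_def using sphere_aut_compose[OF \<tau> s(2)] by blast
  qed
  have "inv \<tau> ` \<tau> ` B = B" "inv \<tau> (\<tau> q) = q"
    using bij_is_inj[OF sphere_autD(1)[OF \<tau>]] by (simp_all add: image_comp)
  then have "branch_orbit B q \<subseteq> branch_orbit (\<tau> ` B) (\<tau> q)"
    using sub[OF sphere_autD(3)[OF \<tau>], of "\<tau> ` B" "\<tau> q"] by simp
  then show ?thesis
    using sub[OF \<tau>] by (rule subset_antisym[rotated])
qed

lemma branch_orbit_memberE:
  assumes "(B', {q'}) \<in> branch_orbit B q"
  obtains \<sigma> where "sphere_aut \<sigma>" "B' = \<sigma> ` B" "q' = \<sigma> q"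
  using assms unfolding branch_orbit_def by blast

text \<open>The roots of D(a x + b) are (e - b) / a, and the factor a^(- deg D) makes the result
  monic again.\<close>

lemma affine_change:
  assumes D: "admissible g D" and a: "a \<noteq> 0"
  shows "smult (inverse (a ^ degree D)) (pcompose D [:b, a:]) = root_poly ((\<lambda>e. (e - b) / a) ` roots D)"
proof -
  note R = admissible_root_form[OF D]
  have "inj_on (\<lambda>e. (e - b) / a) (roots D)"
    using a by (auto simp: inj_on_def)
  then have "root_poly ((\<lambda>e. (e - b) / a) ` roots D) = (\<Prod>e\<in>roots D. [:-((e - b) / a), 1:])"
    unfolding root_poly_def by (simp add: prod.reindex)
  also have "\<dots> = (\<Prod>e\<in>roots D. smult (inverse a) (pcompose [:-e, 1:] [:b, a:]))"
    using a by (intro prod.cong refl) (simp add: pcompose_pCons field_simps)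
  also have "\<dots> = smult (inverse a ^ card (roots D)) (pcompose (root_poly (roots D)) [:b, a:])"
    unfolding root_poly_def by (simp add: prod_smult pcompose_prod)
  also have "\<dots> = smult (inverse (a ^ degree D)) (pcompose D [:b, a:])"
    using R(1,3) D by (simp add: power_inverse admissible_def)
  finally show ?thesis ..
qed

text \<open>The dictionary between polynomials and configurations: an automorphism that matches two
  root sets and fixes infinity is affine, and the affine map on roots is the affine substitution in
  the polynomial.\<close>

lemma affine_orbit_eq:
  assumes D: "admissible g D"
  shows "affine_orbit D = {E. admissible g E \<and> root_orbit E = root_orbit D}"
proof (intro equalityI subsetI)
  note R = admissible_root_form[OF D]
  {
    fix E assume "E \<in> affine_orbit D"
    then obtain a b where ab: "a \<noteq> 0" "E = root_poly ((\<lambda>e. (e - b) / a) ` roots D)"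
      unfolding affine_orbit_def using affine_change[OF D] by auto
    let ?S = "(\<lambda>e. (e - b) / a) ` roots D"
    have "inj_on (\<lambda>e. (e - b) / a) (roots D)"
      using ab(1) by (auto simp: inj_on_def)
    then have "admissible g E"
      unfolding ab(2) using R(3) by (intro admissible_root_poly) (simp add: card_image)
    moreover have "roots E = ?S"
      unfolding ab(2) using R(2) by (intro roots_root_poly) simp
    then have "sphere_affine a b ` Some ` roots E = Some ` roots D"
      using ab(1) by (simp add: image_image sphere_affine_def)
    then have "root_orbit E = root_orbit D"
      using branch_orbit_aut[OF sphere_aut_affine[OF ab(1), of b], of "Some ` roots E" None]
      by (simp add: sphere_affine_def)
    ultimately show "E \<in> {E. admissible g E \<and> root_orbit E = root_orbit D}"
      by simp
  }
  fix E assume "E \<in> {E. admissible g E \<and> root_orbit E = root_orbit D}"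
  then have E: "admissible g E" "root_orbit E = root_orbit D"
    by simp_all
  have "(Some ` roots D, {None}) \<in> root_orbit E"
    using branch_orbit_self E(2) by metis
  then obtain \<sigma> where s: "sphere_aut \<sigma>" "Some ` roots D = \<sigma> ` Some ` roots E" "None = \<sigma> None"
    by (rule branch_orbit_memberE)
  then obtain a b where ab: "a \<noteq> 0" "\<sigma> = sphere_affine a b"
    using aut_None_affine[OF s(1) s(3)[symmetric]] by metis
  have "Some ` roots D = Some ` (\<lambda>x. a * x + b) ` roots E"
    using s(2) unfolding ab(2) by (simp add: image_image sphere_affine_def)
  then have "roots D = (\<lambda>x. a * x + b) ` roots E"
    by (simp add: inj_image_eq_iff)
  then have "(\<lambda>e. (e - b) / a) ` roots D = roots E"
    using ab(1) by (simp add: image_image)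
  then have "E = smult (inverse (a ^ degree D)) (pcompose D [:b, a:])"
    using affine_change[OF D ab(1), of b] admissible_root_form(1)[OF E(1)] by simp
  then show "E \<in> affine_orbit D"
    unfolding affine_orbit_def using ab(1) by blast
qed

lemma affine_orbit_eq_iff:
  assumes "admissible g D" "admissible g E"
  shows "affine_orbit D = affine_orbit E \<longleftrightarrow> root_orbit D = root_orbit E"
  using assms by (auto simp: affine_orbit_eq)

section \<open>Configurations against coefficients, as topological spaces\<close>

lemma topspace_quotient_topology: "topspace (quotient_topology X q) = q ` topspace X"
proof -
  have "{x \<in> topspace X. q x \<in> q ` topspace X} = topspace X"
    by blast
  then have "openin (quotient_topology X q) (q ` topspace X)"
    by (simp add: openin_quotient_topology)
  then show ?thesis
    using openin_subset openin_quotient_topology[of X q "topspace (quotient_topology X q)"]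
    by (metis openin_topspace subset_antisym)
qed

lemma topspace_ordered_configurations:
  "topspace (ordered_configurations g) =
     {(b, q). b \<in> extensional {..<2 * g + 2} \<and> inj_on b {..<2 * g + 2} \<and> q \<notin> b ` {..<2 * g + 2}}"
  by (auto simp: ordered_configurations_def points_sphere PiE_def)

lemma root_orbit_in_configuration_space:
  assumes D: "admissible g D"
  shows "root_orbit D \<in> topspace (configuration_space g)"
proof -
  note R = admissible_root_form[OF D]
  obtain r where r: "bij_betw r {..<2 * g + 2} (roots D)"
    using ex_bij_betw_nat_finite[OF R(2)] R(3) by (metis atLeast0LessThan)
  let ?b = "restrict (Some \<circ> r) {..<2 * g + 2}"
  have im: "?b ` {..<2 * g + 2} = Some ` roots D"
    by (simp only: image_restrict_eq image_comp[symmetric] bij_betw_imp_surj_on[OF r])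
  have "inj_on ?b {..<2 * g + 2}"
    using bij_betw_imp_inj_on[OF r] by (simp add: inj_on_def)
  then have "(?b, None) \<in> topspace (ordered_configurations g)"
    unfolding topspace_ordered_configurations using im by auto
  moreover have "configuration_orbit g (?b, None) = root_orbit D"
    unfolding configuration_orbit_eq im ..
  ultimately show ?thesis
    unfolding configuration_space_def topspace_quotient_topology by (metis imageI)
qed

text \<open>Any automorphism that sends the marked point to infinity turns the branch points into
  roots of a monic polynomial, without changing the orbit.\<close>

lemma root_poly_of_configuration:
  assumes bq: "(b, q) \<in> topspace (ordered_configurations g)" and \<tau>: "sphere_aut \<tau>" "\<tau> q = None"
  defines "S \<equiv> (\<lambda>i. the (\<tau> (b i))) ` {..<2 * g + 2}"
  shows "Some ` S = \<tau> ` b ` {..<2 * g + 2}" "inj_on (\<lambda>i. the (\<tau> (b i))) {..<2 * g + 2}"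
    "admissible g (root_poly S)" "root_orbit (root_poly S) = configuration_orbit g (b, q)"
proof -
  have b: "inj_on b {..<2 * g + 2}" "q \<notin> b ` {..<2 * g + 2}"
    using bq unfolding topspace_ordered_configurations by auto
  have inj: "inj \<tau>"
    using sphere_autD(1)[OF \<tau>(1)] by (rule bij_is_inj)
  have some: "Some (the (\<tau> (b i))) = \<tau> (b i)" if "i < 2 * g + 2" for i
  proof -
    have "b i \<noteq> q"
      using b(2) that by blast
    then have "\<tau> (b i) \<noteq> None"
      using injD[OF inj] \<tau>(2) by metis
    then show ?thesis
      by simp
  qed
  show S: "Some ` S = \<tau> ` b ` {..<2 * g + 2}"
    unfolding S_def image_image by (rule image_cong) (use some in auto)
  show i: "inj_on (\<lambda>i. the (\<tau> (b i))) {..<2 * g + 2}"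
  proof (rule inj_onI)
    fix i j assume ij: "i \<in> {..<2 * g + 2}" "j \<in> {..<2 * g + 2}" "the (\<tau> (b i)) = the (\<tau> (b j))"
    then have "\<tau> (b i) = \<tau> (b j)"
      using some by (metis lessThan_iff)
    then show "i = j"
      using injD[OF inj] inj_onD[OF b(1)] ij(1,2) by metis
  qed
  then show "admissible g (root_poly S)"
    unfolding S_def by (intro admissible_root_poly) (simp add: card_image)
  have fin: "finite S"
    by (simp add: S_def)
  show "root_orbit (root_poly S) = configuration_orbit g (b, q)"
    unfolding configuration_orbit_eq roots_root_poly[OF fin] S \<tau>(2)[symmetric]
    by (rule branch_orbit_aut[OF \<tau>(1)])
qed

lemma configuration_space_cases:
  assumes "\<omega> \<in> topspace (configuration_space g)"
  obtains D where "admissible g D" "root_orbit D = \<omega>"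
proof -
  obtain b q where bq: "(b, q) \<in> topspace (ordered_configurations g)" "\<omega> = configuration_orbit g (b, q)"
    using assms unfolding configuration_space_def topspace_quotient_topology by auto
  obtain \<tau> where \<tau>: "sphere_aut \<tau>" "\<tau> q = None"
    using ex_aut_to_None by blast
  show thesis
    using root_poly_of_configuration(3,4)[OF bq(1) \<tau>] that bq(2) by metis
qed

text \<open>Continuity of roots: if \<open>E\<close> is small at each root of \<open>D\<close>, then
  \<open>E\<close> has a root near each of them, and counting shows that these are all its roots.
  The configuration of \<open>E\<close> is then close to that of \<open>D\<close>.\<close>

lemma openin_root_orbit_preimage:
  assumes O: "openin (configuration_space g) O'"
  obtains W :: "(nat \<Rightarrow> complex) set" where "open W"
    "\<And>D. admissible g D \<Longrightarrow> coeff D \<in> W \<longleftrightarrow> root_orbit D \<in> O'"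
proof -
  let ?N = "2 * g + 2"
  have loc: "\<exists>W. open W \<and> coeff D \<in> W \<and> (\<forall>E. admissible g E \<and> coeff E \<in> W \<longrightarrow> root_orbit E \<in> O')"
    if D: "admissible g D" "root_orbit D \<in> O'" for D
  proof -
    note R = admissible_root_form[OF D(1)]
    obtain r where r: "bij_betw r {..<?N} (roots D)"
      using ex_bij_betw_nat_finite[OF R(2)] R(3) by (metis atLeast0LessThan)
    define enum where "enum s = restrict (Some \<circ> s) {..<?N}" for s :: "nat \<Rightarrow> complex"
    have enum_top: "(enum s, None) \<in> topspace (ordered_configurations g)"
      "configuration_orbit g (enum s, None) = branch_orbit (Some ` s ` {..<?N}) None"
      if "inj_on s {..<?N}" for s
    proof -
      have im: "enum s ` {..<?N} = Some ` s ` {..<?N}"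
        by (simp only: enum_def image_restrict_eq image_comp[symmetric])
      have "inj_on (enum s) {..<?N}"
        using that by (simp add: inj_on_def enum_def)
      then show "(enum s, None) \<in> topspace (ordered_configurations g)"
        unfolding topspace_ordered_configurations im by (auto simp: enum_def)
      show "configuration_orbit g (enum s, None) = branch_orbit (Some ` s ` {..<?N}) None"
        unfolding configuration_orbit_eq im ..
    qed
    let ?P = "prod_topology (product_topology (\<lambda>_. top_space riemann_sphere) {..<?N}) (top_space riemann_sphere)"
    have "openin (ordered_configurations g) {x \<in> topspace (ordered_configurations g). configuration_orbit g x \<in> O'}"
      using O unfolding configuration_space_def openin_quotient_topology by blast
    then obtain \<Omega> where \<Omega>: "openin ?P \<Omega>"
      "{x \<in> topspace (ordered_configurations g). configuration_orbit g x \<in> O'} =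
       \<Omega> \<inter> {(b, q). inj_on b {..<?N} \<and> q \<notin> b ` {..<?N}}"
      unfolding ordered_configurations_def openin_subtopology by blast
    have "configuration_orbit g (enum r, None) \<in> O'"
      using enum_top(2)[OF bij_betw_imp_inj_on[OF r]] bij_betw_imp_surj_on[OF r] D(2) by simp
    then have "(enum r, None) \<in> \<Omega>"
      using enum_top(1)[OF bij_betw_imp_inj_on[OF r]] \<Omega>(2) by blast
    then obtain U V where UV: "openin (product_topology (\<lambda>_. top_space riemann_sphere) {..<?N}) U"
      "enum r \<in> U" "None \<in> V" "U \<times> V \<subseteq> \<Omega>"
      using \<Omega>(1) unfolding openin_prod_topology_alt by metis
    obtain A where A: "\<And>i. i < ?N \<Longrightarrow> openin (top_space riemann_sphere) (A i)"
      "enum r \<in> Pi\<^sub>E {..<?N} A" "Pi\<^sub>E {..<?N} A \<subseteq> U"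
    proof -
      have "\<exists>A. (\<forall>i\<in>{..<?N}. openin (top_space riemann_sphere) (A i)) \<and> enum r \<in> Pi\<^sub>E {..<?N} A \<and> Pi\<^sub>E {..<?N} A \<subseteq> U"
        using bspec[OF UV(1)[unfolded openin_product_topology_alt] UV(2)] by (elim exE conjE) (intro exI conjI)
      then show thesis
        using that by blast
    qed
    have "\<exists>e>0. ball (r i) e \<subseteq> Some -` A i" if "i < ?N" for i
    proof (rule openE)
      show "open (Some -` A i)"
        using A(1)[OF that] unfolding openin_sphere by blast
      have "enum r i \<in> A i"
        using A(2) that by (auto simp: PiE_iff)
      then show "r i \<in> Some -` A i"
        using that by (simp add: enum_def)
    qed blast
    then have "eventually (\<lambda>e. ball (r i) e \<subseteq> Some -` A i) (at_right 0)" if i: "i < ?N" for i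
    proof -
      obtain e where e: "e > 0" "ball (r i) e \<subseteq> Some -` A i"
        using \<open>\<And>i. i < ?N \<Longrightarrow> \<exists>e>0. ball (r i) e \<subseteq> Some -` A i\<close> i by blast
      have "ball (r i) d \<subseteq> Some -` A i" if "d < e" for d
        using that by (intro order.trans[OF subset_ball e(2)]) simp
      then show ?thesis
        unfolding eventually_at_right_field using e(1) by blast
    qed
    moreover have "eventually (\<lambda>e. i \<noteq> j \<longrightarrow> 2 * e < dist (r i) (r j)) (at_right 0)" if "i < ?N" "j < ?N" for i j
    proof (cases "i = j")
      case False
      then have "r i \<noteq> r j"
        using bij_betw_imp_inj_on[OF r] that by (auto simp: inj_on_def)
      then show ?thesis
        unfolding eventually_at_right_field by (intro exI[of _ "dist (r i) (r j) / 2"]) auto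
    qed auto
    \<comment> \<open>The radius \<open>e\<close> keeps the discs inside the given neighbourhoods,
      and no point is within \<open>e\<close> of two roots of \<open>D\<close>.\<close>
    ultimately have "eventually (\<lambda>e. 0 < e \<and> (\<forall>i\<in>{..<?N}. ball (r i) e \<subseteq> Some -` A i) \<and>
        (\<forall>i\<in>{..<?N}. \<forall>j\<in>{..<?N}. i \<noteq> j \<longrightarrow> 2 * e < dist (r i) (r j))) (at_right (0::real))"
      by (intro eventually_conj eventually_ball_finite ballI eventually_at_right_less) auto
    from eventually_happens'[OF trivial_limit_at_right_real this] obtain e
      where e': "0 < e \<and> (\<forall>i\<in>{..<?N}. ball (r i) e \<subseteq> Some -` A i) \<and>
        (\<forall>i\<in>{..<?N}. \<forall>j\<in>{..<?N}. i \<noteq> j \<longrightarrow> 2 * e < dist (r i) (r j))"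
      by (rule exE)
    have e: "0 < e" "\<And>i. i < ?N \<Longrightarrow> ball (r i) e \<subseteq> Some -` A i"
      "\<And>i j. i < ?N \<Longrightarrow> j < ?N \<Longrightarrow> i \<noteq> j \<Longrightarrow> 2 * e < dist (r i) (r j)"
      using e' by simp_all
    \<comment> \<open>The condition bounds the values E(r i), which depend continuously on finitely
      many coefficients; it is open in the product topology.\<close>
    let ?W = "\<Inter>i\<in>{..<?N}. {c :: nat \<Rightarrow> complex. norm (\<Sum>k\<le>?N. c k * r i ^ k) < e ^ ?N}"
    have ev: "(\<Sum>k\<le>?N. coeff E k * x ^ k) = poly E x" if "admissible g E" for E x
      using that by (simp add: poly_altdef admissible_def)
    have "continuous_on UNIV (\<lambda>c :: nat \<Rightarrow> complex. norm (\<Sum>k\<le>?N. c k * r i ^ k))" for i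
      by (intro continuous_intros continuous_on_product_coordinates)
    then have "open ?W"
      by (intro open_INT ballI open_Collect_less continuous_on_const) auto
    moreover have "poly D (r i) = 0" if "i < ?N" for i
      using bij_betw_imp_surj_on[OF r] that by (auto simp: roots_def)
    then have "coeff D \<in> ?W"
      using e(1) by (simp only: INT_iff mem_Collect_eq ev[OF D(1)]) simp
    moreover have "root_orbit E \<in> O'" if E: "admissible g E" "coeff E \<in> ?W" for E
    proof -
      note RE = admissible_root_form[OF E(1)]
      \<comment> \<open>The modulus of the monic polynomial at \<open>r i\<close> is the product of
        the distances to its 2g + 2 roots; were none below \<open>e\<close>, it would be at least
        e^(2g+2).\<close>
      have "\<exists>t\<in>roots E. dist (r i) t < e" if i: "i < ?N" for i
      proof (rule ccontr)
        assume "\<not> (\<exists>t\<in>roots E. dist (r i) t < e)"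
        then have "(\<Prod>t\<in>roots E. e) \<le> (\<Prod>t\<in>roots E. norm (r i - t))"
          using e(1) by (intro prod_mono) (auto simp: dist_norm not_less)
        also have "\<dots> = norm (poly (root_poly (roots E)) (r i))"
          by (simp add: root_poly_def poly_prod prod_norm)
        finally have "e ^ ?N \<le> norm (poly E (r i))"
          using RE(1,3) by simp
        moreover have "norm (poly E (r i)) < e ^ ?N"
          using E(2) i by (simp only: INT_iff mem_Collect_eq ev[OF E(1)] lessThan_iff)
        ultimately show False
          by simp
      qed
      then obtain s where s: "\<And>i. i < ?N \<Longrightarrow> s i \<in> roots E \<and> dist (r i) (s i) < e"
        by metis
      have inj: "inj_on s {..<?N}"
      proof (rule inj_onI, rule ccontr)
        fix i j assume ij: "i \<in> {..<?N}" "j \<in> {..<?N}" "s i = s j" "i \<noteq> j"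
        have "dist (r i) (r j) \<le> dist (r i) (s i) + dist (r j) (s j)"
          using ij(3) dist_triangle2 by metis
        also have "\<dots> < 2 * e"
          using s[of i] s[of j] ij(1,2) by simp
        finally show False
          using e(3)[of i j] ij by simp
      qed
      have "s ` {..<?N} = roots E"
        using s RE(2,3) inj by (intro card_subset_eq) (auto simp: card_image)
      then have "configuration_orbit g (enum s, None) = root_orbit E"
        using enum_top(2)[OF inj] by simp
      moreover have "s i \<in> Some -` A i" if "i < ?N" for i
        using s[OF that] by (intro subsetD[OF e(2)[OF that]]) simp
      then have "enum s \<in> Pi\<^sub>E {..<?N} A"
        by (simp add: enum_def PiE_iff)
      then have "(enum s, None) \<in> \<Omega>"
        using A(3) UV(3,4) by blast
      then have "(enum s, None) \<in> \<Omega> \<inter> {(b, q). inj_on b {..<?N} \<and> q \<notin> b ` {..<?N}}"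
        using enum_top(1)[OF inj] unfolding topspace_ordered_configurations by blast
      ultimately show ?thesis
        unfolding \<Omega>(2)[symmetric] by auto
    qed
    ultimately show ?thesis
      by blast
  qed
  \<comment> \<open>The union of all open sets whose admissible members have their orbits in
    \<open>O'\<close>; one set then works for every \<open>D\<close>.\<close>
  define W where "W = \<Union>{W. open W \<and> (\<forall>E. admissible g E \<and> coeff E \<in> W \<longrightarrow> root_orbit E \<in> O')}"
  show thesis
  proof (rule that)
    show "open W"
      unfolding W_def by (rule open_Union) blast
    show "coeff D \<in> W \<longleftrightarrow> root_orbit D \<in> O'" if "admissible g D" for D
      using loc[OF that] that unfolding W_def by blast
  qed
qed

text \<open>The coefficients are elementary symmetric functions of the \<open>f i\<close>; each
  further linear factor combines the previous ones continuously.\<close>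

lemma continuous_on_coeff_prod:
  fixes f :: "'i \<Rightarrow> 'b::topological_space \<Rightarrow> complex"
  assumes "finite I" "\<And>i. i \<in> I \<Longrightarrow> continuous_on G (f i)"
  shows "continuous_on G (\<lambda>x. coeff (\<Prod>i\<in>I. [:f i x, 1:]) k)"
  using assms
proof (induction I arbitrary: k rule: finite_induct)
  case (insert i I)
  have "coeff (\<Prod>i\<in>insert i I. [:f i x, 1:]) k =
      f i x * coeff (\<Prod>i\<in>I. [:f i x, 1:]) k + (if k = 0 then 0 else coeff (\<Prod>i\<in>I. [:f i x, 1:]) (k - 1))" for x
    using insert.hyps by (simp add: coeff_pCons split: nat.split)
  moreover have "continuous_on G (\<lambda>x. coeff (\<Prod>i\<in>I. [:f i x, 1:]) k)" for k
    using insert by simp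
  ultimately show ?case
    using insert.prems by (cases "k = 0") (auto intro!: continuous_intros)
qed simp

text \<open>The automorphism \<open>z \<mapsto> z / (1 - z u)\<close> moves \<open>1 / u\<close> to infinity and depends continuously on \<open>u\<close>
  also at \<open>u = 0\<close>.\<close>

lemma ex_aut_near_infinity:
  obtains \<tau> where "sphere_aut \<tau>" "\<tau> (from_inv u) = None" "\<And>z. 1 - z * u \<noteq> 0 \<Longrightarrow> \<tau> (Some z) = Some (z / (1 - z * u))"
proof
  let ?\<tau> = "sphere_inv \<circ> sphere_affine 1 (- u) \<circ> sphere_inv"
  have "sphere_aut (sphere_inv \<circ> (sphere_affine 1 (- u) \<circ> sphere_inv))"
    by (intro sphere_aut_compose sphere_aut_inv sphere_aut_affine) simp
  then show "sphere_aut ?\<tau>"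
    by (simp add: comp_assoc)
  show "?\<tau> (from_inv u) = None"
    by (simp add: sphere_inv_def sphere_affine_def from_inv_def)
  show "?\<tau> (Some z) = Some (z / (1 - z * u))" if "1 - z * u \<noteq> 0" for z
  proof (cases "z = 0")
    case False
    then have "inverse z - u = (1 - z * u) / z"
      by (simp add: field_simps)
    then show ?thesis
      using False that by (simp add: sphere_inv_def sphere_affine_def from_inv_def)
  qed (simp add: sphere_inv_def sphere_affine_def from_inv_def)
qed

text \<open>The converse continuity: polynomials obtained from nearby configurations have nearby
  coefficients. The marked point is part of the configuration and may move, so after normalising it
  to infinity at \<open>x0\<close> it has to be brought back there by an automorphism that depends
  continuously on its position.\<close>

lemma openin_root_orbit_image:
  fixes W :: "(nat \<Rightarrow> complex) set"
  assumes W: "open W"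
  shows "openin (configuration_space g) {\<omega> \<in> topspace (configuration_space g). \<exists>D. admissible g D \<and> coeff D \<in> W \<and> root_orbit D = \<omega>}"
    (is "openin _ ?O")
  unfolding configuration_space_def openin_quotient_topology
proof
  let ?T = "ordered_configurations g" and ?N = "2 * g + 2"
  show "{\<omega> \<in> topspace (quotient_topology ?T (configuration_orbit g)). \<exists>D. admissible g D \<and> coeff D \<in> W \<and> root_orbit D = \<omega>}
     \<subseteq> configuration_orbit g ` topspace ?T"
    unfolding topspace_quotient_topology by blast
  define \<Omega> where "\<Omega> = {x \<in> topspace ?T. \<exists>D. admissible g D \<and> coeff D \<in> W \<and> root_orbit D = configuration_orbit g x}"
  have "\<exists>N. openin ?T N \<and> x0 \<in> N \<and> N \<subseteq> \<Omega>" if x0: "x0 \<in> \<Omega>" for x0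
  proof -
    obtain b0 q0 where x0_eq: "x0 = (b0, q0)"
      by (cases x0)
    obtain D where D: "admissible g D" "coeff D \<in> W" "root_orbit D = configuration_orbit g (b0, q0)"
      and top0: "(b0, q0) \<in> topspace ?T"
      using x0 unfolding \<Omega>_def x0_eq by blast
    have "(Some ` roots D, {None}) \<in> branch_orbit (b0 ` {..<?N}) q0"
      using branch_orbit_self D(3) unfolding configuration_orbit_eq by metis
    then obtain \<sigma> where \<sigma>: "sphere_aut \<sigma>" "Some ` roots D = \<sigma> ` b0 ` {..<?N}" "None = \<sigma> q0"
      by (rule branch_orbit_memberE)
    define \<zeta>0 where "\<zeta>0 i = the (\<sigma> (b0 i))" for i
    note Z = root_poly_of_configuration[OF top0 \<sigma>(1) \<sigma>(3)[symmetric], folded \<zeta>0_def]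
    have "\<zeta>0 ` {..<?N} = roots D"
      using Z(1) unfolding \<sigma>(2)[symmetric] by (simp only: inj_image_eq_iff[OF inj_Some])
    then have "D = root_poly (\<zeta>0 ` {..<?N})"
      by (simp only: admissible_root_form(1)[OF D(1)])
    then have D_eq: "D = (\<Prod>i<?N. [:- \<zeta>0 i, 1:])"
      unfolding root_poly_def prod.reindex[OF Z(2)] comp_def .
    have some0: "\<sigma> (b0 i) = Some (\<zeta>0 i)" if "i < ?N" for i
    proof -
      have "\<sigma> (b0 i) \<in> Some ` roots D"
        unfolding \<sigma>(2) using that by simp
      then show ?thesis
        unfolding \<zeta>0_def by auto
    qed
    \<comment> \<open>On \<open>G\<close> the automorphism z / (1 - z u) sends no root to infinity,
      and \<open>F\<close> lists the coefficients after this move. At u = 0 the polynomial is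
      \<open>D\<close> itself.\<close>
    define G where "G = {x :: (nat \<Rightarrow> complex) \<times> complex. \<forall>i\<in>{..<?N}. 1 - fst x i * snd x \<noteq> 0}"
    define F where "F x = coeff (\<Prod>i<?N. [:- (fst x i / (1 - fst x i * snd x)), 1:])" for x :: "(nat \<Rightarrow> complex) \<times> complex"
    have c: "continuous_on S (\<lambda>x :: (nat \<Rightarrow> complex) \<times> complex. fst x i)" for S i
      by (rule continuous_on_compose2[OF continuous_on_product_coordinates continuous_on_fst[OF continuous_on_id]]) simp
    have "G = (\<Inter>i\<in>{..<?N}. {x. 1 - fst x i * snd x \<noteq> 0})"
      by (auto simp: G_def)
    then have "open G"
      by (simp only:) (intro open_INT ballI open_Collect_neq continuous_intros c finite_lessThan)
    moreover have "continuous_on G F"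
      unfolding F_def
      by (intro continuous_on_coordinatewise_then_product continuous_on_coeff_prod continuous_intros c finite_lessThan)
        (auto simp: G_def)
    ultimately have "open (G \<inter> F -` W)"
      using W by (intro continuous_open_preimage)
    moreover have "(\<zeta>0, 0) \<in> G \<inter> F -` W"
      using D(2) by (simp add: G_def F_def D_eq)
    ultimately obtain A B where AB: "open A" "open B" "(\<zeta>0, 0) \<in> A \<times> B" "A \<times> B \<subseteq> G \<inter> F -` W"
      by (rule open_prod_elim)
    have "openin (product_topology (\<lambda>_. euclidean) UNIV) A"
      using AB(1) by (simp add: euclidean_product_topology)
    then obtain A' where A': "\<And>i. open (A' i)" "\<zeta>0 \<in> Pi\<^sub>E UNIV A'" "Pi\<^sub>E UNIV A' \<subseteq> A"
      using AB(3) unfolding openin_product_topology_alt by (simp add: mem_Sigma_iff) metis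
    define Nb where "Nb = {x \<in> topspace ?T. \<forall>i\<in>{..<?N}. \<sigma> (fst x i) \<in> Some ` A' i} \<inter> {x \<in> topspace ?T. \<sigma> (snd x) \<in> from_inv ` B}"
    have \<sigma>c: "continuous_map (top_space riemann_sphere) (top_space riemann_sphere) \<sigma>"
      using sphere_autD(2)[OF \<sigma>(1)] unfolding holomorphic_map_def by (rule conjunct1)
    have p1: "continuous_map ?T (top_space riemann_sphere) (\<lambda>x. \<sigma> (fst x i))" if "i < ?N" for i
    proof -
      have "continuous_map ?T (product_topology (\<lambda>_. top_space riemann_sphere) {..<?N}) fst"
        unfolding ordered_configurations_def by (intro continuous_map_from_subtopology continuous_map_fst)
      moreover have "continuous_map (product_topology (\<lambda>_. top_space riemann_sphere) {..<?N}) (top_space riemann_sphere) (\<lambda>x. x i)"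
        using continuous_map_product_projection[of i "{..<?N}" "\<lambda>_. top_space riemann_sphere"] that by simp
      ultimately have "continuous_map ?T (top_space riemann_sphere) (\<sigma> \<circ> ((\<lambda>x. x i) \<circ> fst))"
        by (intro continuous_map_compose[OF _ \<sigma>c]) (rule continuous_map_compose)
      then show ?thesis
        by (simp add: comp_def)
    qed
    have "continuous_map ?T (top_space riemann_sphere) (\<sigma> \<circ> snd)"
      unfolding ordered_configurations_def by (intro continuous_map_compose[OF _ \<sigma>c] continuous_map_from_subtopology continuous_map_snd)
    then have o2: "openin ?T {x \<in> topspace ?T. \<sigma> (snd x) \<in> from_inv ` B}"
      using openin_continuous_map_preimage[OF _ openin_sphere_from_inv[OF AB(2)]] by (simp add: comp_def)
    have "openin ?T ((\<Inter>i\<in>{..<?N}. {x \<in> topspace ?T. \<sigma> (fst x i) \<in> Some ` A' i}) \<inter> topspace ?T)"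
      by (rule openin_INT[OF finite_lessThan])
        (rule openin_continuous_map_preimage[OF p1 openin_sphere_Some[OF A'(1)]], simp)
    also have "(\<Inter>i\<in>{..<?N}. {x \<in> topspace ?T. \<sigma> (fst x i) \<in> Some ` A' i}) \<inter> topspace ?T =
        {x \<in> topspace ?T. \<forall>i\<in>{..<?N}. \<sigma> (fst x i) \<in> Some ` A' i}"
      by blast
    finally have oN: "openin ?T Nb"
      unfolding Nb_def using o2 by (rule openin_Int)
    have "\<zeta>0 i \<in> A' i" for i
      using A'(2) by (auto simp: PiE_iff)
    moreover have "\<sigma> q0 = from_inv 0" "0 \<in> B"
      using \<sigma>(3) AB(3) by (simp_all add: from_inv_def)
    ultimately have x0N: "x0 \<in> Nb"
      unfolding Nb_def x0_eq using top0 some0 by auto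
    have "Nb \<subseteq> \<Omega>"
    proof
      fix x assume x: "x \<in> Nb"
      obtain b q where x_eq: "x = (b, q)"
        by (cases x)
      have top: "(b, q) \<in> topspace ?T" and bA: "\<And>i. i < ?N \<Longrightarrow> \<sigma> (b i) \<in> Some ` A' i"
        and qB: "\<sigma> q \<in> from_inv ` B"
        using x unfolding Nb_def x_eq by auto
      obtain u where u: "\<sigma> q = from_inv u" "u \<in> B"
        using qB by blast
      \<comment> \<open>Indices from 2g + 2 on keep the value of \<open>\<zeta>0\<close>, so that
        the whole sequence stays in the box \<open>A'\<close>.\<close>
      define \<zeta> where "\<zeta> i = (if i < ?N then the (\<sigma> (b i)) else \<zeta>0 i)" for i
      have \<zeta>: "\<sigma> (b i) = Some (\<zeta> i)" if "i < ?N" for i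
        using bA[OF that] that by (auto simp: \<zeta>_def)
      have "\<zeta> i \<in> A' i" for i
        using bA[of i] \<open>\<And>i. \<zeta>0 i \<in> A' i\<close> by (auto simp: \<zeta>_def)
      then have "(\<zeta>, u) \<in> A \<times> B"
        using A'(3) u(2) by (auto simp: PiE_iff)
      then have GF: "(\<zeta>, u) \<in> G" "F (\<zeta>, u) \<in> W"
        using AB(4) by auto
      obtain \<tau> where \<tau>: "sphere_aut \<tau>" "\<tau> (from_inv u) = None"
        "\<And>z. 1 - z * u \<noteq> 0 \<Longrightarrow> \<tau> (Some z) = Some (z / (1 - z * u))"
        using ex_aut_near_infinity[of u] by metis
      have \<rho>: "sphere_aut (\<tau> \<circ> \<sigma>)" "(\<tau> \<circ> \<sigma>) q = None"
        using sphere_aut_compose[OF \<sigma>(1) \<tau>(1)] \<tau>(2) u(1) by simp_all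
      have val: "the ((\<tau> \<circ> \<sigma>) (b i)) = \<zeta> i / (1 - \<zeta> i * u)" if "i < ?N" for i
        using \<zeta>[OF that] \<tau>(3)[of "\<zeta> i"] GF(1) that by (simp add: G_def)
      note Z' = root_poly_of_configuration[OF top \<rho>]
      have "root_poly ((\<lambda>i. the ((\<tau> \<circ> \<sigma>) (b i))) ` {..<?N}) = (\<Prod>i<?N. [:- the ((\<tau> \<circ> \<sigma>) (b i)), 1:])"
        unfolding root_poly_def using Z'(2) by (simp only: prod.reindex comp_def)
      also have "\<dots> = (\<Prod>i<?N. [:- (\<zeta> i / (1 - \<zeta> i * u)), 1:])"
        by (intro prod.cong refl) (use val in simp)
      finally have "coeff (root_poly ((\<lambda>i. the ((\<tau> \<circ> \<sigma>) (b i))) ` {..<?N})) \<in> W"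
        using GF(2) by (simp add: F_def)
      then show "x \<in> \<Omega>"
        unfolding \<Omega>_def x_eq using top Z'(3,4) by blast
    qed
    then show ?thesis
      using oN x0N by blast
  qed
  then have "openin ?T \<Omega>"
    by (subst openin_subopen) blast
  moreover have "\<Omega> = {x \<in> topspace ?T. configuration_orbit g x \<in>
      {\<omega> \<in> topspace (quotient_topology ?T (configuration_orbit g)). \<exists>D. admissible g D \<and> coeff D \<in> W \<and> root_orbit D = \<omega>}}"
    unfolding topspace_quotient_topology \<Omega>_def by blast
  ultimately show "openin ?T {x \<in> topspace ?T. configuration_orbit g x \<in>
      {\<omega> \<in> topspace (quotient_topology ?T (configuration_orbit g)). \<exists>D. admissible g D \<and> coeff D \<in> W \<and> root_orbit D = \<omega>}}"
    by simp
qed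

section \<open>Branch data of pointed surfaces\<close>

lemma quotient_compose:
  assumes M: "compact_riemann_surface M" and \<pi>: "quotient_to_sphere M J \<pi>" and \<sigma>: "sphere_aut \<sigma>"
  shows "quotient_to_sphere M J (\<lambda>y. \<sigma> (\<pi> y))"
  unfolding quotient_to_sphere_def
proof (intro conjI ballI)
  note S = sphere_autD[OF \<sigma>]
  have "holomorphic_map M riemann_sphere (\<sigma> \<circ> \<pi>)"
    using \<pi> unfolding quotient_to_sphere_def
    by (intro holomorphic_map_compose[OF M compact_riemann_surface_sphere _ S(2)]) simp
  then show "holomorphic_map M riemann_sphere (\<lambda>y. \<sigma> (\<pi> y))"
    by (simp add: comp_def)
  have "(\<lambda>y. \<sigma> (\<pi> y)) ` points M = \<sigma> ` \<pi> ` points M"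
    by (simp add: image_image)
  also have "\<dots> = points riemann_sphere"
    using \<pi> bij_is_surj[OF S(1)] unfolding quotient_to_sphere_def by (simp add: points_sphere)
  finally show "(\<lambda>y. \<sigma> (\<pi> y)) ` points M = points riemann_sphere" .
  fix y z assume "y \<in> points M" "z \<in> points M"
  then have "\<pi> y = \<pi> z \<longleftrightarrow> z = y \<or> z = J y"
    using \<pi> unfolding quotient_to_sphere_def by simp
  then show "\<sigma> (\<pi> y) = \<sigma> (\<pi> z) \<longleftrightarrow> z = y \<or> z = J y"
    using inj_eq[OF bij_is_inj[OF S(1)]] by simp
qed

locale pointed_involution = riemann_surface M for M :: "'a surface" +
  fixes J :: "'a \<Rightarrow> 'a" and p :: 'a
  assumes J_in: "y \<in> points M \<Longrightarrow> J y \<in> points M" and J_J: "y \<in> points M \<Longrightarrow> J (J y) = y"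
    and p_in: "p \<in> points M" and Jp: "J p \<noteq> p"
begin

abbreviation fixed_points :: "'a set" where "fixed_points \<equiv> {y \<in> points M. J y = y}"

text \<open>The fibre over infinity is {p, J p}; off it the quotient map is finite and holomorphic
  in the finite chart, and its continuity at infinity gives the limits at both ends.\<close>

lemma quotient_double_cover:
  assumes \<pi>: "quotient_to_sphere M J \<pi>" and inf: "\<pi> p = None" and fin: "finite fixed_points"
  shows "double_cover M J (\<lambda>y. the (\<pi> y)) p (J p)"
    and "y \<in> points M - {p, J p} \<Longrightarrow> \<pi> y = Some (the (\<pi> y))" and "\<pi> (J p) = None"
proof -
  have fib: "\<pi> y = \<pi> z \<longleftrightarrow> z = y \<or> z = J y" if "y \<in> points M" "z \<in> points M" for y z
    using \<pi> that unfolding quotient_to_sphere_def by simp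
  have hol: "holomorphic_map M riemann_sphere \<pi>" and surj: "\<pi> ` points M = UNIV"
    using \<pi> unfolding quotient_to_sphere_def by (simp_all add: points_sphere)
  have None_iff: "\<pi> y = None \<longleftrightarrow> y = p \<or> y = J p" if "y \<in> points M" for y
    using fib[OF p_in that] inf by metis
  show "\<pi> (J p) = None"
    using None_iff J_in[OF p_in] by blast
  have some: "\<pi> y = Some (the (\<pi> y))" if "y \<in> points M - {p, J p}" for y
    using None_iff[of y] that by (metis DiffE insertCI option.exhaust_sel)
  then show "y \<in> points M - {p, J p} \<Longrightarrow> \<pi> y = Some (the (\<pi> y))" .
  have lim: "filterlim (\<lambda>y. the (\<pi> y)) at_infinity (atin (top_space M) z)" if z: "z \<in> {p, J p}" for z
    unfolding filterlim_at_infinity[OF order_refl]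
  proof (intro allI impI)
    fix r :: real
    let ?W = "{z. z = None \<or> r < norm (the z)}"
    have zp: "z \<in> points M" "\<pi> z = None"
      using z p_in J_in None_iff by auto
    have "openin (top_space riemann_sphere) ?W"
      by (rule openin_sphere_near_infinity)
    moreover have "continuous_map (top_space M) (top_space riemann_sphere) \<pi>"
      using hol unfolding holomorphic_map_def by (rule conjunct1)
    ultimately have "openin (top_space M) {y \<in> points M. \<pi> y \<in> ?W}"
      by (rule openin_continuous_map_preimage[rotated])
    then have "openin (top_space M) ({y \<in> points M. \<pi> y \<in> ?W} - ({p, J p} - {z}))"
      by (rule openin_Diff_finite) (use p_in J_in in auto)
    moreover have "z \<in> {y \<in> points M. \<pi> y \<in> ?W} - ({p, J p} - {z})"
      using zp by simp
    moreover have "r \<le> norm (the (\<pi> y))" if y: "y \<in> {y \<in> points M. \<pi> y \<in> ?W} - ({p, J p} - {z}) - {z}" for y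
    proof -
      have "\<pi> y \<noteq> None"
        using y None_iff[of y] by auto
      then show ?thesis
        using y by auto
    qed
    ultimately show "eventually (\<lambda>y. r \<le> norm (the (\<pi> y))) (atin (top_space M) z)"
      unfolding eventually_atin by blast
  qed
  show "double_cover M J (\<lambda>y. the (\<pi> y)) p (J p)"
  proof (intro double_cover.intro double_cover_axioms.intro)
    show "riemann_surface M"
      by unfold_locales
    show "p \<in> points M" "J p \<in> points M" "p \<noteq> J p"
      using p_in J_in Jp by auto
    show "holomorphic_fun M (points M - {p, J p}) (\<lambda>y. the (\<pi> y))"
      unfolding holomorphic_fun_def
    proof (intro ballI, clarify)
      fix U \<phi> assume U: "(U, \<phi>) \<in> atlas M"
      have eq: "U \<inter> \<pi> -` range Some = U \<inter> (points M - {p, J p})"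
      proof (rule set_eqI)
        fix y
        show "y \<in> U \<inter> \<pi> -` range Some \<longleftrightarrow> y \<in> U \<inter> (points M - {p, J p})"
          using chart_subset[OF U] None_iff[of y] by (cases "\<pi> y") auto
      qed
      have "(the \<circ> \<pi> \<circ> inv_into U \<phi>) holomorphic_on \<phi> ` (U \<inter> \<pi> -` range Some)"
        using hol U unfolding holomorphic_map_def atlas_sphere by blast
      then show "((\<lambda>y. the (\<pi> y)) \<circ> inv_into U \<phi>) holomorphic_on \<phi> ` (U \<inter> (points M - {p, J p}))"
        unfolding eq by (simp add: comp_def)
    qed
    show "(\<lambda>y. the (\<pi> y)) ` (points M - {p, J p}) = UNIV"
    proof (intro equalityI subsetI)
      fix c :: complex
      have "Some c \<in> \<pi> ` points M"
        unfolding surj by simp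
      then obtain y where y: "y \<in> points M" "\<pi> y = Some c"
        by (elim imageE) simp
      then show "c \<in> (\<lambda>y. the (\<pi> y)) ` (points M - {p, J p})"
        using None_iff[OF y(1)] by (intro image_eqI[of _ _ y]) auto
    qed simp
    show "J y \<in> points M - {p, J p}" if "y \<in> points M - {p, J p}" for y
      using that J_in J_J p_in by (metis Diff_iff insert_iff singletonD)
    show "the (\<pi> y) = the (\<pi> z) \<longleftrightarrow> z = y \<or> z = J y"
      if "y \<in> points M - {p, J p}" "z \<in> points M - {p, J p}" for y z
      using that some[of y] some[of z] fib[of y z] by (metis DiffD1)
    show "filterlim (\<lambda>y. the (\<pi> y)) at_infinity (atin (top_space M) p)"
      "filterlim (\<lambda>y. the (\<pi> y)) at_infinity (atin (top_space M) (J p))"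
      by (rule lim; simp)+
    show "finite {y \<in> points M - {p, J p}. J y = y}"
      by (rule finite_subset[OF _ fin]) blast
  qed
qed

text \<open>The second quotient map descends along the first to an entire function, which is
  injective because the fibres coincide and tends to infinity; hence it is affine.\<close>

lemma quotient_unique_infinity:
  assumes \<pi>: "quotient_to_sphere M J \<pi>" "\<pi> p = None" and \<rho>: "quotient_to_sphere M J \<rho>" "\<rho> p = None"
    and fin: "finite fixed_points"
  obtains a b where "a \<noteq> 0" "\<And>y. y \<in> points M \<Longrightarrow> \<rho> y = sphere_affine a b (\<pi> y)"
proof -
  note Q\<pi> = quotient_double_cover[OF \<pi> fin] and Q\<rho> = quotient_double_cover[OF \<rho> fin]
  interpret X: double_cover M J "\<lambda>y. the (\<pi> y)" p "J p"
    by (rule Q\<pi>(1))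
  interpret Y: double_cover M J "\<lambda>y. the (\<rho> y)" p "J p"
    by (rule Q\<rho>(1))
  let ?A = "points M - {p, J p}"
  \<comment> \<open>The mean is a symmetric expression that returns the second coordinate itself,
    since that is invariant under \<open>J\<close>.\<close>
  have "\<exists>S. S holomorphic_on UNIV \<and> (\<forall>y\<in>?A. S (the (\<pi> y)) = (the (\<rho> y) + the (\<rho> (J y))) / 2)"
  proof (rule X.symmetric_descent[OF Y.X_hol, where T = "\<lambda>a b. (a + b) / 2"], goal_cases)
    case (2 W f g)
    then show ?case
      by (intro holomorphic_intros) auto
  next
    case 3
    have "continuous_on UNIV (\<lambda>x :: complex \<times> complex. (fst x + snd x) / 2)"
      by (intro continuous_intros) auto
    then show ?case
      by (simp add: case_prod_unfold)
  next
    case (4 S)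
    then show ?case
      by metis
  qed (simp add: add.commute)
  then obtain S where S: "S holomorphic_on UNIV" "\<And>y. y \<in> ?A \<Longrightarrow> S (the (\<pi> y)) = (the (\<rho> y) + the (\<rho> (J y))) / 2"
    by metis
  have S': "S (the (\<pi> y)) = the (\<rho> y)" if y: "y \<in> ?A" for y
  proof -
    have "the (\<rho> y) = the (\<rho> (J y))"
      using Y.fibre[OF y X.J_aff[OF y]] by simp
    then show ?thesis
      using S(2)[OF y] by simp
  qed
  have inj: "inj S"
  proof (rule injI)
    fix c d assume cd: "S c = S d"
    have "c \<in> (\<lambda>y. the (\<pi> y)) ` ?A" "d \<in> (\<lambda>y. the (\<pi> y)) ` ?A"
      unfolding X.X_surj by simp_all
    then obtain y z where yz: "y \<in> ?A" "z \<in> ?A" "c = the (\<pi> y)" "d = the (\<pi> z)"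
      by (elim imageE) simp
    then have "the (\<rho> y) = the (\<rho> z)"
      using cd S'[OF yz(1)] S'[OF yz(2)] by simp
    then show "c = d"
      unfolding yz(3,4) using Y.fibre[OF yz(1,2)] X.fibre[OF yz(1,2)] by simp
  qed
  have lim: "filterlim S at_infinity at_infinity"
  proof (rule X.section_at_infinity)
    fix s assume s: "eventually (\<lambda>x. s x \<in> ?A \<and> the (\<pi> (s x)) = x) at_infinity"
      "filterlim s (atin (top_space M) p) at_infinity"
    have "filterlim (\<lambda>x. the (\<rho> (s x))) at_infinity at_infinity"
      by (rule filterlim_compose[OF Y.X_inf(1) s(2)])
    moreover have "eventually (\<lambda>x. the (\<rho> (s x)) = S x) at_infinity"
      using s(1) by (rule eventually_mono) (use S' in metis)
    ultimately show ?thesis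
      by (rule filterlim_mono_eventually[OF _ order_refl order_refl])
  qed
  obtain a b where ab: "a \<noteq> 0" "\<And>z. S z = a * z + b"
    using injective_entire_proper_affine[OF S(1) inj lim] by metis
  have "\<rho> y = sphere_affine a b (\<pi> y)" if y: "y \<in> points M" for y
  proof (cases "y \<in> ?A")
    case True
    have "\<rho> y = Some (a * the (\<pi> y) + b)"
      using Q\<rho>(2)[OF True] S'[OF True] ab(2) by simp
    then show ?thesis
      by (subst Q\<pi>(2)[OF True]) (simp add: sphere_affine_def)
  next
    case False
    then have "y = p \<or> y = J p"
      using y by blast
    then show ?thesis
      using \<pi>(2) \<rho>(2) Q\<pi>(3) Q\<rho>(3) by (auto simp: sphere_affine_def)
  qed
  then show thesis
    using that ab(1) by blast
qed

end

text \<open>Any two quotient maps differ by an automorphism of the sphere, after moving the image of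
  \<open>p\<close> to infinity. The second claim recovers a quotient map that realises the given
  branch set with \<open>p\<close> over infinity.\<close>

lemma branch_data_orbit:
  assumes inv: "pointed_involution M J p"
    and B: "(B, {None}) \<in> branch_data (M, J, {p, J p})" and fin: "finite B"
  shows "branch_data (M, J, {p, J p}) = branch_orbit B None"
    and "\<exists>\<pi>. quotient_to_sphere M J \<pi> \<and> \<pi> p = None \<and> B = \<pi> ` {y \<in> points M. J y = y} \<and> finite {y \<in> points M. J y = y}"
proof -
  interpret pointed_involution M J p
    by (rule inv)
  obtain \<pi> where \<pi>: "quotient_to_sphere M J \<pi>" "B = \<pi> ` fixed_points" "{None} = \<pi> ` {p, J p}"
    using B unfolding branch_data_def by auto
  have inf: "\<pi> p = None" "\<pi> (J p) = None"
    using \<pi>(3) by auto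
  \<comment> \<open>A fixed point is alone in its fibre, so finiteness of \<open>B\<close> gives
    finiteness of the fixed point set.\<close>
  have "inj_on \<pi> fixed_points"
  proof (rule inj_onI)
    fix y z assume yz: "y \<in> fixed_points" "z \<in> fixed_points" "\<pi> y = \<pi> z"
    then have "z = y \<or> z = J y"
      using \<pi>(1) unfolding quotient_to_sphere_def by simp
    then show "y = z"
      using yz(1) by auto
  qed
  then have finF: "finite fixed_points"
    using fin finite_imageD unfolding \<pi>(2) by blast
  then show "\<exists>\<pi>. quotient_to_sphere M J \<pi> \<and> \<pi> p = None \<and> B = \<pi> ` fixed_points \<and> finite fixed_points"
    using \<pi>(1,2) inf(1) by blast
  show "branch_data (M, J, {p, J p}) = branch_orbit B None"
  proof (intro equalityI subsetI)
    fix z assume "z \<in> branch_data (M, J, {p, J p})"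
    then obtain \<rho> where \<rho>: "quotient_to_sphere M J \<rho>" "z = (\<rho> ` fixed_points, \<rho> ` {p, J p})"
      unfolding branch_data_def by auto
    obtain \<tau> where \<tau>: "sphere_aut \<tau>" "\<tau> (\<rho> p) = None"
      using ex_aut_to_None by metis
    obtain a b where ab: "a \<noteq> 0" "\<And>y. y \<in> points M \<Longrightarrow> \<tau> (\<rho> y) = sphere_affine a b (\<pi> y)"
      using quotient_unique_infinity[OF \<pi>(1) inf(1) quotient_compose[OF crs \<rho>(1) \<tau>(1)] \<tau>(2) finF] by metis
    let ?\<sigma> = "inv \<tau> \<circ> sphere_affine a b"
    have \<sigma>: "sphere_aut ?\<sigma>"
      by (rule sphere_aut_compose[OF sphere_aut_affine[OF ab(1)] sphere_autD(3)[OF \<tau>(1)]])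
    have eq: "\<rho> y = ?\<sigma> (\<pi> y)" if "y \<in> points M" for y
      using ab(2)[OF that] bij_is_inj[OF sphere_autD(1)[OF \<tau>(1)]] by (metis comp_apply inv_f_f)
    have "\<rho> ` fixed_points = ?\<sigma> ` B"
      unfolding \<pi>(2) image_image by (rule image_cong) (use eq in auto)
    moreover have "\<rho> ` {p, J p} = {?\<sigma> None}"
      using eq[OF p_in] eq[OF J_in[OF p_in]] inf by simp
    ultimately show "z \<in> branch_orbit B None"
      unfolding branch_orbit_def \<rho>(2) using \<sigma> by blast
  next
    fix z assume "z \<in> branch_orbit B None"
    then obtain \<sigma> where \<sigma>: "z = (\<sigma> ` B, {\<sigma> None})" "sphere_aut \<sigma>"
      unfolding branch_orbit_def by blast
    have "z = ((\<lambda>y. \<sigma> (\<pi> y)) ` fixed_points, (\<lambda>y. \<sigma> (\<pi> y)) ` {p, J p})"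
      unfolding \<sigma>(1) \<pi>(2) image_image using inf by simp
    then show "z \<in> branch_data (M, J, {p, J p})"
      unfolding branch_data_def using quotient_compose[OF crs \<pi>(1) \<sigma>(2)] by auto
  qed
qed

section \<open>Surfaces with a torsion pair against Pell-Abel polynomials\<close>

lemma torsion_surfaces_cases:
  assumes "X \<in> torsion_surfaces g n"
  obtains M J p where "X = (M, J, {p, J p})" "pointed_involution M J p" "n \<ge> 1"
    "\<exists>f. has_divisor M f (diff_divisor n p (J p))"
    "\<forall>m. 1 \<le> m \<and> m < n \<longrightarrow> \<not> (\<exists>f. has_divisor M f (diff_divisor m p (J p)))"
proof -
  obtain M J A where X: "X = (M, J, A)" "hyperelliptic g M J" "primitive_torsion_pair n M J A"
    using assms unfolding torsion_surfaces_def by auto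
  obtain p where p: "p \<in> points M" "J p \<noteq> p" "A = {p, J p}" "n \<ge> 1"
    "\<exists>f. has_divisor M f (diff_divisor n p (J p))"
    "\<forall>m. 1 \<le> m \<and> m < n \<longrightarrow> \<not> (\<exists>f. has_divisor M f (diff_divisor m p (J p)))"
    using X(3) unfolding primitive_torsion_pair_def by blast
  have "continuous_map (top_space M) (top_space M) J"
    using X(2) unfolding hyperelliptic_def holomorphic_map_def by blast
  then have "J y \<in> points M" if "y \<in> points M" for y
    using that unfolding continuous_map_def by (simp add: Pi_iff)
  then have "pointed_involution M J p"
    using X(2) p(1,2) unfolding hyperelliptic_def
    by (intro pointed_involution.intro riemann_surface.intro pointed_involution_axioms.intro) auto
  then show thesis
    using that X(1) p(3-) by blast
qed

text \<open>A quotient map with branch values the roots of \<open>D\<close> makes the surface a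
  double cover whose branch polynomial is \<open>D\<close>. The claim holds for every admissible
  \<open>D\<close> with the given orbit, which is used when open sets are compared.\<close>

lemma pell_abel_of_branch_data:
  assumes X: "X \<in> torsion_surfaces g n" and D: "admissible g D" and b: "branch_data X = root_orbit D"
  shows "D \<in> pell_abel_set g n"
proof -
  obtain M J p where M: "X = (M, J, {p, J p})" "pointed_involution M J p" "n \<ge> 1"
    "\<exists>f. has_divisor M f (diff_divisor n p (J p))"
    "\<forall>m. 1 \<le> m \<and> m < n \<longrightarrow> \<not> (\<exists>f. has_divisor M f (diff_divisor m p (J p)))"
    by (rule torsion_surfaces_cases[OF X])
  interpret pointed_involution M J p
    by (rule M(2))
  have "(Some ` roots D, {None}) \<in> branch_data (M, J, {p, J p})"
    using branch_orbit_self[of "Some ` roots D" None] b[symmetric] unfolding M(1) by (rule back_subst[of "\<lambda>S. _ \<in> S"])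
  moreover have "finite (Some ` roots D)"
    using admissible_root_form(2)[OF D] by simp
  ultimately have "\<exists>\<pi>. quotient_to_sphere M J \<pi> \<and> \<pi> p = None \<and> Some ` roots D = \<pi> ` fixed_points \<and> finite fixed_points"
    by (rule branch_data_orbit(2)[OF M(2)])
  then obtain \<pi> where \<pi>: "quotient_to_sphere M J \<pi>" "\<pi> p = None" "Some ` roots D = \<pi> ` fixed_points" "finite fixed_points"
    by (elim exE conjE)
  have "{y \<in> points M - {p, J p}. J y = y} = fixed_points"
    using Jp J_J[OF p_in] by auto
  then have "(\<lambda>y. the (\<pi> y)) ` {y \<in> points M - {p, J p}. J y = y} = the ` Some ` roots D"
    unfolding \<pi>(3) by (simp add: image_image)
  also have "\<dots> = roots D"
    by (simp add: image_image)
  finally have br: "(\<lambda>y. the (\<pi> y)) ` {y \<in> points M - {p, J p}. J y = y} = roots D" .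
  have min: "\<And>m. 1 \<le> m \<Longrightarrow> m < n \<Longrightarrow> \<not> (\<exists>f. has_divisor M f (diff_divisor m p (J p)))"
    using M(5) by simp
  have "\<exists>P Q. primitive_solution (root_poly (roots D)) P Q \<and> degree P = n"
    using double_cover.pell_abel_primitive[OF quotient_double_cover(1)[OF \<pi>(1,2,4)] M(3,4) min]
    unfolding br root_poly_def .
  then show ?thesis
    unfolding pell_abel_set_def using D admissible_root_form(1)[OF D] by simp
qed

lemma torsion_surface_of_pell_abel:
  assumes D: "D \<in> pell_abel_set g n"
  obtains X where "X \<in> torsion_surfaces g n" "branch_data X = root_orbit D"
proof -
  obtain P Q where PQ: "primitive_solution D P Q" "degree P = n" and adm: "admissible g D"
    using D unfolding pell_abel_set_def by blast
  interpret hyp g D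
    by unfold_locales (rule adm)
  let ?X = "(hyp_surface g D, hyp_involution, {Inr True, Inr False})"
  have X: "?X \<in> torsion_surfaces g n"
    unfolding torsion_surfaces_def using hyperelliptic_M torsion_of_primitive_solution[OF PQ(1)] PQ(2) by simp
  obtain M J p where M: "?X = (M, J, {p, J p})" "pointed_involution M J p"
    by (rule torsion_surfaces_cases[OF X])
  have "branch_data ?X = root_orbit D"
    using branch_data_M admissible_root_form(2)[OF adm] unfolding M(1)
    by (intro branch_data_orbit(1)[OF M(2)]) simp_all
  with X show thesis
    by (rule that)
qed

text \<open>Composition with \<open>h\<close> turns quotient maps of \<open>N\<close> into quotient
  maps of \<open>M\<close> and matches fixed points and marked pairs. The other inclusion comes from
  the inverse map.\<close>

lemma branch_data_pullback:
  assumes M: "compact_riemann_surface M" and N: "compact_riemann_surface N"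
    and h: "holomorphic_map M N h" and bij: "bij_betw h (points M) (points N)"
    and J: "\<And>y. y \<in> points M \<Longrightarrow> J y \<in> points M" "\<And>y. y \<in> points M \<Longrightarrow> h (J y) = K (h y)"
    and A: "h ` A = B"
  shows "branch_data (N, K, B) \<subseteq> branch_data (M, J, A)"
proof
  fix z assume "z \<in> branch_data (N, K, B)"
  then obtain \<pi> where \<pi>: "quotient_to_sphere N K \<pi>" "z = (\<pi> ` {y \<in> points N. K y = y}, \<pi> ` B)"
    unfolding branch_data_def by auto
  have inj: "h y = h y' \<longleftrightarrow> y = y'" if "y \<in> points M" "y' \<in> points M" for y y'
    using bij that by (meson bij_betw_imp_inj_on inj_on_eq_iff)
  have im: "h ` points M = points N"
    by (rule bij_betw_imp_surj_on[OF bij])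
  have q: "quotient_to_sphere M J (\<pi> \<circ> h)"
    unfolding quotient_to_sphere_def
  proof (intro conjI ballI)
    show "holomorphic_map M riemann_sphere (\<pi> \<circ> h)"
      using \<pi>(1) unfolding quotient_to_sphere_def by (intro holomorphic_map_compose[OF M N h]) simp
    show "(\<pi> \<circ> h) ` points M = points riemann_sphere"
      unfolding image_comp[symmetric] im using \<pi>(1) unfolding quotient_to_sphere_def by simp
    fix y y' assume y: "y \<in> points M" "y' \<in> points M"
    then have "h y \<in> points N" "h y' \<in> points N"
      unfolding im[symmetric] by simp_all
    then have "\<pi> (h y) = \<pi> (h y') \<longleftrightarrow> h y' = h y \<or> h y' = K (h y)"
      using \<pi>(1) unfolding quotient_to_sphere_def by simp
    also have "\<dots> \<longleftrightarrow> y' = y \<or> y' = J y"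
      using inj[OF y(2,1)] inj[OF y(2) J(1)[OF y(1)]] J(2)[OF y(1)] by simp
    finally show "(\<pi> \<circ> h) y = (\<pi> \<circ> h) y' \<longleftrightarrow> y' = y \<or> y' = J y"
      by simp
  qed
  have "{y \<in> points N. K y = y} = h ` {y \<in> points M. J y = y}"
  proof (intro equalityI subsetI)
    fix y' assume y': "y' \<in> {y \<in> points N. K y = y}"
    then obtain y where y: "y \<in> points M" "y' = h y"
      using im by auto
    then have "h (J y) = h y"
      using y' J(2) by simp
    then show "y' \<in> h ` {y \<in> points M. J y = y}"
      using y inj J(1) by blast
  next
    fix y' assume "y' \<in> h ` {y \<in> points M. J y = y}"
    then obtain y where y: "y \<in> points M" "J y = y" "y' = h y"
      by blast
    then show "y' \<in> {y \<in> points N. K y = y}"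
      using J(2)[OF y(1)] im by auto
  qed
  then have "z = ((\<pi> \<circ> h) ` {y \<in> points M. J y = y}, (\<pi> \<circ> h) ` A)"
    unfolding \<pi>(2) A[symmetric] image_comp[symmetric] by simp
  then show "z \<in> branch_data (M, J, A)"
    unfolding branch_data_def prod.case using q by (intro CollectI exI[of _ "\<pi> \<circ> h"] conjI)
qed

lemma branch_data_isomorphic:
  assumes X: "X \<in> torsion_surfaces g n" and Y: "Y \<in> torsion_surfaces g n" and iso: "isomorphic X Y"
  shows "branch_data X = branch_data Y"
proof -
  obtain M J p where M: "X = (M, J, {p, J p})" "pointed_involution M J p"
    by (rule torsion_surfaces_cases[OF X])
  obtain N K q where N: "Y = (N, K, {q, K q})" "pointed_involution N K q"
    by (rule torsion_surfaces_cases[OF Y])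
  interpret M: pointed_involution M J p
    by (rule M(2))
  interpret N: pointed_involution N K q
    by (rule N(2))
  obtain h where h: "biholomorphic_map M N h" "\<And>y. y \<in> points M \<Longrightarrow> h (J y) = K (h y)" "h ` {p, J p} = {q, K q}"
    using iso unfolding isomorphic_def M(1) N(1) by auto
  have b: "bij_betw h (points M) (points N)" "holomorphic_map M N h" "holomorphic_map N M (inv_into (points M) h)"
    using h(1) unfolding biholomorphic_map_def by simp_all
  let ?k = "inv_into (points M) h"
  have k: "?k (h y) = y" if "y \<in> points M" for y
    by (rule bij_betw_inv_into_left[OF b(1) that])
  show ?thesis
    unfolding M(1) N(1)
  proof (rule subset_antisym)
    show "branch_data (N, K, {q, K q}) \<subseteq> branch_data (M, J, {p, J p})"
      by (rule branch_data_pullback[OF M.crs N.crs b(2,1) M.J_in _ h(3)]) (use h(2) in simp_all)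
    show "branch_data (M, J, {p, J p}) \<subseteq> branch_data (N, K, {q, K q})"
    proof (rule branch_data_pullback[OF N.crs M.crs b(3) bij_betw_inv_into[OF b(1)] N.J_in])
      show "?k (K y) = J (?k y)" if y: "y \<in> points N" for y
      proof -
        obtain x where x: "x \<in> points M" "y = h x"
          using y bij_betw_imp_surj_on[OF b(1)] by blast
        have "?k (K y) = ?k (h (J x))"
          unfolding x(2) h(2)[OF x(1)] ..
        then show ?thesis
          using k[OF M.J_in[OF x(1)]] k[OF x(1)] x(2) by simp
      qed
      have "?k ` h ` {p, J p} = {p, J p}"
        using k[OF M.p_in] k[OF M.J_in[OF M.p_in]] by simp
      then show "?k ` {q, K q} = {p, J p}"
        unfolding h(3) .
    qed
  qed
qed

lemma (in riemann_surface) biholomorphic_map_id: "biholomorphic_map M M id"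
  unfolding biholomorphic_map_def
proof (intro conjI)
  have hol: "holomorphic_map M M f" if f: "\<And>y. y \<in> points M \<Longrightarrow> f y = y" for f
    unfolding holomorphic_map_def
  proof (intro conjI ballI, safe)
    show "continuous_map (top_space M) (top_space M) f"
      by (rule continuous_map_eq[OF continuous_map_id]) (simp add: f)
    fix U \<phi> V \<psi> assume U: "(U, \<phi>) \<in> atlas M" and V: "(V, \<psi>) \<in> atlas M"
    have fU: "f y = y" if "y \<in> U" for y
      using chart_subset[OF U] f that by blast
    then have "U \<inter> f -` V = U \<inter> V"
      by auto
    then show "(\<psi> \<circ> f \<circ> inv_into U \<phi>) holomorphic_on \<phi> ` (U \<inter> f -` V)"
      using transition[OF U V] fU by (auto elim!: holomorphic_transform simp: inv_into_into chart_inv[OF U])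
  qed
  show "bij_betw id (points M) (points M)"
    by simp
  show "holomorphic_map M M id" "holomorphic_map M M (inv_into (points M) id)"
    by (rule hol; simp add: inv_into_f_eq)+
qed

lemma isomorphic_refl:
  assumes "X \<in> torsion_surfaces g n"
  shows "isomorphic X X"
proof -
  obtain M J A where X: "X = (M, J, A)" "hyperelliptic g M J"
    using assms unfolding torsion_surfaces_def by auto
  interpret riemann_surface M
    using X(2) unfolding hyperelliptic_def by unfold_locales simp
  show ?thesis
    unfolding X(1) isomorphic_def using biholomorphic_map_id by (auto intro!: exI[of _ id])
qed

section \<open>Components of the moduli space\<close>

text \<open>Open sets of \<open>X\<close> cannot separate points of one fibre of \<open>h\<close>. A
  separation of the preimage of a set is therefore the preimage of a separation of the set, so
  preimages of connected sets are connected, and components correspond through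
  \<open>h\<close>.\<close>

lemma connected_components_pullback:
  assumes surj: "h ` topspace X = topspace Y"
    and op: "\<And>U. openin X U \<longleftrightarrow> (\<exists>V. openin Y V \<and> U = {x \<in> topspace X. h x \<in> V})"
  shows "connected_components_of X \<approx> connected_components_of Y"
proof -
  have cont: "continuous_map X Y h"
    unfolding continuous_map_def using surj op by blast
  have pre: "connectedin X {x \<in> topspace X. h x \<in> T}" if T: "connectedin Y T" for T
    unfolding connectedin
  proof (intro conjI notI; (elim exE conjE)?)
    fix E1 E2
    let ?S = "{x \<in> topspace X. h x \<in> T}"
    assume E: "openin X E1" "openin X E2" "?S \<subseteq> E1 \<union> E2" "E1 \<inter> E2 \<inter> ?S = {}" "E1 \<inter> ?S \<noteq> {}" "E2 \<inter> ?S \<noteq> {}"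
    obtain V1 V2 where V: "openin Y V1" "E1 = {x \<in> topspace X. h x \<in> V1}" "openin Y V2" "E2 = {x \<in> topspace X. h x \<in> V2}"
      using E(1,2) unfolding op by blast
    have TY: "\<exists>x\<in>topspace X. t = h x" if "t \<in> T" for t
      using connectedin_subset_topspace[OF T] surj that by blast
    have "T \<subseteq> V1 \<union> V2"
    proof
      fix t assume t: "t \<in> T"
      then obtain x where "x \<in> topspace X" "t = h x"
        using TY by blast
      then show "t \<in> V1 \<union> V2"
        using E(3) t unfolding V(2,4) by blast
    qed
    moreover have "V1 \<inter> V2 \<inter> T = {}"
    proof (rule ccontr)
      assume "V1 \<inter> V2 \<inter> T \<noteq> {}"
      then obtain t where "t \<in> V1" "t \<in> V2" "t \<in> T"
        by blast
      moreover obtain x where "x \<in> topspace X" "t = h x"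
        using TY[OF \<open>t \<in> T\<close>] by blast
      ultimately show False
        using E(4) unfolding V(2,4) by blast
    qed
    moreover have "V1 \<inter> T \<noteq> {}" "V2 \<inter> T \<noteq> {}"
      using E(5,6) unfolding V(2,4) by blast+
    ultimately show False
      using T V(1,3) unfolding connectedin by blast
  qed blast
  have pre_comp: "{x \<in> topspace X. h x \<in> h ` C} \<subseteq> C" if C: "C \<in> connected_components_of X" for C
  proof (rule connected_components_of_maximal[OF C pre])
    show "connectedin Y (h ` C)"
      by (rule connectedin_continuous_map_image[OF cont connectedin_connected_components_of[OF C]])
    show "\<not> disjnt C {x \<in> topspace X. h x \<in> h ` C}"
      using nonempty_connected_components_of[OF C] connected_components_of_subset[OF C]
      unfolding disjnt_def by blast
  qed
  have image_sub: "h ` C = E" if C: "C \<in> connected_components_of X" and E: "E \<in> connected_components_of Y"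
    and meet: "\<not> disjnt E (h ` C)" for C E
  proof
    show "h ` C \<subseteq> E"
      by (rule connected_components_of_maximal[OF E connectedin_continuous_map_image[OF cont connectedin_connected_components_of[OF C]] meet])
    have "{x \<in> topspace X. h x \<in> E} \<subseteq> C"
    proof (rule connected_components_of_maximal[OF C pre[OF connectedin_connected_components_of[OF E]]])
      show "\<not> disjnt C {x \<in> topspace X. h x \<in> E}"
        using meet connected_components_of_subset[OF C] unfolding disjnt_def by blast
    qed
    moreover have "\<exists>x\<in>topspace X. e = h x" if "e \<in> E" for e
      using subsetD[OF connected_components_of_subset[OF E] that] unfolding surj[symmetric] by (elim imageE) metis
    ultimately show "E \<subseteq> h ` C"
      by blast
  qed
  have inj: "inj_on ((`) h) (connected_components_of X)"
  proof (rule inj_onI)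
    fix C C' assume C: "C \<in> connected_components_of X" "C' \<in> connected_components_of X" "h ` C = h ` C'"
    have "C \<subseteq> {x \<in> topspace X. h x \<in> h ` C}" "C' \<subseteq> {x \<in> topspace X. h x \<in> h ` C'}"
      using connected_components_of_subset[OF C(1)] connected_components_of_subset[OF C(2)] by blast+
    then show "C = C'"
      using pre_comp[OF C(1)] pre_comp[OF C(2)] C(3) by (metis subset_antisym)
  qed
  have "(`) h ` connected_components_of X = connected_components_of Y"
  proof (intro equalityI subsetI)
    fix E assume "E \<in> (`) h ` connected_components_of X"
    then obtain C where C: "C \<in> connected_components_of X" "E = h ` C"
      by blast
    obtain x where x: "x \<in> C"
      using nonempty_connected_components_of[OF C(1)] by blast
    have hx: "h x \<in> topspace Y"
      using x connected_components_of_subset[OF C(1)] surj by blast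
    let ?E = "connected_component_of_set Y (h x)"
    have E': "?E \<in> connected_components_of Y"
      using hx connected_component_in_connected_components_of by metis
    have "h x \<in> ?E"
      using hx by (simp add: connected_component_of_refl)
    then have "h x \<in> ?E \<inter> h ` C"
      using x by simp
    then have "\<not> disjnt ?E (h ` C)"
      unfolding disjnt_def by (metis empty_iff)
    then have "h ` C = ?E"
      by (rule image_sub[OF C(1) E'])
    then show "E \<in> connected_components_of Y"
      using E' C(2) by simp
  next
    fix E assume E: "E \<in> connected_components_of Y"
    obtain x where x: "x \<in> topspace X" "h x \<in> E"
    proof -
      obtain e where e: "e \<in> E"
        using nonempty_connected_components_of[OF E] by (metis equals0I)
      then have "e \<in> h ` topspace X"
        using connected_components_of_subset[OF E] unfolding surj by (rule subsetD[rotated])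
      then show thesis
        using that e by (elim imageE) simp
    qed
    let ?C = "connected_component_of_set X x"
    have C: "?C \<in> connected_components_of X"
      using x(1) connected_component_in_connected_components_of by metis
    have "x \<in> ?C"
      using x(1) by (simp add: connected_component_of_refl)
    then have "\<not> disjnt E (h ` ?C)"
      using x(2) unfolding disjnt_def by blast
    then show "E \<in> (`) h ` connected_components_of X"
      using image_sub[OF C E] C by (metis imageI)
  qed
  with inj show ?thesis
    unfolding eqpoll_def bij_betw_def by blast
qed

lemma openin_pell_abel_space:
  "openin (pell_abel_space g n) V \<longleftrightarrow> V \<subseteq> affine_orbit ` pell_abel_set g n \<and>
     (\<exists>W. open W \<and> {D \<in> pell_abel_set g n. affine_orbit D \<in> V} = {D \<in> pell_abel_set g n. coeff D \<in> W})"
  unfolding pell_abel_space_def openin_quotient_topology topspace_pullback_topology openin_pullback_topology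
  by (simp add: vimage_def Int_def conj_commute)

lemma topspace_pell_abel_space: "topspace (pell_abel_space g n) = affine_orbit ` pell_abel_set g n"
  unfolding pell_abel_space_def topspace_quotient_topology topspace_pullback_topology by simp

theorem components_torsion_moduli:
  "connected_components_of (torsion_moduli g n) \<approx> connected_components_of (pell_abel_space g n)"
proof -
  let ?T = "torsion_surfaces g n" and ?PA = "pell_abel_set g n" and ?CS = "configuration_space g"
  let ?c = "\<lambda>X. {Y \<in> ?T. isomorphic X Y}"
  \<comment> \<open>The class of a surface goes to the affine orbit of a polynomial with the same
    root orbit. Any choice gives the same value: isomorphic surfaces have equal branch data, and
    equal root orbits mean equal affine orbits.\<close>
  define h where "h c = affine_orbit (SOME D. admissible g D \<and> (\<exists>Y\<in>c. branch_data Y = root_orbit D))" for c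
  \<comment> \<open>The pullback topology has as points the surfaces whose branch data is an orbit
    of 2g + 2 branch points and a marked point.\<close>
  define TS where "TS = {X \<in> ?T. branch_data X \<in> topspace ?CS}"
  have top_pull: "topspace (pullback_topology ?T branch_data ?CS) = TS"
    unfolding topspace_pullback_topology TS_def by blast
  have top_M: "topspace (torsion_moduli g n) = ?c ` TS"
    unfolding torsion_moduli_def topspace_quotient_topology top_pull ..
  have op_M: "openin (torsion_moduli g n) U \<longleftrightarrow> U \<subseteq> ?c ` TS \<and>
      (\<exists>O'. openin ?CS O' \<and> {X \<in> TS. ?c X \<in> U} = {X \<in> ?T. branch_data X \<in> O'})" for U
    unfolding torsion_moduli_def openin_quotient_topology top_pull openin_pullback_topology
    by (simp add: vimage_def Int_def conj_commute)
  have TS_cases: "\<exists>D. admissible g D \<and> D \<in> ?PA \<and> branch_data X = root_orbit D" if "X \<in> TS" for X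
  proof -
    have X: "X \<in> ?T" "branch_data X \<in> topspace ?CS"
      using that by (simp_all add: TS_def)
    obtain D where D: "admissible g D" "root_orbit D = branch_data X"
      by (rule configuration_space_cases[OF X(2)])
    then show ?thesis
      using pell_abel_of_branch_data[OF X(1) D(1)] by metis
  qed
  have h: "h (?c X) = affine_orbit D" if X: "X \<in> ?T" and D: "admissible g D" "branch_data X = root_orbit D" for X D
  proof -
    have bd: "branch_data Y = root_orbit D" if "Y \<in> ?c X" for Y
      using branch_data_isomorphic[OF X, of Y] that D(2) by simp
    have "X \<in> ?c X"
      using X isomorphic_refl[OF X] by simp
    then have ex: "\<exists>D. admissible g D \<and> (\<exists>Y\<in>?c X. branch_data Y = root_orbit D)"
      using D by blast
    define E where "E = (SOME D. admissible g D \<and> (\<exists>Y\<in>?c X. branch_data Y = root_orbit D))"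
    have E: "admissible g E \<and> (\<exists>Y\<in>?c X. branch_data Y = root_orbit E)"
      unfolding E_def by (rule someI_ex[OF ex])
    then obtain Y where "Y \<in> ?c X" "branch_data Y = root_orbit E"
      by (elim conjE bexE)
    then have "root_orbit E = root_orbit D"
      using bd[of Y] by simp
    then have "affine_orbit E = affine_orbit D"
      using affine_orbit_eq_iff[OF conjunct1[OF E] D(1)] by simp
    then show ?thesis
      by (simp add: h_def E_def)
  qed
  have adm: "admissible g D" if "D \<in> ?PA" for D
    using that unfolding pell_abel_set_def by blast
  show ?thesis
  proof (rule connected_components_pullback[of h])
    show "h ` topspace (torsion_moduli g n) = topspace (pell_abel_space g n)"
      unfolding top_M topspace_pell_abel_space
    proof (intro equalityI subsetI)
      fix z assume "z \<in> h ` ?c ` TS"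
      then obtain X where X: "X \<in> TS" "z = h (?c X)"
        by blast
      obtain D where D: "admissible g D" "D \<in> ?PA" "branch_data X = root_orbit D"
        using TS_cases[OF X(1)] by blast
      have "z = affine_orbit D"
        unfolding X(2) using X(1) D by (intro h) (simp_all add: TS_def)
      then show "z \<in> affine_orbit ` ?PA"
        using D(2) by blast
    next
      fix z assume "z \<in> affine_orbit ` ?PA"
      then obtain D where D: "D \<in> ?PA" "z = affine_orbit D"
        by blast
      obtain X where X: "X \<in> ?T" "branch_data X = root_orbit D"
        by (rule torsion_surface_of_pell_abel[OF D(1)])
      have XS: "X \<in> TS"
        using X root_orbit_in_configuration_space[OF adm[OF D(1)]] by (simp add: TS_def)
      show "z \<in> h ` ?c ` TS"
        unfolding D(2) h[OF X(1) adm[OF D(1)] X(2), symmetric] by (intro imageI XS)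
    qed
    fix U
    show "openin (torsion_moduli g n) U \<longleftrightarrow>
      (\<exists>V. openin (pell_abel_space g n) V \<and> U = {c \<in> topspace (torsion_moduli g n). h c \<in> V})"
    proof
      assume "openin (torsion_moduli g n) U"
      then obtain O' where U: "U \<subseteq> ?c ` TS" and O': "openin ?CS O'" "{X \<in> TS. ?c X \<in> U} = {X \<in> ?T. branch_data X \<in> O'}"
        unfolding op_M by blast
      obtain W :: "(nat \<Rightarrow> complex) set" where W: "open W" "\<And>D. admissible g D \<Longrightarrow> coeff D \<in> W \<longleftrightarrow> root_orbit D \<in> O'"
        using openin_root_orbit_preimage[OF O'(1)] by metis
      \<comment> \<open>On the Pell-Abel set membership in \<open>W\<close> is decided by the root
        orbit, so \<open>?V\<close> contains the orbit of \<open>D\<close> exactly if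
        \<open>coeff D\<close> lies in \<open>W\<close>.\<close>
      let ?V = "affine_orbit ` {D \<in> ?PA. coeff D \<in> W}"
      have V_iff: "affine_orbit D \<in> ?V \<longleftrightarrow> coeff D \<in> W" if D: "D \<in> ?PA" for D
      proof
        assume "affine_orbit D \<in> ?V"
        then obtain E where E: "E \<in> ?PA" "coeff E \<in> W" "affine_orbit D = affine_orbit E"
          by blast
        then have "root_orbit D = root_orbit E"
          using affine_orbit_eq_iff[OF adm[OF D] adm[OF E(1)]] by simp
        then show "coeff D \<in> W"
          using W(2)[OF adm[OF D]] W(2)[OF adm[OF E(1)]] E(2) by simp
      qed (use D in blast)
      have "openin (pell_abel_space g n) ?V"
        unfolding openin_pell_abel_space using W(1) V_iff by blast
      moreover have "U = {c \<in> ?c ` TS. h c \<in> ?V}"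
      proof (rule set_eqI)
        fix c
        show "c \<in> U \<longleftrightarrow> c \<in> {c \<in> ?c ` TS. h c \<in> ?V}"
        proof (cases "c \<in> ?c ` TS")
          case True
          then obtain X where X: "X \<in> TS" "c = ?c X"
            by blast
          obtain D where D: "admissible g D" "D \<in> ?PA" "branch_data X = root_orbit D"
            using TS_cases[OF X(1)] by blast
          have XT: "X \<in> ?T"
            using X(1) by (simp add: TS_def)
          have "c \<in> U \<longleftrightarrow> X \<in> {X \<in> TS. ?c X \<in> U}"
            using X by simp
          also have "\<dots> \<longleftrightarrow> root_orbit D \<in> O'"
            unfolding O'(2) using XT D(3) by simp
          also have "\<dots> \<longleftrightarrow> h c \<in> ?V"
            unfolding X(2) h[OF XT D(1,3)] V_iff[OF D(2)] W(2)[OF D(1)] ..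
          finally show ?thesis
            using True by simp
        qed (use U in blast)
      qed
      ultimately show "\<exists>V. openin (pell_abel_space g n) V \<and> U = {c \<in> topspace (torsion_moduli g n). h c \<in> V}"
        unfolding top_M by blast
    next
      assume "\<exists>V. openin (pell_abel_space g n) V \<and> U = {c \<in> topspace (torsion_moduli g n). h c \<in> V}"
      then obtain V W where U: "U = {c \<in> ?c ` TS. h c \<in> V}" and W: "open W"
        "{D \<in> ?PA. affine_orbit D \<in> V} = {D \<in> ?PA. coeff D \<in> W}"
        unfolding top_M openin_pell_abel_space by blast
      \<comment> \<open>\<open>W\<close> may contain coefficients of polynomials outside the
        Pell-Abel set. They do not disturb the comparison, because every admissible polynomial whose
        root orbit is the branch data of a torsion surface lies in the set.\<close>
      let ?O = "{\<omega> \<in> topspace ?CS. \<exists>D. admissible g D \<and> coeff D \<in> W \<and> root_orbit D = \<omega>}"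
      have "X \<in> {X \<in> TS. ?c X \<in> U} \<longleftrightarrow> X \<in> {X \<in> ?T. branch_data X \<in> ?O}" for X
      proof (cases "X \<in> TS")
        case True
        then have XT: "X \<in> ?T" "branch_data X \<in> topspace ?CS"
          by (simp_all add: TS_def)
        have iff: "h (?c X) \<in> V \<longleftrightarrow> coeff D \<in> W" if "admissible g D" "branch_data X = root_orbit D" for D
        proof -
          have "D \<in> ?PA"
            by (rule pell_abel_of_branch_data[OF XT(1) that])
          then show ?thesis
            unfolding h[OF XT(1) that] using W(2) by blast
        qed
        obtain D where D: "admissible g D" "branch_data X = root_orbit D"
          using TS_cases[OF True] by blast
        have "?c X \<in> U \<longleftrightarrow> h (?c X) \<in> V"
          unfolding U using True by simp
        also have "\<dots> \<longleftrightarrow> branch_data X \<in> ?O"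
        proof
          assume "h (?c X) \<in> V"
          then have "coeff D \<in> W"
            using iff[OF D] by simp
          then show "branch_data X \<in> ?O"
            using D XT(2) by (intro CollectI conjI exI[of _ D]) simp_all
        next
          assume "branch_data X \<in> ?O"
          then obtain E where "admissible g E" "coeff E \<in> W" "branch_data X = root_orbit E"
            by (elim CollectE conjE exE) simp
          then show "h (?c X) \<in> V"
            using iff by simp
        qed
        finally show ?thesis
          using True XT(1) by simp
      next
        case False
        then show ?thesis
          by (auto simp: TS_def)
      qed
      then have "{X \<in> TS. ?c X \<in> U} = {X \<in> ?T. branch_data X \<in> ?O}"
        by (rule set_eqI)
      moreover have "U \<subseteq> ?c ` TS"
        unfolding U by blast
      ultimately show "openin (torsion_moduli g n) U"
        unfolding op_M using openin_root_orbit_image[OF W(1)] by (intro conjI exI[of _ ?O])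
    qed
  qed
qed

theorem corollary1p5:
  fixes g n :: nat
  shows "connected_components_of (torsion_moduli g n)
           \<approx> connected_components_of (pell_abel_space g n) \<and>
         (\<forall>D (M :: 'a surface) J \<psi> pinf minf p f.
            admissible g D \<and> curve_compactification g D M J \<psi> pinf minf \<and>
            primitive_torsion_pair n M J {pinf, minf} \<and>
            {p, J p} = {pinf, minf} \<and> has_divisor M f (diff_divisor n p (J p)) \<longrightarrow>
            (\<exists>c. c \<noteq> 0 \<and>
               (\<forall>e\<in>roots D. c * f (\<psi> (e, 0)) \<in> {1, -1}) \<and>
               degree_partition D =
                 {#card {e \<in> roots D. c * f (\<psi> (e, 0)) = -1},
                   card {e \<in> roots D. c * f (\<psi> (e, 0)) = 1}#}))"
proof (intro conjI allI impI components_torsion_moduli, elim conjE)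
  fix D and M :: "'a surface" and J \<psi> pinf minf p f
  assume D: "admissible g D" and c: "curve_compactification g D M J \<psi> pinf minf"
    and tors: "primitive_torsion_pair n M J {pinf, minf}"
    and p: "{p, J p} = {pinf, minf}" and f: "has_divisor M f (diff_divisor n p (J p))"
  interpret curve M g D J \<psi> pinf minf
    using D c by unfold_locales (auto simp: curve_compactification_def)
  show "\<exists>c. c \<noteq> 0 \<and> (\<forall>e\<in>roots D. c * f (\<psi> (e, 0)) \<in> {1, -1}) \<and>
      degree_partition D = {#card {e \<in> roots D. c * f (\<psi> (e, 0)) = -1}, card {e \<in> roots D. c * f (\<psi> (e, 0)) = 1}#}"
    by (rule degree_partition_of_divisor[OF tors p f])
qed

end
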